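(* Let $X$, $D$, $p(X)$ and the integral operator $\mathcal{K}$ be as specified in the context. Then $\mathcal{K}$ extends to compact operators $$\mathcal{K}\colon L^p_{0,r}(X)\to L^p_{0,r-1}(D),\qquad p(X)<p<\infty,$$ and $$\mathcal{K}\colon L^\infty_{0,r}(X)\to C^\alpha_{0,r-1}(D),\qquad 0\le\alpha<4/p(X)-2,$$ for $r=1,2$.
   Context: Setting. $\Omega'\subset\subset\mathbb{C}^3$ is open and pseudoconvex, $f$ is holomorphic in a neighborhood of $\Omega'$, $X=\{\zeta\in\Omega' : f(\zeta)=0\}$, $0\in X$, $df\neq 0$ at every point of $\{f=0\}$ except $0$, and $X$ has an isolated canonical (i.e. du Val) singularity at $0$. $X_{reg}=X\setminus\{0\}$ carries the metric induced from $\mathbb{C}^3$, with volume form $dV_X$. $\Omega\subset\subset\Omega'$ is an open set containing $0$ and $D=X\cap\Omega$. The structure form $\omega_X$ is the unique meromorphic $(2,0)$-form on $X$ with $df\wedge\omega_X=2\pi i\, d\zeta_1\wedge d\zeta_2\wedge d\zeta_3$ (Poincar\'e residue of $d\zeta_1\wedge d\zeta_2\wedge d\zeta_3/f$); it is holomorphic on $X\setminus\{0\}$. $q(X)$ is a fixed number with $2<q(X)\le4$ such that $\omega_X\in L^q(X)$ for all $1\le q<q(X)$ (such a number exists), and $p(X)=q(X)/(q(X)-1)$. Forms. For $U\subset X$ open, a $(0,r)$-form is in $L^p_{0,r}(U)$ if its restriction to $U\cap X_{reg}$ is in $L^p$ with respect to the induced metric and $dV_X$. A $(0,r)$-form $\varphi$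 on $U$ is in $C^\alpha_{0,r}(U)$, $0\le\alpha<1$, if $\varphi=\sum_{|I|=r}\varphi_I\,d\bar z_I$ (locally, pullbacks of ambient $d\bar z_I$) with $\varphi_I$ H\"older continuous with exponent $\alpha$; the norm is $\|\varphi\|_\alpha^2=\inf 2^r\sum\|\varphi_I\|_\alpha^2$, infimum over all such representations. Smooth forms on $X$ are pullbacks of smooth ambient forms. The operator $\mathcal{K}$. Put $\eta=\zeta-z$, let $\delta_\eta$ be interior multiplication by $2\pi i\sum_j\eta_j\,\partial/\partial\zeta_j$, and consider forms with anti-holomorphic differentials in both $\zeta$ and $z$ but holomorphic differentials only in $\zeta$. Let $b=\frac{1}{2\pi i}\,\frac{\sum_j\bar\eta_j\,d\zeta_j}{|\eta|^2}$ and $B=b+b\wedge\bar\partial b+b\wedge(\bar\partial b)^2$. Let $h=\sum_j h_j\,d\zeta_j$ be a Hefer form for $f$: a holomorphic $(1,0)$-form on $\Omega'\times\Omega'$ with $\delta_\eta h=f(\zeta)-f(z)$. Let $\chi=\chi(\zeta)$ be a cut-off function with compact support in $\Omega'$ that is $1$ in a Stein neighborhood $\Omega''\subset\subset\Omega'$ of $\overline\Omega$, let $s=\sum_j s_j(\zeta,z)\,d\zeta_j$ be defined for $\zeta\in\mathrm{supp}\,\bar\partial\chi$, $z\in\overline\Omega$, smooth in $\zeta$, holomorphic in $z$, with $\delta_\eta s=1$, and let $g=\chi-\bar\partial\chi\wedge(s+s\wedge\bar\partial s+s\wedge(\bar\partial s)^2)$. Define $\tilde K$ by $d\zeta_1\wedge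 d\zeta_2\wedge d\zeta_3\wedge\tilde K(\zeta,z)=h\wedge(g\wedge B)_2$, where $(\cdot)_2$ denotes the component of bidegree $(2,* )$, let $K(\zeta,z)=\omega_X(\zeta)\wedge\tilde K(\zeta,z)$, and $$(\mathcal{K}\varphi)(z)=\int_{X_\zeta}K(\zeta,z)\wedge\varphi(\zeta),$$ which maps smooth $(0,r)$-forms on $X$ to smooth $(0,r-1)$-forms on $D\setminus\{0\}$, $r=1,2$. *)

theory Defs
  imports "HOL-Analysis.Analysis"
begin

section \<open>Several complex variables on open subsets of \<open>\<complex>\<^sup>n\<close>\<close>

definition holo_on :: "(complex ^ 'n) set \<Rightarrow> (complex ^ 'n \<Rightarrow> complex) \<Rightarrow> bool" where
  "holo_on U F \<longleftrightarrow>
     (\<forall>x\<in>U. \<exists>D. (F has_derivative D) (at x) \<and> (\<forall>c v. D (c *s v) = c * D v))"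

definition holo_map_on :: "(complex ^ 'n) set \<Rightarrow> (complex ^ 'n \<Rightarrow> complex ^ 'm) \<Rightarrow> bool" where
  "holo_map_on U F \<longleftrightarrow> (\<forall>j. holo_on U (\<lambda>x. F x $ j))"

definition holo_on_prod ::
  "((complex ^ 'n) \<times> (complex ^ 'm)) set \<Rightarrow> ((complex ^ 'n) \<times> (complex ^ 'm) \<Rightarrow> complex) \<Rightarrow> bool" where
  "holo_on_prod U F \<longleftrightarrow>
     (\<forall>x\<in>U. \<exists>D. (F has_derivative D) (at x) \<and> (\<forall>c u v. D (c *s u, c *s v) = c * D (u, v)))"

text \<open>Continuously differentiable of order \<open>k\<close>, and smooth, on an open set.\<close>

primrec Ck_on ::
  "nat \<Rightarrow> 'a::real_normed_vector set \<Rightarrow> ('a \<Rightarrow> 'b::real_normed_vector) \<Rightarrow> bool" where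
  "Ck_on 0 U F = continuous_on U F"
| "Ck_on (Suc k) U F =
     ((\<forall>x\<in>U. F differentiable (at x)) \<and>
      (\<forall>v. Ck_on k U (\<lambda>x. frechet_derivative F (at x) v)))"

definition smooth_on :: "'a::real_normed_vector set \<Rightarrow> ('a \<Rightarrow> 'b::real_normed_vector) \<Rightarrow> bool" where
  "smooth_on U F \<longleftrightarrow> (\<forall>k. Ck_on k U F)"

text \<open>For continuous functions plurisubharmonicity is the sub-mean value property on complex discs.\<close>

definition cont_psh_on :: "(complex ^ 'n) set \<Rightarrow> (complex ^ 'n \<Rightarrow> real) \<Rightarrow> bool" where
  "cont_psh_on U u \<longleftrightarrow> continuous_on U u \<and>
     (\<forall>z w. (\<forall>\<tau>. cmod \<tau> \<le> 1 \<longrightarrow> z + \<tau> *s w \<in> U) \<longrightarrow>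
        u z \<le> integral {0..2 * pi} (\<lambda>t. u (z + cis t *s w)) / (2 * pi))"

definition pseudoconvex :: "(complex ^ 'n) set \<Rightarrow> bool" where
  "pseudoconvex U \<longleftrightarrow> open U \<and>
     (\<exists>u. cont_psh_on U u \<and>
        (\<forall>c. \<exists>C. compact C \<and> C \<subseteq> U \<and> {z \<in> U. u z < c} \<subseteq> C))"

text \<open>Open subsets of \<open>\<complex>\<^sup>n\<close> are holomorphically separable, so that Stein means
  holomorphically convex. The supremum over \<open>C\<close> in the definition of the hull is attained.\<close>

definition stein_open :: "(complex ^ 'n) set \<Rightarrow> bool" where
  "stein_open U \<longleftrightarrow> open U \<and>
     (\<forall>C. compact C \<and> C \<subseteq> U \<longrightarrow>
        compact {z \<in> U. \<forall>g. holo_on U g \<longrightarrow> (\<exists>w\<in>C. cmod (g z) \<le> cmod (g w))})"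


section \<open>Canonical surface singularities\<close>

text \<open>Canonical surface singularities are the du Val singularities, i.e. those that are
  analytically isomorphic to one in the list \<open>A\<^sub>n\<close>, \<open>D\<^sub>n\<close>, \<open>E\<^sub>6\<close>, \<open>E\<^sub>7\<close>, \<open>E\<^sub>8\<close>.\<close>

definition du_val_equations :: "(complex ^ 3 \<Rightarrow> complex) set" where
  "du_val_equations =
     {\<lambda>w. (w$1)^2 + (w$2)^2 + (w$3)^(n+1) | n. n \<ge> 1} \<union>
     {\<lambda>w. (w$1)^2 + (w$2)^2 * w$3 + (w$3)^(n-1) | n. n \<ge> 4} \<union>
     {\<lambda>w. (w$1)^2 + (w$2)^3 + (w$3)^4,
      \<lambda>w. (w$1)^2 + (w$2)^3 + w$2 * (w$3)^3,
      \<lambda>w. (w$1)^2 + (w$2)^3 + (w$3)^5}"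

text \<open>Two hypersurface germs at \<open>0 \<in> \<complex>\<^sup>3\<close> with the reduced structure are isomorphic if they
  correspond under a local biholomorphism of the ambient space.\<close>

definition canonical_singularity_at_0 :: "(complex ^ 3) set \<Rightarrow> bool" where
  "canonical_singularity_at_0 X \<longleftrightarrow>
     (\<exists>P\<in>du_val_equations. \<exists>U V \<Phi> \<Psi>.
        open U \<and> open V \<and> 0 \<in> U \<and> \<Phi> 0 = 0 \<and>
        \<Phi> ` U = V \<and> \<Psi> ` V = U \<and> (\<forall>x\<in>U. \<Psi> (\<Phi> x) = x) \<and> (\<forall>y\<in>V. \<Phi> (\<Psi> y) = y) \<and>
        holo_map_on U \<Phi> \<and> holo_map_on V \<Psi> \<and>
        \<Phi> ` (X \<inter> U) = {w \<in> V. P w = 0})"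


section \<open>The exterior algebra\<close>

text \<open>Generators \<open>d\<zeta>\<^sub>j\<close>, \<open>d\<zeta>\<^sub>j\<close> conjugate, and \<open>dz\<^sub>j\<close> conjugate. Forms in a single
  variable, on \<open>X\<close> or \<open>D\<close>, are written with the first two kinds of generators
  whatever the name of the variable.\<close>

datatype gen = Dzeta 3 | Dzetabar 3 | Dzbar 3

instance gen :: finite
proof
  have "(UNIV :: gen set) = range Dzeta \<union> range Dzetabar \<union> range Dzbar"
  proof -
    have "g \<in> range Dzeta \<union> range Dzetabar \<union> range Dzbar" for g
      by (cases g) auto
    then show ?thesis by blast
  qed
  then show "finite (UNIV :: gen set)"
    by (metis finite_UnI finite_imageI finite)
qed

text \<open>The numeral \<open>3\<close> of type \<^typ>\<open>3\<close> is \<open>0\<close>, so the library order on this type is not the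
  order of the coordinates.\<close>

definition idx :: "3 \<Rightarrow> nat" where
  "idx j = (if j = 1 then 1 else if j = 2 then 2 else 3)"

fun grank :: "gen \<Rightarrow> nat" where
  "grank (Dzeta j) = idx j"
| "grank (Dzetabar j) = 3 + idx j"
| "grank (Dzbar j) = 6 + idx j"

text \<open>\<open>a $ S\<close> is the coefficient of the wedge product of the generators in \<open>S\<close>, in the order
  of increasing rank.\<close>

type_synonym ext = "complex ^ (gen set)"

definition wedge :: "ext \<Rightarrow> ext \<Rightarrow> ext" (infixr "\<^bold>\<and>" 75) where
  "a \<^bold>\<and> b = (\<chi> S. \<Sum>T\<in>Pow S.
     (- 1) ^ card {(g, h). g \<in> T \<and> h \<in> S - T \<and> grank h < grank g} * a $ T * b $ (S - T))"

definition gform :: "gen \<Rightarrow> ext" where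
  "gform g = axis {g} 1"

definition scal :: "complex \<Rightarrow> ext" where
  "scal c = axis {} c"

definition form1 :: "complex ^ 3 \<Rightarrow> ext" where
  "form1 c = (\<Sum>j\<in>UNIV. (c $ j) *s gform (Dzeta j))"

definition dzeta123 :: ext where
  "dzeta123 = gform (Dzeta 1) \<^bold>\<and> gform (Dzeta 2) \<^bold>\<and> gform (Dzeta 3)"

text \<open>Interior multiplication by the vector on which the generator \<open>g\<close> takes the value \<open>l g\<close>.\<close>

definition interior_mult :: "(gen \<Rightarrow> complex) \<Rightarrow> ext \<Rightarrow> ext" where
  "interior_mult l a = (\<chi> S. \<Sum>g\<in>- S.
     (- 1) ^ card {h \<in> S. grank h < grank g} * l g * a $ (insert g S))"

text \<open>A form in one variable is an alternating form on real tangent vectors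
  \<open>v \<in> \<complex>\<^sup>3 = \<real>\<^sup>6\<close>; contracting successively evaluates it.\<close>

fun covec :: "complex ^ 3 \<Rightarrow> gen \<Rightarrow> complex" where
  "covec v (Dzeta j) = v $ j"
| "covec v (Dzetabar j) = cnj (v $ j)"
| "covec v (Dzbar j) = 0"

primrec ev :: "(complex ^ 3) list \<Rightarrow> ext \<Rightarrow> complex" where
  "ev [] a = a $ {}"
| "ev (v # vs) a = ev vs (interior_mult (covec v) a)"

definition form_0r :: "nat \<Rightarrow> ext \<Rightarrow> bool" where
  "form_0r r a \<longleftrightarrow> (\<forall>S. a $ S \<noteq> 0 \<longrightarrow> S \<subseteq> range Dzetabar \<and> card S = r)"

definition form_20 :: "ext \<Rightarrow> bool" where
  "form_20 a \<longleftrightarrow> (\<forall>S. a $ S \<noteq> 0 \<longrightarrow> S \<subseteq> range Dzeta \<and> card S = 2)"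

definition df :: "(complex ^ 3 \<Rightarrow> complex) \<Rightarrow> complex ^ 3 \<Rightarrow> ext" where
  "df f x = form1 (\<chi> j. frechet_derivative f (at x) (axis j 1))"

definition wirtinger_bar :: "(complex ^ 3 \<Rightarrow> ext) \<Rightarrow> complex ^ 3 \<Rightarrow> 3 \<Rightarrow> ext" where
  "wirtinger_bar G x j =
     (1/2) *s (frechet_derivative G (at x) (axis j 1) + \<i> *s frechet_derivative G (at x) (axis j \<i>))"

text \<open>The operator \<open>\<partial>\<close>-bar, in \<open>\<zeta>\<close> and \<open>z\<close> jointly.\<close>

definition dbar :: "(complex ^ 3 \<Rightarrow> complex ^ 3 \<Rightarrow> ext) \<Rightarrow> complex ^ 3 \<Rightarrow> complex ^ 3 \<Rightarrow> ext" where
  "dbar F \<zeta> z = (\<Sum>j\<in>UNIV.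
       gform (Dzetabar j) \<^bold>\<and> wirtinger_bar (\<lambda>\<xi>. F \<xi> z) \<zeta> j
     + gform (Dzbar j) \<^bold>\<and> wirtinger_bar (\<lambda>w. F \<zeta> w) z j)"


section \<open>The induced metric on the regular part of a hypersurface\<close>

definition tangent :: "(complex ^ 3 \<Rightarrow> complex) \<Rightarrow> complex ^ 3 \<Rightarrow> (complex ^ 3) set" where
  "tangent f x = {v. frechet_derivative f (at x) v = 0}"

definition herm :: "complex ^ 3 \<Rightarrow> complex ^ 3 \<Rightarrow> complex" where
  "herm u v = (\<Sum>j\<in>UNIV. u $ j * cnj (v $ j))"

text \<open>A positively oriented real orthonormal basis of the tangent space of \<open>{f = 0}\<close> at \<open>x\<close>,
  obtained from a unitary basis. Everything below is independent of the choice.\<close>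

definition frame :: "(complex ^ 3 \<Rightarrow> complex) \<Rightarrow> complex ^ 3 \<Rightarrow> (complex ^ 3) list" where
  "frame f x = (SOME E. \<exists>u v. u \<in> tangent f x \<and> v \<in> tangent f x \<and>
     norm u = 1 \<and> norm v = 1 \<and> herm u v = 0 \<and> E = [u, \<i> *s u, v, \<i> *s v])"

text \<open>Equality at \<open>x\<close> of the pullbacks of two ambient \<open>r\<close>-forms to \<open>{f = 0}\<close>.\<close>

definition same_pullback ::
  "(complex ^ 3 \<Rightarrow> complex) \<Rightarrow> complex ^ 3 \<Rightarrow> nat \<Rightarrow> ext \<Rightarrow> ext \<Rightarrow> bool" where
  "same_pullback f x r a b \<longleftrightarrow>
     (\<forall>vs. length vs = r \<and> set vs \<subseteq> tangent f x \<longrightarrow> ev vs a = ev vs b)"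

text \<open>Riemannian norm of the pullback of an \<open>r\<close>-form to \<open>{f = 0}\<close>. In this normalization
  \<open>|dz\<^sub>j|\<^sup>2 = 2\<close> in \<open>\<complex>\<^sup>3\<close>.\<close>

definition form_norm :: "(complex ^ 3 \<Rightarrow> complex) \<Rightarrow> complex ^ 3 \<Rightarrow> nat \<Rightarrow> ext \<Rightarrow> real" where
  "form_norm f x r a =
     sqrt (\<Sum>A | A \<subseteq> {..<4} \<and> card A = r. (cmod (ev (nths (frame f x) A) a))\<^sup>2)"

text \<open>The quotient of a form of degree 4 by the volume form of \<open>{f = 0}\<close>.\<close>

definition top_coeff :: "(complex ^ 3 \<Rightarrow> complex) \<Rightarrow> complex ^ 3 \<Rightarrow> ext \<Rightarrow> complex" where
  "top_coeff f x a = ev (frame f x) a"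

text \<open>The volume measure of a two-dimensional complex submanifold \<open>M\<close> of \<open>\<complex>\<^sup>3\<close>: in a holomorphic
  parametrization \<open>\<psi>\<close> its density is the Gram determinant of the complex partial
  derivatives of \<open>\<psi>\<close>.\<close>

definition gram :: "(complex ^ 2 \<Rightarrow> complex ^ 3) \<Rightarrow> complex ^ 2 \<Rightarrow> real" where
  "gram \<psi> t = (let u = frechet_derivative \<psi> (at t) (axis 1 1);
                   v = frechet_derivative \<psi> (at t) (axis 2 1)
               in (norm u)\<^sup>2 * (norm v)\<^sup>2 - (cmod (herm u v))\<^sup>2)"

definition holo_param ::
  "(complex ^ 3) set \<Rightarrow> (complex ^ 2) set \<Rightarrow> (complex ^ 2 \<Rightarrow> complex ^ 3) \<Rightarrow> bool" where
  "holo_param M V \<psi> \<longleftrightarrow> open V \<and> holo_map_on V \<psi> \<and> inj_on \<psi> V \<and> \<psi> ` V \<subseteq> M \<and>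
     (\<forall>t\<in>V. gram \<psi> t \<noteq> 0)"

definition dV :: "(complex ^ 3) set \<Rightarrow> (complex ^ 3) measure" where
  "dV M = (THE \<mu>. sets \<mu> = sets (restrict_space borel M) \<and>
     (\<forall>V \<psi> A. holo_param M V \<psi> \<and> A \<in> sets borel \<and> A \<subseteq> V \<longrightarrow>
        emeasure \<mu> (\<psi> ` A) = (\<integral>\<^sup>+t\<in>A. ennreal (gram \<psi> t) \<partial>lborel)))"

definition dV_reg :: "(complex ^ 3) set \<Rightarrow> (complex ^ 3) set \<Rightarrow> (complex ^ 3) measure" where
  "dV_reg X U = restrict_space (dV (X - {0})) (U - {0})"

text \<open>Poincare residue of \<open>d\<zeta>\<^sub>1 \<and> d\<zeta>\<^sub>2 \<and> d\<zeta>\<^sub>3 / f\<close>: the equation determines the pullback of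
  \<open>\<omega>\<close> to the regular part of \<open>X\<close>, and only this pullback enters below.\<close>

definition structure_form ::
  "(complex ^ 3 \<Rightarrow> complex) \<Rightarrow> (complex ^ 3) set \<Rightarrow> (complex ^ 3 \<Rightarrow> ext) \<Rightarrow> bool" where
  "structure_form f X \<omega> \<longleftrightarrow>
     (\<forall>x\<in>X - {0}. form_20 (\<omega> x) \<and> df f x \<^bold>\<and> \<omega> x = (2 * pi * \<i>) *s dzeta123)"


section \<open>Spaces of forms\<close>

text \<open>A \<open>(0,r)\<close>-form on \<open>U\<close> is given by ambient coefficients at the points of \<open>U - {0}\<close>. The
  norms depend only on the pullback to the regular part, so the spaces below are seminormed
  spaces, in which forms with the same pullback (almost everywhere, for Lebesgue spaces)
  have distance zero.\<close>

definition Lp_forms ::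
  "(complex ^ 3 \<Rightarrow> complex) \<Rightarrow> (complex ^ 3) set \<Rightarrow> (complex ^ 3) set \<Rightarrow> real \<Rightarrow> nat
     \<Rightarrow> (complex ^ 3 \<Rightarrow> ext) set" where
  "Lp_forms f X U p r = {\<phi>. (\<forall>x\<in>U - {0}. form_0r r (\<phi> x)) \<and>
     \<phi> \<in> borel_measurable (dV_reg X U) \<and>
     integrable (dV_reg X U) (\<lambda>x. form_norm f x r (\<phi> x) powr p)}"

definition Lp_norm ::
  "(complex ^ 3 \<Rightarrow> complex) \<Rightarrow> (complex ^ 3) set \<Rightarrow> (complex ^ 3) set \<Rightarrow> real \<Rightarrow> nat
     \<Rightarrow> (complex ^ 3 \<Rightarrow> ext) \<Rightarrow> real" where
  "Lp_norm f X U p r \<phi> = (\<integral>x. form_norm f x r (\<phi> x) powr p \<partial>dV_reg X U) powr (1 / p)"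

definition Linf_forms ::
  "(complex ^ 3 \<Rightarrow> complex) \<Rightarrow> (complex ^ 3) set \<Rightarrow> (complex ^ 3) set \<Rightarrow> nat
     \<Rightarrow> (complex ^ 3 \<Rightarrow> ext) set" where
  "Linf_forms f X U r = {\<phi>. (\<forall>x\<in>U - {0}. form_0r r (\<phi> x)) \<and>
     \<phi> \<in> borel_measurable (dV_reg X U) \<and>
     (\<exists>C. AE x in dV_reg X U. form_norm f x r (\<phi> x) \<le> C)}"

definition Linf_norm ::
  "(complex ^ 3 \<Rightarrow> complex) \<Rightarrow> (complex ^ 3) set \<Rightarrow> (complex ^ 3) set \<Rightarrow> nat
     \<Rightarrow> (complex ^ 3 \<Rightarrow> ext) \<Rightarrow> real" where
  "Linf_norm f X U r \<phi> = Inf {C. 0 \<le> C \<and> (AE x in dV_reg X U. form_norm f x r (\<phi> x) \<le> C)}"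

text \<open>Bounded functions that are Hoelder continuous with exponent \<open>\<alpha>\<close>; bounded continuous
  functions if \<open>\<alpha> = 0\<close>.\<close>

definition holder_on :: "real \<Rightarrow> (complex ^ 3) set \<Rightarrow> (complex ^ 3 \<Rightarrow> complex) \<Rightarrow> bool" where
  "holder_on \<alpha> U u \<longleftrightarrow> continuous_on U u \<and> (\<exists>C. \<forall>x\<in>U. cmod (u x) \<le> C) \<and>
     (\<exists>C. \<forall>x\<in>U. \<forall>y\<in>U. x \<noteq> y \<longrightarrow> cmod (u x - u y) \<le> C * dist x y powr \<alpha>)"

definition holder_norm :: "real \<Rightarrow> (complex ^ 3) set \<Rightarrow> (complex ^ 3 \<Rightarrow> complex) \<Rightarrow> real" where
  "holder_norm \<alpha> U u = Sup ((\<lambda>x. cmod (u x)) ` U) +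
     Sup {cmod (u x - u y) / dist x y powr \<alpha> | x y. x \<in> U \<and> y \<in> U \<and> x \<noteq> y}"

definition holder_rep ::
  "(complex ^ 3 \<Rightarrow> complex) \<Rightarrow> (complex ^ 3) set \<Rightarrow> real \<Rightarrow> nat
     \<Rightarrow> (complex ^ 3 \<Rightarrow> ext) \<Rightarrow> (complex ^ 3 \<Rightarrow> ext) \<Rightarrow> bool" where
  "holder_rep f U \<alpha> r \<phi> c \<longleftrightarrow>
     (\<forall>x\<in>U. form_0r r (c x)) \<and> (\<forall>S. holder_on \<alpha> U (\<lambda>x. c x $ S)) \<and>
     (\<forall>x\<in>U - {0}. same_pullback f x r (\<phi> x) (c x))"

definition Calpha_forms ::
  "(complex ^ 3 \<Rightarrow> complex) \<Rightarrow> (complex ^ 3) set \<Rightarrow> real \<Rightarrow> nat \<Rightarrow> (complex ^ 3 \<Rightarrow> ext) set" where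
  "Calpha_forms f U \<alpha> r =
     {\<phi>. (\<forall>x\<in>U - {0}. form_0r r (\<phi> x)) \<and> (\<exists>c. holder_rep f U \<alpha> r \<phi> c)}"

definition Calpha_norm ::
  "(complex ^ 3 \<Rightarrow> complex) \<Rightarrow> (complex ^ 3) set \<Rightarrow> real \<Rightarrow> nat \<Rightarrow> (complex ^ 3 \<Rightarrow> ext) \<Rightarrow> real" where
  "Calpha_norm f U \<alpha> r \<phi> =
     sqrt (Inf {2 ^ r * (\<Sum>S | S \<subseteq> range Dzetabar \<and> card S = r. (holder_norm \<alpha> U (\<lambda>x. c x $ S))\<^sup>2)
                | c. holder_rep f U \<alpha> r \<phi> c})"

text \<open>Compact linear operators between seminormed spaces of forms.\<close>

definition compact_operator ::
  "('a \<Rightarrow> ext) set \<Rightarrow> (('a \<Rightarrow> ext) \<Rightarrow> real) \<Rightarrow> ('b \<Rightarrow> ext) set \<Rightarrow> (('b \<Rightarrow> ext) \<Rightarrow> real)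
     \<Rightarrow> (('a \<Rightarrow> ext) \<Rightarrow> ('b \<Rightarrow> ext)) \<Rightarrow> bool" where
  "compact_operator E nE F nF T \<longleftrightarrow>
     (\<forall>\<phi>\<in>E. T \<phi> \<in> F) \<and>
     (\<forall>\<phi>\<in>E. \<forall>\<psi>\<in>E. nF (\<lambda>x. T (\<lambda>y. \<phi> y + \<psi> y) x - (T \<phi> x + T \<psi> x)) = 0) \<and>
     (\<forall>\<phi>\<in>E. \<forall>c. nF (\<lambda>x. T (\<lambda>y. c *s \<phi> y) x - c *s T \<phi> x) = 0) \<and>
     (\<forall>\<Phi> :: nat \<Rightarrow> 'a \<Rightarrow> ext. (\<forall>n. \<Phi> n \<in> E \<and> nE (\<Phi> n) \<le> 1) \<longrightarrow>
        (\<exists>\<psi>\<in>F. \<exists>k. strict_mono k \<and>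
           (\<lambda>n. nF (\<lambda>x. T (\<Phi> (k n)) x - \<psi> x)) \<longlonglongrightarrow> 0))"


section \<open>The integral operator\<close>

fun eta_covec :: "complex ^ 3 \<Rightarrow> complex ^ 3 \<Rightarrow> gen \<Rightarrow> complex" where
  "eta_covec \<zeta> z (Dzeta j) = 2 * pi * \<i> * (\<zeta> $ j - z $ j)"
| "eta_covec \<zeta> z (Dzetabar j) = 0"
| "eta_covec \<zeta> z (Dzbar j) = 0"

definition delta_eta :: "complex ^ 3 \<Rightarrow> complex ^ 3 \<Rightarrow> ext \<Rightarrow> ext" where
  "delta_eta \<zeta> z = interior_mult (eta_covec \<zeta> z)"

definition b_form :: "complex ^ 3 \<Rightarrow> complex ^ 3 \<Rightarrow> ext" where
  "b_form \<zeta> z =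
     (1 / (2 * pi * \<i>)) *s form1 (\<chi> j. cnj (\<zeta> $ j - z $ j) / of_real ((norm (\<zeta> - z))\<^sup>2))"

text \<open>The sum \<open>a + a \<and> \<partial>a + a \<and> (\<partial>a)\<^sup>2\<close> with \<open>\<partial>\<close>-bar in place of \<open>\<partial>\<close>.\<close>

definition geometric :: "(complex ^ 3 \<Rightarrow> complex ^ 3 \<Rightarrow> ext) \<Rightarrow> complex ^ 3 \<Rightarrow> complex ^ 3 \<Rightarrow> ext" where
  "geometric a \<zeta> z = a \<zeta> z + a \<zeta> z \<^bold>\<and> dbar a \<zeta> z + a \<zeta> z \<^bold>\<and> dbar a \<zeta> z \<^bold>\<and> dbar a \<zeta> z"

definition B_form :: "complex ^ 3 \<Rightarrow> complex ^ 3 \<Rightarrow> ext" where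
  "B_form = geometric b_form"

definition cut_form :: "(complex ^ 3 \<Rightarrow> real) \<Rightarrow> complex ^ 3 \<Rightarrow> complex ^ 3 \<Rightarrow> ext" where
  "cut_form cutoff \<zeta> z = scal (of_real (cutoff \<zeta>))"

definition supp_dbar :: "(complex ^ 3 \<Rightarrow> real) \<Rightarrow> (complex ^ 3) set" where
  "supp_dbar cutoff = closure {\<zeta>. dbar (cut_form cutoff) \<zeta> 0 \<noteq> 0}"

definition g_form ::
  "(complex ^ 3 \<Rightarrow> real) \<Rightarrow> (complex ^ 3 \<Rightarrow> complex ^ 3 \<Rightarrow> complex ^ 3)
     \<Rightarrow> complex ^ 3 \<Rightarrow> complex ^ 3 \<Rightarrow> ext" where
  "g_form cutoff s \<zeta> z = cut_form cutoff \<zeta> z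
     - dbar (cut_form cutoff) \<zeta> z \<^bold>\<and> geometric (\<lambda>\<xi> w. form1 (s \<xi> w)) \<zeta> z"

definition bideg_hol :: "nat \<Rightarrow> ext \<Rightarrow> ext" where
  "bideg_hol k a = (\<chi> S. if card (S \<inter> range Dzeta) = k then a $ S else 0)"

definition K_numerator ::
  "(complex ^ 3 \<Rightarrow> real) \<Rightarrow> (complex ^ 3 \<Rightarrow> complex ^ 3 \<Rightarrow> complex ^ 3)
     \<Rightarrow> (complex ^ 3 \<Rightarrow> complex ^ 3 \<Rightarrow> complex ^ 3) \<Rightarrow> complex ^ 3 \<Rightarrow> complex ^ 3 \<Rightarrow> ext" where
  "K_numerator cutoff s h \<zeta> z =
     form1 (h \<zeta> z) \<^bold>\<and> bideg_hol 2 (g_form cutoff s \<zeta> z \<^bold>\<and> B_form \<zeta> z)"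

definition divide_dzeta :: "ext \<Rightarrow> ext" where
  "divide_dzeta a = (\<chi> S. if S \<inter> range Dzeta = {} then a $ (range Dzeta \<union> S) else 0)"

lemma wedge_axis_disjoint:
  assumes "S \<inter> T = {}"
  shows "axis S x \<^bold>\<and> axis T y =
    axis (S \<union> T) ((- 1) ^ card {(g, h). g \<in> S \<and> h \<in> T \<and> grank h < grank g} * x * y)"
proof (rule vec_eq_iff[THEN iffD2], rule allI)
  fix R
  have *: "(\<Sum>P\<in>Pow R. (- 1) ^ card {(g, h). g \<in> P \<and> h \<in> R - P \<and> grank h < grank g}
              * axis S x $ P * axis T y $ (R - P))
     = (\<Sum>P\<in>Pow R. if P = S then (if R - S = T then
           (- 1) ^ card {(g, h). g \<in> S \<and> h \<in> T \<and> grank h < grank g} * x * y else 0) else 0)"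
    by (intro sum.cong) (auto simp: axis_def)
  have "S \<subseteq> R \<and> R - S = T \<longleftrightarrow> R = S \<union> T"
    using assms by blast
  then show "(axis S x \<^bold>\<and> axis T y) $ R = axis (S \<union> T)
      ((- 1) ^ card {(g, h). g \<in> S \<and> h \<in> T \<and> grank h < grank g} * x * y) $ R"
    unfolding wedge_def vec_lambda_beta *
    by (auto simp: axis_def sum.delta)
qed

lemma range_Dzeta: "range Dzeta = {Dzeta 1, Dzeta 2, Dzeta 3}"
  unfolding UNIV_3 by simp

lemma dzeta123_eq: "dzeta123 = axis (range Dzeta) 1"
proof -
  have d: "(1::3) \<noteq> 2" "(1::3) \<noteq> 3" "(2::3) \<noteq> 3" by simp_all
  have e1: "{(g, h). g \<in> {Dzeta 2} \<and> h \<in> {Dzeta 3} \<and> grank h < grank g} = {}"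
    and e2: "{(g, h). g \<in> {Dzeta 1} \<and> h \<in> {Dzeta 2, Dzeta 3} \<and> grank h < grank g} = {}"
    using d by (auto simp: idx_def)
  have "gform (Dzeta 2) \<^bold>\<and> gform (Dzeta 3) = axis {Dzeta 2, Dzeta 3} 1"
  proof -
    have "{Dzeta 2} \<inter> {Dzeta 3} = {}" "{Dzeta 2} \<union> {Dzeta 3} = {Dzeta 2, Dzeta 3}"
      using d by auto
    then show ?thesis
      unfolding gform_def by (metis (no_types) wedge_axis_disjoint e1 card.empty power_0 mult_1)
  qed
  moreover have "gform (Dzeta 1) \<^bold>\<and> axis {Dzeta 2, Dzeta 3} 1 = axis {Dzeta 1, Dzeta 2, Dzeta 3} 1"
  proof -
    have "{Dzeta 1} \<inter> {Dzeta 2, Dzeta 3} = {}"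
      "{Dzeta 1} \<union> {Dzeta 2, Dzeta 3} = {Dzeta 1, Dzeta 2, Dzeta 3}"
      using d by auto
    then show ?thesis
      unfolding gform_def by (metis (no_types) wedge_axis_disjoint e2 card.empty power_0 mult_1)
  qed
  ultimately show ?thesis
    unfolding dzeta123_def range_Dzeta by simp
qed

lemma dzeta123_wedge:
  assumes "\<forall>S. k $ S \<noteq> 0 \<longrightarrow> S \<inter> range Dzeta = {}"
  shows "(dzeta123 \<^bold>\<and> k) $ R = (if range Dzeta \<subseteq> R then k $ (R - range Dzeta) else 0)"
proof -
  have "(dzeta123 \<^bold>\<and> k) $ R = (\<Sum>P\<in>Pow R. if P = range Dzeta then
      (- 1) ^ card {(g, h). g \<in> range Dzeta \<and> h \<in> R - range Dzeta \<and> grank h < grank g}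
        * k $ (R - range Dzeta) else 0)"
    unfolding wedge_def vec_lambda_beta dzeta123_eq
    by (intro sum.cong) (auto simp: axis_def)
  also have "{(g, h). g \<in> range Dzeta \<and> h \<in> R - range Dzeta \<and> grank h < grank g} = {}"
  proof -
    have "grank g < grank h" if "g \<in> range Dzeta" "h \<notin> range Dzeta" for g h
      using that by (cases h) (auto simp: idx_def split: if_splits)
    then have "\<not> (g \<in> range Dzeta \<and> h \<in> R - range Dzeta \<and> grank h < grank g)" for g h
      by (meson DiffD2 less_asym)
    then show ?thesis by (simp only: case_prod_beta) simp
  qed
  finally show ?thesis by (simp add: sum.delta)
qed

text \<open>\<open>divide_dzeta a\<close> is the unique form without holomorphic differentials whose product with
  \<open>dzeta123\<close> is \<open>a\<close>.\<close>

lemma divide_dzeta_unique: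
  assumes a: "\<forall>S. a $ S \<noteq> 0 \<longrightarrow> range Dzeta \<subseteq> S"
  shows "(\<forall>S. k $ S \<noteq> 0 \<longrightarrow> S \<inter> range Dzeta = {}) \<and> dzeta123 \<^bold>\<and> k = a
           \<longleftrightarrow> k = divide_dzeta a"
proof
  assume k: "(\<forall>S. k $ S \<noteq> 0 \<longrightarrow> S \<inter> range Dzeta = {}) \<and> dzeta123 \<^bold>\<and> k = a"
  show "k = divide_dzeta a"
  proof (rule vec_eq_iff[THEN iffD2], rule allI)
    fix S
    show "k $ S = divide_dzeta a $ S"
    proof (cases "S \<inter> range Dzeta = {}")
      case True
      then have "range Dzeta \<union> S - range Dzeta = S" by blast
      then show ?thesis
        using k dzeta123_wedge[of k "range Dzeta \<union> S"] True by (simp add: divide_dzeta_def)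
    qed (use k in \<open>auto simp: divide_dzeta_def\<close>)
  qed
next
  assume k: "k = divide_dzeta a"
  have 0: "\<forall>S. k $ S \<noteq> 0 \<longrightarrow> S \<inter> range Dzeta = {}"
    by (simp add: k divide_dzeta_def)
  have "(dzeta123 \<^bold>\<and> k) $ R = a $ R" for R
  proof (cases "range Dzeta \<subseteq> R")
    case True
    then have "range Dzeta \<union> (R - range Dzeta) = R" "(R - range Dzeta) \<inter> range Dzeta = {}"
      by blast+
    then have "divide_dzeta a $ (R - range Dzeta) = a $ R"
      unfolding divide_dzeta_def by (simp only: vec_lambda_beta if_True simp_thms)
    then show ?thesis
      using True unfolding dzeta123_wedge[OF 0] by (simp only: k if_True)
  next
    case False
    then show ?thesis using a unfolding dzeta123_wedge[OF 0] by auto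
  qed
  then show "(\<forall>S. k $ S \<noteq> 0 \<longrightarrow> S \<inter> range Dzeta = {}) \<and> dzeta123 \<^bold>\<and> k = a"
    using 0 by (simp add: vec_eq_iff)
qed

definition K_tilde ::
  "(complex ^ 3 \<Rightarrow> real) \<Rightarrow> (complex ^ 3 \<Rightarrow> complex ^ 3 \<Rightarrow> complex ^ 3)
     \<Rightarrow> (complex ^ 3 \<Rightarrow> complex ^ 3 \<Rightarrow> complex ^ 3) \<Rightarrow> complex ^ 3 \<Rightarrow> complex ^ 3 \<Rightarrow> ext" where
  "K_tilde cutoff s h \<zeta> z = divide_dzeta (K_numerator cutoff s h \<zeta> z)"

text \<open>Hence \<open>dzeta123 \<and> K_tilde = h \<and> (g \<and> B)\<^sub>2\<close>, as the right-hand side has degree 3 in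
  \<open>d\<zeta>\<^sub>j\<close>:\<close>

lemma K_numerator_support: "K_numerator cutoff s h \<zeta> z $ S \<noteq> 0 \<longrightarrow> range Dzeta \<subseteq> S"
proof
  assume "K_numerator cutoff s h \<zeta> z $ S \<noteq> 0"
  then obtain T where "T \<in> Pow S" and T2: "form1 (h \<zeta> z) $ T \<noteq> 0"
    and "bideg_hol 2 (g_form cutoff s \<zeta> z \<^bold>\<and> B_form \<zeta> z) $ (S - T) \<noteq> 0"
    unfolding K_numerator_def wedge_def[of "form1 _"] vec_lambda_beta
    by (elim sum.not_neutral_contains_not_neutral) simp
  then have T1: "T \<subseteq> S"
    and "bideg_hol 2 (g_form cutoff s \<zeta> z \<^bold>\<and> B_form \<zeta> z) $ (S - T) \<noteq> 0"
    by simp_all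
  then have c2: "card ((S - T) \<inter> range Dzeta) = 2"
    unfolding bideg_hol_def vec_lambda_beta by presburger
  obtain j where "T = {Dzeta j}"
    using T2 unfolding form1_def gform_def sum_component
    by (elim sum.not_neutral_contains_not_neutral) (simp add: axis_def split: if_splits)
  with T1 have "S \<inter> range Dzeta = insert (Dzeta j) ((S - T) \<inter> range Dzeta)"
    "Dzeta j \<notin> (S - T) \<inter> range Dzeta"
    by auto
  with c2 have "card (S \<inter> range Dzeta) = 3"
    by simp
  moreover have "card (range Dzeta) = 3"
    by (subst card_image) (simp_all add: inj_on_def)
  ultimately have "S \<inter> range Dzeta = range Dzeta"
    by (intro card_subset_eq) auto
  then show "range Dzeta \<subseteq> S" by blast
qed

lemma K_tilde_eq: "dzeta123 \<^bold>\<and> K_tilde cutoff s h \<zeta> z =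
    form1 (h \<zeta> z) \<^bold>\<and> bideg_hol 2 (g_form cutoff s \<zeta> z \<^bold>\<and> B_form \<zeta> z)"
proof -
  have "\<forall>S. K_numerator cutoff s h \<zeta> z $ S \<noteq> 0 \<longrightarrow> range Dzeta \<subseteq> S"
    by (intro allI K_numerator_support)
  from divide_dzeta_unique[OF this, THEN iffD2, OF refl, THEN conjunct2] show ?thesis
    unfolding K_tilde_def by (simp only: K_numerator_def)
qed

definition K_kernel ::
  "(complex ^ 3 \<Rightarrow> ext) \<Rightarrow> (complex ^ 3 \<Rightarrow> real) \<Rightarrow> (complex ^ 3 \<Rightarrow> complex ^ 3 \<Rightarrow> complex ^ 3)
     \<Rightarrow> (complex ^ 3 \<Rightarrow> complex ^ 3 \<Rightarrow> complex ^ 3) \<Rightarrow> complex ^ 3 \<Rightarrow> complex ^ 3 \<Rightarrow> ext" where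
  "K_kernel \<omega> cutoff s h \<zeta> z = \<omega> \<zeta> \<^bold>\<and> K_tilde cutoff s h \<zeta> z"

text \<open>The coefficient, a form in \<open>\<zeta>\<close>, of the product over \<open>j \<in> J\<close> of the conjugates of \<open>dz\<^sub>j\<close>.
  It stands on the left; for the component of degree 4 in \<open>\<zeta>\<close>, which is the one that is
  integrated, the side does not matter.\<close>

definition z_part :: "3 set \<Rightarrow> ext \<Rightarrow> ext" where
  "z_part J a = (\<chi> S. if S \<inter> range Dzbar = {} then a $ (S \<union> Dzbar ` J) else 0)"

definition K_integrand ::
  "(complex ^ 3 \<Rightarrow> complex) \<Rightarrow> (complex ^ 3 \<Rightarrow> ext) \<Rightarrow> (complex ^ 3 \<Rightarrow> real)
     \<Rightarrow> (complex ^ 3 \<Rightarrow> complex ^ 3 \<Rightarrow> complex ^ 3) \<Rightarrow> (complex ^ 3 \<Rightarrow> complex ^ 3 \<Rightarrow> complex ^ 3)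
     \<Rightarrow> (complex ^ 3 \<Rightarrow> ext) \<Rightarrow> complex ^ 3 \<Rightarrow> 3 set \<Rightarrow> complex ^ 3 \<Rightarrow> complex" where
  "K_integrand f \<omega> cutoff s h \<phi> z J \<zeta> =
     top_coeff f \<zeta> (z_part J (K_kernel \<omega> cutoff s h \<zeta> z \<^bold>\<and> \<phi> \<zeta>))"

text \<open>Absolute convergence of the integral. The formula for the operator thus makes sense for forms
  that are not smooth, and this is how it is extended to Lebesgue spaces.\<close>

definition K_converges ::
  "(complex ^ 3 \<Rightarrow> complex) \<Rightarrow> (complex ^ 3) set \<Rightarrow> (complex ^ 3 \<Rightarrow> ext) \<Rightarrow> (complex ^ 3 \<Rightarrow> real)
     \<Rightarrow> (complex ^ 3 \<Rightarrow> complex ^ 3 \<Rightarrow> complex ^ 3) \<Rightarrow> (complex ^ 3 \<Rightarrow> complex ^ 3 \<Rightarrow> complex ^ 3)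
     \<Rightarrow> (complex ^ 3 \<Rightarrow> ext) \<Rightarrow> complex ^ 3 \<Rightarrow> bool" where
  "K_converges f X \<omega> cutoff s h \<phi> z \<longleftrightarrow>
     (\<forall>J. integrable (dV_reg X X) (K_integrand f \<omega> cutoff s h \<phi> z J))"

text \<open>The result, which is a form in the conjugates of \<open>dz\<^sub>j\<close>, is written with the one-variable generators
  \<open>Dzetabar\<close>.\<close>

definition K_op ::
  "(complex ^ 3 \<Rightarrow> complex) \<Rightarrow> (complex ^ 3) set \<Rightarrow> (complex ^ 3 \<Rightarrow> ext) \<Rightarrow> (complex ^ 3 \<Rightarrow> real)
     \<Rightarrow> (complex ^ 3 \<Rightarrow> complex ^ 3 \<Rightarrow> complex ^ 3) \<Rightarrow> (complex ^ 3 \<Rightarrow> complex ^ 3 \<Rightarrow> complex ^ 3)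
     \<Rightarrow> (complex ^ 3 \<Rightarrow> ext) \<Rightarrow> complex ^ 3 \<Rightarrow> ext" where
  "K_op f X \<omega> cutoff s h \<phi> z =
     (\<chi> S. if S \<subseteq> range Dzetabar
           then (\<integral>\<zeta>. K_integrand f \<omega> cutoff s h \<phi> z {j. Dzetabar j \<in> S} \<zeta> \<partial>dV_reg X X)
           else 0)"

end

(* No cancellation in the kernel is needed; absolute values suffice. The Hefer form restricts to a
  multiple of the gradient of f on the diagonal, and the structure form has size 1/|grad f|, so with
  W = 1/|grad f| and t = |zeta - z| the kernel is bounded by t^(-3) + W t^(-2), and its differences in
  z by |z - w|^a times the same expression with t^(-3-a) + W t^(-2-a), 0 <= a <= 1, at the nearer point.
  The volume of X in a ball of radius t is at most C t^4, uniformly up to the singular point, because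
  X is a union of graphs over coordinate planes whose number of sheets is bounded by the order of
  vanishing of f along lines. Since W lies in L^q', q' < q, Hoelder's inequality gives the Hoelder
  estimate for a < 2 - 4/q and the L^p estimate for p > q/(q - 1), the latter with a small constant
  for forms carried by a set of small measure. Arzela-Ascoli and interpolation give compactness from
  bounded forms to Hoelder forms; in L^p one truncates the forms, passes to a diagonal sequence of
  the truncations, and uses the small constant for the remainders. *)

theory Submission
 imports Defs "HOL-Complex_Analysis.Great_Picard" "HOL-Library.Diagonal_Subsequence"
begin

section \<open>Holomorphic functions of several variables\<close>

text \<open>The thresholds come from one count. On a set with volume growth r^4, the kernel t^(-b)
  is integrable for b < 4. For W t^(-2-a), with W in L^q' for all q' < q, this asks for (2 + a) q/(q
  - 1) < 4, i.e. a < 2 - 4/q = 4/p(X) - 2; the term t^(-3-a) asks for a < 1, which then follows from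
  q \<le> 4. Two obstacles shape the formal side. The volume measure is a definite description, so
  existence and uniqueness must be established from charts before any integral can be estimated. The
  orthonormal frame is an arbitrary choice at each point, without any measurability in the point;
  the integrand and the norms of the images are therefore rewritten through the gradient of f, which
  is possible because the bilinear cross product of two tangent vectors is a multiple of the
  gradient. At the singular point, a given coordinate axis may lie inside X. The axes are therefore
  tilted so that f does not vanish identically on any of the three lines through the point, and each
  piece of X is projected along the axis with the largest derivative of f.\<close>

lemma norm_smult_vec: "norm (c *s v) = cmod c * norm (v :: complex ^ 'n)"
 by (simp add: norm_vec_def L2_set_def norm_mult power_mult_distrib real_sqrt_mult flip: sum_distrib_left)

lemma bounded_linear_smult_right: "bounded_linear (%v :: complex ^ 'n. c *s v)"
 by (rule linear_conv_bounded_linear[THEN iffD1])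
   (auto intro!: linearI simp: vec_eq_iff algebra_simps)

lemma bounded_linear_smult_left: "bounded_linear (%c :: complex. c *s (v :: complex ^ 'n))"
 by (rule linear_conv_bounded_linear[THEN iffD1])
   (auto intro!: linearI simp: vec_eq_iff algebra_simps)

lemma scaleR_smult: "r *\<^sub>R (v :: complex ^ 'n) = complex_of_real r *s v"
 unfolding vec_eq_iff by (simp add: scaleR_conv_of_real[where 'a = complex])

lemma holo_onD:
 assumes "holo_on U F" "x \<in> U"
 shows "(F has_derivative frechet_derivative F (at x)) (at x)"
  and "frechet_derivative F (at x) (c *s v) = c * frechet_derivative F (at x) v"
proof -
 obtain D where D: "(F has_derivative D) (at x)" "ALL c v. D (c *s v) = c * D v"
  using assms unfolding holo_on_def by blast
 then have "frechet_derivative F (at x) = D"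
  using frechet_derivative_at by metis
 with D show "(F has_derivative frechet_derivative F (at x)) (at x)"
  and "frechet_derivative F (at x) (c *s v) = c * frechet_derivative F (at x) v" by simp_all
qed

lemma holo_on_subset: "holo_on U F ==> V <= U ==> holo_on V F"
 unfolding holo_on_def by blast

lemma holo_on_imp_continuous_on: "holo_on U F ==> continuous_on U F"
 by (meson continuous_at_imp_continuous_on has_derivative_continuous holo_onD(1))

text \<open>The facts about several variables below are read off from one-variable function theory
  on complex lines; complex linearity of the derivative is what makes the restriction to a line
  holomorphic.\<close>

lemma holo_on_line:
 assumes F: "holo_on U F" and U: "x + \<tau> *s v \<in> U"
 shows "((%\<tau>. F (x + \<tau> *s v)) has_field_derivative frechet_derivative F (at (x + \<tau> *s v)) v) (at \<tau>)"
proof -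
 have "((%\<tau>. x + \<tau> *s v) has_derivative (%h. 0 + h *s v)) (at \<tau>)"
  by (intro has_derivative_add has_derivative_const
    bounded_linear_imp_has_derivative bounded_linear_smult_left)
 then have "((%\<tau>. x + \<tau> *s v) has_derivative (%h. h *s v)) (at \<tau>)" by simp
 from has_derivative_compose[OF this holo_onD(1)[OF F U]]
 show ?thesis
  unfolding has_field_derivative_def
  by (simp add: holo_onD(2)[OF F U] mult.commute[of _ "frechet_derivative F _ v"] )
qed

lemma holo_on_line_holomorphic:
 assumes "holo_on U F" "!!\<tau>. \<tau> \<in> S ==> x + \<tau> *s v \<in> U"
 shows "(%\<tau>. F (x + \<tau> *s v)) holomorphic_on S"
 unfolding holomorphic_on_def field_differentiable_def
 using holo_on_line[OF assms(1)] assms(2) has_field_derivative_at_within by blast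

text \<open>Stated for a function of one variable so that it applies both to \<open>F\<close> along
  one line and to the difference of \<open>F\<close> along two parallel lines.\<close>

lemma has_field_derivative_Cauchy_bound:
 assumes "!!\<tau>. cmod \<tau> <= \<rho> ==> EX d. (g has_field_derivative d) (at \<tau>)" "0 < \<rho>"
  and "!!\<tau>. cmod \<tau> <= \<rho> ==> cmod (g \<tau>) <= B" and "(g has_field_derivative d) (at 0)"
 shows "cmod d <= B / \<rho>"
proof -
 have hol: "g holomorphic_on cball 0 \<rho>"
  unfolding holomorphic_on_def field_differentiable_def
  using assms(1) has_field_derivative_at_within by (metis dist_0_norm mem_cball)
 have "cmod ((deriv ^^ 1) g 0) <= fact 1 * B / \<rho> ^ 1"
  using assms(2,3) hol
  by (intro Cauchy_inequality holomorphic_on_imp_continuous_on)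
    (auto intro: holomorphic_on_subset)
 then show ?thesis using DERIV_imp_deriv[OF assms(4)] by simp
qed

lemma holo_deriv_bound:
 assumes "holo_on U F" "0 < \<rho>"
  and "!!\<tau>. cmod \<tau> <= \<rho> ==> x + \<tau> *s v \<in> U \<and> cmod (F (x + \<tau> *s v)) <= B"
 shows "cmod (frechet_derivative F (at x) v) <= B / \<rho>"
proof (rule has_field_derivative_Cauchy_bound[where g = "%\<tau>. F (x + \<tau> *s v)"])
 show "EX d. ((%\<tau>. F (x + \<tau> *s v)) has_field_derivative d) (at \<tau>)" if "cmod \<tau> <= \<rho>" for \<tau>
  using holo_on_line[OF assms(1)] assms(3)[OF that] by blast
 show "((%\<tau>. F (x + \<tau> *s v)) has_field_derivative frechet_derivative F (at x) v) (at 0)"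
  using holo_on_line[OF assms(1), of x 0 v] assms(2) assms(3)[of 0] by simp
qed (use assms in auto)

text \<open>The derivative at y minus the one at x, in direction v, is the derivative at 0 of F(y +
  \<tau> v) - F(x + \<tau> v) in \<tau>. Uniform continuity makes this difference small on a fixed
  disc, and Cauchy's bound then makes its derivative small. The inverse function theorem and the
  measurability of the gradient both rest on this.\<close>

lemma holo_deriv_continuous:
 fixes U :: "(complex ^ 'n) set"
 assumes U: "open U" and F: "holo_on U F"
 shows "continuous_on U (%x. frechet_derivative F (at x) v)"
 unfolding continuous_on_eq_continuous_at[OF U]
proof
 fix x assume "x \<in> U"
 then obtain R where R: "0 < R" "cball x R <= U"
  using U open_contains_cball by blast
 \<comment> \<open>Discs of this radius in direction v, centred within R/2 of x, stay in the closed
   ball of radius R; the summand 1 covers v = 0.\<close>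
 define \<rho> where "\<rho> = R / (2 * (norm v + 1))"
 have \<rho>: "0 < \<rho>" "\<rho> * norm v <= R / 2"
  using R by (auto simp: \<rho>_def field_simps add_pos_nonneg)
 have uc: "uniformly_continuous_on (cball x R) F"
  using R(2) F by (intro compact_uniformly_continuous continuous_on_subset[OF holo_on_imp_continuous_on]) auto
 show "isCont (%x. frechet_derivative F (at x) v) x"
  unfolding continuous_at_eps_delta
 proof (intro allI impI)
  fix e :: real assume e: "0 < e"
  then have "0 < e * \<rho> / 2" using \<rho> by simp
  then obtain d where d: "0 < d"
   "!!p q. p \<in> cball x R ==> q \<in> cball x R ==> dist q p < d ==> dist (F q) (F p) < e * \<rho> / 2"
   using uc unfolding uniformly_continuous_on_def by metis
  have "dist (frechet_derivative F (at y) v) (frechet_derivative F (at x) v) < e"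
   if y: "dist y x < min d (R / 2)" for y
  proof -
   have in1: "y + \<tau> *s v \<in> cball x R" "x + \<tau> *s v \<in> cball x R" if "cmod \<tau> <= \<rho>" for \<tau>
   proof -
    have "norm (\<tau> *s v) <= R / 2"
     using that \<rho> mult_right_mono[of "cmod \<tau>" \<rho> "norm v"] by (simp add: norm_smult_vec)
    then show "y + \<tau> *s v \<in> cball x R" "x + \<tau> *s v \<in> cball x R"
     using y R norm_triangle_ineq[of "y - x" "\<tau> *s v"]
     by (auto simp: dist_norm norm_minus_commute algebra_simps)
   qed
   have "cmod (frechet_derivative F (at y) v - frechet_derivative F (at x) v) <= (e * \<rho> / 2) / \<rho>"
   proof (rule has_field_derivative_Cauchy_bound[where g = "%\<tau>. F (y + \<tau> *s v) - F (x + \<tau> *s v)"])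
    fix \<tau> :: complex assume t: "cmod \<tau> <= \<rho>"
    show "EX d. ((%\<tau>. F (y + \<tau> *s v) - F (x + \<tau> *s v)) has_field_derivative d) (at \<tau>)"
     by (intro exI, rule DERIV_diff[OF holo_on_line[OF F, of y \<tau> v] holo_on_line[OF F, of x \<tau> v]])
      (use in1[OF t] R(2) in auto)
    have "dist (y + \<tau> *s v) (x + \<tau> *s v) < d"
     using y by (simp add: dist_norm)
    then show "cmod (F (y + \<tau> *s v) - F (x + \<tau> *s v)) <= e * \<rho> / 2"
     using d(2)[OF in1(2,1)[OF t]] by (simp add: dist_norm less_imp_le)
   next
    have "y \<in> U" "x \<in> U" using in1[of 0] \<rho> R(2) by auto
    then show "((%\<tau>. F (y + \<tau> *s v) - F (x + \<tau> *s v)) has_field_derivative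
      frechet_derivative F (at y) v - frechet_derivative F (at x) v) (at 0)"
     using DERIV_diff[OF holo_on_line[OF F, of y 0 v] holo_on_line[OF F, of x 0 v]] by simp
   qed (use \<rho> in auto)
   also have "... < e" using e \<rho> by simp
   finally show ?thesis by (simp add: dist_norm)
  qed
  then show "\<exists>d>0. ALL y. dist y x < d -->
    dist (frechet_derivative F (at y) v) (frechet_derivative F (at x) v) < e"
   using d(1) R(1) by (intro exI[of _ "min d (R / 2)"]) auto
 qed
qed

lemma vec_eq_sum_axis: "(v :: complex ^ 'n) = (\<Sum>j\<in>UNIV. v $ j *s axis j 1)"
 by (simp add: vec_eq_iff axis_def if_distrib[of "%x. _ * x"] cong: if_cong)

lemma holo_frechet_sum:
 assumes "holo_on U F" "x \<in> U"
 shows "frechet_derivative F (at x) v = (\<Sum>j\<in>UNIV. v $ j * frechet_derivative F (at x) (axis j 1))"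
proof -
 interpret linear "frechet_derivative F (at x)"
  using holo_onD(1)[OF assms] has_derivative_linear by blast
 have "frechet_derivative F (at x) (\<Sum>j\<in>UNIV. v $ j *s axis j 1) =
   (\<Sum>j\<in>UNIV. v $ j * frechet_derivative F (at x) (axis j 1))"
  by (simp add: sum holo_onD(2)[OF assms])
 then show ?thesis by (simp only: vec_eq_sum_axis[of v, symmetric])
qed

text \<open>\<open>Z\<close> need not be convex. Two points closer than \<epsilon>/2 lie in a ball
  on which Cauchy's estimate bounds the derivative; for all other pairs the sup bound divided by the
  distance suffices. The parameter \<open>a\<close> keeps the constant uniform in the other variable
  of the kernel.\<close>

lemma holo_uniform_lipschitz:
 fixes F :: "'a::euclidean_space => complex ^ 'n => complex"
 assumes A: "compact A" and Z: "compact Z" "Z <= W" "open W"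
  and cont: "continuous_on (A \<times> W) (%(a, z). F a z)"
  and holo: "!!a. a \<in> A ==> holo_on W (F a)"
 obtains L where "0 < L" "!!a z. a \<in> A ==> z \<in> Z ==> cmod (F a z) <= L"
  "!!a z w. a \<in> A ==> z \<in> Z ==> w \<in> Z ==> cmod (F a z - F a w) <= L * dist z w"
proof -
 obtain \<epsilon> where \<epsilon>: "0 < \<epsilon>" "(\<Union>z\<in>Z. cball z \<epsilon>) <= W"
  using compact_subset_open_imp_cball_epsilon_subset[OF Z(1,3,2)] by blast
 define Z' where "Z' = (\<Union>z\<in>Z. cball z \<epsilon>)"
 have Z'eq: "Z' = {x + y |x y. x \<in> Z \<and> y \<in> cball 0 \<epsilon>}"
 proof (intro set_eqI iffI)
  fix x assume "x \<in> Z'"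
  then obtain z where "z \<in> Z" "dist z x <= \<epsilon>" unfolding Z'_def by auto
  then show "x \<in> {x + y |x y. x \<in> Z \<and> y \<in> cball 0 \<epsilon>}"
   by (intro CollectI exI[of _ z] exI[of _ "x - z"]) (auto simp: dist_norm norm_minus_commute)
 next
  fix p assume "p \<in> {x + y |x y. x \<in> Z \<and> y \<in> cball 0 \<epsilon>}"
  then obtain x y where "p = x + y" "x \<in> Z" "norm y <= \<epsilon>" by auto
  then show "p \<in> Z'" unfolding Z'_def by (intro UN_I[of x]) (auto simp: dist_norm)
 qed
 have Z': "compact Z'" unfolding Z'eq using Z(1) by (intro compact_sums) auto
 have "compact ((%(a, z). F a z) ` (A \<times> Z'))"
  using A Z' \<epsilon>(2) by (intro compact_continuous_image compact_Times continuous_on_subset[OF cont])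
   (auto simp: Z'_def)
 then obtain M where M0: "0 < M" "\<forall>x\<in>(%(a, z). F a z) ` (A \<times> Z'). cmod x <= M"
  using compact_imp_bounded bounded_pos by metis
 have M: "0 < M" "!!a z. a \<in> A ==> z \<in> Z' ==> cmod (F a z) <= M"
  using M0 by auto
 have ZZ': "z \<in> Z'" if "z \<in> Z" for z
  using that \<epsilon>(1) unfolding Z'_def by (intro UN_I[of z]) auto
 \<comment> \<open>A disc of radius \<epsilon>/(2 |v|) gives the derivative bound 2 M
   |v|/\<epsilon>, while a pair at distance at least \<epsilon>/2 needs 2 M \<le> L \<epsilon>/2;
   the second requirement fixes the constant.\<close>
 define L where "L = 4 * M / \<epsilon>"
 have L: "0 < L" using M \<epsilon> by (simp add: L_def)
 have lip: "cmod (F a z - F a w) <= L * dist z w" if a: "a \<in> A" and z: "z \<in> Z" and w: "w \<in> Z" for a z w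
 proof (cases "dist z w < \<epsilon> / 2")
  case True
  have b: "cmod (frechet_derivative (F a) (at x) v) <= L * norm v" if x: "x \<in> ball z (\<epsilon> / 2)" for x v
  proof (cases "v = 0")
   case False
   have "cmod (frechet_derivative (F a) (at x) v) <= M / (\<epsilon> / (2 * norm v))"
   proof (rule holo_deriv_bound[OF holo[OF a]])
    fix \<tau> assume "cmod \<tau> <= \<epsilon> / (2 * norm v)"
    then have "norm (\<tau> *s v) <= \<epsilon> / 2" using False by (simp add: norm_smult_vec field_simps)
    then have "x + \<tau> *s v \<in> cball z \<epsilon>"
     using x norm_triangle_ineq[of "x - z" "\<tau> *s v"]
     by (auto simp: dist_norm norm_minus_commute algebra_simps)
    then have "x + \<tau> *s v \<in> Z'" using z unfolding Z'_def by blast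
    then show "x + \<tau> *s v \<in> W \<and> cmod (F a (x + \<tau> *s v)) <= M"
     using M a \<epsilon>(2) unfolding Z'_def by blast
   qed (use False \<epsilon> in simp)
   also have "... <= L * norm v" using \<epsilon> M by (simp add: L_def field_simps)
   finally show ?thesis .
  next
   case True
   have "x \<in> W" using x z \<epsilon> by (force simp: Z'_def)
   then show ?thesis using True holo_frechet_sum[OF holo[OF a], of x 0] by simp
  qed
  have "cmod (F a z - F a w) <= L * norm (z - w)"
  proof (rule differentiable_bound[of "ball z (\<epsilon> / 2)"])
   fix x assume x: "x \<in> ball z (\<epsilon> / 2)"
   then have "x \<in> W" using z \<epsilon> by (force simp: Z'_def)
   then have d: "(F a has_derivative frechet_derivative (F a) (at x)) (at x)"
    by (rule holo_onD(1)[OF holo[OF a]])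
   then show "(F a has_derivative frechet_derivative (F a) (at x)) (at x within ball z (\<epsilon> / 2))"
    using has_derivative_at_withinI by blast
   show "onorm (frechet_derivative (F a) (at x)) <= L"
    by (rule onorm_le) (rule b[OF x])
  qed (use True \<epsilon> in \<open>auto simp: dist_commute\<close>)
  then show ?thesis by (simp add: dist_norm)
 next
  case False
  have "cmod (F a z - F a w) <= 2 * M"
   using M(2)[OF a ZZ'[OF z]] M(2)[OF a ZZ'[OF w]] norm_triangle_ineq4[of "F a z" "F a w"] by linarith
  also have "... <= L * dist z w"
   using False \<epsilon> M by (simp add: L_def field_simps)
  finally show ?thesis .
 qed
 show ?thesis
 proof (rule that[of "M + L"])
  fix a z w assume *: "a \<in> A" "z \<in> Z"
  show "cmod (F a z) <= M + L" using M(2)[OF *(1) ZZ'[OF *(2)]] L by simp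
  assume "w \<in> Z"
  then show "cmod (F a z - F a w) <= (M + L) * dist z w"
   using lip[OF *, of w] M(1) by (simp add: distrib_right add_increasing)
 qed (use M L in simp)
qed

text \<open>A Jensen-type bound by dividing out zeros. A factor t - a has modulus at least 4 \<rho>
  on the circle of radius 5 \<rho> and at most 2 \<rho> at \<open>t1\<close>, so division turns M
  into M/(4 \<rho>) and m into m/(2 \<rho>): every zero costs a factor 2.\<close>

lemma card_zeros_bound:
 assumes "finite Z" "Z <= cball t0 \<rho>" "0 < \<rho>" "open S" "cball t0 (5 * \<rho>) <= S" "g holomorphic_on S"
  and "!!t. t \<in> Z ==> g t = 0" "!!t. t \<in> cball t0 (5 * \<rho>) ==> cmod (g t) <= M"
  and "t1 \<in> cball t0 \<rho>" "m <= cmod (g t1)"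
 shows "m * 2 ^ card Z <= M"
 using assms(1,2,6-10)
proof (induction Z arbitrary: g m M rule: finite_induct)
 case empty
 then have "cmod (g t1) <= M" using \<open>0 < \<rho>\<close> by auto
 with empty show ?case by simp
next
 case (insert a Z)
 \<comment> \<open>The value at \<open>a\<close> removes the singularity, so the maximum principle
   applies to the quotient on the whole disc.\<close>
 define k where "k z = (if z = a then deriv g a else (g z - g a) / (z - a))" for z
 have ga: "g a = 0" and a: "a \<in> cball t0 \<rho>" using insert.prems by auto
 have aS: "a \<in> S" using a assms(3,5) by (auto simp: subset_iff)
 have k: "k holomorphic_on S"
  unfolding k_def using insert.prems \<open>open S\<close> aS by (intro pole_lemma_open) auto
 have gk: "g z = (z - a) * k z" for z
  using ga by (simp add: k_def)
 have far: "4 * \<rho> <= cmod (z - a)" if "dist t0 z = 5 * \<rho>" for z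
  using that a norm_triangle_ineq4[of "z - a" "t0 - a"] by (simp add: dist_norm norm_minus_commute)
 have M0: "0 <= M" using insert.prems(4)[of t0] \<open>0 < \<rho>\<close> order_trans[OF norm_ge_zero[of "g t0"]] by simp
 have kM: "cmod (k z) <= M / (4 * \<rho>)" if z: "z \<in> cball t0 (5 * \<rho>)" for z
 proof (rule maximum_modulus_frontier[of k "cball t0 (5 * \<rho>)"])
  show "k holomorphic_on interior (cball t0 (5 * \<rho>))"
   using k assms(5) by (meson holomorphic_on_subset interior_subset subset_trans)
  show "continuous_on (closure (cball t0 (5 * \<rho>))) k"
   using k assms(5) by (auto intro: holomorphic_on_imp_continuous_on holomorphic_on_subset)
  fix w assume "w \<in> frontier (cball t0 (5 * \<rho>))"
  then have w: "dist t0 w = 5 * \<rho>" by (simp add: frontier_cball)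
  have "cmod (k w) = cmod (g w) / cmod (w - a)"
   using far[OF w] \<open>0 < \<rho>\<close> by (auto simp: gk norm_mult)
  also have "... <= M / (4 * \<rho>)"
   using far[OF w] insert.prems(4)[of w] w M0 \<open>0 < \<rho>\<close> by (intro frac_le) auto
  finally show "cmod (k w) <= M / (4 * \<rho>)" .
 qed (use z in auto)
 have kz: "k t = 0" if "t \<in> Z" for t
  using insert.hyps insert.prems(3)[of t] that gk[of t] by auto
 have near: "cmod (t1 - a) <= 2 * \<rho>"
  using a insert.prems(5) norm_triangle_ineq4[of "t1 - t0" "a - t0"] by (simp add: dist_norm norm_minus_commute)
 have "m <= cmod (t1 - a) * cmod (k t1)"
  using insert.prems(6) gk[of t1] by (simp add: norm_mult)
 also have "... <= 2 * \<rho> * cmod (k t1)" using near by (intro mult_right_mono) auto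
 finally have mk: "m / (2 * \<rho>) <= cmod (k t1)" using \<open>0 < \<rho>\<close> by (simp add: field_simps)
 have "m / (2 * \<rho>) * 2 ^ card Z <= M / (4 * \<rho>)"
  by (rule insert.IH[of k]) (use insert.prems k kM kz mk in auto)
 then show ?case
  using insert.hyps \<open>0 < \<rho>\<close> by (simp add: field_simps)
qed

section \<open>Zero sets as graphs\<close>

text \<open>C^3 is split as C^2 \<times> C; the third coordinate is the one that the implicit
  function theorem solves for and along which X is projected.\<close>

definition cons3 :: "complex ^ 2 => complex => complex ^ 3" where
 "cons3 y t = (\<chi> i. if i = 1 then y $ 1 else if i = 2 then y $ 2 else t)"

definition proj3 :: "complex ^ 3 => complex ^ 2" where
 "proj3 x = (\<chi> i. if i = 1 then x $ 1 else x $ 2)"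

lemma cons3_nth [simp]: "cons3 y t $ 1 = y $ 1" "cons3 y t $ 2 = y $ 2" "cons3 y t $ 3 = t"
 by (simp_all add: cons3_def)

lemma proj3_nth [simp]: "proj3 x $ 1 = x $ 1" "proj3 x $ 2 = x $ 2"
 by (simp_all add: proj3_def)

lemma proj3_cons3 [simp]: "proj3 (cons3 y t) = y"
 by (simp add: vec_eq_iff forall_2)

lemma cons3_proj3 [simp]: "cons3 (proj3 x) (x $ 3) = x"
 by (simp add: vec_eq_iff forall_3)

lemma cons3_eq_iff [simp]: "cons3 y t = cons3 y' t' \<longleftrightarrow> y = y' \<and> t = t'"
 by (auto simp: vec_eq_iff forall_2 forall_3)

lemma cons3_add: "cons3 y t + cons3 y' t' = cons3 (y + y') (t + t')"
 and cons3_diff: "cons3 y t - cons3 y' t' = cons3 (y - y') (t - t')"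
 and cons3_smult: "c *s cons3 y t = cons3 (c *s y) (c * t)"
 and proj3_add: "proj3 (x + x') = proj3 x + proj3 x'"
 and proj3_diff: "proj3 (x - x') = proj3 x - proj3 x'"
 and proj3_smult: "proj3 (c *s x) = c *s proj3 x"
 by (simp_all add: vec_eq_iff forall_2 forall_3)

lemma norm_cons3: "norm (cons3 y t) <= norm y + cmod t"
proof -
 have "norm (cons3 y 0) = norm y" "norm (cons3 0 t) = cmod t"
  by (simp_all add: norm_vec_def L2_set_def sum_3 sum_2)
 moreover have "cons3 y t = cons3 y 0 + cons3 0 t" by (simp add: cons3_add)
 ultimately show ?thesis using norm_triangle_ineq[of "cons3 y 0" "cons3 0 t"] by simp
qed

lemma norm_proj3: "norm (proj3 x) <= norm x"
 by (simp add: norm_vec_def L2_set_def sum_3 sum_2)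

lemma bounded_linear_proj3: "bounded_linear proj3"
 by (rule linear_conv_bounded_linear[THEN iffD1])
   (auto intro!: linearI simp: proj3_add proj3_smult scaleR_smult)

lemma bounded_linear_cons3: "bounded_linear (%(y, t). cons3 y t)"
 by (rule linear_conv_bounded_linear[THEN iffD1])
   (auto intro!: linearI simp: cons3_add scaleR_smult cons3_smult scaleR_conv_of_real[where 'a = complex])

lemma cons3_has_derivative:
 assumes "(f has_derivative f') (at x within S)" "(g has_derivative g') (at x within S)"
 shows "((%x. cons3 (f x) (g x)) has_derivative (%v. cons3 (f' v) (g' v))) (at x within S)"
 using bounded_linear.has_derivative[OF bounded_linear_cons3 has_derivative_Pair[OF assms]] by simp

lemma continuous_on_cons3:
 assumes "continuous_on S f" "continuous_on S g"
 shows "continuous_on S (%x. cons3 (f x) (g x))"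
 using bounded_linear.continuous_on[OF bounded_linear_cons3 continuous_on_Pair[OF assms]] by simp

lemma holo_frechet_cons3:
 assumes "holo_on U F" "x \<in> U"
 shows "frechet_derivative F (at x) (cons3 y t) = y $ 1 * frechet_derivative F (at x) (axis 1 1)
  + y $ 2 * frechet_derivative F (at x) (axis 2 1) + t * frechet_derivative F (at x) (axis 3 1)"
 by (subst holo_frechet_sum[OF assms]) (simp add: sum_3)

text \<open>The inverse function theorem is applied to x -> (x1, x2, F x), and \<open>g\<close> is
  the third coordinate of the inverse on the plane where the last entry is 0. The inverse of a
  complex-linear bijection is complex linear, which makes \<open>g\<close> holomorphic and not
  merely differentiable.\<close>

lemma holo_implicit:
 assumes U: "open U" and F: "holo_on U F" and a: "a \<in> U" "F a = 0"
  and nz: "frechet_derivative F (at a) (axis 3 1) ~= 0"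
 obtains N V g where "open N" "a \<in> N" "N <= U" "open V" "holo_on V g"
  "{x \<in> N. F x = 0} = (%y. cons3 y (g y)) ` V"
  "!!x. x \<in> N ==> frechet_derivative F (at x) (axis 3 1) ~= 0"
proof -
 define d where "d x = frechet_derivative F (at x)" for x
 define U0 where "U0 = {x \<in> U. d x (axis 3 1) ~= 0}"
 have "U0 = U Int (%x. d x (axis 3 1)) -` (- {0})" by (auto simp: U0_def)
 then have U0: "open U0" "a \<in> U0" "U0 <= U"
  using holo_deriv_continuous[OF U F] a nz U
  by (auto simp: U0_def d_def intro!: continuous_open_preimage)
 have F0: "holo_on U0 F" using F U0(3) holo_on_subset by blast
 have dlin: "bounded_linear (d x)" if "x \<in> U0" for x
  using holo_onD(1)[OF F0 that] has_derivative_bounded_linear unfolding d_def by blast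
 have dc: "d x (c *s v) = c * d x v" if "x \<in> U0" for x c v
  unfolding d_def by (rule holo_onD(2)[OF F0 that])
 define G where "G x = cons3 (proj3 x) (F x)" for x
 define A where "A x v = cons3 (proj3 v) (d x v)" for x v
 have A: "(G has_derivative A x) (at x)" if "x \<in> U0" for x
  unfolding G_def A_def d_def
  by (intro cons3_has_derivative bounded_linear_imp_has_derivative bounded_linear_proj3
    holo_onD(1)[OF F0 that])
 have Abl: "bounded_linear (A x)" if "x \<in> U0" for x
  using A[OF that] has_derivative_bounded_linear by blast
 have Ac: "A x (c *s v) = c *s A x v" if "x \<in> U0" for x c v
  by (simp add: A_def dc[OF that] cons3_smult proj3_smult)
 define f' where "f' x = Blinfun (A x)" for x
 have f': "blinfun_apply (f' x) = A x" if "x \<in> U0" for x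
  unfolding f'_def using Abl[OF that] by (simp add: bounded_linear_Blinfun_apply)
 \<comment> \<open>The inverse function theorem asks for continuity as a map into the bounded
   operators; in finite dimension it can be tested on single vectors.\<close>
 have contf: "continuous_on U0 f'"
 proof (rule continuous_on_blinfun_componentwise)
  fix i :: "complex ^ 3"
  have "continuous_on U0 (%x. A x i)"
   unfolding A_def d_def
   by (intro continuous_on_cons3 continuous_intros continuous_on_subset[OF holo_deriv_continuous[OF U F] U0(3)])
  then show "continuous_on U0 (%x. blinfun_apply (f' x) i)"
   using continuous_on_cong[of U0 U0 "%x. blinfun_apply (f' x) i"] by (simp add: f')
 qed
 \<comment> \<open>The explicit inverse of \<open>A a\<close>: the last entry is solved for the
   third coordinate, dividing by the derivative in that direction.\<close>
 define I where "I w = cons3 (proj3 w) ((w $ 3 - d a (cons3 (proj3 w) 0)) / d a (axis 3 1))" for w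
 have dac: "d a (cons3 y t) = y $ 1 * d a (axis 1 1) + y $ 2 * d a (axis 2 1) + t * d a (axis 3 1)" for y t
  unfolding d_def by (rule holo_frechet_cons3[OF F a(1)])
 have IA: "I (A a v) = v" for v
 proof -
  have "d a v = d a (cons3 (proj3 v) (v $ 3))" by simp
  also have "... = d a (cons3 (proj3 v) 0) + v $ 3 * d a (axis 3 1)" unfolding dac by simp
  finally show ?thesis
   using nz unfolding I_def A_def d_def[symmetric] by simp
 qed
 have Ibl: "bounded_linear I"
  by (rule linear_conv_bounded_linear[THEN iffD1])
   (auto intro!: linearI simp: I_def dac vec_eq_iff forall_3 add_divide_distrib diff_divide_distrib algebra_simps scaleR_conv_of_real[where 'a = complex])
 have inv: "Blinfun I o\<^sub>L f' a = id_blinfun"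
  by (intro blinfun_eqI) (simp add: bounded_linear_Blinfun_apply[OF Ibl] f'[OF U0(2)] IA)
 obtain N V' Gi g' where N: "open N" "N <= U0" "a \<in> N" "open V'" "G a \<in> V'" "homeomorphism N V' G Gi"
  and gd: "!!y. y \<in> V' ==> (Gi has_derivative g' y) (at y)"
   "!!y. y \<in> V' ==> g' y = inv (blinfun_apply (f' (Gi y)))"
   "!!y. y \<in> V' ==> bij (blinfun_apply (f' (Gi y)))"
  by (rule inverse_function_theorem[OF U0(1) _ contf U0(2) inv, of G]) (use A f' in auto)
 have hom: "Gi (G x) = x" "G x \<in> V'" if "x \<in> N" for x
  using N(6) that by (auto simp: homeomorphism_def)
 have hom': "G (Gi y) = y" "Gi y \<in> N" if "y \<in> V'" for y
  using N(6) that by (auto simp: homeomorphism_def)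
 define V where "V = (%y. cons3 y 0) -` V'"
 define g where "g y = Gi (cons3 y 0) $ 3" for y
 have "continuous_on UNIV (%y. cons3 y 0)" by (intro continuous_on_cons3 continuous_intros)
 then have V: "open V" unfolding V_def using N(4) open_vimage by blast
 have "holo_on V g"
  unfolding holo_on_def
 proof
  fix y assume "y \<in> V"
  then have y: "cons3 y 0 \<in> V'" by (simp add: V_def)
  define p where "p = Gi (cons3 y 0)"
  have p: "p \<in> U0" using hom'(2)[OF y] N(2) by (auto simp: p_def)
  have bij: "bij (A p)" using gd(3)[OF y] f'[OF p] by (simp add: p_def)
  have g'y: "g' (cons3 y 0) = inv (A p)" using gd(2)[OF y] f'[OF p] by (simp add: p_def)
  have ic: "inv (A p) (c *s v) = c *s inv (A p) v" for c v
   by (metis Ac[OF p] bij bij_inv_eq_iff)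
  have "((%y. cons3 y 0) has_derivative (%v. cons3 v 0)) (at y)"
   by (intro cons3_has_derivative derivative_intros)
  from has_derivative_compose[OF this gd(1)[OF y]]
  have "((%y. Gi (cons3 y 0) $ 3) has_derivative (%v. g' (cons3 y 0) (cons3 v 0) $ 3)) (at y)"
   by (rule bounded_linear.has_derivative[OF bounded_linear_vec_nth])
  then have "(g has_derivative (%v. inv (A p) (cons3 v 0) $ 3)) (at y)"
   unfolding g_def g'y .
  moreover have "inv (A p) (cons3 (c *s v) 0) $ 3 = c * inv (A p) (cons3 v 0) $ 3" for c v
  proof -
   have "cons3 (c *s v) 0 = c *s cons3 v 0" by (simp add: cons3_smult)
   then show ?thesis by (simp add: ic)
  qed
  ultimately show "EX D. (g has_derivative D) (at y) \<and> (ALL c v. D (c *s v) = c * D v)" by blast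
 qed
 moreover have "{x \<in> N. F x = 0} = (%y. cons3 y (g y)) ` V"
 proof (intro set_eqI iffI)
  fix x assume "x \<in> {x \<in> N. F x = 0}"
  then have x: "x \<in> N" "F x = 0" by auto
  then have "G x = cons3 (proj3 x) 0" by (simp add: G_def)
  then have "proj3 x \<in> V" "g (proj3 x) = x $ 3"
   using hom[OF x(1)] by (simp_all add: V_def g_def)
  then show "x \<in> (%y. cons3 y (g y)) ` V"
   by (intro image_eqI[of _ _ "proj3 x"]) auto
 next
  fix x assume "x \<in> (%y. cons3 y (g y)) ` V"
  then obtain y where y: "cons3 y 0 \<in> V'" "x = cons3 y (g y)" by (auto simp: V_def)
  have G: "cons3 (proj3 (Gi (cons3 y 0))) (F (Gi (cons3 y 0))) = cons3 y 0"
   using hom'(1)[OF y(1)] by (simp add: G_def)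
  then have "proj3 (Gi (cons3 y 0)) = y" "F (Gi (cons3 y 0)) = 0" by simp_all
  then have "x = Gi (cons3 y 0)" using y(2) cons3_proj3[of "Gi (cons3 y 0)"] by (simp add: g_def)
  then show "x \<in> {x \<in> N. F x = 0}" using hom'(2)[OF y(1)] G by simp
 qed
 ultimately show ?thesis
  using that[of N V g] N V U0 by (auto simp: U0_def d_def)
qed

text \<open>F is nonzero at some point of the line through \<open>a\<close>, at height
  \<open>t1\<close>, and hence of size at least m at that height on all nearby parallel lines. The
  zero count m 2^card \<le> M is then the same for all of them. The point \<open>a\<close> may be
  singular on the zero set.\<close>

lemma holo_zeros_local_bound:
 assumes U: "open U" and F: "holo_on U F" and a: "a \<in> U"
  and nz: "!!e. 0 < e ==> EX t. cmod (t - a $ 3) < e \<and> F (cons3 (proj3 a) t) ~= 0"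
 obtains \<rho> n where "0 < \<rho>"
  "!!y Z. finite Z ==> (!!t. t \<in> Z ==> cons3 y t \<in> ball a \<rho> \<and> F (cons3 y t) = 0) ==> card Z <= n"
proof -
 obtain R where R: "0 < R" "cball a R <= U" using U a open_contains_cball by blast
 have "compact (F ` cball a R)"
  using R(2) by (intro compact_continuous_image continuous_on_subset[OF holo_on_imp_continuous_on[OF F]]) auto
 then obtain M where M: "0 < M" "\<forall>x\<in>F ` cball a R. cmod x <= M"
  using compact_imp_bounded bounded_pos by metis
 \<comment> \<open>The factor 8 leaves room for a disc of radius 5 \<rho>1 about the third
   coordinate together with an offset of at most \<rho>1 in the other two.\<close>
 define \<rho>1 where "\<rho>1 = R / 8"
 have \<rho>1: "0 < \<rho>1" "R = 8 * \<rho>1" using R by (auto simp: \<rho>1_def)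
 obtain t1 where t1: "cmod (t1 - a $ 3) < \<rho>1" "F (cons3 (proj3 a) t1) ~= 0"
  using nz[OF \<rho>1(1)] by blast
 define m where "m = cmod (F (cons3 (proj3 a) t1)) / 2"
 have m: "0 < m" using t1 by (simp add: m_def)
 have dist_cons: "dist a (cons3 y t) <= norm (y - proj3 a) + cmod (t - a $ 3)" for y t
  using norm_cons3[of "proj3 a - y" "a $ 3 - t"] cons3_diff[of "proj3 a" "a $ 3" y t]
  by (simp add: dist_norm norm_minus_commute)
 have "cons3 (proj3 a) t1 \<in> U"
  using dist_cons[of "proj3 a" t1] t1 R \<rho>1 by (auto simp: subset_iff)
 then have "isCont F (cons3 (proj3 a) t1)"
  using holo_on_imp_continuous_on[OF F] U continuous_on_eq_continuous_at by blast
 then obtain \<delta> where \<delta>: "0 < \<delta>"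
  "!!x. dist x (cons3 (proj3 a) t1) < \<delta> ==> dist (F x) (F (cons3 (proj3 a) t1)) < m"
  using m unfolding continuous_at_eps_delta by metis
 define \<rho> where "\<rho> = min \<delta> \<rho>1"
 have "card Z <= nat \<lceil>M / m\<rceil>"
  if Z: "finite Z" "!!t. t \<in> Z ==> cons3 y t \<in> ball a \<rho> \<and> F (cons3 y t) = 0" for y Z
 proof (cases "Z = {}")
  case False
  then obtain t where "t \<in> Z" by blast
  then have "dist a (cons3 y t) < \<rho>" using Z by auto
  then have y: "norm (y - proj3 a) < \<rho>"
   using norm_proj3[of "a - cons3 y t"] by (simp add: dist_norm proj3_diff norm_minus_commute)
  have "m * 2 ^ card Z <= M"
  proof (rule card_zeros_bound[where \<rho> = \<rho>1 and ?t0.0 = "a $ 3" and ?t1.0 = t1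
     and g = "%t. F (cons3 y t)" and S = "(%t. cons3 y t) -` U"])
   show "Z <= cball (a $ 3) \<rho>1"
   proof
    fix t assume "t \<in> Z"
    then have "norm (a - cons3 y t) < \<rho>1" using Z(2) by (auto simp: dist_norm \<rho>_def)
    then show "t \<in> cball (a $ 3) \<rho>1"
     using Finite_Cartesian_Product.norm_nth_le[of "a - cons3 y t" 3] by (simp add: dist_norm)
   qed
   have "continuous_on UNIV (%t. cons3 y t)" by (intro continuous_on_cons3 continuous_intros)
   then show "open ((%t. cons3 y t) -` U)" using U open_vimage by blast
   have inR: "cons3 y t \<in> cball a R" if "t \<in> cball (a $ 3) (5 * \<rho>1)" for t
    using dist_cons[of y t] y that \<rho>1 by (auto simp: \<rho>_def dist_norm norm_minus_commute)
   then show "cball (a $ 3) (5 * \<rho>1) <= (%t. cons3 y t) -` U" using R by blast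
   show "cmod (F (cons3 y t)) <= M" if "t \<in> cball (a $ 3) (5 * \<rho>1)" for t
    using M inR[OF that] by blast
   have eq: "cons3 y t = cons3 y 0 + t *s axis 3 1" for t
    by (simp add: vec_eq_iff forall_3 axis_def)
   have "(%t. F (cons3 y 0 + t *s axis 3 1)) holomorphic_on (%t. cons3 y t) -` U"
    by (rule holo_on_line_holomorphic[OF F]) (simp add: eq[symmetric])
   then show "(%t. F (cons3 y t)) holomorphic_on (%t. cons3 y t) -` U"
    by (simp only: eq[symmetric])
   have "dist (cons3 y t1) (cons3 (proj3 a) t1) < \<delta>"
    using y norm_cons3[of "y - proj3 a" 0] by (simp add: dist_norm cons3_diff \<rho>_def)
   from \<delta>(2)[OF this] show "m <= cmod (F (cons3 y t1))"
    using norm_triangle_ineq2[of "F (cons3 (proj3 a) t1)" "F (cons3 y t1)"]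
    unfolding m_def by (auto simp: dist_norm norm_minus_commute)
  qed (use Z t1 \<rho>1 in \<open>auto simp: dist_norm norm_minus_commute\<close>)
  then have "2 ^ card Z <= M / m" using m by (simp add: field_simps)
  moreover have "real (card Z) < 2 ^ card Z" by (rule of_nat_less_two_power)
  ultimately have "real (card Z) <= M / m" by linarith
  then show ?thesis by linarith
 qed simp
 then show ?thesis
  using that[of \<rho> "nat \<lceil>M / m\<rceil>"] \<delta>(1) \<rho>1(1) by (auto simp: \<rho>_def)
qed

section \<open>Change of variables in \<open>\<complex>\<^sup>2\<close>\<close>

text \<open>C^2 is identified with R^4 because the change of variables formula is applied to real
  vectors and real Jacobian matrices. Each complex coordinate gives two adjacent real ones, so that
  boxes correspond to boxes.\<close>

definition to4 :: "complex ^ 2 => real ^ 4" where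
 "to4 z = vector [Re (z $ 1), Im (z $ 1), Re (z $ 2), Im (z $ 2)]"

definition of4 :: "real ^ 4 => complex ^ 2" where
 "of4 x = vector [Complex (x $ 1) (x $ 2), Complex (x $ 3) (x $ 4)]"

lemma forall_4_index: "(\<forall>i::4. P i) \<longleftrightarrow> P 1 \<and> P 2 \<and> P 3 \<and> P 4"
 by (metis exhaust_4)

lemma to4_nth [simp]: "to4 z $ 1 = Re (z $ 1)" "to4 z $ 2 = Im (z $ 1)"
  "to4 z $ 3 = Re (z $ 2)" "to4 z $ 4 = Im (z $ 2)"
 and of4_nth [simp]: "of4 x $ 1 = Complex (x $ 1) (x $ 2)" "of4 x $ 2 = Complex (x $ 3) (x $ 4)"
 by (simp_all add: to4_def of4_def vector_def)

lemma to4_of4 [simp]: "to4 (of4 x) = x"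
 by (simp add: vec_eq_iff forall_4_index)

lemma of4_to4 [simp]: "of4 (to4 z) = z"
 by (simp add: vec_eq_iff forall_2)

lemma bounded_linear_to4: "bounded_linear to4"
 by (rule linear_conv_bounded_linear[THEN iffD1])
   (auto intro!: linearI simp: vec_eq_iff forall_4_index)

lemma bounded_linear_of4: "bounded_linear of4"
 by (rule linear_conv_bounded_linear[THEN iffD1])
   (auto intro!: linearI simp: vec_eq_iff forall_2 complex_eq_iff)

text \<open>The real Jacobian of a map of C^2 is a determinant of size 4; the expansion allows it to
  be recognised as the squared modulus of a complex determinant of size 2.\<close>

lemma det_4:
 "det (A::'a::comm_ring_1^4^4) =
  A$1$1 * (A$2$2 * (A$3$3 * A$4$4 - A$3$4 * A$4$3) - A$2$3 * (A$3$2 * A$4$4 - A$3$4 * A$4$2) + A$2$4 * (A$3$2 * A$4$3 - A$3$3 * A$4$2))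
 - A$1$2 * (A$2$1 * (A$3$3 * A$4$4 - A$3$4 * A$4$3) - A$2$3 * (A$3$1 * A$4$4 - A$3$4 * A$4$1) + A$2$4 * (A$3$1 * A$4$3 - A$3$3 * A$4$1))
 + A$1$3 * (A$2$1 * (A$3$2 * A$4$4 - A$3$4 * A$4$2) - A$2$2 * (A$3$1 * A$4$4 - A$3$4 * A$4$1) + A$2$4 * (A$3$1 * A$4$2 - A$3$2 * A$4$1))
 - A$1$4 * (A$2$1 * (A$3$2 * A$4$3 - A$3$3 * A$4$2) - A$2$2 * (A$3$1 * A$4$3 - A$3$3 * A$4$1) + A$2$3 * (A$3$1 * A$4$2 - A$3$2 * A$4$1))"
proof -
 have f1234: "finite {2::4, 3, 4}" "1 \<notin> {2::4, 3, 4}" by auto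
 have f234: "finite {3::4, 4}" "2 \<notin> {3::4, 4}" by auto
 have f34: "finite {4::4}" "3 \<notin> {4::4}" by auto
 show ?thesis
  unfolding det_def UNIV_4
  unfolding sum_over_permutations_insert[OF f1234]
  unfolding sum_over_permutations_insert[OF f234]
  unfolding sum_over_permutations_insert[OF f34]
  unfolding permutes_sing
  apply (simp add: sign_swap_id permutation_swap_id permutation_compose sign_compose sign_id swap_id_eq)
  apply (simp only: algebra_simps)?
  done
qed

lemma Basis_complex2: "(Basis :: (complex ^ 2) set) = {axis 1 1, axis 1 \<i>, axis 2 1, axis 2 \<i>}"
 by (auto simp: Basis_vec_def Basis_complex_def UNIV_2)

lemma Basis_real4: "(Basis :: (real ^ 4) set) = {axis 1 1, axis 2 1, axis 3 1, axis 4 1}"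
 by (auto simp: Basis_vec_def UNIV_4)

text \<open>Lebesgue measure is determined by its values on boxes, and \<open>of4\<close> matches
  boxes of equal volume.\<close>

lemma lborel_complex2: "(lborel :: (complex ^ 2) measure) = distr lborel borel of4"
proof (rule lborel_eqI)
 fix l u :: "complex ^ 2" assume le: "!!b. b \<in> Basis ==> l \<bullet> b <= u \<bullet> b"
 have m: "of4 \<in> borel_measurable borel"
  by (intro borel_measurable_continuous_onI linear_continuous_on bounded_linear_of4)
 have "of4 -` box l u = box (to4 l) (to4 u)"
  by (auto simp: mem_box Basis_complex2 Basis_real4 inner_axis inner_complex_def)
 then have "emeasure (distr lborel borel of4) (box l u) = emeasure lborel (box (to4 l) (to4 u))"
  using m by (simp add: emeasure_distr)
 also have "... = (\<Prod>b\<in>Basis. (to4 u - to4 l) \<bullet> b)"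
  using le[of "axis 1 1"] le[of "axis 1 \<i>"] le[of "axis 2 1"] le[of "axis 2 \<i>"]
  by (intro emeasure_lborel_box) (auto simp: Basis_complex2 Basis_real4 inner_axis inner_complex_def)
 also have "(\<Prod>b\<in>Basis. (to4 u - to4 l) \<bullet> b) = (\<Prod>b\<in>Basis. (u - l) \<bullet> b)"
  by (simp add: Basis_complex2 Basis_real4 axis_eq_axis inner_axis inner_complex_def complex_eq_iff)
 finally show "emeasure (distr lborel borel of4) (box l u) = ennreal (\<Prod>b\<in>Basis. (u - l) \<bullet> b)" .
qed simp

section \<open>Holomorphic maps and their Jacobians\<close>

lemma holo_map_onD:
 assumes "holo_map_on U F" "x \<in> U"
 shows "(F has_derivative frechet_derivative F (at x)) (at x)"
  and "frechet_derivative F (at x) v $ j = frechet_derivative (%x. F x $ j) (at x) v"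
  and "frechet_derivative F (at x) (c *s v) = c *s frechet_derivative F (at x) v"
proof -
 have h: "holo_on U (%x. F x $ j)" for j using assms(1) by (simp add: holo_map_on_def)
 have D: "(F has_derivative (%v. \<chi> j. frechet_derivative (%x. F x $ j) (at x) v)) (at x)"
  unfolding has_derivative_componentwise_within[of F]
 proof
  fix b :: "complex ^ 'b" assume "b \<in> Basis"
  then obtain j u where b: "b = axis j u" by (auto simp: Basis_vec_def)
  show "((%x. F x \<bullet> b) has_derivative (%v. (\<chi> j. frechet_derivative (%x. F x $ j) (at x) v) \<bullet> b)) (at x)"
   unfolding b inner_axis vec_lambda_beta
   by (intro has_derivative_inner_left holo_onD(1)[OF h assms(2)])
 qed
 have eq: "frechet_derivative F (at x) = (%v. \<chi> j. frechet_derivative (%x. F x $ j) (at x) v)"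
  using frechet_derivative_at[OF D] by simp
 show "(F has_derivative frechet_derivative F (at x)) (at x)"
  using D unfolding eq .
 show "frechet_derivative F (at x) v $ j = frechet_derivative (%x. F x $ j) (at x) v"
  by (simp add: eq)
 show "frechet_derivative F (at x) (c *s v) = c *s frechet_derivative F (at x) v"
  by (simp add: eq vec_eq_iff holo_onD(2)[OF h assms(2)])
qed

lemma holo_map_onI:
 assumes "!!x. x \<in> U ==> EX D. (F has_derivative D) (at x) \<and> (ALL c v. D (c *s v) = c *s D v)"
 shows "holo_map_on U F"
 unfolding holo_map_on_def holo_on_def
proof (intro allI ballI)
 fix j x assume "x \<in> U"
 then obtain D where D: "(F has_derivative D) (at x)" "!!c v. D (c *s v) = c *s D v"
  using assms by blast
 show "EX D. ((%x. F x $ j) has_derivative D) (at x) \<and> (ALL c v. D (c *s v) = c * D v)"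
  by (intro exI[of _ "%v. D v $ j"] conjI bounded_linear.has_derivative[OF bounded_linear_vec_nth D(1)])
    (simp add: D(2))
qed

lemma holo_map_on_imp_continuous_on: "holo_map_on U F ==> continuous_on U F"
 by (meson continuous_at_imp_continuous_on has_derivative_continuous holo_map_onD(1))

lemma holo_map_deriv_continuous:
 assumes "open U" "holo_map_on U F"
 shows "continuous_on U (%x. frechet_derivative F (at x) v)"
proof -
 have "continuous_on U (%x. \<chi> j. frechet_derivative (%x. F x $ j) (at x) v)"
  using assms by (intro continuous_on_vec_lambda holo_deriv_continuous) (auto simp: holo_map_on_def)
 then show ?thesis
  by (rule continuous_on_eq) (simp add: vec_eq_iff holo_map_onD(2)[OF assms(2)])
qed

definition jac2 :: "(complex ^ 2 => complex ^ 2) => complex ^ 2 => complex" where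
 "jac2 \<tau> t = (let u = frechet_derivative \<tau> (at t) (axis 1 1); v = frechet_derivative \<tau> (at t) (axis 2 1)
   in u $ 1 * v $ 2 - u $ 2 * v $ 1)"

lemma borel_Int_vimage:
 assumes "continuous_on S g" "S \<in> sets borel" "B \<in> sets borel"
 shows "S Int g -` B \<in> sets borel"
proof -
 have "g \<in> borel_measurable (restrict_space borel S)"
  by (rule borel_measurable_continuous_on_restrict[OF assms(1)])
 from measurable_sets[OF this assms(3)] show ?thesis
  using assms(2) by (auto simp: sets_restrict_space_iff space_restrict_space Int_commute)
qed

text \<open>By invariance of domain the inverse is continuous on an open image, so the image of a
  Borel set is a preimage under a continuous map.\<close>

lemma borel_injective_image:
 fixes f :: "'a::euclidean_space => 'b::euclidean_space"
 assumes "open V" "continuous_on V f" "DIM('b) <= DIM('a)" "inj_on f V" "B \<in> sets borel" "B <= V"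
 shows "f ` B \<in> sets borel"
proof -
 obtain g where g: "homeomorphism V (f ` V) f g"
  using invariance_of_domain_homeomorphism[OF assms(1-4)] .
 have "open (f ` V)" using invariance_of_domain_gen[OF assms(1,2,4,3)] .
 then have "f ` V Int g -` B \<in> sets borel"
  using g assms(5) by (intro borel_Int_vimage) (auto simp: homeomorphism_def)
 moreover have "f ` B = f ` V Int g -` B"
  using g assms(6) unfolding homeomorphism_def by force
 ultimately show ?thesis by simp
qed

text \<open>The transformation theorem equates a finite measure with a finite integral; the infinite
  case follows by contradiction from the same equivalence. \<open>J\<close> is kept abstract because
  the determinant is controlled only on \<open>S\<close>.\<close>

lemma emeasure_image_C1_real4:
 fixes f :: "real ^ 4 => real ^ 4"
 assumes "S \<in> sets borel" and "f ` S \<in> sets borel" "inj_on f S"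
  and d: "!!x. x \<in> S ==> (f has_derivative f' x) (at x)"
  and J: "!!x. x \<in> S ==> \<bar>det (matrix (f' x))\<bar> = J x"
  and meas: "(%x. indicator S x * J x) \<in> borel_measurable borel"
 shows "emeasure lborel (f ` S) = (\<integral>\<^sup>+x. ennreal (indicator S x * J x) \<partial>lborel)"
proof -
 define k where "k x = indicator S x * J x" for x
 have k0: "0 <= k x" for x
  by (cases "x \<in> S") (auto simp: k_def simp flip: J)
 have "f ` S \<in> lmeasurable \<and> measure lebesgue (f ` S) = m
   \<longleftrightarrow> ((%x. \<bar>det (matrix (f' x))\<bar>) has_integral m) S" for m
  using assms by (intro has_measure_differentiable_image) (auto intro: has_derivative_at_withinI)
 moreover have "((%x. \<bar>det (matrix (f' x))\<bar>) has_integral m) S \<longleftrightarrow> (k has_integral m) UNIV" for m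
 proof -
  have "((%x. \<bar>det (matrix (f' x))\<bar>) has_integral m) S \<longleftrightarrow>
    ((%x. if x \<in> S then \<bar>det (matrix (f' x))\<bar> else 0) has_integral m) UNIV"
   by (simp add: has_integral_restrict_UNIV)
  also have "(%x. if x \<in> S then \<bar>det (matrix (f' x))\<bar> else 0) = k"
   by (auto simp: k_def J fun_eq_iff)
  finally show ?thesis .
 qed
 ultimately have iff: "f ` S \<in> lmeasurable \<and> measure lebesgue (f ` S) = m \<longleftrightarrow> (k has_integral m) UNIV" for m
  by simp
 have kb: "k \<in> borel_measurable borel" using meas by (simp add: k_def[abs_def])
 have eml: "emeasure lborel (f ` S) = emeasure lebesgue (f ` S)"
  using assms(2) by simp
 show ?thesis
 proof (cases "(\<integral>\<^sup>+x. ennreal (k x) \<partial>lborel) = \<infinity>")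
  case False
  then obtain r where r: "(\<integral>\<^sup>+x. ennreal (k x) \<partial>lborel) = ennreal r" "0 <= r"
   by (cases "\<integral>\<^sup>+x. ennreal (k x) \<partial>lborel") auto
  have "(k has_integral r) UNIV" by (rule nn_integral_has_integral[OF kb k0 r])
  then have "f ` S \<in> lmeasurable" "measure lebesgue (f ` S) = r" using iff by auto
  then have "emeasure lebesgue (f ` S) = ennreal r"
   by (metis emeasure_eq_measure2 fmeasurable_def mem_Collect_eq emeasure_eq_ennreal_measure less_irrefl top.not_eq_extremum infinity_ennreal_def)
  then show ?thesis using r eml by (simp add: k_def)
 next
  case True
  have "f ` S \<notin> lmeasurable"
  proof
   assume "f ` S \<in> lmeasurable"
   then have "(k has_integral measure lebesgue (f ` S)) UNIV" using iff by blast
   from nn_integral_has_integral_lborel[OF kb k0 this] True show False by simp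
  qed
  then have "emeasure lebesgue (f ` S) = \<infinity>"
   using assms(2) by (simp add: fmeasurable_def less_top[symmetric])
  then show ?thesis using True eml by (simp add: k_def)
 qed
qed

lemma emeasure_image_holo:
 fixes \<tau> :: "complex ^ 2 => complex ^ 2"
 assumes V: "open V" and \<tau>: "holo_map_on V \<tau>" "inj_on \<tau> V" and B: "B \<in> sets borel" "B <= V"
 shows "\<tau> ` B \<in> sets borel"
  and "emeasure lborel (\<tau> ` B) = (\<integral>\<^sup>+t\<in>B. ennreal ((cmod (jac2 \<tau> t))\<^sup>2) \<partial>lborel)"
proof -
 show im: "\<tau> ` B \<in> sets borel"
  using assms holo_map_on_imp_continuous_on by (intro borel_injective_image[of V]) auto
 define f where "f = to4 \<circ> \<tau> \<circ> of4"
 define S where "S = of4 -` B"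
 have of4m: "of4 \<in> borel_measurable borel"
  by (intro borel_measurable_continuous_onI linear_continuous_on bounded_linear_of4)
 have of4img: "of4 -` C = to4 ` C" for C
  by (metis (no_types, lifting) of4_to4 surj_image_vimage_eq to4_of4 subset_antisym image_subset_iff_subset_vimage image_vimage_subset vimage_subsetI subsetI image_eqI vimage_eq)
 have S: "S \<in> sets borel" using measurable_sets_borel[OF of4m B(1)] by (simp add: S_def)
 have fS: "f ` S = of4 -` (\<tau> ` B)"
  unfolding of4img f_def S_def image_comp[symmetric] by (simp add: image_comp o_def)
 have fSb: "f ` S \<in> sets borel" unfolding fS using measurable_sets_borel[OF of4m im] .
 define J where "J x = (cmod (jac2 \<tau> (of4 x)))\<^sup>2" for x
 have cont: "continuous_on V (%t. (cmod (jac2 \<tau> t))\<^sup>2)"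
  unfolding jac2_def Let_def by (intro continuous_intros holo_map_deriv_continuous[OF V \<tau>(1)])
 have Jb: "(%t. indicator B t * (cmod (jac2 \<tau> t))\<^sup>2) \<in> borel_measurable borel"
  using borel_measurable_continuous_on_indicator[OF B(1) continuous_on_subset[OF cont B(2)]]
  by (simp only: real_scaleR_def)
 have "emeasure lborel (f ` S) = (\<integral>\<^sup>+x. ennreal (indicator S x * J x) \<partial>lborel)"
 proof (rule emeasure_image_C1_real4[OF S fSb])
  show "inj_on f S"
  proof (rule inj_onI)
   fix x y assume xy: "x \<in> S" "y \<in> S" "f x = f y"
   then have "of4 (f x) = of4 (f y)" by simp
   then have "\<tau> (of4 x) = \<tau> (of4 y)" unfolding f_def o_def of4_to4 .
   then have "of4 x = of4 y" using inj_onD[OF \<tau>(2)] xy B(2) by (auto simp: S_def)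
   then have "to4 (of4 x) = to4 (of4 y)" by simp
   then show "x = y" unfolding to4_of4 .
  qed
  fix x assume x: "x \<in> S"
  then have xV: "of4 x \<in> V" using B by (auto simp: S_def)
  define A where "A = frechet_derivative \<tau> (at (of4 x))"
  show d: "(f has_derivative (%v. to4 (A (of4 v)))) (at x)"
   unfolding f_def o_def A_def
   by (intro bounded_linear.has_derivative[OF bounded_linear_to4]
     has_derivative_compose[OF bounded_linear_imp_has_derivative[OF bounded_linear_of4] holo_map_onD(1)[OF \<tau>(1) xV]])
  have o: "of4 (axis 1 1) = axis 1 1" "of4 (axis 2 1) = \<i> *s axis 1 1"
   "of4 (axis 3 1) = axis 2 1" "of4 (axis 4 1) = \<i> *s axis 2 1"
   by (simp_all add: vec_eq_iff forall_2 axis_def complex_eq_iff)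
  have Ac: "A (c *s v) = c *s A v" for c v unfolding A_def by (rule holo_map_onD(3)[OF \<tau>(1) xV])
  \<comment> \<open>For a complex-linear map the real determinant is the squared modulus of the
    complex one: the second and fourth columns are i times the first and third.\<close>
  have "det (matrix (%v. to4 (A (of4 v)))) = (cmod (A (axis 1 1) $ 1 * A (axis 2 1) $ 2 - A (axis 1 1) $ 2 * A (axis 2 1) $ 1))\<^sup>2"
   unfolding det_4 matrix_def vec_lambda_beta o Ac to4_nth vector_smult_component cmod_power2
   by (simp add: power2_eq_square) algebra
  then show "\<bar>det (matrix (%v. to4 (A (of4 v))))\<bar> = J x"
   by (simp add: J_def jac2_def A_def Let_def)
 next
  show "(%x. indicator S x * J x) \<in> borel_measurable borel"
   using measurable_compose[OF of4m Jb] by (simp add: S_def J_def indicator_def)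
 qed
 then have "emeasure lborel (of4 -` (\<tau> ` B)) = (\<integral>\<^sup>+x. ennreal (indicator B (of4 x) * (cmod (jac2 \<tau> (of4 x)))\<^sup>2) \<partial>lborel)"
  unfolding fS by (simp add: S_def J_def indicator_def)
 then have *: "emeasure (distr lborel borel of4) (\<tau> ` B) = (\<integral>\<^sup>+t. ennreal (indicator B t * (cmod (jac2 \<tau> t))\<^sup>2) \<partial>(distr lborel borel of4))"
  using of4m im Jb by (simp add: emeasure_distr nn_integral_distr)
 show "emeasure lborel (\<tau> ` B) = (\<integral>\<^sup>+t\<in>B. ennreal ((cmod (jac2 \<tau> t))\<^sup>2) \<partial>lborel)"
 proof -
  have "(%t. ennreal (indicator B t * (cmod (jac2 \<tau> t))\<^sup>2)) = (%t. ennreal ((cmod (jac2 \<tau> t))\<^sup>2) * indicator B t)"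
   by (auto simp: indicator_def fun_eq_iff)
  then show ?thesis
   using * by (simp only: lborel_complex2[symmetric])
 qed
qed

text \<open>The formula for sets says that the push-forward of the density |jac|^2 on B is Lebesgue
  measure restricted to the image. Integrating G against both measures gives the formula for
  functions.\<close>

lemma nn_integral_image_holo:
 fixes \<tau> :: "complex ^ 2 => complex ^ 2" and G :: "complex ^ 2 => ennreal"
 assumes V: "open V" and \<tau>: "holo_map_on V \<tau>" "inj_on \<tau> V" and B: "B \<in> sets borel" "B <= V"
  and G: "(%y. G y * indicator (\<tau> ` B) y) \<in> borel_measurable borel"
 shows "(\<integral>\<^sup>+y\<in>\<tau> ` B. G y \<partial>lborel) = (\<integral>\<^sup>+t\<in>B. G (\<tau> t) * ennreal ((cmod (jac2 \<tau> t))\<^sup>2) \<partial>lborel)"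
proof -
 define j where "j t = ennreal ((cmod (jac2 \<tau> t))\<^sup>2) * indicator B t" for t
 have "continuous_on V (%t. (cmod (jac2 \<tau> t))\<^sup>2)"
  unfolding jac2_def Let_def by (intro continuous_intros holo_map_deriv_continuous[OF V \<tau>(1)])
 then have "(%t. indicator B t *\<^sub>R (cmod (jac2 \<tau> t))\<^sup>2) \<in> borel_measurable borel"
  using borel_measurable_continuous_on_indicator[OF B(1) continuous_on_subset[OF _ B(2)]] by blast
 then have "(%t. ennreal (indicator B t *\<^sub>R (cmod (jac2 \<tau> t))\<^sup>2)) \<in> borel_measurable borel" by measurable
 also have "(%t. ennreal (indicator B t *\<^sub>R (cmod (jac2 \<tau> t))\<^sup>2)) = j"
  by (auto simp: j_def indicator_def fun_eq_iff)
 finally have j: "j \<in> borel_measurable borel" .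
 \<comment> \<open>Extended by 0 to be measurable on the whole space; the density \<open>j\<close>
   vanishes off B.\<close>
 define \<tau>' where "\<tau>' t = (if t \<in> B then \<tau> t else 0)" for t
 have \<tau>': "\<tau>' \<in> borel_measurable borel"
  unfolding \<tau>'_def using B holo_map_on_imp_continuous_on[OF \<tau>(1)]
  by (intro borel_measurable_continuous_on_if) (auto intro: continuous_on_subset)
 have im: "\<tau> ` B \<in> sets borel" by (rule emeasure_image_holo(1)[OF V \<tau> B])
 have *: "distr (density lborel j) borel \<tau>' = density lborel (indicator (\<tau> ` B))"
 proof (rule measure_eqI)
  fix A assume "A \<in> sets (distr (density lborel j) borel \<tau>')"
  then have A: "A \<in> sets borel" by simp
  have A': "\<tau>' -` A \<in> sets borel" using measurable_sets_borel[OF \<tau>' A] .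
  have "emeasure (distr (density lborel j) borel \<tau>') A = (\<integral>\<^sup>+t. j t * indicator (\<tau>' -` A) t \<partial>lborel)"
   using \<tau>' A A' j by (simp add: emeasure_distr emeasure_density)
  also have "... = (\<integral>\<^sup>+t\<in>B Int \<tau>' -` A. ennreal ((cmod (jac2 \<tau> t))\<^sup>2) \<partial>lborel)"
   by (intro nn_integral_cong) (auto simp: j_def indicator_def)
  also have "... = emeasure lborel (\<tau> ` (B Int \<tau>' -` A))"
   using B A' by (intro emeasure_image_holo(2)[OF V \<tau>, symmetric]) auto
  also have "\<tau> ` (B Int \<tau>' -` A) = \<tau> ` B Int A" by (auto simp: \<tau>'_def)
  also have "emeasure lborel ... = emeasure (density lborel (indicator (\<tau> ` B))) A"
   using A im by (simp add: emeasure_density indicator_inter_arith[symmetric])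
  finally show "emeasure (distr (density lborel j) borel \<tau>') A = emeasure (density lborel (indicator (\<tau> ` B))) A" .
 qed simp
 define G' where "G' y = G y * indicator (\<tau> ` B) y" for y
 have G': "G' \<in> borel_measurable borel" using G by (simp add: G'_def[abs_def])
 have "(\<integral>\<^sup>+y\<in>\<tau> ` B. G y \<partial>lborel) = (\<integral>\<^sup>+y. G' y \<partial>density lborel (indicator (\<tau> ` B)))"
  using im G' by (simp add: nn_integral_density)
    (auto intro!: nn_integral_cong simp: G'_def indicator_def)
 also have "... = (\<integral>\<^sup>+t. j t * G' (\<tau>' t) \<partial>lborel)"
  unfolding *[symmetric] using \<tau>' G' j by (simp add: nn_integral_distr nn_integral_density measurable_compose[OF \<tau>'])
 also have "... = (\<integral>\<^sup>+t\<in>B. G (\<tau> t) * ennreal ((cmod (jac2 \<tau> t))\<^sup>2) \<partial>lborel)"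
  by (intro nn_integral_cong) (auto simp: j_def G'_def \<tau>'_def indicator_def mult.commute)
 finally show ?thesis .
qed

section \<open>The volume measure of a regular hypersurface\<close>

text \<open>Bilinear, without conjugation. Its squared norm is the Gram determinant, so Gram
  densities transform by a scalar factor under linear combinations; for tangent vectors it is
  proportional to the gradient of f.\<close>

definition cross :: "complex ^ 3 => complex ^ 3 => complex ^ 3" where
 "cross u v = vector [u $ 2 * v $ 3 - u $ 3 * v $ 2, u $ 3 * v $ 1 - u $ 1 * v $ 3, u $ 1 * v $ 2 - u $ 2 * v $ 1]"

lemma cross_nth [simp]: "cross u v $ 1 = u $ 2 * v $ 3 - u $ 3 * v $ 2"
  "cross u v $ 2 = u $ 3 * v $ 1 - u $ 1 * v $ 3" "cross u v $ 3 = u $ 1 * v $ 2 - u $ 2 * v $ 1"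
 by (simp_all add: cross_def vector_def)

lemma norm_vec3_sq: "(norm (u :: complex ^ 3))\<^sup>2 = (cmod (u $ 1))\<^sup>2 + (cmod (u $ 2))\<^sup>2 + (cmod (u $ 3))\<^sup>2"
 by (simp add: norm_vec_def L2_set_def sum_3 sum_nonneg)

lemma lagrange_identity: "(norm u)\<^sup>2 * (norm v)\<^sup>2 - (cmod (herm u v))\<^sup>2 = (norm (cross u v))\<^sup>2"
proof -
 have "complex_of_real ((norm u)\<^sup>2 * (norm v)\<^sup>2 - (cmod (herm u v))\<^sup>2) = complex_of_real ((norm (cross u v))\<^sup>2)"
  unfolding norm_vec3_sq herm_def sum_3 of_real_add of_real_mult of_real_diff complex_norm_square
  by (simp add: algebra_simps)
 then show ?thesis by (simp only: of_real_eq_iff)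
qed

lemma gram_eq: "gram \<psi> t = (norm (cross (frechet_derivative \<psi> (at t) (axis 1 1)) (frechet_derivative \<psi> (at t) (axis 2 1))))\<^sup>2"
 by (simp add: gram_def Let_def lagrange_identity)

lemma gram_nonneg: "0 <= gram \<psi> t"
 by (simp add: gram_eq)

lemma cross_lincomb: "cross (a *s u + b *s v) (c *s u + d *s v) = (a * d - b * c) *s cross u v"
 by (simp add: vec_eq_iff forall_3 algebra_simps)

lemma cross_eq_0D:
 assumes "cross u v = 0" "u ~= 0"
 shows "EX c. v = c *s u"
proof -
 obtain j where j: "u $ j ~= 0" using assms(2) by (auto simp: vec_eq_iff)
 define c where "c = v $ j / u $ j"
 have "v $ k = c * u $ k" for k
  using assms(1) j exhaust_3[of j] exhaust_3[of k] unfolding c_def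
  by (auto simp: vec_eq_iff forall_3 field_simps)
 then have "v = c *s u" by (simp add: vec_eq_iff)
 then show ?thesis ..
qed

section \<open>Linear coordinate changes and graph charts\<close>

definition clin_iso :: "(complex ^ 3 => complex ^ 3) => (complex ^ 3 => complex ^ 3) => bool" where
 "clin_iso T T' \<longleftrightarrow> bounded_linear T \<and> bounded_linear T' \<and> (ALL c v. T (c *s v) = c *s T v) \<and>
   (ALL x. T' (T x) = x) \<and> (ALL x. T (T' x) = x)"

lemma clin_isoD:
 assumes "clin_iso T T'"
 shows "bounded_linear T" "bounded_linear T'" "T (c *s v) = c *s T v" "T' (T x) = x" "T (T' x) = x"
  "T (x + y) = T x + T y" "T' (x + y) = T' x + T' y" "T' (x - y) = T' x - T' y" "T' (c *s v) = c *s T' v"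
proof -
 show *: "bounded_linear T" "bounded_linear T'" "T (c *s v) = c *s T v" "T' (T x) = x" "T (T' x) = x" for c v x
  using assms by (simp_all add: clin_iso_def)
 show "T (x + y) = T x + T y" by (rule linear_add) (rule bounded_linear.linear[OF *(1)])
 show "T' (x + y) = T' x + T' y" by (rule linear_add) (rule bounded_linear.linear[OF *(2)])
 show "T' (x - y) = T' x - T' y" by (rule linear_diff) (rule bounded_linear.linear[OF *(2)])
 show "T' (c *s v) = c *s T' v" using *(3)[of c "T' v"] *(4)[of "c *s T' v"] *(5)[of v] by simp
qed

definition gpar :: "(complex ^ 3 => complex ^ 3) => (complex ^ 2 => complex) => complex ^ 2 => complex ^ 3" where
 "gpar T g y = T (cons3 y (g y))"

lemma proj_gpar [simp]: "clin_iso T T' ==> proj3 (T' (gpar T g y)) = y"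
 by (simp add: gpar_def clin_isoD)

lemma gpar_has_derivative:
 assumes T: "clin_iso T T'" and g: "holo_on V g" and y: "y \<in> V"
 shows "(gpar T g has_derivative (%v. T (cons3 v (frechet_derivative g (at y) v)))) (at y)"
  and "frechet_derivative (gpar T g) (at y) v = T (cons3 v (frechet_derivative g (at y) v))"
proof -
 show *: "(gpar T g has_derivative (%v. T (cons3 v (frechet_derivative g (at y) v)))) (at y)"
  unfolding gpar_def[abs_def]
  by (intro bounded_linear.has_derivative[OF clin_isoD(1)[OF T]] cons3_has_derivative
    has_derivative_ident holo_onD(1)[OF g y])
 show "frechet_derivative (gpar T g) (at y) v = T (cons3 v (frechet_derivative g (at y) v))"
  using frechet_derivative_at[OF *] by metis
qed

lemma gpar_holo:
 assumes T: "clin_iso T T'" and g: "holo_on V g"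
 shows "holo_map_on V (gpar T g)"
proof (rule holo_map_onI)
 fix x assume x: "x \<in> V"
 show "EX D. (gpar T g has_derivative D) (at x) \<and> (ALL c v. D (c *s v) = c *s D v)"
  by (rule exI, rule conjI, rule gpar_has_derivative(1)[OF T g x])
    (simp add: holo_onD(2)[OF g x] clin_isoD(3)[OF T, symmetric] cons3_smult)
qed

lemma gpar_gram_nonzero:
 assumes T: "clin_iso T T'" and g: "holo_on V g" and y: "y \<in> V"
 shows "gram (gpar T g) y ~= 0"
proof
 define u where "u = T (cons3 (axis 1 1) (frechet_derivative g (at y) (axis 1 1)))"
 define v where "v = T (cons3 (axis 2 1) (frechet_derivative g (at y) (axis 2 1)))"
 have inj: "T x = T x' \<longleftrightarrow> x = x'" for x x' using clin_isoD(4)[OF T] by metis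
 assume "gram (gpar T g) y = 0"
 then have c: "cross u v = 0"
  by (simp add: gram_eq gpar_has_derivative(2)[OF T g y] u_def v_def)
 have T0: "T 0 = 0" using clin_isoD(3)[OF T, of 0 0] by simp
 have "u ~= 0"
 proof
  assume "u = 0"
  then have "cons3 (axis 1 1) (frechet_derivative g (at y) (axis 1 1)) = 0"
   using inj[of _ 0] T0 by (simp add: u_def)
  then show False by (auto simp: vec_eq_iff forall_3 axis_def)
 qed
 then obtain c where "v = c *s u" using cross_eq_0D c by blast
 then have "cons3 (axis 2 1) (frechet_derivative g (at y) (axis 2 1)) = c *s cons3 (axis 1 1) (frechet_derivative g (at y) (axis 1 1))"
  unfolding u_def v_def clin_isoD(3)[OF T, symmetric] inj by simp
 then show False by (auto simp: vec_eq_iff forall_3 axis_def)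
qed

text \<open>The inverse of the chart is the restriction of the ambient linear map
  \<open>proj3 \<circ> T'\<close>, so images of Borel sets and transitions to other parametrizations
  are explicit. The equation for \<open>M Int N\<close> says that N meets no other sheet.\<close>

definition graph_chart ::
 "(complex ^ 3) set => (complex ^ 3 => complex ^ 3) => (complex ^ 3 => complex ^ 3) => (complex ^ 3) set
   => (complex ^ 2) set => (complex ^ 2 => complex) => bool" where
 "graph_chart M T T' N V g \<longleftrightarrow> clin_iso T T' \<and> open N \<and> open V \<and> holo_on V g \<and> M Int N = gpar T g ` V"

lemma graph_chart_holo_param:
 assumes "graph_chart M T T' N V g"
 shows "holo_param M V (gpar T g)"
 unfolding holo_param_def
proof (intro conjI ballI)
 have T: "clin_iso T T'" and g: "holo_on V g" using assms by (auto simp: graph_chart_def)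
 show "open V" "gpar T g ` V <= M" using assms by (auto simp: graph_chart_def)
 show "holo_map_on V (gpar T g)" by (rule gpar_holo[OF T g])
 show "inj_on (gpar T g) V" by (rule inj_on_inverseI[of V "%x. proj3 (T' x)"]) (simp add: T)
 show "gram (gpar T g) t ~= 0" if "t \<in> V" for t by (rule gpar_gram_nonzero[OF T g that])
qed

lemma graph_chart_inverse:
 assumes "graph_chart M T T' N V g" "x \<in> M" "x \<in> N"
 shows "proj3 (T' x) \<in> V" "gpar T g (proj3 (T' x)) = x"
proof -
 have T: "clin_iso T T'" using assms(1) by (auto simp: graph_chart_def)
 obtain y where y: "y \<in> V" "x = gpar T g y" using assms by (auto simp: graph_chart_def)
 then show "proj3 (T' x) \<in> V" "gpar T g (proj3 (T' x)) = x" using T by simp_all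
qed

lemma graph_chart_image_borel:
 assumes c: "graph_chart M T T' N V g" and M: "M \<in> sets borel" and C: "C \<in> sets borel" "C <= V"
 shows "gpar T g ` C \<in> sets borel"
proof -
 have T: "clin_iso T T'" and N: "open N" and MN: "M Int N = gpar T g ` V"
  using c by (auto simp: graph_chart_def)
 have "continuous_on (M Int N) (%x. proj3 (T' x))"
  by (intro linear_continuous_on bounded_linear_compose[OF bounded_linear_proj3 clin_isoD(2)[OF T]])
 then have "(M Int N) Int (%x. proj3 (T' x)) -` C \<in> sets borel"
  using M N C by (intro borel_Int_vimage) auto
 also have "(M Int N) Int (%x. proj3 (T' x)) -` C = gpar T g ` C"
  unfolding MN using C(2) T by auto
 finally show ?thesis .
qed

text \<open>Any holomorphic parametrization factors through a graph chart, \<psi> =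
  \<open>gpar T g\<close> \<circ> \<tau> with \<tau> explicit. By the chain rule the cross product
  of the partial derivatives is multiplied by the complex Jacobian of \<tau>, hence the Gram density
  by its squared modulus, which is the factor in the change of variables for Lebesgue
  measure.\<close>

lemma transition:
 assumes c: "graph_chart M T T' N V g" and p: "holo_param M U \<psi>"
  and U': "U' = U Int \<psi> -` N" and \<tau>: "\<tau> = (%t. proj3 (T' (\<psi> t)))"
 shows "open U'" "holo_map_on U' \<tau>" "inj_on \<tau> U'" "!!t. t \<in> U' ==> \<tau> t \<in> V \<and> gpar T g (\<tau> t) = \<psi> t"
  "!!t. t \<in> U' ==> gram \<psi> t = gram (gpar T g) (\<tau> t) * (cmod (jac2 \<tau> t))\<^sup>2"
proof -
 have T: "clin_iso T T'" and N: "open N" and g: "holo_on V g"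
  using c by (auto simp: graph_chart_def)
 have U: "open U" and \<psi>: "holo_map_on U \<psi>" "inj_on \<psi> U" "\<psi> ` U <= M"
  using p by (auto simp: holo_param_def)
 show U'o: "open U'" unfolding U' using U N holo_map_on_imp_continuous_on[OF \<psi>(1)] continuous_open_preimage by blast
 show in1: "\<tau> t \<in> V \<and> gpar T g (\<tau> t) = \<psi> t" if "t \<in> U'" for t
  using graph_chart_inverse[OF c, of "\<psi> t"] that \<psi>(3) unfolding U' \<tau> by auto
 show "inj_on \<tau> U'"
 proof (rule inj_onI)
  fix x y assume xy: "x \<in> U'" "y \<in> U'" and eq: "\<tau> x = \<tau> y"
  have "\<psi> x = \<psi> y" using conjunct2[OF in1[OF xy(1)]] conjunct2[OF in1[OF xy(2)]] unfolding eq by (rule trans[OF sym])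
  then show "x = y" using inj_onD[OF \<psi>(2)] xy unfolding U' by blast
 qed
 have d\<tau>: "(\<tau> has_derivative (%v. proj3 (T' (frechet_derivative \<psi> (at t) v)))) (at t)" if "t \<in> U'" for t
  unfolding \<tau> using that unfolding U'
  by (intro bounded_linear.has_derivative[OF bounded_linear_proj3]
    bounded_linear.has_derivative[OF clin_isoD(2)[OF T]] holo_map_onD(1)[OF \<psi>(1)]) auto
 show h: "holo_map_on U' \<tau>"
 proof (rule holo_map_onI)
  fix t assume t: "t \<in> U'"
  show "EX D. (\<tau> has_derivative D) (at t) \<and> (ALL c v. D (c *s v) = c *s D v)"
   by (rule exI, rule conjI, rule d\<tau>[OF t])
    (use t in \<open>simp add: U' holo_map_onD(3)[OF \<psi>(1)] clin_isoD(9)[OF T] proj3_smult\<close>)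
 qed
 show "gram \<psi> t = gram (gpar T g) (\<tau> t) * (cmod (jac2 \<tau> t))\<^sup>2" if t: "t \<in> U'" for t
 proof -
  have tU: "t \<in> U" and tV: "\<tau> t \<in> V" using t in1 by (auto simp: U')
  define D where "D = frechet_derivative \<tau> (at t)"
  define G where "G = frechet_derivative (gpar T g) (at (\<tau> t))"
  have Gd: "(gpar T g has_derivative G) (at (\<tau> t))" and Gs: "G (c *s v) = c *s G v" for c v
   unfolding G_def by (rule holo_map_onD[OF gpar_holo[OF T g] tV])+
  have Dd: "(\<tau> has_derivative D) (at t)" unfolding D_def by (rule holo_map_onD(1)[OF h t])
  have "((%t. gpar T g (\<tau> t)) has_derivative (%v. G (D v))) (at t)"
   by (rule has_derivative_compose[OF Dd Gd])
  then have "(\<psi> has_derivative (%v. G (D v))) (at t)"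
   by (rule has_derivative_transform_within_open[OF _ U'o t]) (use in1 in simp)
  then have fd: "frechet_derivative \<psi> (at t) v = G (D v)" for v
   using frechet_derivative_at by metis
  have Glin: "G (x + y) = G x + G y" for x y
   using has_derivative_linear[OF Gd] linear_add by blast
  have Gw: "G w = w $ 1 *s G (axis 1 1) + w $ 2 *s G (axis 2 1)" for w
  proof -
   have "w = w $ 1 *s axis 1 1 + w $ 2 *s axis 2 1" by (simp add: vec_eq_iff forall_2 axis_def)
   then show ?thesis by (metis Gs Glin)
  qed
  have "cross (G (D (axis 1 1))) (G (D (axis 2 1))) = jac2 \<tau> t *s cross (G (axis 1 1)) (G (axis 2 1))"
   unfolding Gw[of "D (axis 1 1)"] Gw[of "D (axis 2 1)"] cross_lincomb by (simp add: jac2_def Let_def D_def)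
  then show ?thesis
   by (simp add: gram_eq fd G_def[symmetric] norm_smult_vec power_mult_distrib)
 qed
qed

section \<open>The volume measure assembled from countably many graph charts\<close>

lemma countable_open_subcover:
 assumes "!!x. x \<in> S ==> EX N. open N \<and> x \<in> N \<and> P N" "S ~= {}"
 shows "\<exists>N :: nat => 'a::second_countable_topology set. (ALL i. open (N i) \<and> P (N i)) \<and> S <= (\<Union>i. N i)"
proof -
 define F where "F = {N. open N \<and> P N}"
 obtain F' where F': "F' <= F" "countable F'" "\<Union>F' = \<Union>F"
  using Lindelof[of F] unfolding F_def by blast
 have cov: "S <= \<Union>F'" unfolding F'(3) F_def using assms(1) by blast
 then have "F' ~= {}" using assms(2) by auto
 then have "range (from_nat_into F') = F'" using F'(2) by (simp add: range_from_nat_into)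
 then show ?thesis
  using cov F'(1) unfolding F_def by (intro exI[of _ "from_nat_into F'"]) auto
qed

lemma disjointed_chart_pieces:
 fixes N :: "nat => 'a::topological_space set"
 assumes "!!i. open (N i)"
 shows "disjointed N i \<in> sets borel" "disjointed N i <= N i" "disjoint_family (disjointed N)" "(\<Union>i. disjointed N i) = (\<Union>i. N i)"
proof -
 have "N j \<in> sets borel" for j using assms by simp
 then show "disjointed N i \<in> sets borel" unfolding disjointed_def by blast
qed (simp_all add: disjointed_subset disjoint_family_disjointed UN_disjointed_eq)

lemma vimage_image_inj_on: "inj_on f A ==> C <= A ==> A Int f -` f ` C = C"
 unfolding inj_on_def by blast

text \<open>\<open>dV\<close> is a definite description. From a countable graph atlas a measure with
  the defining property is built, and the property is shown to determine it, so that the atlas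
  leaves no trace in the result.\<close>

locale chart_cover =
 fixes M :: "(complex ^ 3) set" and T T' N V g
 assumes M: "M \<in> sets borel" "M ~= {}"
  and chart: "!!i::nat. graph_chart M (T i) (T' i) (N i) (V i) (g i)"
  and cover: "M <= (\<Union>i. N i)"
begin

abbreviation par where "par i \<equiv> gpar (T i) (g i)"

definition piece where "piece i = M Int disjointed N i"

lemma openN: "open (N i)" and openV: "open (V i)"
 using chart by (auto simp: graph_chart_def)

lemma piece: "piece i \<in> sets borel" "piece i <= M" "piece i <= N i" "disjoint_family piece" "(\<Union>i. piece i) = M"
 using disjointed_chart_pieces[of N, OF openN] M(1) cover unfolding piece_def
 by (auto simp: disjoint_family_on_def) blast

lemma par_continuous: "continuous_on (V i) (par i)"
proof -
 have "holo_map_on (V i) (par i)" using graph_chart_holo_param[OF chart[of i]] by (simp add: holo_param_def)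
 then show ?thesis by (rule holo_map_on_imp_continuous_on)
qed

definition pull where "pull i E = V i Int par i -` E"

lemma pull_borel: "E \<in> sets borel ==> pull i E \<in> sets borel"
 unfolding pull_def using openV by (intro borel_Int_vimage[OF par_continuous]) auto

lemma par_pull: "E <= M Int N i ==> par i ` pull i E = E"
proof -
 assume "E <= M Int N i"
 moreover have "M Int N i = par i ` V i" using chart[of i] by (simp add: graph_chart_def)
 ultimately have "E <= par i ` V i" by blast
 then show ?thesis unfolding pull_def by auto
qed

lemma gram_measurable: "B \<in> sets borel ==> B <= V i ==> (%t. ennreal (gram (par i) t) * indicator B t) \<in> borel_measurable borel"
proof -
 assume B: "B \<in> sets borel" "B <= V i"
 have h: "holo_map_on (V i) (par i)" using graph_chart_holo_param[OF chart] by (auto simp: holo_param_def)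
 have c: "continuous_on (V i) (gram (par i))"
  unfolding gram_def[abs_def] Let_def herm_def
  by (intro continuous_intros holo_map_deriv_continuous[OF openV h])
 have "(%t. ennreal (indicator B t *\<^sub>R gram (par i) t)) \<in> borel_measurable borel"
  using borel_measurable_continuous_on_indicator[OF B(1) continuous_on_subset[OF c B(2)]] by measurable
 also have "(%t. ennreal (indicator B t *\<^sub>R gram (par i) t)) = (%t. ennreal (gram (par i) t) * indicator B t)"
  by (auto simp: indicator_def fun_eq_iff)
 finally show ?thesis .
qed

text \<open>The push-forward from the disjoint union of the parameter domains, coded as pairs of
  chart index and parameter. The pieces are disjoint and cover \<open>M\<close>, so each point is
  reached once. Off the pieces the density is 0, and the map takes an arbitrary value in
  \<open>M\<close> merely to stay in the target space.\<close>

definition vol :: "(complex ^ 3) measure" where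
 "vol = distr (density (count_space UNIV \<Otimes>\<^sub>M lborel)
   (%(i, t). ennreal (gram (par i) t) * indicator (pull i (piece i)) t))
  (restrict_space borel M) (%(i, t). if t \<in> pull i (piece i) then par i t else (SOME x. x \<in> M))"

lemma sets_vol: "sets vol = sets (restrict_space borel M)"
 by (simp add: vol_def)

lemma emeasure_vol:
 assumes E: "E \<in> sets borel" "E <= M"
 shows "emeasure vol E = (\<Sum>i. \<integral>\<^sup>+t\<in>pull i (E Int piece i). ennreal (gram (par i) t) \<partial>lborel)"
proof -
 define d where "d = (%(i, t). ennreal (gram (par i) t) * indicator (pull i (piece i)) t)"
 define m where "m = (%(i, t). if t \<in> pull i (piece i) then par i t else (SOME x. x \<in> M))"
 have some: "(SOME x. x \<in> M) \<in> M" using M(2) by (simp add: some_in_eq)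
 have d: "d \<in> borel_measurable (count_space UNIV \<Otimes>\<^sub>M lborel)"
 proof (rule measurable_pair_measure_countable1)
  fix i :: nat
  have "pull i (piece i) <= V i" by (auto simp: pull_def)
  from gram_measurable[OF pull_borel[OF piece(1)] this]
  show "(%t. d (i, t)) \<in> borel_measurable lborel" by (simp add: d_def)
 qed simp
 have m: "m \<in> measurable (count_space UNIV \<Otimes>\<^sub>M lborel) (restrict_space borel M)"
 proof (rule measurable_pair_measure_countable1)
  fix i :: nat
  have "(%t. if t \<in> pull i (piece i) then par i t else (SOME x. x \<in> M)) \<in> borel_measurable borel"
   using pull_borel[OF piece(1)] continuous_on_subset[OF par_continuous[of i]]
   by (intro borel_measurable_continuous_on_if continuous_on_const) (auto simp: pull_def)
  then show "(%t. m (i, t)) \<in> measurable lborel (restrict_space borel M)"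
   using some subsetD[OF piece(2)] unfolding m_def by (intro measurable_restrict_space2) (auto simp: pull_def)
 qed simp
 have E': "E \<in> sets (restrict_space borel M)" using E M by (simp add: sets_restrict_space_iff)
 have mE: "m -` E Int space (count_space UNIV \<Otimes>\<^sub>M lborel) \<in> sets (count_space UNIV \<Otimes>\<^sub>M lborel)"
  using measurable_sets[OF m E'] .
 have "emeasure vol E = emeasure (density (count_space UNIV \<Otimes>\<^sub>M lborel) d) (m -` E Int space (count_space UNIV \<Otimes>\<^sub>M lborel))"
  unfolding vol_def d_def[symmetric] m_def[symmetric] using m E' by (simp add: emeasure_distr)
 also have "... = (\<integral>\<^sup>+x. d x * indicator (m -` E Int space (count_space UNIV \<Otimes>\<^sub>M lborel)) x \<partial>(count_space UNIV \<Otimes>\<^sub>M lborel))"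
  by (rule emeasure_density[OF d mE])
 also have "... = (\<integral>\<^sup>+i. \<integral>\<^sup>+t. d (i, t) * indicator (m -` E Int space (count_space UNIV \<Otimes>\<^sub>M lborel)) (i, t) \<partial>lborel \<partial>count_space UNIV)"
  by (intro lborel.nn_integral_fst[symmetric] borel_measurable_times_ennreal d borel_measurable_indicator mE)
 also have "... = (\<Sum>i. \<integral>\<^sup>+t. d (i, t) * indicator (m -` E Int space (count_space UNIV \<Otimes>\<^sub>M lborel)) (i, t) \<partial>lborel)"
  by (rule nn_integral_count_space_nat)
 also have "... = (\<Sum>i. \<integral>\<^sup>+t\<in>pull i (E Int piece i). ennreal (gram (par i) t) \<partial>lborel)"
  by (intro suminf_cong nn_integral_cong) (auto simp: d_def m_def indicator_def pull_def space_pair_measure)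
 finally show ?thesis .
qed

text \<open>A is cut by the pieces. On each part \<psi> is a chart composed with its transition map,
  and the factor relating the two Gram densities is the Jacobian from the change of
  variables.\<close>

lemma vol_param:
 assumes p: "holo_param M U \<psi>" and A: "A \<in> sets borel" "A <= U"
 shows "\<psi> ` A \<in> sets borel" "\<psi> ` A <= M" "emeasure vol (\<psi> ` A) = (\<integral>\<^sup>+t\<in>A. ennreal (gram \<psi> t) \<partial>lborel)"
proof -
 have U: "open U" and \<psi>: "holo_map_on U \<psi>" "inj_on \<psi> U" "\<psi> ` U <= M"
  using p by (auto simp: holo_param_def)
 define \<tau> where "\<tau> i = (%t. proj3 (T' i (\<psi> t)))" for i
 define B where "B i = A Int \<psi> -` piece i" for i
 note tr = transition[OF chart p refl refl]
 have Ac: "continuous_on A \<psi>" using holo_map_on_imp_continuous_on[OF \<psi>(1)] A(2) continuous_on_subset by blast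
 have B: "B i \<in> sets borel" "B i <= U Int \<psi> -` N i" for i
  unfolding B_def using A piece(1) subsetD[OF piece(3)] by (auto intro!: borel_Int_vimage[OF Ac])
 have tau: "\<tau> i t \<in> V i \<and> par i (\<tau> i t) = \<psi> t" if "t \<in> B i" for i t
  using tr(4)[of t i] that B(2) unfolding \<tau>_def by auto
 have tB: "\<tau> i ` B i \<in> sets borel" for i
  unfolding \<tau>_def by (rule emeasure_image_holo(1)[OF tr(1,2,3) B])
 have im: "\<psi> ` A Int piece i = par i ` (\<tau> i ` B i)" for i
  using tau by (force simp: B_def image_iff)
 have eqU: "\<psi> ` A = (\<Union>i. par i ` (\<tau> i ` B i))"
 proof -
  have "\<psi> ` A <= M" using \<psi>(3) A(2) by blast
  then have "\<psi> ` A = \<psi> ` A Int (\<Union>i. piece i)" unfolding piece(5) by blast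
  also have "... = (\<Union>i. \<psi> ` A Int piece i)" by blast
  finally show ?thesis by (simp only: im)
 qed
 show bor: "\<psi> ` A \<in> sets borel"
  unfolding eqU using tau
  by (intro sets.countable_UN image_subsetI graph_chart_image_borel[OF chart M(1) tB]) blast
 show sub: "\<psi> ` A <= M" using A \<psi> by blast
 have pul: "pull i (\<psi> ` A Int piece i) = \<tau> i ` B i" for i
 proof -
  have inj: "inj_on (par i) (V i)" using graph_chart_holo_param[OF chart[of i]] by (simp add: holo_param_def)
  have sub: "\<tau> i ` B i <= V i" using tau by blast
  show ?thesis unfolding im pull_def by (rule vimage_image_inj_on[OF inj sub])
 qed
 have "(\<integral>\<^sup>+t\<in>\<tau> i ` B i. ennreal (gram (par i) t) \<partial>lborel) = (\<integral>\<^sup>+t\<in>B i. ennreal (gram \<psi> t) \<partial>lborel)" for i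
 proof -
  have "(\<integral>\<^sup>+t\<in>\<tau> i ` B i. ennreal (gram (par i) t) \<partial>lborel) =
   (\<integral>\<^sup>+t\<in>B i. ennreal (gram (par i) (\<tau> i t)) * ennreal ((cmod (jac2 (\<tau> i) t))\<^sup>2) \<partial>lborel)"
   unfolding \<tau>_def using tB[of i] tau
   by (intro nn_integral_image_holo[OF tr(1,2,3) B]) (auto intro!: gram_measurable simp: \<tau>_def)
  also have "... = (\<integral>\<^sup>+t\<in>B i. ennreal (gram \<psi> t) \<partial>lborel)"
  proof (rule nn_integral_cong)
   fix t
   have "gram \<psi> t = gram (par i) (\<tau> i t) * (cmod (jac2 (\<tau> i) t))\<^sup>2" if "t \<in> B i"
    using tr(5)[of t i] that B(2) unfolding \<tau>_def by blast
   then show "ennreal (gram (par i) (\<tau> i t)) * ennreal ((cmod (jac2 (\<tau> i) t))\<^sup>2) * indicator (B i) t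
     = ennreal (gram \<psi> t) * indicator (B i) t"
    by (cases "t \<in> B i") (simp_all add: ennreal_mult gram_nonneg)
  qed
  finally show ?thesis .
 qed
 then have "emeasure vol (\<psi> ` A) = (\<Sum>i. \<integral>\<^sup>+t\<in>B i. ennreal (gram \<psi> t) \<partial>lborel)"
  by (simp add: emeasure_vol[OF bor sub] pul)
 also have "... = (\<integral>\<^sup>+t. (\<Sum>i. ennreal (gram \<psi> t) * indicator (B i) t) \<partial>lborel)"
 proof (rule nn_integral_suminf[symmetric])
  fix i
  have BU: "B i <= U" using B(2)[of i] by blast
  have c: "continuous_on U (gram \<psi>)"
   unfolding gram_def[abs_def] Let_def herm_def
   by (intro continuous_intros holo_map_deriv_continuous[OF U \<psi>(1)])
  have "(%t. ennreal (indicator (B i) t *\<^sub>R gram \<psi> t)) \<in> borel_measurable borel"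
   using borel_measurable_continuous_on_indicator[OF B(1) continuous_on_subset[OF c BU]] by measurable
  also have "(%t. ennreal (indicator (B i) t *\<^sub>R gram \<psi> t)) = (%t. ennreal (gram \<psi> t) * indicator (B i) t)"
   by (auto simp: indicator_def fun_eq_iff)
  finally show "(%t. ennreal (gram \<psi> t) * indicator (B i) t) \<in> borel_measurable lborel" by simp
 qed
 also have "... = (\<integral>\<^sup>+t\<in>A. ennreal (gram \<psi> t) \<partial>lborel)"
 proof (rule nn_integral_cong)
  fix t
  have "disjoint_family B" using piece(4) by (auto simp: disjoint_family_on_def B_def)
  moreover have "(\<Union>i. B i) = A" using piece(5) A \<psi>(3) by (auto simp: B_def) blast
  ultimately show "(\<Sum>i. ennreal (gram \<psi> t) * indicator (B i) t) = ennreal (gram \<psi> t) * indicator A t"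
   using suminf_indicator[of B t] by (simp add: ennreal_suminf_cmult)
 qed
 finally show "emeasure vol (\<psi> ` A) = (\<integral>\<^sup>+t\<in>A. ennreal (gram \<psi> t) \<partial>lborel)" .
qed

text \<open>Uniqueness: a Borel subset of one piece is the image of a Borel set under a single
  chart, so the defining property fixes its measure, and the countably many pieces add up.\<close>

lemma dV_eq_vol: "dV M = vol"
 unfolding dV_def
proof (rule the_equality)
 show "sets vol = sets (restrict_space borel M) \<and> (\<forall>V \<psi> A. holo_param M V \<psi> \<and> A \<in> sets borel \<and> A <= V -->
    emeasure vol (\<psi> ` A) = (\<integral>\<^sup>+t\<in>A. ennreal (gram \<psi> t) \<partial>lborel))"
  using sets_vol vol_param(3) by blast
next
 fix \<mu> :: "(complex ^ 3) measure"
 assume \<mu>: "sets \<mu> = sets (restrict_space borel M) \<and> (\<forall>V \<psi> A. holo_param M V \<psi> \<and> A \<in> sets borel \<and> A <= V -->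
    emeasure \<mu> (\<psi> ` A) = (\<integral>\<^sup>+t\<in>A. ennreal (gram \<psi> t) \<partial>lborel))"
 show "\<mu> = vol"
 proof (rule measure_eqI)
  show "sets \<mu> = sets vol" using \<mu> sets_vol by simp
  fix E assume "E \<in> sets \<mu>"
  then have E: "E \<in> sets borel" "E <= M" using \<mu> M(1) by (auto simp: sets_restrict_space_iff)
  have p: "emeasure \<nu> E = (\<Sum>i. emeasure \<nu> (E Int piece i))" if "sets \<nu> = sets (restrict_space borel M)" for \<nu>
  proof -
   have "(\<Sum>i. emeasure \<nu> (E Int piece i)) = emeasure \<nu> (\<Union>i. E Int piece i)"
    using piece(4) E piece(1) M(1) that
    by (intro suminf_emeasure) (auto simp: disjoint_family_on_def sets_restrict_space_iff)
   also have "(\<Union>i. E Int piece i) = E" using piece(5) E by blast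
   finally show ?thesis by simp
  qed
  have "emeasure \<mu> (E Int piece i) = emeasure vol (E Int piece i)" for i
  proof -
   have e: "E Int piece i = par i ` pull i (E Int piece i)"
    using piece(2,3) by (intro par_pull[symmetric]) blast
   have C: "pull i (E Int piece i) \<in> sets borel" "pull i (E Int piece i) <= V i"
    using pull_borel[of "E Int piece i" i] E piece(1) by (auto simp: pull_def)
   show ?thesis
    by (subst (1 2) e) (use \<mu> graph_chart_holo_param[OF chart] C vol_param(3) in metis)
  qed
  then show "emeasure \<mu> E = emeasure vol E"
   using p[of \<mu>] p[OF sets_vol] \<mu> by simp
 qed
qed

end

section \<open>Hypersurfaces and the growth of their volume\<close>

lemma clin_iso_comp:
 assumes "clin_iso T T'" "clin_iso S S'"
 shows "clin_iso (T \<circ> S) (S' \<circ> T')"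
 using assms unfolding clin_iso_def o_def by (simp add: bounded_linear_compose)

text \<open>Brings the k-th axis to the third place, so that one implicit function theorem serves
  all three coordinate planes.\<close>

definition coord_swap :: "3 => complex ^ 3 => complex ^ 3" where
 "coord_swap k x = (\<chi> i. if i = 3 then x $ k else if i = k then x $ 3 else x $ i)"

lemma clin_iso_coord_swap: "clin_iso (coord_swap k) (coord_swap k)"
proof -
 have "bounded_linear (coord_swap k)"
  by (rule linear_conv_bounded_linear[THEN iffD1]) (auto intro!: linearI simp: coord_swap_def vec_eq_iff)
 then show ?thesis unfolding clin_iso_def by (auto simp: coord_swap_def vec_eq_iff)
qed

lemma coord_swap_axis: "coord_swap k (axis 3 1) = axis k 1"
 "j ~= 3 ==> EX i. coord_swap k (axis j 1) = axis i 1"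
 by (auto simp: coord_swap_def vec_eq_iff axis_def intro: exI[of _ "if j = k then 3 else j"])

lemma holo_on_clin_comp:
 assumes T: "clin_iso T T'" and f: "holo_on U f"
 shows "holo_on (T -` U) (f \<circ> T)"
  and "T y \<in> U ==> frechet_derivative (f \<circ> T) (at y) v = frechet_derivative f (at (T y)) (T v)"
proof -
 have *: "((f \<circ> T) has_derivative (%v. frechet_derivative f (at (T y)) (T v))) (at y)" if "T y \<in> U" for y
  unfolding o_def
  by (rule has_derivative_compose[OF bounded_linear_imp_has_derivative[OF clin_isoD(1)[OF T]] holo_onD(1)[OF f that]])
 show "T y \<in> U ==> frechet_derivative (f \<circ> T) (at y) v = frechet_derivative f (at (T y)) (T v)"
  using frechet_derivative_at[OF *] by metis
 show "holo_on (T -` U) (f \<circ> T)"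
  unfolding holo_on_def
 proof
  fix y assume y: "y \<in> T -` U"
  show "EX D. ((f \<circ> T) has_derivative D) (at y) \<and> (ALL c v. D (c *s v) = c * D v)"
   by (rule exI, rule conjI, rule *) (use y in \<open>auto simp: clin_isoD(3)[OF T] holo_onD(2)[OF f]\<close>)
 qed
qed

lemma graph_chart_exists:
 assumes T: "clin_iso T T'" and \<Omega>0: "open \<Omega>0" and f: "holo_on \<Omega>0 f" and x: "x \<in> \<Omega>0" "f x = 0"
  and nz: "frechet_derivative f (at x) (T (axis 3 1)) ~= 0"
 shows "EX N V g. graph_chart {x \<in> \<Omega>0. f x = 0} T T' N V g \<and> x \<in> N
  \<and> (\<forall>x\<in>N. x \<in> \<Omega>0 \<and> frechet_derivative f (at x) (T (axis 3 1)) ~= 0)"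
proof -
 have cT: "continuous_on UNIV T" "continuous_on UNIV T'"
  using clin_isoD(1,2)[OF T] linear_continuous_on by auto
 have TT: "T (T' y) = y" "T' (T y) = y" for y using clin_isoD(4,5)[OF T] by auto
 note h = holo_on_clin_comp[OF T f]
 obtain N V g where N: "open N" "T' x \<in> N" "N <= T -` \<Omega>0" "open V" "holo_on V g"
  "{y \<in> N. (f \<circ> T) y = 0} = (%y. cons3 y (g y)) ` V"
  "!!y. y \<in> N ==> frechet_derivative (f \<circ> T) (at y) (axis 3 1) ~= 0"
  by (rule holo_implicit[OF open_vimage[OF \<Omega>0 cT(1)] h(1), of "T' x"])
   (use x nz in \<open>auto simp: TT h(2)\<close>)
 have "{x \<in> \<Omega>0. f x = 0} Int T' -` N = T ` {y \<in> N. (f \<circ> T) y = 0}"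
  using N(3) by (auto simp: TT image_iff) (metis TT(1))
 also have "... = gpar T g ` V" unfolding N(6) by (auto simp: gpar_def)
 finally have "graph_chart {x \<in> \<Omega>0. f x = 0} T T' (T' -` N) V g"
  unfolding graph_chart_def using T N open_vimage[OF N(1) cT(2)] by simp
 moreover have "y \<in> \<Omega>0 \<and> frechet_derivative f (at y) (T (axis 3 1)) ~= 0" if "y \<in> T' -` N" for y
 proof -
  have "T' y \<in> T -` \<Omega>0" using that N(3) by blast
  then show ?thesis using N(7)[of "T' y"] h(2)[of "T' y" "axis 3 1"] that by (simp add: TT)
 qed
 ultimately show ?thesis using N(2) by (intro exI[of _ "T' -` N"]) blast
qed

text \<open>Meant for the punctured domain, where the gradient has no zeros on \<open>M\<close>. The
  growth estimates at the removed point need f on a neighbourhood of it; this enters there as a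
  separate larger set \<Omega>'.\<close>

locale hypersurface =
 fixes f :: "complex ^ 3 => complex" and \<Omega>0 M :: "(complex ^ 3) set"
 assumes \<Omega>0: "open \<Omega>0" and f: "holo_on \<Omega>0 f" and M_eq: "M = {x \<in> \<Omega>0. f x = 0}" and M_ne: "M ~= {}"
  and nonsing: "!!x. x \<in> M ==> EX j. frechet_derivative f (at x) (axis j 1) ~= 0"
begin

lemma M_borel: "M \<in> sets borel"
proof -
 have "M = \<Omega>0 Int f -` {0}" by (auto simp: M_eq)
 then show ?thesis
  using borel_Int_vimage[OF holo_on_imp_continuous_on[OF f], of "{0}"] \<Omega>0 by simp
qed

lemma dV_props:
 shows "sets (dV M) = sets (restrict_space borel M)"
  and "holo_param M U \<psi> ==> A \<in> sets borel ==> A <= U ==>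
   emeasure (dV M) (\<psi> ` A) = (\<integral>\<^sup>+t\<in>A. ennreal (gram \<psi> t) \<partial>lborel)"
proof -
 have "EX N. open N \<and> x \<in> N \<and> (EX T T' V g. graph_chart M T T' N V g)" if "x \<in> M" for x
 proof -
  from nonsing[OF that] obtain j where j: "frechet_derivative f (at x) (axis j 1) ~= 0" by blast
  from that j obtain N V g where N: "graph_chart {x \<in> \<Omega>0. f x = 0} (coord_swap j) (coord_swap j) N V g" "x \<in> N"
   using graph_chart_exists[OF clin_iso_coord_swap \<Omega>0 f, of x j] by (auto simp: M_eq coord_swap_axis)
  then show ?thesis unfolding M_eq[symmetric] by (auto simp: graph_chart_def)
 qed
 from countable_open_subcover[OF this M_ne] obtain N where N: "!!i::nat. open (N i)"
  "!!i. EX T T' V g. graph_chart M T T' (N i) V g" "M <= (\<Union>i. N i)" by blast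
 obtain T T' V g where "!!i. graph_chart M (T i) (T' i) (N i) (V i) (g i)"
  using N(2) by metis
 then interpret chart_cover M T T' N V g
  using M_borel M_ne N(3) by unfold_locales auto
 show "sets (dV M) = sets (restrict_space borel M)"
  by (simp add: dV_eq_vol sets_vol)
 show "holo_param M U \<psi> ==> A \<in> sets borel ==> A <= U ==>
   emeasure (dV M) (\<psi> ` A) = (\<integral>\<^sup>+t\<in>A. ennreal (gram \<psi> t) \<partial>lborel)"
  by (simp add: dV_eq_vol vol_param(3))
qed

lemma sets_dV_iff: "E \<in> sets (dV M) \<longleftrightarrow> E \<in> sets borel \<and> E <= M"
 using M_borel by (auto simp: dV_props(1) sets_restrict_space_iff)

lemma df_eq: "x \<in> \<Omega>0 ==> clin_iso T T' ==>
  frechet_derivative f (at x) v = (\<Sum>j\<in>UNIV. T' v $ j * frechet_derivative f (at x) (T (axis j 1)))"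
proof -
 assume x: "x \<in> \<Omega>0" and T: "clin_iso T T'"
 have "frechet_derivative f (at x) v = frechet_derivative (f \<circ> T) (at (T' x)) (T' v)"
  using holo_on_clin_comp(2)[OF T f, of "T' x" "T' v"] x by (simp add: clin_isoD(5)[OF T])
 also have "... = (\<Sum>j\<in>UNIV. T' v $ j * frechet_derivative (f \<circ> T) (at (T' x)) (axis j 1))"
  using x by (intro holo_frechet_sum[OF holo_on_clin_comp(1)[OF T f]]) (simp add: clin_isoD(5)[OF T])
 also have "... = (\<Sum>j\<in>UNIV. T' v $ j * frechet_derivative f (at x) (T (axis j 1)))"
  using holo_on_clin_comp(2)[OF T f, of "T' x"] x by (simp add: clin_isoD(5)[OF T])
 finally show ?thesis .
qed

text \<open>If the third axis of \<open>T\<close> carries the largest derivative of f, implicit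
  differentiation bounds the partial derivatives of \<open>g\<close> by 1. Both tangent vectors then
  have length at most 2 B, whence 16 B^4, however small the gradient of f may be.\<close>

lemma gram_bound:
 assumes c: "graph_chart M T T' N V g" and y: "y \<in> V" and B: "!!x. norm (T x) <= B * norm x" "0 < B"
  and nz: "frechet_derivative f (at (gpar T g y)) (T (axis 3 1)) ~= 0"
  and le: "!!j. cmod (frechet_derivative f (at (gpar T g y)) (T (axis j 1))) <=
    cmod (frechet_derivative f (at (gpar T g y)) (T (axis 3 1)))"
 shows "gram (gpar T g) y <= 16 * B ^ 4"
proof -
 have T: "clin_iso T T'" and V: "open V" and g: "holo_on V g" and MV: "!!y. y \<in> V ==> gpar T g y \<in> M"
  using c by (auto simp: graph_chart_def)
 define x where "x = gpar T g y"
 have x: "x \<in> \<Omega>0" using MV[OF y] by (auto simp: x_def M_eq)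
 define D where "D = frechet_derivative f (at x)"
 define G where "G = frechet_derivative g (at y)"
 have "((%y. f (gpar T g y)) has_derivative (%v. D (T (cons3 v (G v))))) (at y)"
  unfolding G_def D_def x_def
  by (rule has_derivative_compose[OF gpar_has_derivative(1)[OF T g y] holo_onD(1)[OF f]]) (use x in \<open>simp add: x_def\<close>)
 \<comment> \<open>f vanishes identically along the graph, so its differential annihilates the
   tangent vectors of the graph.\<close>
 moreover have "((%y. f (gpar T g y)) has_derivative (%v. 0)) (at y)"
  by (rule has_derivative_transform_within_open[OF has_derivative_const V y]) (use MV in \<open>auto simp: M_eq\<close>)
 ultimately have z: "D (T (cons3 v (G v))) = 0" for v
  using has_derivative_unique by metis
 have exp: "D (T w) = w $ 1 * D (T (axis 1 1)) + w $ 2 * D (T (axis 2 1)) + w $ 3 * D (T (axis 3 1))" for w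
  unfolding D_def using df_eq[OF x T, of "T w"] by (simp add: clin_isoD(4)[OF T] sum_3)
 have Gb: "cmod (G v) <= 1" if "v = axis 1 1 \<or> v = axis 2 1" for v
 proof -
  have "v $ 1 = 1 \<and> v $ 2 = 0 \<or> v $ 1 = 0 \<and> v $ 2 = 1" using that by (auto simp: axis_def)
  moreover have "v $ 1 * D (T (axis 1 1)) + v $ 2 * D (T (axis 2 1)) + G v * D (T (axis 3 1)) = 0"
   using z[of v] unfolding exp[of "cons3 v (G v)"] by simp
  ultimately have "G v * D (T (axis 3 1)) = - D (T (axis 1 1)) \<or> G v * D (T (axis 3 1)) = - D (T (axis 2 1))"
   by (auto simp: eq_neg_iff_add_eq_0 add.commute)
  then obtain j where j: "G v * D (T (axis 3 1)) = - D (T (axis j 1))" by blast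
  from arg_cong[OF this, of cmod]
  have "cmod (G v) * cmod (D (T (axis 3 1))) <= 1 * cmod (D (T (axis 3 1)))"
   using le[of j] by (simp add: D_def x_def norm_mult)
  then show ?thesis using nz by (simp add: D_def x_def)
 qed
 have nb: "norm (T (cons3 v (G v))) <= 2 * B" if "v = axis 1 1 \<or> v = axis 2 1" for v
 proof -
  have "norm v = 1" using that norm_axis_1 by auto
  then have "norm (cons3 v (G v)) <= 2" using norm_cons3[of v "G v"] Gb[OF that] by linarith
  then have "B * norm (cons3 v (G v)) <= B * 2" using B(2) by (intro mult_left_mono) auto
  with B(1)[of "cons3 v (G v)"] show ?thesis by linarith
 qed
 have "gram (gpar T g) y <= (norm (T (cons3 (axis 1 1) (G (axis 1 1)))))\<^sup>2 * (norm (T (cons3 (axis 2 1) (G (axis 2 1)))))\<^sup>2"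
  unfolding gram_def Let_def gpar_has_derivative(2)[OF T g y] G_def by simp
 also have "... <= (2 * B)\<^sup>2 * (2 * B)\<^sup>2"
  using nb by (intro mult_mono power_mono) auto
 also have "... = 16 * B ^ 4" by (simp add: power2_eq_square power4_eq_xxxx)
 finally show ?thesis .
qed

text \<open>Project along the third axis of \<open>T\<close>. The parameters of E lie in a ball of
  radius K r in C^2, of volume comparable to r^4. Over each parameter there are at most n sheets,
  because they are distinct zeros of f on a line close to x0, and over each sheet the density is
  bounded since the third derivative dominates. None of these constants depends on whether x0 is
  regular.\<close>

lemma growth_direction:
 assumes \<Omega>': "open \<Omega>'" "\<Omega>0 <= \<Omega>'" "holo_on \<Omega>' f" "x0 \<in> \<Omega>'" and T: "clin_iso T T'"
  and nontriv: "!!e. 0 < e ==> EX t. cmod t < e \<and> f (x0 + t *s T (axis 3 1)) ~= 0"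
 shows "\<exists>\<rho> C. 0 < \<rho> \<and> 0 <= C \<and>
  (ALL E z r. E \<in> sets borel --> E <= M Int ball x0 \<rho> --> E <= ball z r --> 0 < r -->
   (\<forall>x\<in>E. frechet_derivative f (at x) (T (axis 3 1)) ~= 0 \<and>
    (ALL j. cmod (frechet_derivative f (at x) (T (axis j 1))) <= cmod (frechet_derivative f (at x) (T (axis 3 1))))) -->
   emeasure (dV M) E <= ennreal (C * r ^ 4))"
proof -
 have TT: "T (T' y) = y" "T' (T y) = y" for y using clin_isoD(4,5)[OF T] by auto
 have cT: "continuous_on UNIV T" using clin_isoD(1)[OF T] linear_continuous_on by auto
 obtain B where B: "0 < B" "!!x. norm (T x) <= B * norm x"
  using bounded_linear.pos_bounded[OF clin_isoD(1)[OF T]] by (auto simp: mult.commute)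
 obtain K where K: "0 < K" "!!x. norm (T' x) <= K * norm x"
  using bounded_linear.pos_bounded[OF clin_isoD(2)[OF T]] by (auto simp: mult.commute)
 have nz: "EX t. cmod (t - T' x0 $ 3) < e \<and> (f \<circ> T) (cons3 (proj3 (T' x0)) t) ~= 0" if "0 < e" for e
 proof -
  from nontriv[OF that] obtain t where t: "cmod t < e" "f (x0 + t *s T (axis 3 1)) ~= 0" by blast
  have "cons3 (proj3 (T' x0)) (T' x0 $ 3 + t) = T' x0 + t *s axis 3 1"
   by (simp add: vec_eq_iff forall_3 axis_def)
  then have "T (cons3 (proj3 (T' x0)) (T' x0 $ 3 + t)) = x0 + t *s T (axis 3 1)"
   by (simp add: clin_isoD(3,6)[OF T] TT)
  then show ?thesis using t by (intro exI[of _ "T' x0 $ 3 + t"]) simp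
 qed
 obtain \<rho>1 n where \<rho>1: "0 < \<rho>1"
  "!!y Z. finite Z ==> (!!t. t \<in> Z ==> cons3 y t \<in> ball (T' x0) \<rho>1 \<and> (f \<circ> T) (cons3 y t) = 0) ==> card Z <= n"
  by (rule holo_zeros_local_bound[OF open_vimage[OF \<Omega>'(1) cT] holo_on_clin_comp(1)[OF T \<Omega>'(3)], of "T' x0"])
   (use nz \<Omega>'(4) in \<open>auto simp: TT\<close>)
 \<comment> \<open>Density bound, number of sheets, volume of a ball of radius K r, in this
   order.\<close>
 define C where "C = 16 * B ^ 4 * (real n * (unit_ball_vol 4 * K ^ 4))"
 have C: "0 <= C" using B K by (simp add: C_def)
 have *: "emeasure (dV M) E <= ennreal (C * r ^ 4)"
  if E: "E \<in> sets borel" "E <= M Int ball x0 (\<rho>1 / K)" "E <= ball z r" "0 < r"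
   and le: "!!x. x \<in> E ==> frechet_derivative f (at x) (T (axis 3 1)) ~= 0 \<and>
    (ALL j. cmod (frechet_derivative f (at x) (T (axis j 1))) <= cmod (frechet_derivative f (at x) (T (axis 3 1))))"
  for E z r
 proof (cases "E = {}")
  case False
  define S where "S = {x \<in> M. frechet_derivative f (at x) (T (axis 3 1)) ~= 0}"
  have ES: "E <= S" using E le by (auto simp: S_def)
  have Sne: "S ~= {}" using False ES by blast
  have "EX N. open N \<and> x \<in> N \<and> (EX V g. graph_chart M T T' N V g)" if "x \<in> S" for x
   using graph_chart_exists[OF T \<Omega>0 f, of x] that by (auto simp: S_def M_eq graph_chart_def)
  from countable_open_subcover[OF this Sne] obtain N where N: "!!i::nat. open (N i)"
   "!!i. EX V g. graph_chart M T T' (N i) V g" "S <= (\<Union>i. N i)" by blast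
  obtain V g where ch: "!!i. graph_chart M T T' (N i) (V i) (g i)" using N(2) by metis
  define P where "P i = disjointed N i" for i
  have P: "P i \<in> sets borel" "P i <= N i" "disjoint_family P" "(\<Union>i. P i) = (\<Union>i. N i)" for i
   unfolding P_def[abs_def] by (rule disjointed_chart_pieces[of N, OF N(1)])+
  define Cc where "Cc i = V i Int gpar T (g i) -` (E Int P i)" for i
  have hp: "holo_param M (V i) (gpar T (g i))" for i by (rule graph_chart_holo_param[OF ch])
  have Cb: "Cc i \<in> sets borel" "Cc i <= V i" for i
  proof -
   show "Cc i \<in> sets borel" unfolding Cc_def
   proof (rule borel_Int_vimage)
    show "continuous_on (V i) (gpar T (g i))"
     by (rule holo_map_on_imp_continuous_on) (use hp[of i] in \<open>simp add: holo_param_def\<close>)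
   qed (use hp[of i] E P(1) in \<open>auto simp: holo_param_def\<close>)
  qed (auto simp: Cc_def)
  have im: "gpar T (g i) ` Cc i = E Int P i" for i
  proof -
   have "E Int P i <= gpar T (g i) ` V i" using ch[of i] E P(2)[of i] unfolding graph_chart_def by blast
   then show ?thesis unfolding Cc_def by blast
  qed
  have yC: "gpar T (g i) y \<in> E" "gpar T (g i) y \<in> P i" if "y \<in> Cc i" for i y
   using that by (auto simp: Cc_def)
  \<comment> \<open>Points of disjoint pieces over the same parameter are different, so they are
    different zeros of f on one line, and \<open>\<rho>1\<close> bounds their number by n.\<close>
  have mult: "(\<Sum>i. indicator (Cc i) y) <= ennreal n * indicator (ball (proj3 (T' z)) (K * r)) y" for y
  proof (cases "EX i. y \<in> Cc i")
   case False
   then have "(%i. indicator (Cc i) y) = (%i. 0::ennreal)" by (auto simp: indicator_def)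
   then show ?thesis by simp
  next
   case True
   then obtain i where i: "y \<in> Cc i" by blast
   have "y = proj3 (T' (gpar T (g i) y))" using T by simp
   then have "dist (proj3 (T' z)) y = norm (proj3 (T' (z - gpar T (g i) y)))"
    unfolding dist_norm clin_isoD(8)[OF T] proj3_diff by simp
   also have "... <= norm (T' (z - gpar T (g i) y))" by (rule norm_proj3)
   also have "... <= K * norm (z - gpar T (g i) y)" by (rule K(2))
   also have "... < K * r" using yC(1)[OF i] E(3) K(1) by (auto simp: dist_norm)
   finally have inb: "y \<in> ball (proj3 (T' z)) (K * r)" by simp
   have "(\<Sum>i<m. indicator (Cc i) y) <= ennreal n" for m
   proof -
    define I where "I = {i\<in>{..<m}. y \<in> Cc i}"
    have "(\<Sum>i<m. indicator (Cc i) y :: ennreal) = (\<Sum>i\<in>I. 1)"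
     by (rule sum.mono_neutral_cong_right) (auto simp: I_def indicator_def)
    also have "... = of_nat (card I)" by simp
    also have "... <= of_nat n"
    proof -
     have "inj_on (%i. g i y) I"
     proof (rule inj_onI)
      fix i j assume ij: "i \<in> I" "j \<in> I" "g i y = g j y"
      then have "gpar T (g i) y \<in> P i" "gpar T (g i) y \<in> P j"
       using yC(2)[of y i] yC(2)[of y j] by (auto simp: I_def gpar_def)
      then show "i = j" using P(3) by (auto simp: disjoint_family_on_def)
     qed
     then have "card I = card ((%i. g i y) ` I)" by (simp add: card_image)
     also have "... <= n"
     proof (rule \<rho>1(2)[where y = y])
      fix t assume "t \<in> (%i. g i y) ` I"
      then obtain i where i: "y \<in> Cc i" "t = g i y" by (auto simp: I_def)
      define x where "x = gpar T (g i) y"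
      have x: "x \<in> E" "T' x = cons3 y t" using yC(1)[OF i(1)] i(2) by (auto simp: x_def gpar_def TT)
      have "dist (T' x0) (cons3 y t) = norm (T' (x0 - x))"
       by (simp add: dist_norm clin_isoD(8)[OF T] x(2))
      also have "... <= K * norm (x0 - x)" by (rule K(2))
      also have "... < K * (\<rho>1 / K)" using x(1) E(2) K(1) by (intro mult_strict_left_mono) (auto simp: dist_norm)
      also have "... = \<rho>1" using K(1) by simp
      finally have "cons3 y t \<in> ball (T' x0) \<rho>1" by simp
      moreover have "(f \<circ> T) (cons3 y t) = 0"
       using x E(2) by (auto simp: M_eq TT simp flip: x(2))
      ultimately show "cons3 y t \<in> ball (T' x0) \<rho>1 \<and> (f \<circ> T) (cons3 y t) = 0" by simp
     qed (simp add: I_def)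
     finally show ?thesis by simp
    qed
    finally show ?thesis by (simp add: ennreal_of_nat_eq_real_of_nat)
   qed
   then have "(\<Sum>i. indicator (Cc i) y) <= ennreal n" by (intro suminf_le_const) auto
   then show ?thesis using inb by simp
  qed
  have "emeasure (dV M) E = (\<Sum>i. emeasure (dV M) (E Int P i))"
  proof -
   have "disjoint_family (%i. E Int P i)" using P(3) unfolding disjoint_family_on_def by blast
   then have "(\<Sum>i. emeasure (dV M) (E Int P i)) = emeasure (dV M) (\<Union>i. E Int P i)"
    using P(1) E(1,2) by (intro suminf_emeasure) (auto simp: sets_dV_iff)
   also have "(\<Union>i. E Int P i) = E" using ES N(3) unfolding P(4)[symmetric] by blast
   finally show ?thesis by simp
  qed
  also have "... = (\<Sum>i. \<integral>\<^sup>+t\<in>Cc i. ennreal (gram (gpar T (g i)) t) \<partial>lborel)"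
   unfolding im[symmetric] by (simp add: dV_props(2)[OF hp Cb])
  also have "... <= (\<Sum>i. \<integral>\<^sup>+t. ennreal (16 * B ^ 4) * indicator (Cc i) t \<partial>lborel)"
  proof (rule suminf_le, rule nn_integral_mono)
   fix i t
   have "gram (gpar T (g i)) t <= 16 * B ^ 4" if "t \<in> Cc i"
    using le[OF yC(1)[OF that]] Cb(2) that by (intro gram_bound[OF ch _ B(2,1)]) auto
   then show "ennreal (gram (gpar T (g i)) t) * indicator (Cc i) t <= ennreal (16 * B ^ 4) * indicator (Cc i) t"
    by (auto simp: indicator_def ennreal_leI)
  qed auto
  also have "... = (\<integral>\<^sup>+t. (\<Sum>i. ennreal (16 * B ^ 4) * indicator (Cc i) t) \<partial>lborel)"
   using Cb by (intro nn_integral_suminf[symmetric]) auto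
  also have "... <= (\<integral>\<^sup>+t. ennreal (16 * B ^ 4) * (ennreal n * indicator (ball (proj3 (T' z)) (K * r)) t) \<partial>lborel)"
   using mult by (intro nn_integral_mono) (simp add: ennreal_suminf_cmult mult_left_mono)
  also have "... = ennreal (16 * B ^ 4) * (ennreal n * emeasure lborel (ball (proj3 (T' z)) (K * r)))"
   unfolding mult.assoc[symmetric] by (rule nn_integral_cmult_indicator) simp
  also have "emeasure lborel (ball (proj3 (T' z)) (K * r)) = ennreal (unit_ball_vol 4 * (K * r) ^ 4)"
   using K E(4) by (subst emeasure_ball) auto
  also have "ennreal (16 * B ^ 4) * (ennreal n * ennreal (unit_ball_vol 4 * (K * r) ^ 4)) = ennreal (C * r ^ 4)"
   using B K E(4) by (simp add: C_def ennreal_mult''[symmetric] power_mult_distrib mult_ac)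
  finally show ?thesis .
 qed simp
 show ?thesis
  using * C K(1) \<rho>1(1) by (intro exI[of _ "\<rho>1 / K"] exI[of _ C] conjI) (simp_all)
qed

end

text \<open>If f vanished on the line near t = 0, the identity theorem would make it vanish on the
  disc of all t for which the line stays in the ball, and this disc contains t = 1.\<close>

lemma holo_nontrivial_direction:
 assumes f: "holo_on U f" and R: "ball x0 R <= U" and v: "x0 + v \<in> ball x0 R" "f (x0 + v) ~= 0" and e: "0 < e"
 shows "EX t. cmod t < e \<and> f (x0 + t *s v) ~= 0"
proof (rule ccontr)
 assume neg: "\<not> ?thesis"
 then have z: "f (x0 + t *s v) = 0" if "cmod t < e" for t using that by blast
 define S where "S = ball (0::complex) (R / norm v)"
 have "v ~= 0" using z[of 0] v(2) e by auto
 then have nv: "0 < norm v" by simp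
 have R0: "norm v < R" using v(1) by (simp add: dist_norm)
 have S: "x0 + t *s v \<in> U" if "t \<in> S" for t
 proof -
  have "cmod t * norm v < R" using that nv by (simp add: S_def field_simps)
  then have "x0 + t *s v \<in> ball x0 R" by (simp add: dist_norm norm_smult_vec)
  then show ?thesis using R by blast
 qed
 have oS: "open S" "connected S" "0 \<in> S" "1 \<in> S"
  using R0 nv less_trans[OF nv R0] by (auto simp: S_def field_simps)
 have "(%t. f (x0 + t *s v)) 1 = 0"
 proof (rule analytic_continuation[of "%t. f (x0 + t *s v)" S "S Int ball 0 e" 0])
  show "(%t. f (x0 + t *s v)) holomorphic_on S" by (rule holo_on_line_holomorphic[OF f S])
  show "0 islimpt (S Int ball 0 e)"
   using oS e by (intro interior_limit_point) (auto simp: interior_open open_Int)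
 qed (use oS z in auto)
 then show False using v(2) by simp
qed

context hypersurface
begin

text \<open>Each of the three axes must be a direction in which f does not vanish identically
  through x0, also when x0 is singular. With f nonzero at x0 + v0, the axes v0 + c e_k have this
  property for small c, and they form a basis if c and c + \<sigma> v0 are nonzero. E is then split
  according to the axis along which the derivative of f is largest, and each part falls under the
  estimate for one direction.\<close>

lemma growth:
 assumes \<Omega>': "open \<Omega>'" "\<Omega>0 <= \<Omega>'" "holo_on \<Omega>' f" "x0 \<in> \<Omega>'"
  and nontriv: "!!e. 0 < e ==> \<exists>x\<in>ball x0 e. f x ~= 0"
 obtains \<rho> C where "0 < \<rho>" "0 <= C"
  "!!E z r. E \<in> sets borel ==> E <= M Int ball x0 \<rho> ==> E <= ball z r ==> 0 < r ==>
   emeasure (dV M) E <= ennreal (C * r ^ 4)"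
proof -
 obtain R where R: "0 < R" "ball x0 R <= \<Omega>'" using \<Omega>'(1,4) open_contains_ball by blast
 obtain x1 where x1: "x1 \<in> ball x0 R" "f x1 ~= 0" using nontriv[OF R(1)] by blast
 define W where "W = ball x0 R Int f -` (- {0})"
 have "open W" unfolding W_def
  using continuous_on_subset[OF holo_on_imp_continuous_on[OF \<Omega>'(3)] R(2)] by (intro continuous_open_preimage) auto
 moreover have "x1 \<in> W" using x1 by (simp add: W_def)
 ultimately obtain \<delta> where \<delta>: "0 < \<delta>" "ball x1 \<delta> <= W" using open_contains_ball by blast
 define v0 where "v0 = x1 - x0"
 define \<sigma> where "\<sigma> x = x $ 1 + x $ 2 + x $ 3" for x :: "complex ^ 3"
 \<comment> \<open>Of the two candidates \<delta>/2 and \<delta>/3, at most one makes the sum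
   vanish.\<close>
 obtain s :: real where s: "0 < s" "s < \<delta>" "of_real s + \<sigma> v0 ~= 0"
 proof (cases "of_real (\<delta> / 2) + \<sigma> v0 = 0")
  case False then show ?thesis using that[of "\<delta> / 2"] \<delta>(1) by auto
 next
  case True
  then have "of_real (\<delta> / 3) + \<sigma> v0 = of_real (\<delta> / 3 - \<delta> / 2)"
   by (simp add: algebra_simps eq_neg_iff_add_eq_0)
  also have "... ~= 0" using \<delta>(1) by (simp only: of_real_eq_0_iff)
  finally show ?thesis using that[of "\<delta> / 3"] \<delta>(1) by auto
 qed
 define c where "c = complex_of_real s"
 have c: "c ~= 0" "c + \<sigma> v0 ~= 0" using s by (auto simp: c_def)
 define T where "T x = c *s x + \<sigma> x *s v0" for x
 \<comment> \<open>T is c times the identity plus a map of rank one; this is the Sherman-Morrison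
   formula for its inverse.\<close>
 define T' where "T' y = (1 / c) *s (y - (\<sigma> y / (c + \<sigma> v0)) *s v0)" for y
 have \<sigma>: "\<sigma> (x + y) = \<sigma> x + \<sigma> y" "\<sigma> (x - y) = \<sigma> x - \<sigma> y" "\<sigma> (a *s x) = a * \<sigma> x" for x y a
  by (auto simp: \<sigma>_def algebra_simps)
 have "bounded_linear T" "bounded_linear T'"
  by (rule linear_conv_bounded_linear[THEN iffD1],
    auto intro!: linearI simp: T_def T'_def \<sigma> scaleR_smult vec_eq_iff algebra_simps add_divide_distrib diff_divide_distrib)+
 moreover have "T' (T x) = x" for x
 proof -
  have "\<sigma> (T x) = (c + \<sigma> v0) * \<sigma> x" by (simp add: T_def \<sigma> algebra_simps)
  then show ?thesis using c by (simp add: T'_def) (simp add: T_def vec_eq_iff)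
 qed
 moreover have "T (T' y) = y" for y
 proof -
  have *: "\<sigma> y - \<sigma> y / (c + \<sigma> v0) * \<sigma> v0 = c * (\<sigma> y / (c + \<sigma> v0))"
   using c(2) by (simp add: divide_simps) (simp add: algebra_simps)
  have "\<sigma> (T' y) = (1 / c) * (\<sigma> y - \<sigma> y / (c + \<sigma> v0) * \<sigma> v0)" by (simp only: T'_def \<sigma>)
  then have "\<sigma> (T' y) = \<sigma> y / (c + \<sigma> v0)" unfolding * using c(1) by simp
  then show ?thesis using c by (simp add: T_def) (simp add: T'_def vec_eq_iff)
 qed
 moreover have "T (a *s x) = a *s T x" for a x by (simp add: T_def \<sigma> vec_eq_iff algebra_simps)
 ultimately have T: "clin_iso T T'" by (simp add: clin_iso_def)
 have Tax: "T (axis k 1) = v0 + c *s axis k 1" for k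
  using exhaust_3[of k] by (auto simp: T_def \<sigma>_def axis_def vec_eq_iff)
 define Tk where "Tk k = T \<circ> coord_swap k" for k
 define Tk' where "Tk' k = coord_swap k \<circ> T'" for k
 have Tk: "clin_iso (Tk k) (Tk' k)" for k
  unfolding Tk_def Tk'_def by (rule clin_iso_comp[OF T clin_iso_coord_swap])
 have Tk3: "Tk k (axis 3 1) = T (axis k 1)" for k by (simp add: Tk_def coord_swap_axis)
 have Tkj: "EX i. Tk k (axis j 1) = T (axis i 1)" for k j
  using coord_swap_axis[of k] coord_swap_axis(2)[of j k] by (cases "j = 3") (auto simp: Tk_def)
 have dir: "EX t. cmod t < e \<and> f (x0 + t *s Tk k (axis 3 1)) ~= 0" if "0 < e" for k e
 proof -
  have "x0 + T (axis k 1) = x1 + c *s axis k 1" by (simp add: Tax v0_def)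
  then have "x0 + T (axis k 1) \<in> ball x1 \<delta>"
   using s by (simp add: dist_norm norm_smult_vec norm_axis_1 c_def)
  then have "x0 + T (axis k 1) \<in> W" using \<delta>(2) by blast
  then show ?thesis unfolding Tk3
   using holo_nontrivial_direction[OF \<Omega>'(3) R(2) _ _ that] by (auto simp: W_def)
 qed
 define Q where "Q k E \<longleftrightarrow> (\<forall>x\<in>E. frechet_derivative f (at x) (Tk k (axis 3 1)) ~= 0 \<and>
    (ALL j. cmod (frechet_derivative f (at x) (Tk k (axis j 1))) <= cmod (frechet_derivative f (at x) (Tk k (axis 3 1)))))" for k E
 have "\<exists>\<rho> C. 0 < \<rho> \<and> 0 <= C \<and> (ALL E z r. E \<in> sets borel --> E <= M Int ball x0 \<rho> --> E <= ball z r --> 0 < r -->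
   Q k E --> emeasure (dV M) E <= ennreal (C * r ^ 4))" for k
  using growth_direction[OF \<Omega>' Tk dir, of k] unfolding Q_def .
 then obtain \<rho> C where \<rho>C: "!!k. 0 < \<rho> k" "!!k. 0 <= C k"
  "!!k E z r. E \<in> sets borel ==> E <= M Int ball x0 (\<rho> k) ==> E <= ball z r ==> 0 < r ==>
   Q k E ==> emeasure (dV M) E <= ennreal (C k * r ^ 4)"
  by metis
 define \<rho>m where "\<rho>m = Min (range \<rho>)"
 have \<rho>m: "0 < \<rho>m" "!!k. \<rho>m <= \<rho> k" using \<rho>C(1) by (auto simp: \<rho>m_def)
 show ?thesis
 proof (rule that[of \<rho>m "\<Sum>k\<in>UNIV. C k"])
  fix E z r assume E: "E \<in> sets borel" "E <= M Int ball x0 \<rho>m" "E <= ball z r" "0 < (r::real)"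
  define b where "b k x = cmod (frechet_derivative f (at x) (T (axis k 1)))" for k x
  have bc: "continuous_on \<Omega>0 (b k)" for k
   unfolding b_def by (intro continuous_intros holo_deriv_continuous[OF \<Omega>0 f])
  define Ek where "Ek k = E Int (\<Inter>j\<in>UNIV. \<Omega>0 Int (%x. b k x - b j x) -` {0..})" for k
  have Ekb: "Ek k \<in> sets borel" for k
   unfolding Ek_def using E(1) \<Omega>0
   by (intro sets.Int sets.finite_INT borel_Int_vimage continuous_intros bc) auto
  have Ecov: "E = (\<Union>k\<in>UNIV. Ek k)"
  proof (intro equalityI subsetI)
   fix x assume x: "x \<in> E"
   have "Max (range (%j. b j x)) \<in> range (%j. b j x)" by (rule Max_in) auto
   then obtain k where k: "Max (range (%j. b j x)) = b k x" by blast
   have "b j x <= b k x" for j unfolding k[symmetric] by (rule Max_ge) auto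
   then have "x \<in> Ek k" using x E(2) by (auto simp: Ek_def M_eq)
   then show "x \<in> (\<Union>k\<in>UNIV. Ek k)" by blast
  qed (auto simp: Ek_def)
  have Qk: "Q k (Ek k)" for k
   unfolding Q_def
  proof (intro ballI conjI allI)
   fix x assume x: "x \<in> Ek k"
   then have xM: "x \<in> M" "x \<in> \<Omega>0" and le: "b j x <= b k x" for j using E(2) by (auto simp: Ek_def)
   show "cmod (frechet_derivative f (at x) (Tk k (axis j 1))) <= cmod (frechet_derivative f (at x) (Tk k (axis 3 1)))" for j
    using Tkj[of k j] le unfolding Tk3 b_def by metis
   show "frechet_derivative f (at x) (Tk k (axis 3 1)) ~= 0"
   proof
    assume "frechet_derivative f (at x) (Tk k (axis 3 1)) = 0"
    then have "b k x = 0" by (simp add: Tk3 b_def)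
    then have "b j x = 0" for j using le[of j] by (simp add: b_def)
    then have "frechet_derivative f (at x) v = 0" for v
     using df_eq[OF xM(2) T, of v] by (simp add: b_def)
    then show False using nonsing[OF xM(1)] by blast
   qed
  qed
  have "emeasure (dV M) E <= (\<Sum>k\<in>UNIV. emeasure (dV M) (Ek k))"
  proof -
   have "Ek k \<in> sets (dV M)" for k using Ekb E(2) by (auto simp: sets_dV_iff Ek_def)
   then show ?thesis by (subst Ecov) (intro emeasure_subadditive_finite, auto)
  qed
  also have "... <= (\<Sum>k\<in>UNIV. ennreal (C k * r ^ 4))"
  proof (rule sum_mono)
   fix k
   have "Ek k <= M Int ball x0 (\<rho> k)" using E(2) \<rho>m(2)[of k] by (force simp: Ek_def)
   then show "emeasure (dV M) (Ek k) <= ennreal (C k * r ^ 4)"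
    using E(3,4) Ekb Qk by (intro \<rho>C(3)) (auto simp: Ek_def)
  qed
  also have "... = ennreal ((\<Sum>k\<in>UNIV. C k) * r ^ 4)"
   using \<rho>C(2) E(4) by (simp add: sum_ennreal sum_distrib_right)
  finally show "emeasure (dV M) E <= ennreal ((\<Sum>k\<in>UNIV. C k) * r ^ 4)" .
 qed (use \<rho>m \<rho>C in \<open>auto intro: sum_nonneg\<close>)
qed

end

section \<open>Exterior algebra\<close>

text \<open>The sign of sorting the generators of S together with those of T. It is multiplicative
  under disjoint unions in either argument, and associativity of the wedge product follows from
  this.\<close>

definition wsign :: "gen set => gen set => complex" where
 "wsign S T = (- 1) ^ card {(g, h). g \<in> S \<and> h \<in> T \<and> grank h < grank g}"

lemma finite_inversions: "finite {(g, h). g \<in> S \<and> h \<in> T \<and> grank h < grank (g::gen)}"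
 by (rule finite_subset[of _ "UNIV \<times> UNIV"]) auto

lemma wsign_Un_left:
 assumes "S Int S' = {}"
 shows "wsign (S \<union> S') T = wsign S T * wsign S' T"
proof -
 have "card {(g, h). g \<in> S \<union> S' \<and> h \<in> T \<and> grank h < grank g} =
  card {(g, h). g \<in> S \<and> h \<in> T \<and> grank h < grank g} + card {(g, h). g \<in> S' \<and> h \<in> T \<and> grank h < grank g}"
  using assms by (subst card_Un_disjoint[symmetric]) (auto simp: finite_inversions intro!: arg_cong[where f = card])
 then show ?thesis by (simp add: wsign_def power_add)
qed

lemma wsign_Un_right:
 assumes "T Int T' = {}"
 shows "wsign S (T \<union> T') = wsign S T * wsign S T'"
proof -
 have "card {(g, h). g \<in> S \<and> h \<in> T \<union> T' \<and> grank h < grank g} =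
  card {(g, h). g \<in> S \<and> h \<in> T \<and> grank h < grank g} + card {(g, h). g \<in> S \<and> h \<in> T' \<and> grank h < grank g}"
  using assms by (subst card_Un_disjoint[symmetric]) (auto simp: finite_inversions intro!: arg_cong[where f = card])
 then show ?thesis by (simp add: wsign_def power_add)
qed

lemma wedge_nth: "(a \<^bold>\<and> b) $ S = (\<Sum>T\<in>Pow S. wsign T (S - T) * a $ T * b $ (S - T))"
 by (simp add: wedge_def wsign_def)

lemma wedge_axis:
 "axis S x \<^bold>\<and> axis T y = (if S Int T = {} then axis (S \<union> T) (wsign S T * x * y) else 0)"
proof (cases "S Int T = {}")
 case True then show ?thesis by (simp add: wedge_axis_disjoint wsign_def)
next
 case False
 have "(axis S x \<^bold>\<and> axis T y) $ R = 0" for R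
  unfolding wedge_nth by (rule sum.neutral) (use False in \<open>auto simp: axis_def\<close>)
 then show ?thesis using False by (simp add: vec_eq_iff)
qed

lemma wedge_add_left: "(a + a') \<^bold>\<and> b = a \<^bold>\<and> b + a' \<^bold>\<and> b"
 and wedge_add_right: "a \<^bold>\<and> (b + b') = a \<^bold>\<and> b + a \<^bold>\<and> b'"
 and wedge_diff_left: "(a - a') \<^bold>\<and> b = a \<^bold>\<and> b - a' \<^bold>\<and> b"
 and wedge_diff_right: "a \<^bold>\<and> (b - b') = a \<^bold>\<and> b - a \<^bold>\<and> b'"
 and wedge_smult_left: "(c *s a) \<^bold>\<and> b = c *s (a \<^bold>\<and> b)"
 and wedge_smult_right: "a \<^bold>\<and> (c *s b) = c *s (a \<^bold>\<and> b)"
 by (simp_all add: vec_eq_iff wedge_nth algebra_simps sum.distrib sum_subtractf sum_distrib_left)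

lemma wedge_zero_left [simp]: "0 \<^bold>\<and> b = 0" and wedge_zero_right [simp]: "a \<^bold>\<and> 0 = 0"
 by (simp_all add: vec_eq_iff wedge_nth)

lemma bounded_bilinear_wedge: "bounded_bilinear (\<^bold>\<and>)"
 unfolding bilinear_conv_bounded_bilinear[symmetric] bilinear_def
 by (intro conjI allI linearI) (simp_all add: wedge_add_left wedge_add_right scaleR_smult wedge_smult_left wedge_smult_right)

lemmas wedge_sum_left = bounded_bilinear.sum_left[OF bounded_bilinear_wedge]
 and wedge_sum_right = bounded_bilinear.sum_right[OF bounded_bilinear_wedge]

lemma ext_eq_sum: "(a :: ext) = (\<Sum>S\<in>UNIV. axis S (a $ S))"
proof -
 have "(\<Sum>S\<in>UNIV. axis S (a $ S)) $ R = (\<Sum>S\<in>UNIV. if S = R then a $ S else 0)" for R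
  by (simp add: axis_def)
 then show ?thesis by (simp add: vec_eq_iff)
qed

text \<open>By multilinearity it is enough to consider basis forms, where both sides carry the
  product of the three pairwise signs.\<close>

lemma wedge_assoc: "(a \<^bold>\<and> b) \<^bold>\<and> c = a \<^bold>\<and> (b \<^bold>\<and> c)"
proof -
 have *: "(axis S x \<^bold>\<and> axis T y) \<^bold>\<and> axis R z = axis S x \<^bold>\<and> (axis T y \<^bold>\<and> axis R z)" for S T R x y z
 proof (cases "S Int T = {} \<and> S Int R = {} \<and> T Int R = {}")
  case True
  then show ?thesis
   by (simp add: wedge_axis Int_Un_distrib Int_Un_distrib2 wsign_Un_left wsign_Un_right Un_assoc mult_ac)
 next
  case False
  then show ?thesis by (auto simp: wedge_axis Int_Un_distrib Int_Un_distrib2)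
 qed
 have "(axis S x \<^bold>\<and> axis T y) \<^bold>\<and> (\<Sum>R\<in>UNIV. axis R (c $ R)) = axis S x \<^bold>\<and> (axis T y \<^bold>\<and> (\<Sum>R\<in>UNIV. axis R (c $ R)))" for S T x y
  by (simp only: wedge_sum_right *)
 then have "(axis S x \<^bold>\<and> (\<Sum>T\<in>UNIV. axis T (b $ T))) \<^bold>\<and> c = axis S x \<^bold>\<and> ((\<Sum>T\<in>UNIV. axis T (b $ T)) \<^bold>\<and> c)" for S x
  by (simp only: wedge_sum_right wedge_sum_left ext_eq_sum[of c, symmetric])
 then have "((\<Sum>S\<in>UNIV. axis S (a $ S)) \<^bold>\<and> b) \<^bold>\<and> c = (\<Sum>S\<in>UNIV. axis S (a $ S)) \<^bold>\<and> (b \<^bold>\<and> c)"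
  by (simp only: wedge_sum_left ext_eq_sum[of b, symmetric])
 then show ?thesis by (simp only: ext_eq_sum[of a, symmetric])
qed

section \<open>Interior multiplication, degrees, and evaluation on tangent vectors\<close>

lemma interior_mult_add: "interior_mult l (a + b) = interior_mult l a + interior_mult l b"
 and interior_mult_diff: "interior_mult l (a - b) = interior_mult l a - interior_mult l b"
 and interior_mult_smult: "interior_mult l (c *s a) = c *s interior_mult l a"
 and interior_mult_zero [simp]: "interior_mult l 0 = 0"
 by (simp_all add: vec_eq_iff interior_mult_def algebra_simps sum.distrib sum_subtractf sum_distrib_left)

lemma ev_add: "ev vs (a + b) = ev vs a + ev vs b"
 by (induction vs arbitrary: a b) (simp_all add: interior_mult_add)
lemma ev_diff: "ev vs (a - b) = ev vs a - ev vs b"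
 by (induction vs arbitrary: a b) (simp_all add: interior_mult_diff)
lemma ev_smult: "ev vs (c *s a) = c * ev vs a"
 by (induction vs arbitrary: a) (simp_all add: interior_mult_smult)
lemma ev_zero [simp]: "ev vs 0 = 0"
 by (induction vs) simp_all
lemma ev_sum: "ev vs (\<Sum>i\<in>I. a i) = (\<Sum>i\<in>I. ev vs (a i))"
 by (induction I rule: infinite_finite_induct) (simp_all add: ev_add)

text \<open>\<open>i\<close> counts the holomorphic differentials and \<open>k\<close> all
  differentials. The zero form is pure of every degree, so sums and vanishing terms need no special
  treatment.\<close>

definition degr :: "nat => nat => ext => bool" where
 "degr i k a \<longleftrightarrow> (ALL S. a $ S ~= 0 --> card (S Int range Dzeta) = i \<and> card S = k)"

lemma degrD: "degr i k a ==> a $ S ~= 0 ==> card (S Int range Dzeta) = i \<and> card S = k"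
 by (simp add: degr_def)

lemma degr_zero: "degr i k 0" by (simp add: degr_def)

lemma degr_add: "degr i k a ==> degr i k b ==> degr i k (a + b)"
 unfolding degr_def vector_add_component by (metis add_0)

lemma degr_diff: "degr i k a ==> degr i k b ==> degr i k (a - b)"
 unfolding degr_def vector_minus_component by (metis diff_self)

lemma degr_smult: "degr i k a ==> degr i k (c *s a)"
 by (simp add: degr_def)

lemma degr_sum: "(!!x. x \<in> I ==> degr i k (a x)) ==> degr i k (\<Sum>x\<in>I. a x)"
 by (induction I rule: infinite_finite_induct) (auto intro: degr_zero degr_add)

lemma degr_wedge:
 assumes "degr i k a" "degr i' k' b"
 shows "degr (i + i') (k + k') (a \<^bold>\<and> b)"
 unfolding degr_def
proof (intro allI impI)
 fix S assume "(a \<^bold>\<and> b) $ S ~= 0"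
 then obtain T where T: "T <= S" "a $ T ~= 0" "b $ (S - T) ~= 0"
  unfolding wedge_nth by (metis (no_types, lifting) PowD mult_eq_0_iff sum.neutral)
 have S: "S = T \<union> (S - T)" using T(1) by blast
 have "card S = card T + card (S - T)" by (subst S, rule card_Un_disjoint) auto
 moreover have "S Int range Dzeta = (T Int range Dzeta) \<union> ((S - T) Int range Dzeta)" using T(1) by blast
 then have "card (S Int range Dzeta) = card (T Int range Dzeta) + card ((S - T) Int range Dzeta)"
  by (metis (no_types, lifting) Diff_disjoint Int_assoc Int_empty_right card_Un_disjoint finite inf_commute inf_left_commute)
 ultimately show "card (S Int range Dzeta) = i + i' \<and> card S = k + k'"
  using degrD[OF assms(1) T(2)] degrD[OF assms(2) T(3)] by simp
qed

lemma degr_gform: "degr 1 1 (gform (Dzeta j))" "degr 0 1 (gform (Dzetabar j))" "degr 0 1 (gform (Dzbar j))"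
 by (auto simp: degr_def gform_def axis_def split: if_splits)

lemma degr_form1: "degr 1 1 (form1 c)"
 unfolding form1_def by (intro degr_sum degr_smult degr_gform)

lemma degr_scal: "degr 0 0 (scal c)"
 by (auto simp: degr_def scal_def axis_def split: if_splits)

lemma bideg_hol_degr: "degr i k a ==> bideg_hol j a = (if i = j then a else 0)"
 by (auto simp: degr_def bideg_hol_def vec_eq_iff)

lemma bideg_hol_add: "bideg_hol j (a + b) = bideg_hol j a + bideg_hol j b"
 and bideg_hol_diff: "bideg_hol j (a - b) = bideg_hol j a - bideg_hol j b"
 by (auto simp: bideg_hol_def vec_eq_iff)

lemma scal_wedge: "scal c \<^bold>\<and> a = c *s a"
proof -
 have "wsign {} T = 1" for T by (simp add: wsign_def)
 then have "axis {} c \<^bold>\<and> axis S x = c *s axis S x" for S x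
  by (simp add: wedge_axis) (simp add: vec_eq_iff axis_def)
 then have "scal c \<^bold>\<and> (\<Sum>S\<in>UNIV. axis S (a $ S)) = c *s (\<Sum>S\<in>UNIV. axis S (a $ S))"
  by (simp add: scal_def wedge_sum_right vec_eq_iff sum_distrib_left)
 then show ?thesis by (simp only: ext_eq_sum[of a, symmetric])
qed

text \<open>Each contraction lowers the degree by one, and what is read off at the end is the
  coefficient of the empty product; if the degree runs out earlier, the form has become
  zero.\<close>

lemma ev_degree:
 assumes "ALL S. a $ S ~= 0 --> card S = k" "length vs ~= k"
 shows "ev vs a = 0"
 using assms
proof (induction vs arbitrary: a k)
 case Nil
 then have "a $ {} = 0" by (metis card.empty list.size(3))
 then show ?case by simp
next
 case (Cons v vs)
 show ?case
 proof (cases k)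
  case 0
  have "interior_mult (covec v) a $ S = 0" for S
   unfolding interior_mult_def vec_lambda_beta
  proof (rule sum.neutral, rule ballI)
   fix g
   have "card (insert g S) ~= 0" by simp
   moreover have "a $ insert g S ~= 0 --> card (insert g S) = k" using Cons.prems(1) by (rule spec)
   ultimately have "a $ insert g S = 0" using 0 by simp
   then show "(- 1) ^ card {h \<in> S. grank h < grank g} * covec v g * a $ insert g S = 0" by simp
  qed
  then have "interior_mult (covec v) a = 0" by (simp add: vec_eq_iff)
  then show ?thesis by simp
 next
  case (Suc k')
  have "ALL S. interior_mult (covec v) a $ S ~= 0 --> card S = k'"
  proof (intro allI impI)
   fix S assume "interior_mult (covec v) a $ S ~= 0"
   then obtain g where "g \<in> - S" "a $ insert g S ~= 0"
    unfolding interior_mult_def vec_lambda_beta by (metis (no_types, lifting) mult_eq_0_iff sum.neutral)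
   then have "card (insert g S) = k" "g \<notin> S" using Cons.prems(1)[rule_format, of "insert g S"] by auto
   then show "card S = k'" using Suc by simp
  qed
  then show ?thesis using Cons Suc by simp
 qed
qed

lemma interior_axis:
 "interior_mult l (axis S x) = (\<Sum>g\<in>S. axis (S - {g}) ((- 1) ^ card {h \<in> S - {g}. grank h < grank g} * l g * x))"
proof (rule vec_eq_iff[THEN iffD2], rule allI)
 fix R
 have "interior_mult l (axis S x) $ R =
   (\<Sum>g\<in>UNIV. if g \<in> S \<and> R = S - {g} then (- 1) ^ card {h \<in> R. grank h < grank g} * l g * x else 0)"
  unfolding interior_mult_def vec_lambda_beta
  by (rule sum.mono_neutral_cong_left) (auto simp: axis_def)
 also have "... = (\<Sum>g\<in>S. axis (S - {g}) ((- 1) ^ card {h \<in> S - {g}. grank h < grank g} * l g * x)) $ R"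
  unfolding sum_component
  by (rule sum.mono_neutral_cong_right) (auto simp: axis_def)
 finally show "interior_mult l (axis S x) $ R =
  (\<Sum>g\<in>S. axis (S - {g}) ((- 1) ^ card {h \<in> S - {g}. grank h < grank g} * l g * x)) $ R" .
qed

lemma axis_neg: "axis S (- x) = - axis S (x :: complex)"
 by (simp add: vec_eq_iff axis_def)

lemma interior_axis_1: "interior_mult l (axis {g} x) = axis {} (l g * x)"
 by (simp add: interior_axis)

lemma Collect_rank:
 "{h \<in> insert a S. grank h < n} = (if grank a < n then insert a {h \<in> S. grank h < n} else {h \<in> S. grank h < n})"
 "{h \<in> {}. grank h < n} = {}"
 by auto

lemma interior_axis_2:
 assumes "grank g1 < grank g2"
 shows "interior_mult l (axis {g1, g2} x) = axis {g2} (l g1 * x) - axis {g1} (l g2 * x)"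
proof -
 have n: "g1 ~= g2" using assms by auto
 have d: "{g1, g2} - {g1} = {g2}" "{g1, g2} - {g2} = {g1}" using n by auto
 have e: "(\<Sum>g\<in>{g1, g2}. F g) = F g1 + F g2" for F :: "gen => ext" using n by (simp add: add.assoc)
 show ?thesis unfolding interior_axis e d Collect_rank using assms n
  by (simp add: axis_neg)
qed

lemma interior_axis_3:
 assumes "grank g1 < grank g2" "grank g2 < grank g3"
 shows "interior_mult l (axis {g1, g2, g3} x) = axis {g2, g3} (l g1 * x) - axis {g1, g3} (l g2 * x) + axis {g1, g2} (l g3 * x)"
proof -
 have n: "g1 ~= g2" "g1 ~= g3" "g2 ~= g3" using assms by auto
 have d: "{g1, g2, g3} - {g1} = {g2, g3}" "{g1, g2, g3} - {g2} = {g1, g3}" "{g1, g2, g3} - {g3} = {g1, g2}" using n by auto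
 have e: "(\<Sum>g\<in>{g1, g2, g3}. F g) = F g1 + F g2 + F g3" for F :: "gen => ext" using n by (simp add: add.assoc)
 show ?thesis unfolding interior_axis e d Collect_rank using assms n
  by (simp add: axis_neg)
qed

lemma interior_axis_4:
 assumes "grank g1 < grank g2" "grank g2 < grank g3" "grank g3 < grank g4"
 shows "interior_mult l (axis {g1, g2, g3, g4} x) = axis {g2, g3, g4} (l g1 * x) - axis {g1, g3, g4} (l g2 * x)
  + axis {g1, g2, g4} (l g3 * x) - axis {g1, g2, g3} (l g4 * x)"
proof -
 have n: "g1 ~= g2" "g1 ~= g3" "g1 ~= g4" "g2 ~= g3" "g2 ~= g4" "g3 ~= g4" using assms by auto
 have d: "{g1, g2, g3, g4} - {g1} = {g2, g3, g4}" "{g1, g2, g3, g4} - {g2} = {g1, g3, g4}"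
  "{g1, g2, g3, g4} - {g3} = {g1, g2, g4}" "{g1, g2, g3, g4} - {g4} = {g1, g2, g3}" using n by auto
 have e: "(\<Sum>g\<in>{g1, g2, g3, g4}. F g) = F g1 + F g2 + F g3 + F g4" for F :: "gen => ext" using n by (simp add: add.assoc)
 show ?thesis unfolding interior_axis e d Collect_rank using assms n
  by (simp add: axis_neg)
qed

lemma ev_axis_1: "ev [v] (axis {g} x) = covec v g * x"
 by (simp only: ev.simps interior_axis_1) (simp add: axis_def)

lemma ev_axis_2:
 assumes "grank g1 < grank g2"
 shows "ev [v1, v2] (axis {g1, g2} x) = (covec v1 g1 * covec v2 g2 - covec v1 g2 * covec v2 g1) * x"
 unfolding ev.simps(2)[of v1] interior_axis_2[OF assms] ev_diff ev_axis_1 by (simp add: algebra_simps)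

lemma ev_axis_3:
 assumes "grank g1 < grank g2" "grank g2 < grank g3"
 shows "ev [v1, v2, v3] (axis {g1, g2, g3} x) =
  (covec v1 g1 * (covec v2 g2 * covec v3 g3 - covec v2 g3 * covec v3 g2)
  - covec v1 g2 * (covec v2 g1 * covec v3 g3 - covec v2 g3 * covec v3 g1)
  + covec v1 g3 * (covec v2 g1 * covec v3 g2 - covec v2 g2 * covec v3 g1)) * x"
 using assms unfolding ev.simps(2)[of v1] interior_axis_3[OF assms] ev_diff ev_add
 by (simp add: ev_axis_2 del: ev.simps) (simp add: algebra_simps)

lemma ev_axis_4:
 assumes "grank g1 < grank g2" "grank g2 < grank g3" "grank g3 < grank g4"
 shows "ev [v1, v2, v3, v4] (axis {g1, g2, g3, g4} x) =
   covec v1 g1 * ev [v2, v3, v4] (axis {g2, g3, g4} x) - covec v1 g2 * ev [v2, v3, v4] (axis {g1, g3, g4} x)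
  + covec v1 g3 * ev [v2, v3, v4] (axis {g1, g2, g4} x) - covec v1 g4 * ev [v2, v3, v4] (axis {g1, g2, g3} x)"
 using assms unfolding ev.simps(2)[of v1] interior_axis_4[OF assms] ev_diff ev_add
 by (simp add: ev_axis_3 del: ev.simps)

definition bd :: "complex ^ 3 => complex ^ 3 => complex" where
 "bd x y = (\<Sum>j\<in>UNIV. x $ j * y $ j)"

definition cv :: "complex ^ 3 => complex ^ 3" where
 "cv x = (\<chi> j. cnj (x $ j))"

lemma cv_nth [simp]: "cv x $ j = cnj (x $ j)" by (simp add: cv_def)

lemma bd_3: "bd x y = x $ 1 * y $ 1 + x $ 2 * y $ 2 + x $ 3 * y $ 3"
 by (simp add: bd_def sum_3)

lemma idx_less [simp]: "idx 1 = 1" "idx 2 = 2" "idx 3 = 3"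
 by (simp_all add: idx_def)

lemma three_index [simp]: "(1::3) ~= 2" "(1::3) ~= 3" "(2::3) ~= 3" "(2::3) ~= 1" "(3::3) ~= 1" "(3::3) ~= 2"
 by simp_all

text \<open>The coefficients of forms of bidegree (2,0) and (0,2) as vectors, so that evaluating on two
 tangent vectors becomes a product with \<open>cross u v\<close> or its conjugate.\<close>

definition dual_hol :: "ext => complex ^ 3" where
 "dual_hol a = vector [a $ {Dzeta 2, Dzeta 3}, - a $ {Dzeta 1, Dzeta 3}, a $ {Dzeta 1, Dzeta 2}]"

definition dual_anti :: "ext => complex ^ 3" where
 "dual_anti a = vector [a $ {Dzetabar 2, Dzetabar 3}, - a $ {Dzetabar 1, Dzetabar 3}, a $ {Dzetabar 1, Dzetabar 2}]"

lemma dual_nth [simp]: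
 "dual_hol a $ 1 = a $ {Dzeta 2, Dzeta 3}" "dual_hol a $ 2 = - a $ {Dzeta 1, Dzeta 3}" "dual_hol a $ 3 = a $ {Dzeta 1, Dzeta 2}"
 "dual_anti a $ 1 = a $ {Dzetabar 2, Dzetabar 3}" "dual_anti a $ 2 = - a $ {Dzetabar 1, Dzetabar 3}" "dual_anti a $ 3 = a $ {Dzetabar 1, Dzetabar 2}"
 by (simp_all add: dual_hol_def dual_anti_def vector_def)

lemma card_2_subset_3:
 assumes "S <= {a, b, c}" "card S = 2" "a ~= b" "a ~= c" "b ~= c"
 shows "S = {a, b} \<or> S = {a, c} \<or> S = {b, c}"
proof -
 obtain x y where S: "S = {x, y}" and n: "x ~= y" using assms(2) card_2_iff by metis
 have "x = a \<or> x = b \<or> x = c" "y = a \<or> y = b \<or> y = c" using assms(1) by (auto simp: S)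
 then show ?thesis using n unfolding S by (elim disjE) (simp_all add: insert_commute)
qed

lemma range_Dzetabar: "range Dzetabar = {Dzetabar 1, Dzetabar 2, Dzetabar 3}"
 unfolding UNIV_3 by simp

lemma form_20_eq:
 assumes "form_20 a"
 shows "a = axis {Dzeta 2, Dzeta 3} (dual_hol a $ 1) - axis {Dzeta 1, Dzeta 3} (dual_hol a $ 2) + axis {Dzeta 1, Dzeta 2} (dual_hol a $ 3)"
proof -
 have "a $ S = 0" if "S ~= {Dzeta 2, Dzeta 3}" "S ~= {Dzeta 1, Dzeta 3}" "S ~= {Dzeta 1, Dzeta 2}" for S
 proof (rule ccontr)
  assume "a $ S ~= 0"
  then have "S <= {Dzeta 1, Dzeta 2, Dzeta 3}" "card S = 2" using assms by (auto simp: form_20_def range_Dzeta)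
  from card_2_subset_3[OF this] that show False by simp
 qed
 moreover have "{Dzeta 2, Dzeta 3} ~= {Dzeta 1, Dzeta 3}" "{Dzeta 2, Dzeta 3} ~= {Dzeta 1, Dzeta 2}" "{Dzeta 1, Dzeta 3} ~= {Dzeta 1, Dzeta 2}"
  by (auto simp: doubleton_eq_iff)
 ultimately show ?thesis unfolding vec_eq_iff
  by (auto simp: axis_def)
qed

lemma form_02_eq:
 assumes "form_0r 2 a"
 shows "a = axis {Dzetabar 2, Dzetabar 3} (dual_anti a $ 1) - axis {Dzetabar 1, Dzetabar 3} (dual_anti a $ 2) + axis {Dzetabar 1, Dzetabar 2} (dual_anti a $ 3)"
proof -
 have "a $ S = 0" if "S ~= {Dzetabar 2, Dzetabar 3}" "S ~= {Dzetabar 1, Dzetabar 3}" "S ~= {Dzetabar 1, Dzetabar 2}" for S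
 proof (rule ccontr)
  assume "a $ S ~= 0"
  then have "S <= {Dzetabar 1, Dzetabar 2, Dzetabar 3}" "card S = 2" using assms by (auto simp: form_0r_def range_Dzetabar)
  from card_2_subset_3[OF this] that show False by simp
 qed
 moreover have "{Dzetabar 2, Dzetabar 3} ~= {Dzetabar 1, Dzetabar 3}" "{Dzetabar 2, Dzetabar 3} ~= {Dzetabar 1, Dzetabar 2}" "{Dzetabar 1, Dzetabar 3} ~= {Dzetabar 1, Dzetabar 2}"
  by (auto simp: doubleton_eq_iff)
 ultimately show ?thesis unfolding vec_eq_iff
  by (auto simp: axis_def)
qed

definition anti1 :: "ext => complex ^ 3" where
 "anti1 a = (\<chi> j. a $ {Dzetabar j})"

lemma anti1_nth [simp]: "anti1 a $ j = a $ {Dzetabar j}" by (simp add: anti1_def)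

lemma form_01_eq:
 assumes "form_0r 1 a"
 shows "a = axis {Dzetabar 1} (anti1 a $ 1) + axis {Dzetabar 2} (anti1 a $ 2) + axis {Dzetabar 3} (anti1 a $ 3)"
proof -
 have "a $ S = 0" if "S ~= {Dzetabar 1}" "S ~= {Dzetabar 2}" "S ~= {Dzetabar 3}" for S
 proof (rule ccontr)
  assume "a $ S ~= 0"
  then have "S <= {Dzetabar 1, Dzetabar 2, Dzetabar 3}" "card S = 1" using assms by (auto simp: form_0r_def range_Dzetabar)
  then show False using that by (auto simp: card_1_singleton_iff)
 qed
 then show ?thesis unfolding vec_eq_iff by (auto simp: axis_def)
qed

lemma ev_form_01: "form_0r 1 a ==> ev [v] a = bd (anti1 a) (cv v)"
 by (subst form_01_eq, assumption) (simp add: ev_add ev_axis_1 bd_3 algebra_simps del: ev.simps)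

lemma ev_form_02: "form_0r 2 a ==> ev [u, v] a = bd (dual_anti a) (cv (cross u v))"
 by (subst form_02_eq, assumption)
  (simp add: ev_add ev_diff ev_axis_2 bd_3 algebra_simps del: ev.simps)

lemma ev_form_20: "form_20 a ==> ev [u, v] a = bd (dual_hol a) (cross u v)"
 by (subst form_20_eq, assumption)
  (simp add: ev_add ev_diff ev_axis_2 bd_3 algebra_simps del: ev.simps)

text \<open>The factor 4 and its sign: in the oriented real basis of an orthonormal complex pair,
  dz1 dz2 followed by the conjugate differentials in the same order is 4 times the volume
  form.\<close>

lemma ev_frame_axis:
 assumes "idx a < idx b" "idx c < idx d"
 shows "ev [u, \<i> *s u, v, \<i> *s v] (axis {Dzeta a, Dzeta b, Dzetabar c, Dzetabar d} x) =
  4 * (u $ a * v $ b - u $ b * v $ a) * cnj (u $ c * v $ d - u $ d * v $ c) * x"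
proof -
 have i: "\<i> * (\<i> * y) = - y" for y by (simp add: mult.assoc[symmetric])
 have ib: "idx j <= 3" "1 <= idx j" for j by (auto simp: idx_def)
 have "idx b < 3 + idx c" using ib[of b] ib[of c] by linarith
 moreover have "idx a < 3 + idx c" using ib[of a] ib[of c] assms by linarith
 moreover have "idx a < 3 + idx d" "idx b < 3 + idx d" using ib[of b] ib[of c] ib[of a] assms by linarith+
 ultimately show ?thesis
  using assms by (simp add: ev_axis_4 ev_axis_3 del: ev.simps) (simp add: algebra_simps i)
qed

lemma wsign_hol_anti: "S <= range Dzeta ==> T Int range Dzeta = {} ==> wsign S T = 1"
proof -
 assume *: "S <= range Dzeta" "T Int range Dzeta = {}"
 have "grank g < grank h" if "g \<in> S" "h \<in> T" for g h
  using that * by (cases h) (auto simp: idx_def subset_iff split: if_splits)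
 then have e: "{(g, h). g \<in> S \<and> h \<in> T \<and> grank h < grank g} = {}" by (auto dest: less_asym)
 show ?thesis unfolding wsign_def e by simp
qed

lemma wedge_hol_anti_axis:
 "axis {Dzeta a, Dzeta b} x \<^bold>\<and> axis {Dzetabar c, Dzetabar d} y = axis {Dzeta a, Dzeta b, Dzetabar c, Dzetabar d} (x * y)"
proof -
 have "wsign {Dzeta a, Dzeta b} {Dzetabar c, Dzetabar d} = 1" by (rule wsign_hol_anti) auto
 then show ?thesis by (simp add: wedge_axis insert_commute)
qed

text \<open>The value splits into a (2,0) and a (0,2) factor, each of which sees the frame only
  through \<open>cross u v\<close>. As this is a multiple of the gradient, the frame can later be
  eliminated.\<close>

lemma ev_frame_wedge:
 assumes "form_20 a" "form_0r 2 b"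
 shows "ev [u, \<i> *s u, v, \<i> *s v] (a \<^bold>\<and> b) =
   4 * bd (dual_hol a) (cross u v) * bd (dual_anti b) (cv (cross u v))"
proof -
 have "ev [u, \<i> *s u, v, \<i> *s v] (a \<^bold>\<and> b) =
  ev [u, \<i> *s u, v, \<i> *s v] ((axis {Dzeta 2, Dzeta 3} (dual_hol a $ 1) - axis {Dzeta 1, Dzeta 3} (dual_hol a $ 2) + axis {Dzeta 1, Dzeta 2} (dual_hol a $ 3))
   \<^bold>\<and> (axis {Dzetabar 2, Dzetabar 3} (dual_anti b $ 1) - axis {Dzetabar 1, Dzetabar 3} (dual_anti b $ 2) + axis {Dzetabar 1, Dzetabar 2} (dual_anti b $ 3)))"
  using form_20_eq[OF assms(1)] form_02_eq[OF assms(2)] by simp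
 also have "... = 4 * bd (dual_hol a) (cross u v) * bd (dual_anti b) (cv (cross u v))"
  unfolding wedge_add_left wedge_add_right wedge_diff_left wedge_diff_right wedge_hol_anti_axis ev_add ev_diff
  by (simp add: ev_frame_axis bd_3 del: ev.simps dual_nth) (simp add: algebra_simps del: dual_nth)
 finally show ?thesis .
qed

lemma wsign_empty: "wsign {} S = 1" "wsign S {} = 1"
 by (simp_all add: wsign_def)

lemma wsign_single: "wsign {g} {h} = (if grank h < grank g then - 1 else 1)"
proof -
 have e: "{(x, y). x \<in> {g} \<and> y \<in> {h} \<and> grank y < grank x} = (if grank h < grank g then {(g, h)} else {})" by auto
 show ?thesis unfolding wsign_def e by simp
qed

lemma wedge_axis_pair:
 assumes "grank g < grank h"
 shows "(a \<^bold>\<and> b) $ {g, h} = a $ {} * b $ {g, h} + a $ {g} * b $ {h} - a $ {h} * b $ {g} + a $ {g, h} * b $ {}"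
proof -
 have n: "g ~= h" using assms by auto
 have P: "Pow {g, h} = {{}, {g}, {h}, {g, h}}" by (auto simp: Pow_insert)
 have d: "{g, h} - {g} = {h}" "{g, h} - {h} = {g}" using n by auto
 have s: "wsign {} S = 1" "wsign S {} = 1" "wsign {g} {h} = 1" "wsign {h} {g} = - 1" for S
  using assms by (simp_all add: wsign_empty wsign_single)
 show ?thesis unfolding wedge_nth P using n
  by (simp add: d s doubleton_eq_iff)
qed

section \<open>Pullbacks to the hypersurface\<close>

definition grad :: "(complex ^ 3 => complex) => complex ^ 3 => complex ^ 3" where
 "grad f x = (\<chi> j. frechet_derivative f (at x) (axis j 1))"

lemma grad_nth [simp]: "grad f x $ j = frechet_derivative f (at x) (axis j 1)"
 by (simp add: grad_def)

lemma tangent_eq: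
 assumes "holo_on U f" "x \<in> U"
 shows "tangent f x = {v. bd (grad f x) v = 0}"
proof -
 have "frechet_derivative f (at x) v = bd (grad f x) v" for v
  unfolding bd_def grad_nth by (subst holo_frechet_sum[OF assms]) (simp only: mult.commute)
 then show ?thesis by (simp only: tangent_def)
qed

lemma df_eq_0_iff: "df f x = 0 \<longleftrightarrow> grad f x = 0"
proof
 assume "df f x = 0"
 then have *: "(\<Sum>j\<in>UNIV. (grad f x $ j) *s gform (Dzeta j)) = 0" by (simp add: df_def form1_def)
 have "grad f x $ k = (\<Sum>j\<in>UNIV. (grad f x $ j) *s gform (Dzeta j)) $ {Dzeta k}" for k
  by (simp add: gform_def axis_def if_distrib cong: if_cong)
 then show "grad f x = 0" unfolding * by (simp add: vec_eq_iff)
qed (simp add: df_def form1_def grad_def vec_eq_iff)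

lemma bd_cross_self [simp]: "bd g (cross g y) = 0" "bd (cross x y) y = 0"
 by (simp_all add: bd_3 algebra_simps)

lemma herm_eq_bd: "herm x y = bd x (cv y)"
 by (simp add: herm_def bd_def)

lemma cv_cv [simp]: "cv (cv x) = x" and norm_cv [simp]: "norm (cv x) = norm x"
 and cv_smult: "cv (c *s x) = cnj c *s cv x"
 by (simp_all add: vec_eq_iff norm_vec_def)

lemma cmod_bd_le: "cmod (bd x y) <= norm x * norm y"
proof -
 have "(cmod (bd x y))\<^sup>2 <= (norm x * norm y)\<^sup>2"
  using lagrange_identity[of x "cv y"] zero_le_power2[of "norm (cross x (cv y))"]
  unfolding herm_eq_bd cv_cv norm_cv power_mult_distrib by linarith
 then show ?thesis by (rule power2_le_imp_le) simp
qed

lemma norm_cross_le: "norm (cross x y) <= norm x * norm y"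
proof -
 have "(norm (cross x y))\<^sup>2 <= (norm x * norm y)\<^sup>2"
  using lagrange_identity[of x y] zero_le_power2[of "cmod (herm x y)"]
  unfolding power_mult_distrib by linarith
 then show ?thesis by (rule power2_le_imp_le) simp
qed

lemma bd_smult: "bd (c *s x) y = c * bd x y" "bd x (c *s y) = c * bd x y"
 by (simp_all add: bd_def sum_distrib_left algebra_simps)

lemma bd_cv_self: "bd (cv x) x = of_real ((norm x)\<^sup>2)"
 unfolding norm_vec3_sq of_real_add complex_norm_square by (simp add: bd_3 mult.commute)

text \<open>The frame is a choice, so existence has to be known before anything follows about it.
  For a tangent vector w, \<open>cross g (cv w)\<close> is tangent and orthogonal to w. It could
  vanish only if the conjugate of w were a multiple of g, and then w would be orthogonal to
  itself.\<close>

lemma orthonormal_pair_exists: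
 assumes "g ~= 0"
 shows "EX u v. bd g u = 0 \<and> bd g v = 0 \<and> norm u = 1 \<and> norm v = 1 \<and> herm u v = 0"
proof -
 obtain w where w: "w ~= 0" "bd g w = 0"
 proof (cases "g $ 1 = 0 \<and> g $ 2 = 0")
  case True
  have "axis 1 1 ~= (0 :: complex ^ 3)" by (simp add: axis_eq_0_iff)
  moreover have "bd g (axis 1 1) = 0" using True by (simp add: bd_3 axis_def)
  ultimately show ?thesis by (rule that)
 next
  case False
  then show ?thesis using that[of "vector [g $ 2, - g $ 1, 0]"]
   by (auto simp: bd_3 vector_def vec_eq_iff forall_3)
 qed
 define v where "v = cross g (cv w)"
 have gv: "bd g v = 0" by (simp add: v_def)
 have hv: "herm v w = 0" by (simp add: v_def herm_eq_bd)
 have v0: "v ~= 0"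
 proof
  assume "v = 0"
  then obtain c where "cv w = c *s g" using cross_eq_0D[OF _ assms, of "cv w"] by (auto simp: v_def)
  then have "bd (cv w) w = 0" using w(2) by (simp add: bd_smult)
  then show False using w(1) by (simp add: bd_cv_self)
 qed
 have hw: "herm w v = 0"
 proof -
  have "herm w v = cnj (herm v w)" by (simp add: herm_def mult.commute)
  then show ?thesis using hv by simp
 qed
 define n where "n x = complex_of_real (1 / norm x) *s x" for x :: "complex ^ 3"
 have "norm (n x) = 1" if "x ~= 0" for x using that by (simp add: n_def norm_smult_vec norm_divide)
 then show ?thesis using w v0 gv hw
  by (intro exI[of _ "n w"] exI[of _ "n v"]) (simp add: n_def bd_smult herm_eq_bd cv_smult)
qed

text \<open>The bilinear cross product of two tangent vectors is a multiple of the gradient. The unimodular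
 freedom in the frame therefore drops out of \<open>top_coeff\<close>.\<close>

lemma frame_gradient:
 assumes f: "holo_on U f" "x \<in> U" and g: "grad f x ~= 0"
 obtains u v l where "frame f x = [u, \<i> *s u, v, \<i> *s v]" "u \<in> tangent f x" "v \<in> tangent f x"
  "norm u = 1" "norm v = 1" "herm u v = 0" "cross u v = l *s grad f x" "cmod l * norm (grad f x) = 1"
proof -
 define P where "P E \<longleftrightarrow> (EX u v. u \<in> tangent f x \<and> v \<in> tangent f x \<and>
   norm u = 1 \<and> norm v = 1 \<and> herm u v = 0 \<and> E = [u, \<i> *s u, v, \<i> *s v])" for E
 obtain u0 v0 where "bd (grad f x) u0 = 0 \<and> bd (grad f x) v0 = 0 \<and> norm u0 = 1 \<and> norm v0 = 1 \<and> herm u0 v0 = 0"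
  using orthonormal_pair_exists[OF g] by blast
 then have "P [u0, \<i> *s u0, v0, \<i> *s v0]"
  unfolding P_def tangent_eq[OF f] by blast
 then have "P (frame f x)" unfolding frame_def P_def[symmetric] by (rule someI[of P])
 then obtain u v where uv: "u \<in> tangent f x" "v \<in> tangent f x" "norm u = 1" "norm v = 1" "herm u v = 0"
  "frame f x = [u, \<i> *s u, v, \<i> *s v]" unfolding P_def by blast
 have t: "bd (grad f x) u = 0" "bd (grad f x) v = 0" using uv(1,2) unfolding tangent_eq[OF f] by auto
 have "cross g (cross u v) = bd g v *s u - bd g u *s v" for g
  by (simp add: vec_eq_iff forall_3 bd_3 algebra_simps)
 then have "cross (grad f x) (cross u v) = 0" using t by simp
 then obtain l where l: "cross u v = l *s grad f x" using cross_eq_0D[OF _ g] by blast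
 have "(norm (cross u v))\<^sup>2 = 1" using lagrange_identity[of u v] uv by simp
 then have "norm (cross u v) = 1" using power2_eq_iff_nonneg[of "norm (cross u v)" 1] by simp
 then have "cmod l * norm (grad f x) = 1" by (simp add: l norm_smult_vec)
 then show ?thesis using that uv l by blast
qed

lemma form1_axis: "form1 c = axis {Dzeta 1} (c $ 1) + axis {Dzeta 2} (c $ 2) + axis {Dzeta 3} (c $ 3)"
 unfolding form1_def gform_def sum_3 by (simp add: vec_eq_iff axis_def)

lemma wsign_pair:
 assumes "b ~= c"
 shows "wsign S {b, c} = wsign S {b} * wsign S {c}"
proof -
 have "{b, c} = {b} \<union> {c}" by auto
 then show ?thesis using assms by (simp only: wsign_Un_right) (rule wsign_Un_right, simp)
qed

text \<open>\<omega> is known only through its product with df, that is, through the pairing of its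
  dual vector with the gradient. Since \<open>cross u v\<close> is a multiple of the gradient, this
  pairing determines \<omega> on the tangent space.\<close>

lemma structure_form_pairing:
 assumes "form_20 w" "df f x \<^bold>\<and> w = (2 * pi * \<i>) *s dzeta123"
 shows "bd (grad f x) (dual_hol w) = 2 * pi * \<i>"
proof -
 have "df f x \<^bold>\<and> w = (axis {Dzeta 1} (grad f x $ 1) + axis {Dzeta 2} (grad f x $ 2) + axis {Dzeta 3} (grad f x $ 3))
   \<^bold>\<and> (axis {Dzeta 2, Dzeta 3} (dual_hol w $ 1) - axis {Dzeta 1, Dzeta 3} (dual_hol w $ 2) + axis {Dzeta 1, Dzeta 2} (dual_hol w $ 3))"
  using form_20_eq[OF assms(1)] by (simp add: df_def form1_axis)
 also have "... = axis {Dzeta 1, Dzeta 2, Dzeta 3} (bd (grad f x) (dual_hol w))"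
  unfolding wedge_add_left wedge_add_right wedge_diff_left wedge_diff_right wedge_axis
  by (simp add: wsign_pair wsign_single insert_commute bd_3 del: dual_nth grad_nth)
   (simp add: vec_eq_iff axis_def del: dual_nth grad_nth)
 finally have "(df f x \<^bold>\<and> w) $ {Dzeta 1, Dzeta 2, Dzeta 3} = bd (grad f x) (dual_hol w)" by (simp add: axis_def)
 then show ?thesis unfolding assms(2) by (simp add: dzeta123_eq range_Dzeta axis_def)
qed

section \<open>Riemannian norms of forms of low degree\<close>

lemma sum_card1_subsets: "(\<Sum>A | A <= {..<4::nat} \<and> card A = 1. F A) = F {0} + F {1} + F {2} + F {3}"
 for F :: "nat set => real"
proof -
 have "{A. A <= {..<4::nat} \<and> card A = 1} = {{0}, {1}, {2}, {3}}"
  by (auto simp: card_1_singleton_iff)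
 then show ?thesis by (simp add: add.assoc)
qed

lemma form_norm_0: "form_norm f x 0 a = cmod (a $ {})"
proof -
 have "{A. A <= {..<4::nat} \<and> card A = 0} = {{}}"
  using finite_subset[of _ "{..<4::nat}"] by auto
 then show ?thesis by (simp add: form_norm_def)
qed

lemma nths_frame:
 "nths [a, b, c, d] {0} = [a]" "nths [a, b, c, d] {1} = [b]" "nths [a, b, c, d] {2} = [c]"
 "nths [a, b, c, d] {3} = [d]" "nths [a, b, c, d] {0, 2} = [a, c]"
 by (simp_all add: nths_Cons numeral_2_eq_2 numeral_3_eq_3)

lemma cv_i: "bd y (cv (\<i> *s u)) = - \<i> * bd y (cv u)"
 by (simp add: bd_def sum_distrib_left algebra_simps)

lemma form_norm_1:
 assumes fr: "frame f x = [u, \<i> *s u, v, \<i> *s v]" and a: "form_0r 1 a"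
 shows "form_norm f x 1 a = sqrt (2 * ((cmod (bd (anti1 a) (cv u)))\<^sup>2 + (cmod (bd (anti1 a) (cv v)))\<^sup>2))"
 unfolding form_norm_def fr sum_card1_subsets nths_frame ev_form_01[OF a] cv_i
 by (simp add: norm_mult)

text \<open>The pair u, v sits at positions 0 and 2 of the frame and contributes one of the squares
  in the norm.\<close>

lemma form_norm_2_ge:
 assumes fr: "frame f x = [u, \<i> *s u, v, \<i> *s v]"
 shows "cmod (ev [u, v] a) <= form_norm f x 2 a"
proof -
 have fin: "finite {A. A <= {..<4::nat} \<and> card A = 2}" by (rule finite_subset[of _ "Pow {..<4}"]) auto
 have "(\<Sum>A\<in>{{0, 2}}. (cmod (ev (nths (frame f x) A) a))\<^sup>2) <= (\<Sum>A | A <= {..<4} \<and> card A = 2. (cmod (ev (nths (frame f x) A) a))\<^sup>2)"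
  by (rule sum_mono2[OF fin]) auto
 then have "(cmod (ev [u, v] a))\<^sup>2 <= (form_norm f x 2 a)\<^sup>2"
  unfolding form_norm_def fr by (simp add: nths_frame sum_nonneg del: ev.simps)
 then show ?thesis by (rule power2_le_imp_le) (simp add: form_norm_def sum_nonneg)
qed

lemma form_norm_nonneg [simp]: "0 <= form_norm f x r a"
 by (simp add: form_norm_def sum_nonneg)

text \<open>A formula free of the frame and hence measurable in the point: the frame is chosen point
  by point, whereas the gradient is continuous. It results from expanding
  \<open>cross y (cv (cross u v))\<close> in the orthonormal vectors conjugate to u and v.\<close>

lemma form_norm_1_cross:
 assumes f: "holo_on U f" "x \<in> U" "grad f x ~= 0" and a: "form_0r 1 a"
 shows "form_norm f x 1 a = sqrt 2 * norm (cross (anti1 a) (cv (grad f x))) / norm (grad f x)"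
proof -
 obtain u v l where fr: "frame f x = [u, \<i> *s u, v, \<i> *s v]" and uv: "norm u = 1" "norm v = 1" "herm u v = 0"
  and l: "cross u v = l *s grad f x" "cmod l * norm (grad f x) = 1" by (rule frame_gradient[OF f])
 define y where "y = anti1 a"
 have 1: "cross y (cv (cross u v)) = bd y (cv v) *s cv u - bd y (cv u) *s cv v"
  by (simp add: vec_eq_iff forall_3 bd_3 algebra_simps)
 have "complex_of_real ((norm (p *s cv u - q *s cv v))\<^sup>2) = of_real ((cmod p)\<^sup>2 * (norm u)\<^sup>2 + (cmod q)\<^sup>2 * (norm v)\<^sup>2)
   - p * cnj q * cnj (herm u v) - cnj p * q * herm u v" for p q
  unfolding norm_vec3_sq of_real_add of_real_mult complex_norm_square herm_def sum_3 by (simp add: algebra_simps)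
 then have "(norm (p *s cv u - q *s cv v))\<^sup>2 = (cmod p)\<^sup>2 + (cmod q)\<^sup>2" for p q
  using uv by (simp del: of_real_add of_real_power)
 then have "(norm (cross y (cv (cross u v))))\<^sup>2 = (cmod (bd y (cv u)))\<^sup>2 + (cmod (bd y (cv v)))\<^sup>2"
  unfolding 1 by simp
 moreover have "cross y (cv (cross u v)) = cnj l *s cross y (cv (grad f x))"
  unfolding l(1) by (simp add: vec_eq_iff forall_3 algebra_simps)
 ultimately have "form_norm f x 1 a = sqrt (2 * (cmod l * norm (cross y (cv (grad f x))))\<^sup>2)"
  unfolding form_norm_1[OF fr a] y_def[symmetric] by (simp add: norm_smult_vec)
 also have "... = sqrt 2 * (cmod l * norm (cross y (cv (grad f x))))"
  by (simp add: real_sqrt_mult)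
 also have "cmod l = 1 / norm (grad f x)" using l(2) f(3) by (simp add: field_simps)
 finally show ?thesis by (simp add: y_def)
qed

lemma norm_vec3_le: "norm (x :: complex ^ 3) <= cmod (x $ 1) + cmod (x $ 2) + cmod (x $ 3)"
proof -
 have "(norm x)\<^sup>2 <= (cmod (x $ 1) + cmod (x $ 2) + cmod (x $ 3))\<^sup>2"
  unfolding norm_vec3_sq by (simp add: power2_eq_square algebra_simps)
 then show ?thesis by (rule power2_le_imp_le) auto
qed

lemma norm_anti1_le: "norm (anti1 a) <= 3 * norm a"
proof -
 have "cmod (a $ S) <= norm a" for S by (rule Finite_Cartesian_Product.norm_nth_le)
 then have "cmod (anti1 a $ 1) + cmod (anti1 a $ 2) + cmod (anti1 a $ 3) <= norm a + norm a + norm a"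
  unfolding anti1_nth by (intro add_mono)
 then show ?thesis using norm_vec3_le[of "anti1 a"] by linarith
qed

lemma form_norm_le:
 assumes f: "holo_on U f" "x \<in> U" "grad f x ~= 0" and r: "r = 0 \<or> r = 1" and a: "form_0r r a"
 shows "form_norm f x r a <= 6 * norm a"
 using r
proof
 assume r: "r = 0"
 have "cmod (a $ {}) <= norm a" by (rule Finite_Cartesian_Product.norm_nth_le)
 moreover have "0 <= norm a" by simp
 ultimately show ?thesis unfolding r form_norm_0 by linarith
next
 assume r: "r = 1"
 have a1: "form_0r 1 a" using a r by simp
 have g: "0 < norm (grad f x)" using f(3) by simp
 have "norm (cross (anti1 a) (cv (grad f x))) <= norm (anti1 a) * norm (grad f x)"
  using norm_cross_le[of "anti1 a" "cv (grad f x)"] by simp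
 then have "norm (cross (anti1 a) (cv (grad f x))) / norm (grad f x) <= norm (anti1 a)"
  using g by (simp add: field_simps)
 then have "sqrt 2 * (norm (cross (anti1 a) (cv (grad f x))) / norm (grad f x)) <= 2 * (3 * norm a)"
  using norm_anti1_le[of a] sqrt2_less_2 by (intro mult_mono) auto
 then show ?thesis unfolding r form_norm_1_cross[OF f a1] by simp
qed

section \<open>The integrand at a single point\<close>

lemma z_part_add: "z_part J (a + b) = z_part J a + z_part J b"
 and z_part_diff: "z_part J (a - b) = z_part J a - z_part J b"
 and z_part_smult: "z_part J (c *s a) = c *s z_part J a"
 and z_part_zero: "z_part J 0 = 0"
 by (auto simp: z_part_def vec_eq_iff)

lemma wedge_hol_nth:
 assumes a: "form_20 a" and b: "!!S. b $ S ~= 0 ==> S Int range Dzeta = {}"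
 shows "(a \<^bold>\<and> b) $ R = a $ (R Int range Dzeta) * b $ (R - range Dzeta)"
proof -
 have "(a \<^bold>\<and> b) $ R = (\<Sum>P\<in>Pow R. if P = R Int range Dzeta then a $ P * b $ (R - P) else 0)"
  unfolding wedge_nth
 proof (intro sum.cong refl)
  fix P assume P: "P \<in> Pow R"
  show "wsign P (R - P) * a $ P * b $ (R - P) = (if P = R Int range Dzeta then a $ P * b $ (R - P) else 0)"
  proof (cases "a $ P = 0 \<or> b $ (R - P) = 0")
   case False
   then have *: "P <= range Dzeta" "(R - P) Int range Dzeta = {}" using a b by (auto simp: form_20_def)
   have set: "P <= R ==> P <= Q ==> (R - P) Int Q = {} ==> P = R Int Q" for Q by blast
   have "P = R Int range Dzeta" using P by (intro set *) simp
   then show ?thesis using wsign_hol_anti[OF *] by simp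
  qed auto
 qed
 also have "... = a $ (R Int range Dzeta) * b $ (R - (R Int range Dzeta))" by simp
 also have "R - (R Int range Dzeta) = R - range Dzeta" by blast
 finally show ?thesis .
qed

text \<open>The left factor has holomorphic differentials only, so extracting coefficients of the
  conjugate differentials of z passes it by.\<close>

lemma z_part_wedge_hol:
 assumes a: "form_20 a" and b: "!!S. b $ S ~= 0 ==> S Int range Dzeta = {}"
 shows "z_part J (a \<^bold>\<and> b) = a \<^bold>\<and> z_part J b"
proof -
 have zb: "S Int range Dzeta = {}" if "z_part J b $ S ~= 0" for S
  using that b[of "S \<union> Dzbar ` J"] by (auto simp: z_part_def split: if_splits)
 have "z_part J (a \<^bold>\<and> b) $ R = (a \<^bold>\<and> z_part J b) $ R" for R
 proof -
  have e: "(R \<union> Dzbar ` J) Int range Dzeta = R Int range Dzeta"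
   "(R \<union> Dzbar ` J) - range Dzeta = (R - range Dzeta) \<union> Dzbar ` J"
   "(R - range Dzeta) Int range Dzbar = R Int range Dzbar" by auto
  have 1: "(a \<^bold>\<and> z_part J b) $ R = a $ (R Int range Dzeta) * z_part J b $ (R - range Dzeta)"
   by (rule wedge_hol_nth[OF a]) (rule zb)
  have 2: "(a \<^bold>\<and> b) $ (R \<union> Dzbar ` J) = a $ (R Int range Dzeta) * b $ ((R - range Dzeta) \<union> Dzbar ` J)"
   unfolding e[symmetric] by (rule wedge_hol_nth[OF a]) (rule b)
  show ?thesis unfolding 1 by (simp only: z_part_def vec_lambda_beta 2 e(3)) simp
 qed
 then show ?thesis by (simp add: vec_eq_iff)
qed

lemma gen_cases_range: "x \<in> range Dzeta \<or> x \<in> range Dzetabar \<or> x \<in> range Dzbar"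
 by (cases x) auto

lemma z_part_degree:
 assumes b: "degr 0 k b" and "z_part J b $ S ~= 0"
 shows "S <= range Dzetabar" "card S + card J = k"
proof -
 have S: "S Int range Dzbar = {}" "b $ (S \<union> Dzbar ` J) ~= 0"
  using assms(2) by (auto simp: z_part_def split: if_splits)
 then have c: "card ((S \<union> Dzbar ` J) Int range Dzeta) = 0" "card (S \<union> Dzbar ` J) = k"
  using degrD[OF b] by auto
 from c(1) have "S Int range Dzeta = {}" by (auto simp: card_eq_0_iff)
 then show "S <= range Dzetabar" using S(1) gen_cases_range by blast
 have "card (S \<union> Dzbar ` J) = card S + card (Dzbar ` J)"
  using S(1) by (intro card_Un_disjoint) auto
 also have "card (Dzbar ` J) = card J" by (rule card_image) (auto intro: inj_onI)
 finally show "card S + card J = k" using c(2) by simp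
qed

lemma degr_form_0r: "form_0r r a ==> degr 0 r a"
proof -
 assume a: "form_0r r a"
 have "S Int range Dzeta = {}" if "S <= range Dzetabar" for S using that by auto
 then show ?thesis using a by (auto simp: form_0r_def degr_def)
qed

lemma form_20_degr: "form_20 a ==> degr 2 2 a"
 by (auto simp: form_20_def degr_def Int_absorb2)

text \<open>The integrand as a function of the values of \<omega>, of the kernel and of the form at
  one point. It is linear in the kernel value, so differences in z reduce to differences of the
  kernel.\<close>

definition KT :: "(complex ^ 3 => complex) => complex ^ 3 => ext => 3 set => ext => ext => complex" where
 "KT f x w J k p = top_coeff f x (z_part J ((w \<^bold>\<and> k) \<^bold>\<and> p))"

lemma KT_linear:
 "KT f x w J (k + k') p = KT f x w J k p + KT f x w J k' p"
 "KT f x w J (k - k') p = KT f x w J k p - KT f x w J k' p"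
 "KT f x w J k (p + p') = KT f x w J k p + KT f x w J k p'"
 "KT f x w J k (c *s p) = c * KT f x w J k p"
 "KT f x w J 0 p = 0"
 unfolding KT_def top_coeff_def
 by (simp_all add: wedge_add_left wedge_add_right wedge_diff_left wedge_diff_right wedge_smult_right
   z_part_add z_part_diff z_part_smult z_part_zero ev_add ev_diff ev_smult)

text \<open>A count of degrees: \<omega>, kernel and form together have degree 3 + r, and exactly 4
  must remain after removing the differentials indexed by \<open>J\<close>; hence J must have r - 1
  elements.\<close>

lemma KT_cases:
 assumes fr: "frame f x = [u, \<i> *s u, v, \<i> *s v]" and w: "form_20 w" and k: "degr 0 1 k" and p: "form_0r r p" and r: "1 <= r"
 shows "KT f x w J k p = (if card J = r - 1
   then 4 * bd (dual_hol w) (cross u v) * bd (dual_anti (z_part J (k \<^bold>\<and> p))) (cv (cross u v)) else 0)"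
proof -
 have d: "degr 0 (1 + r) (k \<^bold>\<and> p)" using degr_wedge[OF k degr_form_0r[OF p]] by simp
 have nz: "S Int range Dzeta = {}" if "(k \<^bold>\<and> p) $ S ~= 0" for S
  using degrD[OF d that] by (simp add: card_eq_0_iff)
 have eq: "KT f x w J k p = ev [u, \<i> *s u, v, \<i> *s v] (w \<^bold>\<and> z_part J (k \<^bold>\<and> p))"
 proof -
  have "z_part J (w \<^bold>\<and> (k \<^bold>\<and> p)) = w \<^bold>\<and> z_part J (k \<^bold>\<and> p)"
   by (rule z_part_wedge_hol[OF w]) (rule nz)
  then show ?thesis unfolding KT_def top_coeff_def fr wedge_assoc by (simp only:)
 qed
 note zd = z_part_degree[OF d]
 show ?thesis
 proof (cases "card J = r - 1")
  case True
  then have "form_0r 2 (z_part J (k \<^bold>\<and> p))"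
   unfolding form_0r_def using zd r by fastforce
  then show ?thesis using True ev_frame_wedge[OF w] eq by simp
 next
  case False
  have "ALL S. z_part J (k \<^bold>\<and> p) $ S ~= 0 --> card (S Int range Dzeta) = 0 \<and> card S = 1 + r - card J"
  proof (intro allI impI conjI)
   fix S assume S: "z_part J (k \<^bold>\<and> p) $ S ~= 0"
   show "card S = 1 + r - card J" using zd(2)[OF S] by simp
   show "card (S Int range Dzeta) = 0" using zd(1)[OF S] by (auto simp: card_eq_0_iff)
  qed
  then have "degr 0 (1 + r - card J) (z_part J (k \<^bold>\<and> p))" by (simp add: degr_def)
  from degr_wedge[OF form_20_degr[OF w] this]
  have d4: "ALL S. (w \<^bold>\<and> z_part J (k \<^bold>\<and> p)) $ S ~= 0 --> card S = 2 + (1 + r - card J)" by (auto simp: degr_def)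
  show ?thesis
  proof (cases "z_part J (k \<^bold>\<and> p) = 0")
   case True then show ?thesis using False eq by simp
  next
   case nz: False
   then obtain S where "z_part J (k \<^bold>\<and> p) $ S ~= 0" by (auto simp: vec_eq_iff)
   from zd(2)[OF this] have "2 + (1 + r - card J) ~= 4" using False r by linarith
   then have "ev [u, \<i> *s u, v, \<i> *s v] (w \<^bold>\<and> z_part J (k \<^bold>\<and> p)) = 0"
    using ev_degree[OF d4, of "[u, \<i> *s u, v, \<i> *s v]"] by (simp del: ev.simps)
   then show ?thesis using False eq by simp
  qed
 qed
qed

lemma dual_anti_wedge_1:
 assumes "degr 0 1 k" "form_0r 1 p"
 shows "dual_anti (z_part {} (k \<^bold>\<and> p)) = cross (anti1 k) (anti1 p)"
proof -
 have k0: "k $ {} = 0" using degrD[OF assms(1), of "{}"] by auto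
 have p0: "p $ {} = 0" using assms(2) unfolding form_0r_def by (metis card.empty zero_neq_one)
 have "z_part {} (k \<^bold>\<and> p) $ {Dzetabar a, Dzetabar b} = k $ {Dzetabar a} * p $ {Dzetabar b} - k $ {Dzetabar b} * p $ {Dzetabar a}"
  if "idx a < idx b" for a b
  using that wedge_axis_pair[of "Dzetabar a" "Dzetabar b" k p] by (auto simp: z_part_def k0 p0)
 then show ?thesis by (simp add: vec_eq_iff forall_3)
qed

text \<open>p contains no conjugate differential of z, so this one must come from k. Moving it past
  the two differentials of p costs no sign.\<close>

lemma dual_anti_wedge_2:
 assumes k: "degr 0 1 k" and p: "form_0r 2 p"
 shows "dual_anti (z_part {j} (k \<^bold>\<and> p)) = (k $ {Dzbar j}) *s dual_anti p"
proof -
 have "z_part {j} (k \<^bold>\<and> p) $ {Dzetabar a, Dzetabar b} = k $ {Dzbar j} * p $ {Dzetabar a, Dzetabar b}" if "a ~= b" for a b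
 proof -
  define R where "R = insert (Dzbar j) {Dzetabar a, Dzetabar b}"
  have ws: "wsign {Dzbar j} {Dzetabar a, Dzetabar b} = 1"
  proof -
   have "3 + idx i < 6 + idx j" for i by (auto simp: idx_def)
   then show ?thesis using that by (simp add: wsign_pair wsign_single)
  qed
  have "(k \<^bold>\<and> p) $ R = (\<Sum>P\<in>Pow R. if P = {Dzbar j} then k $ {Dzbar j} * p $ {Dzetabar a, Dzetabar b} else 0)"
   unfolding wedge_nth
  proof (intro sum.cong refl)
   fix P assume P: "P \<in> Pow R"
   show "wsign P (R - P) * k $ P * p $ (R - P) = (if P = {Dzbar j} then k $ {Dzbar j} * p $ {Dzetabar a, Dzetabar b} else 0)"
   proof (cases "P = {Dzbar j}")
    case True
    then have "R - P = {Dzetabar a, Dzetabar b}" by (auto simp: R_def)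
    then show ?thesis using True ws by simp
   next
    case False
    have "k $ P = 0 \<or> p $ (R - P) = 0"
    proof (rule ccontr)
     assume "\<not> ?thesis"
     then have *: "card P = 1" "R - P <= range Dzetabar"
      using degrD[OF k] p by (auto simp: form_0r_def)
     then have "Dzbar j \<in> P" by (auto simp: R_def)
     then show False using *(1) False by (auto simp: card_1_singleton_iff)
    qed
    then show ?thesis using False by auto
   qed
  qed
  also have "... = k $ {Dzbar j} * p $ {Dzetabar a, Dzetabar b}" by (simp add: R_def)
  finally have "(k \<^bold>\<and> p) $ R = k $ {Dzbar j} * p $ {Dzetabar a, Dzetabar b}" .
  moreover have "{Dzetabar a, Dzetabar b} \<union> Dzbar ` {j} = R" by (auto simp: R_def)
  moreover have "{Dzetabar a, Dzetabar b} Int range Dzbar = {}" by auto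
  ultimately show ?thesis unfolding z_part_def vec_lambda_beta by (simp only: if_True simp_thms)
 qed
 then show ?thesis by (simp add: vec_eq_iff forall_3)
qed

lemma bd_cross_cross: "bd (cross a b) (cv (cross u v)) = bd a (cv u) * bd b (cv v) - bd a (cv v) * bd b (cv u)"
 by (simp add: bd_3 algebra_simps)

text \<open>The frame enters only through l times its conjugate, which is 1/|grad f|^2. What remains
  is explicit in the gradient; this is the version from which measurability is derived.\<close>

lemma KT_formula:
 assumes f: "holo_on U f" "x \<in> U" "grad f x ~= 0" and w: "form_20 w" "df f x \<^bold>\<and> w = (2 * pi * \<i>) *s dzeta123"
  and k: "degr 0 1 k" and p: "form_0r r p" and r: "1 <= r"
 shows "KT f x w J k p = (if card J = r - 1
   then 8 * pi * \<i> * bd (dual_anti (z_part J (k \<^bold>\<and> p))) (cv (grad f x)) / of_real ((norm (grad f x))\<^sup>2) else 0)"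
proof -
 obtain u v l where fr: "frame f x = [u, \<i> *s u, v, \<i> *s v]"
  and l: "cross u v = l *s grad f x" "cmod l * norm (grad f x) = 1" by (rule frame_gradient[OF f])
 have "bd (dual_hol w) (grad f x) = 2 * pi * \<i>"
  using structure_form_pairing[OF w] by (simp add: bd_def mult.commute)
 then have "4 * bd (dual_hol w) (cross u v) * bd (dual_anti (z_part J (k \<^bold>\<and> p))) (cv (cross u v)) =
   8 * pi * \<i> * (l * cnj l) * bd (dual_anti (z_part J (k \<^bold>\<and> p))) (cv (grad f x))"
  unfolding l(1) cv_smult bd_smult by (simp add: algebra_simps)
 also have "l * cnj l = 1 / of_real ((norm (grad f x))\<^sup>2)"
 proof -
  have "cmod l = 1 / norm (grad f x)" using l(2) f(3) by (simp add: field_simps)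
  then show ?thesis unfolding complex_norm_square[symmetric] by (simp add: power_divide)
 qed
 finally show ?thesis unfolding KT_cases[OF fr w(1) k p r] by simp
qed

text \<open>\<omega> contributes 2 \<pi>/|grad f|. The constant is 4 times 2 \<pi> times 6, with 4
  from the volume form and 6 from the two products that occur for r = 1, each with a factor 3
  |k|.\<close>

lemma KT_bound:
 assumes f: "holo_on U f" "x \<in> U" "grad f x ~= 0" and w: "form_20 w" "df f x \<^bold>\<and> w = (2 * pi * \<i>) *s dzeta123"
  and k: "degr 0 1 k" and p: "form_0r r p" and r: "r = 1 \<or> r = 2"
 shows "cmod (KT f x w J k p) <= 48 * pi * norm k * form_norm f x r p / norm (grad f x)"
proof -
 obtain u v l where fr: "frame f x = [u, \<i> *s u, v, \<i> *s v]" and uv: "norm u = 1" "norm v = 1"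
  and l: "cross u v = l *s grad f x" "cmod l * norm (grad f x) = 1" by (rule frame_gradient[OF f])
 have g: "0 < norm (grad f x)" using f(3) by simp
 have cl: "cmod l = 1 / norm (grad f x)" using l(2) g by (simp add: field_simps)
 have "bd (dual_hol w) (grad f x) = 2 * pi * \<i>"
  using structure_form_pairing[OF w] by (simp add: bd_def mult.commute)
 then have om: "cmod (bd (dual_hol w) (cross u v)) = 2 * pi / norm (grad f x)"
  unfolding l(1) bd_smult by (simp add: norm_mult cl)
 have main: "cmod (bd (dual_anti (z_part J (k \<^bold>\<and> p))) (cv (cross u v))) <= 6 * norm k * form_norm f x r p"
  if J: "card J = r - 1"
  using r
 proof
  assume r: "r = 1"
  then have J0: "J = {}" using J by simp
  have p1: "form_0r 1 p" using p r by simp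
  define a where "a = cmod (bd (anti1 p) (cv u))"
  define b where "b = cmod (bd (anti1 p) (cv v))"
  have ab: "a <= form_norm f x 1 p" "b <= form_norm f x 1 p"
   unfolding form_norm_1[OF fr p1] a_def[symmetric] b_def[symmetric]
   by (rule real_le_rsqrt, simp)+
  have kb: "cmod (bd (anti1 k) (cv y)) <= 3 * norm k" if "norm y = 1" for y
   using cmod_bd_le[of "anti1 k" "cv y"] norm_anti1_le[of k] that by simp
  have "cmod (bd (dual_anti (z_part J (k \<^bold>\<and> p))) (cv (cross u v))) <=
    cmod (bd (anti1 k) (cv u)) * b + cmod (bd (anti1 k) (cv v)) * a"
   unfolding J0 dual_anti_wedge_1[OF k p1] bd_cross_cross a_def b_def
   by (rule order_trans[OF norm_triangle_ineq4]) (simp add: norm_mult)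
  also have "... <= 3 * norm k * form_norm f x 1 p + 3 * norm k * form_norm f x 1 p"
   using kb uv ab by (intro add_mono mult_mono) (auto simp: a_def b_def)
  finally show ?thesis by (simp add: r)
 next
  assume r: "r = 2"
  then obtain j where Jj: "J = {j}" using J by (auto simp: card_1_singleton_iff)
  have p2: "form_0r 2 p" using p r by simp
  have "cmod (bd (dual_anti (z_part J (k \<^bold>\<and> p))) (cv (cross u v))) = cmod (k $ {Dzbar j}) * cmod (ev [u, v] p)"
   unfolding Jj dual_anti_wedge_2[OF k p2] bd_smult ev_form_02[OF p2] by (simp add: norm_mult)
  also have "... <= norm k * form_norm f x 2 p"
   using form_norm_2_ge[OF fr, of p] Finite_Cartesian_Product.norm_nth_le[of k "{Dzbar j}"]
   by (intro mult_mono) auto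
  also have "... <= 6 * norm k * form_norm f x 2 p" by simp
  finally show ?thesis by (simp add: r)
 qed
 show ?thesis
 proof (cases "card J = r - 1")
  case True
  have r1: "1 <= r" using r by auto
  have "cmod (KT f x w J k p) = 4 * (2 * pi / norm (grad f x)) * cmod (bd (dual_anti (z_part J (k \<^bold>\<and> p))) (cv (cross u v)))"
   unfolding KT_cases[OF fr w(1) k p r1] using True by (simp add: norm_mult om)
  also have "... <= 4 * (2 * pi / norm (grad f x)) * (6 * norm k * form_norm f x r p)"
   using main[OF True] by (intro mult_left_mono) auto
  finally show ?thesis by (simp add: mult_ac)
 next
  case False
  have r1: "1 <= r" using r by auto
  have "KT f x w J k p = 0" unfolding KT_cases[OF fr w(1) k p r1] using False by simp
  then show ?thesis by simp
 qed
qed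

text \<open>Turns the integrability of \<omega> into that of the weight 1/|grad f|.\<close>

lemma structure_form_norm:
 assumes f: "holo_on U f" "x \<in> U" "grad f x ~= 0" and w: "form_20 w" "df f x \<^bold>\<and> w = (2 * pi * \<i>) *s dzeta123"
 shows "1 / norm (grad f x) <= form_norm f x 2 w"
proof -
 obtain u v l where fr: "frame f x = [u, \<i> *s u, v, \<i> *s v]"
  and l: "cross u v = l *s grad f x" "cmod l * norm (grad f x) = 1" by (rule frame_gradient[OF f])
 have g: "0 < norm (grad f x)" using f(3) by simp
 have cl: "cmod l = 1 / norm (grad f x)" using l(2) g by (simp add: field_simps)
 have "bd (dual_hol w) (grad f x) = 2 * pi * \<i>"
  using structure_form_pairing[OF w] by (simp add: bd_def mult.commute)
 then have "cmod (ev [u, v] w) = 2 * pi / norm (grad f x)"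
  unfolding ev_form_20[OF w(1)] l(1) bd_smult by (simp add: norm_mult cl)
 moreover have "1 / norm (grad f x) <= 2 * pi / norm (grad f x)"
  using pi_ge_two by (intro divide_right_mono) auto
 ultimately show ?thesis using form_norm_2_ge[OF fr, of w] by linarith
qed

section \<open>The kernel\<close>

text \<open>The coefficient vector of the Bochner-Martinelli form is the conjugate of the inversion
  \<eta>/|\<eta>|^2. The exact formula for distances under inversion then gives its Lipschitz bound
  away from 0.\<close>

definition kelvin :: "complex ^ 3 => complex ^ 3" where
 "kelvin \<eta> = (\<chi> k. cnj (\<eta> $ k) / of_real ((norm \<eta>)\<^sup>2))"

lemma kelvin_nth [simp]: "kelvin \<eta> $ k = cnj (\<eta> $ k) / of_real ((norm \<eta>)\<^sup>2)"
 by (simp add: kelvin_def)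

lemma kelvin_eq: "kelvin \<eta> = cv ((1 / (norm \<eta>)\<^sup>2) *\<^sub>R \<eta>)"
 by (simp add: vec_eq_iff scaleR_conv_of_real[where 'a = complex] divide_inverse mult.commute)

lemma cv_diff: "cv x - cv y = cv (x - y)"
 by (simp add: vec_eq_iff)

lemma bounded_linear_cv: "bounded_linear cv"
 by (rule linear_conv_bounded_linear[THEN iffD1]) (auto intro!: linearI simp: vec_eq_iff)

lemma norm_kelvin: "\<eta> ~= 0 ==> norm (kelvin \<eta>) = 1 / norm \<eta>"
 by (simp add: kelvin_eq power2_eq_square)

lemma inversion_dist:
 fixes x y :: "'a::real_inner"
 assumes "x ~= 0" "y ~= 0"
 shows "norm ((1 / (norm x)\<^sup>2) *\<^sub>R x - (1 / (norm y)\<^sup>2) *\<^sub>R y) = norm (x - y) / (norm x * norm y)"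
proof -
 define a where "a = x \<bullet> x" define b where "b = y \<bullet> y" define c where "c = x \<bullet> y"
 have ab: "a ~= 0" "b ~= 0" using assms by (auto simp: a_def b_def)
 have "(norm ((1 / (norm x)\<^sup>2) *\<^sub>R x - (1 / (norm y)\<^sup>2) *\<^sub>R y))\<^sup>2 = (1 / a) * (1 / a) * a - 2 * ((1 / a) * (1 / b) * c) + (1 / b) * (1 / b) * b"
  unfolding power2_norm_eq_inner a_def b_def c_def
  by (simp add: inner_diff_left inner_diff_right inner_commute algebra_simps)
 also have "... = (a - 2 * c + b) / (a * b)"
  using ab by (simp add: field_simps)
 also have "... = (norm (x - y) / (norm x * norm y))\<^sup>2"
  unfolding power_divide power_mult_distrib power2_norm_eq_inner a_def b_def c_def
  by (simp add: inner_diff_left inner_diff_right inner_commute algebra_simps)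
 finally show ?thesis by (rule power2_eq_imp_eq) auto
qed

lemma kelvin_dist: "x ~= 0 ==> y ~= 0 ==> norm (kelvin x - kelvin y) = norm (x - y) / (norm x * norm y)"
 unfolding kelvin_eq cv_diff norm_cv by (rule inversion_dist)

text \<open>A singularity of order n at 0 with a Lipschitz bound on the set of points of norm at
  least s. That set is not convex, so the bound is recorded for pairs of points instead of for a
  derivative. Orders add under bilinear maps, which reduces the singular part of the kernel to
  \<open>kelvin\<close>.\<close>

definition sing :: "nat => ('a::real_normed_vector => 'b::real_normed_vector) => bool" where
 "sing n F \<longleftrightarrow> (EX C>=0. (ALL x. x ~= 0 --> norm (F x) <= C / norm x ^ n) \<and>
   (ALL x y s. 0 < s --> s <= norm x --> s <= norm y --> norm (F x - F y) <= C * norm (x - y) / s ^ (n + 1)))"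

lemma sing_kelvin: "sing 1 kelvin"
 unfolding sing_def
proof (intro exI[of _ 1] conjI allI impI)
 fix x y :: "complex ^ 3" and s :: real assume s: "0 < s" "s <= norm x" "s <= norm y"
 then have "norm (kelvin x - kelvin y) = norm (x - y) / (norm x * norm y)" by (intro kelvin_dist) auto
 also have "... <= norm (x - y) / (s * s)"
  using s by (intro divide_left_mono mult_mono mult_pos_pos) auto
 finally show "norm (kelvin x - kelvin y) <= 1 * norm (x - y) / s ^ (1 + 1)" by simp
qed (simp_all add: norm_kelvin)

lemma sing_bilinear:
 fixes F :: "'a::real_normed_vector => 'b::real_normed_vector" and G :: "'a => 'c::real_normed_vector"
  and B :: "'b => 'c => 'd::real_normed_vector"
 assumes B: "bounded_bilinear B" and F: "sing m F" and G: "sing n G"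
 shows "sing (m + n) (%x. B (F x) (G x))"
proof -
 obtain K where K: "0 <= K" "!!a b. norm (B a b) <= norm a * norm b * K"
  using bounded_bilinear.nonneg_bounded[OF B] by auto
 obtain C where C: "0 <= C" "!!x. x ~= 0 ==> norm (F x) <= C / norm x ^ m"
  "!!x y s. 0 < s ==> s <= norm x ==> s <= norm y ==> norm (F x - F y) <= C * norm (x - y) / s ^ (m + 1)"
  using F unfolding sing_def by blast
 obtain E where E: "0 <= E" "!!x. x ~= 0 ==> norm (G x) <= E / norm x ^ n"
  "!!x y s. 0 < s ==> s <= norm x ==> s <= norm y ==> norm (G x - G y) <= E * norm (x - y) / s ^ (n + 1)"
  using G unfolding sing_def by blast
 show ?thesis unfolding sing_def
 proof (intro exI[of _ "2 * (C * E * K)"] conjI allI impI)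
  show "0 <= 2 * (C * E * K)" using C E K by simp
  fix x :: 'a assume x: "x ~= 0"
  have "norm (B (F x) (G x)) <= norm (F x) * norm (G x) * K" by (rule K)
  also have "... <= (C / norm x ^ m) * (E / norm x ^ n) * K"
   using C E K x by (intro mult_right_mono mult_mono) auto
  also have "... = 1 * (C * E * K) / norm x ^ (m + n)" by (simp add: power_add)
  also have "... <= 2 * (C * E * K) / norm x ^ (m + n)"
   using C E K by (intro divide_right_mono mult_right_mono) auto
  finally show "norm (B (F x) (G x)) <= 2 * (C * E * K) / norm x ^ (m + n)" .
 next
  fix x y :: 'a and s :: real assume s: "0 < s" "s <= norm x" "s <= norm y"
  have x: "x ~= 0" "y ~= 0" using s by auto
  have Fy: "norm (F y) <= C / s ^ m"
   by (rule order_trans[OF C(2)[OF x(2)]]) (use s C in \<open>intro divide_left_mono power_mono mult_pos_pos zero_less_power; auto\<close>)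
  have Gx: "norm (G x) <= E / s ^ n"
   by (rule order_trans[OF E(2)[OF x(1)]]) (use s E in \<open>intro divide_left_mono power_mono mult_pos_pos zero_less_power; auto\<close>)
  have "B (F x) (G x) - B (F y) (G y) = B (F x - F y) (G x) + B (F y) (G x - G y)"
   by (simp add: bounded_bilinear.diff_left[OF B] bounded_bilinear.diff_right[OF B])
  then have "norm (B (F x) (G x) - B (F y) (G y)) <= norm (F x - F y) * norm (G x) * K + norm (F y) * norm (G x - G y) * K"
   using norm_triangle_ineq[of "B (F x - F y) (G x)" "B (F y) (G x - G y)"] K(2)[of "F x - F y" "G x"] K(2)[of "F y" "G x - G y"] by simp
  also have "... <= (C * norm (x - y) / s ^ (m + 1)) * (E / s ^ n) * K + (C / s ^ m) * (E * norm (x - y) / s ^ (n + 1)) * K"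
   using C E K s Fy Gx by (intro add_mono mult_right_mono mult_mono) auto
  also have "... = 2 * (C * E * K) * norm (x - y) / s ^ (m + n + 1)"
   by (simp add: power_add field_simps)
  finally show "norm (B (F x) (G x) - B (F y) (G y)) <= 2 * (C * E * K) * norm (x - y) / s ^ (m + n + 1)" .
 qed
qed

text \<open>A linear map is treated as a bilinear one whose other argument is the constant 1, of
  order 0.\<close>

lemma sing_linear:
 fixes F :: "'a::real_normed_vector => 'b::real_normed_vector" and L :: "'b => 'c::real_normed_vector"
 assumes L: "bounded_linear L" and F: "sing m F"
 shows "sing m (%x. L (F x))"
proof -
 have B: "bounded_bilinear (%(r::real) y. r *\<^sub>R L y)"
  by (rule bounded_bilinear.comp[OF bounded_bilinear_scaleR bounded_linear_ident L])
 have "sing 0 (%x::'a. 1::real)" unfolding sing_def by (intro exI[of _ 1]) auto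
 from sing_bilinear[OF B this F] show ?thesis by simp
qed

lemma sing_add:
 fixes F :: "'a::real_normed_vector => 'b::real_normed_vector" and G :: "'a => 'b"
 assumes F: "sing m F" and G: "sing m G"
 shows "sing m (%x. F x + G x)"
proof -
 obtain C where C: "0 <= C" "!!x. x ~= 0 ==> norm (F x) <= C / norm x ^ m"
  "!!x y s. 0 < s ==> s <= norm x ==> s <= norm y ==> norm (F x - F y) <= C * norm (x - y) / s ^ (m + 1)"
  using F unfolding sing_def by blast
 obtain E where E: "0 <= E" "!!x. x ~= 0 ==> norm (G x) <= E / norm x ^ m"
  "!!x y s. 0 < s ==> s <= norm x ==> s <= norm y ==> norm (G x - G y) <= E * norm (x - y) / s ^ (m + 1)"
  using G unfolding sing_def by blast
 show ?thesis unfolding sing_def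
 proof (intro exI[of _ "C + E"] conjI allI impI)
  show "0 <= C + E" using C E by simp
  show "norm (F x + G x) <= (C + E) / norm x ^ m" if "x ~= 0" for x
   using norm_triangle_ineq[of "F x" "G x"] C(2)[OF that] E(2)[OF that] by (simp add: add_divide_distrib)
  fix x y :: 'a and s :: real assume s: "0 < s" "s <= norm x" "s <= norm y"
  have "F x + G x - (F y + G y) = (F x - F y) + (G x - G y)" by simp
  then have "norm (F x + G x - (F y + G y)) <= norm (F x - F y) + norm (G x - G y)"
   by (simp only: norm_triangle_ineq)
  also have "... <= C * norm (x - y) / s ^ (m + 1) + E * norm (x - y) / s ^ (m + 1)"
   by (intro add_mono C(3)[OF s] E(3)[OF s])
  finally show "norm (F x + G x - (F y + G y)) <= (C + E) * norm (x - y) / s ^ (m + 1)"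
   by (simp add: distrib_right add_divide_distrib)
 qed
qed

lemma sing_sum: "finite I ==> I ~= {} ==> (!!i. i \<in> I ==> sing m (F i)) ==> sing m (%x. \<Sum>i\<in>I. F i x)"
proof (induction I rule: finite_ne_induct)
 case (insert i I)
 then show ?case by (simp add: sing_add)
qed simp

lemma sing_isCont:
 fixes F :: "'a::real_normed_vector => 'b::real_normed_vector"
 assumes "sing m F"
 shows "continuous_on (- {0}) F"
proof -
 obtain C where C: "0 <= C"
  "!!x y s. 0 < s ==> s <= norm x ==> s <= norm y ==> norm (F x - F y) <= C * norm (x - y) / s ^ (m + 1)"
  using assms unfolding sing_def by blast
 have "isCont F x" if "x ~= 0" for x
 proof -
  define s where "s = norm x / 2"
  have s: "0 < s" "s <= norm x" using that by (auto simp: s_def)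
  have ev: "\<forall>\<^sub>F y in at x. dist (F y) (F x) <= C * dist y x / s ^ (m + 1)"
   unfolding eventually_at
  proof (intro exI[of _ s] conjI ballI impI)
   fix y assume "y ~= x \<and> dist y x < s"
   then have "s <= norm y" using norm_triangle_ineq2[of x y] by (simp add: s_def dist_norm norm_minus_commute)
   then show "dist (F y) (F x) <= C * dist y x / s ^ (m + 1)"
    using C(2)[OF s(1) _ s(2), of y] by (simp add: dist_norm)
  qed (rule s)
  have "((%y. C * dist y x / s ^ (m + 1)) \<longlongrightarrow> C * dist x x / s ^ (m + 1)) (at x)"
   by (intro tendsto_intros) (use s in auto)
  then have "((%y. dist (F y) (F x)) \<longlongrightarrow> 0) (at x)"
   by (intro tendsto_sandwich[OF _ ev tendsto_const]) auto
  then show ?thesis unfolding isCont_def by (rule tendsto_dist_iff[THEN iffD2])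
 qed
 then show ?thesis by (intro continuous_at_imp_continuous_on) auto
qed

section \<open>The Bochner-Martinelli form and its dbar derivative\<close>

lemma bounded_linear_form1: "bounded_linear form1"
proof (rule linear_conv_bounded_linear[THEN iffD1], rule linearI)
 show "form1 (x + y) = form1 x + form1 y" for x y
  by (simp add: form1_def vec_eq_iff algebra_simps sum.distrib)
 show "form1 (r *\<^sub>R x) = r *\<^sub>R form1 x" for r x
  by (simp add: form1_def vec_eq_iff scaleR_sum_right)
qed

definition bF :: "complex ^ 3 => ext" where
 "bF \<eta> = (1 / (2 * pi * \<i>)) *s form1 (kelvin \<eta>)"

text \<open>On the diagonal x = y = \<open>kelvin\<close> \<eta> this is the derivative of
  \<open>kelvin\<close> in the conjugate of \<eta>_j: a quadratic expression in
  \<open>kelvin\<close> and its conjugate. Written as a bilinear map, it gets its singularity of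
  order 2 without any estimate of derivatives.\<close>

definition kelvin_dbar :: "3 => complex ^ 3 => complex ^ 3 => complex ^ 3" where
 "kelvin_dbar j x y = (\<chi> k. (if k = j then \<Sum>l\<in>UNIV. x $ l * cnj (y $ l) else 0) - x $ k * cnj (y $ j))"

text \<open>b depends on \<zeta> - z alone, so its derivatives in the conjugates of \<zeta> and z
  are opposite, and the two kinds of generators occur as a difference.\<close>

definition dbF :: "complex ^ 3 => ext" where
 "dbF \<eta> = (\<Sum>j\<in>UNIV. (gform (Dzetabar j) - gform (Dzbar j)) \<^bold>\<and>
   ((1 / (2 * pi * \<i>)) *s form1 (kelvin_dbar j (kelvin \<eta>) (kelvin \<eta>))))"

text \<open>The only term of \<open>B_form\<close> with exactly two holomorphic
  differentials.\<close>

definition P1 :: "complex ^ 3 => ext" where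
 "P1 \<eta> = bF \<eta> \<^bold>\<and> dbF \<eta>"

lemma bounded_bilinear_kelvin_dbar: "bounded_bilinear (kelvin_dbar j)"
 unfolding bilinear_conv_bounded_bilinear[symmetric] bilinear_def
 by (intro conjI allI linearI)
  (auto simp: kelvin_dbar_def vec_eq_iff algebra_simps sum.distrib sum_distrib_left scaleR_conv_of_real[where 'a = complex])

lemma sing_bF: "sing 1 bF"
 unfolding bF_def[abs_def]
 by (intro sing_linear[OF bounded_linear_smult_right] sing_linear[OF bounded_linear_form1] sing_kelvin)

lemma sing_dbF: "sing 2 dbF"
proof -
 have "sing (1 + 1) (%\<eta>. kelvin_dbar j (kelvin \<eta>) (kelvin \<eta>))" for j
  by (intro sing_bilinear[OF bounded_bilinear_kelvin_dbar] sing_kelvin)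
 then show ?thesis
  unfolding dbF_def[abs_def]
  by (intro sing_sum sing_linear[OF bounded_bilinear.bounded_linear_right[OF bounded_bilinear_wedge]]
    sing_linear[OF bounded_linear_smult_right] sing_linear[OF bounded_linear_form1]) (auto simp: numeral_2_eq_2)
qed

lemma sing_P1: "sing 3 P1"
 unfolding P1_def[abs_def] using sing_bilinear[OF bounded_bilinear_wedge sing_bF sing_dbF] by (simp add: numeral_eq_Suc)

lemma b_form_eq: "b_form zt z = bF (zt - z)"
 by (simp add: b_form_def bF_def kelvin_def)

text \<open>Division by zero yields zero, so b is 0 on the diagonal, and the identities for the
  kernel can be checked there as well.\<close>

lemma kelvin_0 [simp]: "kelvin 0 = 0" by (simp add: vec_eq_iff)

lemma bF_0: "bF 0 = 0" by (simp add: bF_def form1_def)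

definition kelvin' :: "complex ^ 3 => complex ^ 3 => complex ^ 3" where
 "kelvin' \<eta> w = cv ((1 / (norm \<eta>)\<^sup>2) *\<^sub>R w - (2 * (\<eta> \<bullet> w) / (norm \<eta>) ^ 4) *\<^sub>R \<eta>)"

lemma kelvin_has_derivative:
 assumes "\<eta> ~= 0"
 shows "(kelvin has_derivative kelvin' \<eta>) (at \<eta>)"
proof -
 have "((%x. 1 / (x \<bullet> x)) has_derivative (%w. - (2 * (\<eta> \<bullet> w)) / (\<eta> \<bullet> \<eta>)\<^sup>2)) (at \<eta>)"
  using assms by (auto intro!: derivative_eq_intros simp: inner_commute field_simps power2_eq_square)
 then have "((%x. (1 / (x \<bullet> x)) *\<^sub>R x) has_derivative
   (%w. (1 / (\<eta> \<bullet> \<eta>)) *\<^sub>R w + (- (2 * (\<eta> \<bullet> w)) / (\<eta> \<bullet> \<eta>)\<^sup>2) *\<^sub>R \<eta>)) (at \<eta>)"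
  by (intro has_derivative_scaleR has_derivative_ident)
 from bounded_linear.has_derivative[OF bounded_linear_cv this]
 have "((%x. cv ((1 / (norm x)\<^sup>2) *\<^sub>R x)) has_derivative kelvin' \<eta>) (at \<eta>)"
  unfolding power2_norm_eq_inner kelvin'_def
  by (simp add: power2_norm_eq_inner[symmetric] power_mult[symmetric])
 then show ?thesis unfolding kelvin_eq[abs_def] .
qed

lemma kelvin_wirtinger:
 assumes "\<eta> ~= 0"
 shows "(1/2) *s (kelvin' \<eta> (axis j 1) + \<i> *s kelvin' \<eta> (axis j \<i>)) = kelvin_dbar j (kelvin \<eta>) (kelvin \<eta>)"
proof -
 define r where "r = complex_of_real ((norm \<eta>)\<^sup>2)"
 have r: "r ~= 0" using assms by (simp add: r_def)
 have i1: "complex_of_real (\<eta> \<bullet> axis j 1) + \<i> * complex_of_real (\<eta> \<bullet> axis j \<i>) = \<eta> $ j"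
  by (simp add: inner_axis inner_complex_def complex_eq_iff)
 have r4: "complex_of_real ((norm \<eta>) ^ 4) = r * r" by (simp add: r_def power2_eq_square power4_eq_xxxx)
 have rs: "r = (\<Sum>l\<in>UNIV. \<eta> $ l * cnj (\<eta> $ l))"
  unfolding r_def norm_vec3_sq sum_3 of_real_add complex_norm_square ..
 have k: "kelvin' \<eta> w $ k = cnj (w $ k) / r - 2 * complex_of_real (\<eta> \<bullet> w) * cnj (\<eta> $ k) / (r * r)" for w k
  unfolding kelvin'_def r4[symmetric] r_def
  by (simp add: scaleR_conv_of_real[where 'a = complex] divide_inverse mult_ac)
 have "((1/2) *s (kelvin' \<eta> (axis j 1) + \<i> *s kelvin' \<eta> (axis j \<i>))) $ k =
  (cnj (axis j 1 $ k) + \<i> * cnj (axis j \<i> $ k)) / (2 * r)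
   - (complex_of_real (\<eta> \<bullet> axis j 1) + \<i> * complex_of_real (\<eta> \<bullet> axis j \<i>)) * cnj (\<eta> $ k) / (r * r)" for k
  using r by (simp add: k field_simps)
 also have "... k = (if k = j then 1 / r else 0) - \<eta> $ j * cnj (\<eta> $ k) / (r * r)" for k
  unfolding i1 by (simp add: axis_def)
 also have "... k = kelvin_dbar j (kelvin \<eta>) (kelvin \<eta>) $ k" for k
 proof -
  have kk: "kelvin \<eta> $ l * cnj (kelvin \<eta> $ m) = \<eta> $ m * cnj (\<eta> $ l) / (r * r)" for l m
   by (simp add: r_def mult.commute)
  have "(\<Sum>l\<in>UNIV. kelvin \<eta> $ l * cnj (kelvin \<eta> $ l)) = r / (r * r)"
   unfolding kk by (simp only: sum_divide_distrib[symmetric] rs[symmetric])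
  then show ?thesis
   unfolding kelvin_dbar_def vec_lambda_beta kk using r by simp
 qed
 finally show ?thesis by (simp add: vec_eq_iff)
qed

lemma wirtinger_linear:
 assumes L: "bounded_linear L" "!!c x. L (c *s x) = c *s L x" and F: "(F has_derivative F') (at x)"
 shows "wirtinger_bar (%x. L (F x)) x j = L ((1/2) *s (F' (axis j 1) + \<i> *s F' (axis j \<i>)))"
proof -
 have "((%x. L (F x)) has_derivative (%v. L (F' v))) (at x)"
  by (rule bounded_linear.has_derivative[OF L(1) F])
 then have "frechet_derivative (%x. L (F x)) (at x) = (%v. L (F' v))"
  using frechet_derivative_at by metis
 then show ?thesis
  by (simp add: wirtinger_bar_def L(2) linear_add[OF bounded_linear.linear[OF L(1)]])
qed

lemma form1_smult: "form1 (c *s x) = c *s form1 x"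
 by (simp add: form1_def vec_eq_iff sum_distrib_left algebra_simps)

lemma dbar_b_form:
 assumes "zt ~= z"
 shows "dbar b_form zt z = dbF (zt - z)"
proof -
 define L where "L x = (1 / (2 * pi * \<i>)) *s form1 x" for x
 have L: "bounded_linear L" "L (c *s x) = c *s L x" for c x
  unfolding L_def using bounded_linear_compose[OF bounded_linear_smult_right bounded_linear_form1]
  by (auto simp: form1_smult vec_eq_iff)
 have e: "zt - z ~= 0" using assms by simp
 have s1: "((%\<xi>. \<xi> - z) has_derivative (%w. w)) (at zt)" and s2: "((%w. zt - w) has_derivative (%w. - w)) (at z)"
  by (auto intro!: derivative_eq_intros)
 have d1: "((%\<xi>. kelvin (\<xi> - z)) has_derivative (%w. kelvin' (zt - z) w)) (at zt)"
  by (rule has_derivative_compose[OF s1]) (rule kelvin_has_derivative[OF e])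
 have d2: "((%w. kelvin (zt - w)) has_derivative (%w. kelvin' (zt - z) (- w))) (at z)"
  by (rule has_derivative_compose[OF s2]) (rule kelvin_has_derivative[OF e])
 have neg: "kelvin' (zt - z) (- w) = - kelvin' (zt - z) w" for w
  using linear_neg[OF has_derivative_linear[OF kelvin_has_derivative[OF e]]] by simp
 have w1: "wirtinger_bar (%\<xi>. b_form \<xi> z) zt j = L (kelvin_dbar j (kelvin (zt - z)) (kelvin (zt - z)))" for j
  unfolding b_form_eq bF_def L_def[symmetric] wirtinger_linear[OF L d1] kelvin_wirtinger[OF e] ..
 have w2: "wirtinger_bar (%w. b_form zt w) z j = - L (kelvin_dbar j (kelvin (zt - z)) (kelvin (zt - z)))" for j
 proof -
  have "wirtinger_bar (%w. b_form zt w) z j = L (- ((1/2) *s (kelvin' (zt - z) (axis j 1) + \<i> *s kelvin' (zt - z) (axis j \<i>))))"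
   unfolding b_form_eq bF_def L_def[symmetric] wirtinger_linear[OF L d2] neg
   by (rule arg_cong[where f = L]) (simp add: vec_eq_iff)
  then show ?thesis unfolding kelvin_wirtinger[OF e] using linear_neg[OF bounded_linear.linear[OF L(1)]] by simp
 qed
 have "gform (Dzbar j) \<^bold>\<and> (- a) = - (gform (Dzbar j) \<^bold>\<and> a)" for a j
  using wedge_smult_right[of "gform (Dzbar j)" "-1" a] by simp
 then show ?thesis
  unfolding dbar_def w1 w2 dbF_def L_def[symmetric] wedge_diff_left by simp
qed

section \<open>Degrees of the parts of the kernel\<close>

lemma degr_bF: "degr 1 1 (bF \<eta>)"
 unfolding bF_def by (intro degr_smult degr_form1)

lemma degr_dbF: "degr 1 2 (dbF \<eta>)"
proof -
 have "degr (0 + 1) (1 + 1) ((gform (Dzetabar j) - gform (Dzbar j)) \<^bold>\<and> ((1 / (2 * pi * \<i>)) *s form1 x))" for j x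
  by (intro degr_wedge degr_diff degr_gform degr_smult degr_form1)
 then show ?thesis unfolding dbF_def by (intro degr_sum) (simp add: numeral_2_eq_2)
qed

lemma degr_dbar_form1:
 assumes "(%\<xi>. c \<xi> z) differentiable (at zt)" "(%w. c zt w) differentiable (at z)"
 shows "degr 1 2 (dbar (%\<xi> w. form1 (c \<xi> w)) zt z)"
proof -
 obtain A B where A: "((%\<xi>. c \<xi> z) has_derivative A) (at zt)" and B: "((%w. c zt w) has_derivative B) (at z)"
  using assms unfolding differentiable_def by blast
 have "degr (0 + 1) (1 + 1) (gform (Dzetabar j) \<^bold>\<and> form1 x + gform (Dzbar j) \<^bold>\<and> form1 y)" for j x y
  by (intro degr_wedge degr_add degr_gform degr_form1)
 then show ?thesis
  unfolding dbar_def wirtinger_linear[OF bounded_linear_form1 form1_smult A] wirtinger_linear[OF bounded_linear_form1 form1_smult B]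
  by (intro degr_sum) (simp add: numeral_2_eq_2)
qed

definition dcut :: "(complex ^ 3 => real) => complex ^ 3 => ext" where
 "dcut c zt = (\<Sum>j\<in>UNIV. gform (Dzetabar j) \<^bold>\<and>
   scal ((of_real (frechet_derivative c (at zt) (axis j 1)) + \<i> * of_real (frechet_derivative c (at zt) (axis j \<i>))) / 2))"

lemma bounded_linear_scal: "bounded_linear (%x. scal (of_real x))"
 by (rule linear_conv_bounded_linear[THEN iffD1])
  (auto intro!: linearI simp: scal_def vec_eq_iff axis_def scaleR_conv_of_real[where 'a = complex])

lemma dbar_cut_form:
 assumes "c differentiable (at zt)"
 shows "dbar (cut_form c) zt z = dcut c zt"
proof -
 have d: "(c has_derivative frechet_derivative c (at zt)) (at zt)"
  using assms frechet_derivative_works by blast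
 have "((%\<xi>. scal (of_real (c \<xi>))) has_derivative (%v. scal (of_real (frechet_derivative c (at zt) v)))) (at zt)"
  by (rule bounded_linear.has_derivative[OF bounded_linear_scal d])
 then have 1: "frechet_derivative (%\<xi>. scal (of_real (c \<xi>))) (at zt) = (%v. scal (of_real (frechet_derivative c (at zt) v)))"
  using frechet_derivative_at by metis
 have 2: "frechet_derivative (%w. scal (of_real (c zt))) (at z) = (%v. 0)"
  using frechet_derivative_const by metis
 have "wirtinger_bar (%\<xi>. cut_form c \<xi> z) zt j =
  scal ((of_real (frechet_derivative c (at zt) (axis j 1)) + \<i> * of_real (frechet_derivative c (at zt) (axis j \<i>))) / 2)" for j
  unfolding wirtinger_bar_def cut_form_def 1 by (simp add: scal_def vec_eq_iff axis_def)
 moreover have "wirtinger_bar (%w. cut_form c zt w) z j = 0" for j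
  unfolding wirtinger_bar_def cut_form_def 2 by (simp add: vec_eq_iff)
 ultimately show ?thesis by (simp add: dbar_def dcut_def)
qed

lemma degr_dcut: "degr 0 1 (dcut c zt)"
proof -
 have "degr (0 + 0) (1 + 0) (gform (Dzetabar j) \<^bold>\<and> scal x)" for j x
  by (intro degr_wedge degr_gform degr_scal)
 then show ?thesis unfolding dcut_def by (intro degr_sum) simp
qed

text \<open>What remains of g \<and> B in holomorphic degree 2. The term with the cutoff derivative
  has a singularity of order 1 only, against order 3 of the first term.\<close>

definition Pker :: "(complex ^ 3 => real) => (complex ^ 3 => complex ^ 3 => complex ^ 3) => complex ^ 3 => complex ^ 3 => ext" where
 "Pker c s zt z = of_real (c zt) *s P1 (zt - z) - (dcut c zt \<^bold>\<and> form1 (s zt z)) \<^bold>\<and> bF (zt - z)"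

lemma bideg_hol_zero [simp]: "bideg_hol k 0 = 0"
 by (simp add: bideg_hol_def vec_eq_iff)

text \<open>Only the terms of bidegree (2,1) of \<open>g \<and> B\<close> survive; all other terms have the wrong number of
 holomorphic differentials.\<close>

lemma bideg_hol_g_B:
 assumes c: "c differentiable (at zt)"
  and s: "dcut c zt ~= 0 ==> (%\<xi>. s \<xi> z) differentiable (at zt) \<and> (%w. s zt w) differentiable (at z)"
 shows "bideg_hol 2 (g_form c s zt z \<^bold>\<and> B_form zt z) = Pker c s zt z"
proof (cases "zt = z")
 case True
 then have "B_form zt z = 0" by (simp add: B_form_def geometric_def b_form_eq bF_0)
 then show ?thesis using True by (simp add: Pker_def P1_def bF_0)
next
 case False
 define b where "b = bF (zt - z)" define b' where "b' = dbF (zt - z)"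
 define a where "a = form1 (s zt z)" define a' where "a' = dbar (%\<xi> w. form1 (s \<xi> w)) zt z"
 define \<delta> where "\<delta> = dcut c zt" define \<gamma> where "\<gamma> = scal (of_real (c zt))"
 have B: "B_form zt z = b + b \<^bold>\<and> b' + b \<^bold>\<and> b' \<^bold>\<and> b'"
  unfolding B_form_def geometric_def b_form_eq dbar_b_form[OF False] b_def b'_def by simp
 have db: "degr 1 1 b" "degr 1 2 b'" unfolding b_def b'_def by (rule degr_bF degr_dbF)+
 have dB: "degr 2 3 (b \<^bold>\<and> b')" "degr 3 5 (b \<^bold>\<and> b' \<^bold>\<and> b')"
  using degr_wedge[OF db] degr_wedge[OF db(1) degr_wedge[OF db(2,2)]] by (simp_all add: numeral_eq_Suc)
 have d0: "degr 0 0 \<gamma>" unfolding \<gamma>_def by (rule degr_scal)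
 have dd: "degr 0 1 \<delta>" unfolding \<delta>_def by (rule degr_dcut)
 have G: "g_form c s zt z = \<gamma> - \<delta> \<^bold>\<and> (a + a \<^bold>\<and> a' + a \<^bold>\<and> a' \<^bold>\<and> a')"
  unfolding g_form_def dbar_cut_form[OF c] geometric_def cut_form_def \<gamma>_def \<delta>_def a_def a'_def ..
 have fin: "Pker c s zt z = \<gamma> \<^bold>\<and> (b \<^bold>\<and> b') - (\<delta> \<^bold>\<and> a) \<^bold>\<and> b"
  unfolding Pker_def P1_def \<gamma>_def scal_wedge b_def b'_def \<delta>_def a_def ..
 have g1: "bideg_hol 2 (\<gamma> \<^bold>\<and> B_form zt z) = \<gamma> \<^bold>\<and> (b \<^bold>\<and> b')"
  unfolding B wedge_add_right bideg_hol_add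
  using bideg_hol_degr[OF degr_wedge[OF d0 db(1)], of 2] bideg_hol_degr[OF degr_wedge[OF d0 dB(1)], of 2]
   bideg_hol_degr[OF degr_wedge[OF d0 dB(2)], of 2] by simp
 show ?thesis
 proof (cases "\<delta> = 0")
  case True
  then show ?thesis using g1 unfolding G fin by simp
 next
  case nz: False
  have da: "degr 1 1 a" "degr 1 2 a'"
  proof -
   show "degr 1 1 a" unfolding a_def by (rule degr_form1)
   show "degr 1 2 a'" unfolding a'_def
    by (rule degr_dbar_form1) (use s nz in \<open>auto simp: \<delta>_def\<close>)
  qed
  have d1: "degr 1 2 (\<delta> \<^bold>\<and> a)" using degr_wedge[OF dd da(1)] by (simp add: numeral_eq_Suc)
  have d2: "degr 2 4 (\<delta> \<^bold>\<and> (a \<^bold>\<and> a'))"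
   using degr_wedge[OF dd degr_wedge[OF da]] by (simp add: numeral_eq_Suc)
  have d3: "degr 3 6 (\<delta> \<^bold>\<and> (a \<^bold>\<and> a' \<^bold>\<and> a'))"
   using degr_wedge[OF dd degr_wedge[OF da(1) degr_wedge[OF da(2,2)]]] by (simp add: numeral_eq_Suc)
  have z: "bideg_hol 2 (x \<^bold>\<and> y) = 0" if "degr i k x" "degr i' k' y" "i + i' ~= 2" for x y i k i' k'
   using bideg_hol_degr[OF degr_wedge[OF that(1,2)], of 2] that(3) by simp
  have "bideg_hol 2 ((\<delta> \<^bold>\<and> a) \<^bold>\<and> b) = (\<delta> \<^bold>\<and> a) \<^bold>\<and> b"
   using bideg_hol_degr[OF degr_wedge[OF d1 db(1)], of 2] by simp
  moreover have "bideg_hol 2 ((\<delta> \<^bold>\<and> a) \<^bold>\<and> (b \<^bold>\<and> b')) = 0" by (rule z[OF d1 dB(1)]) simp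
  moreover have "bideg_hol 2 ((\<delta> \<^bold>\<and> a) \<^bold>\<and> (b \<^bold>\<and> b' \<^bold>\<and> b')) = 0" by (rule z[OF d1 dB(2)]) simp
  moreover have "bideg_hol 2 ((\<delta> \<^bold>\<and> (a \<^bold>\<and> a')) \<^bold>\<and> b) = 0" by (rule z[OF d2 db(1)]) simp
  moreover have "bideg_hol 2 ((\<delta> \<^bold>\<and> (a \<^bold>\<and> a')) \<^bold>\<and> (b \<^bold>\<and> b')) = 0" by (rule z[OF d2 dB(1)]) simp
  moreover have "bideg_hol 2 ((\<delta> \<^bold>\<and> (a \<^bold>\<and> a')) \<^bold>\<and> (b \<^bold>\<and> b' \<^bold>\<and> b')) = 0" by (rule z[OF d2 dB(2)]) simp
  moreover have "bideg_hol 2 ((\<delta> \<^bold>\<and> (a \<^bold>\<and> a' \<^bold>\<and> a')) \<^bold>\<and> b) = 0" by (rule z[OF d3 db(1)]) simp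
  moreover have "bideg_hol 2 ((\<delta> \<^bold>\<and> (a \<^bold>\<and> a' \<^bold>\<and> a')) \<^bold>\<and> (b \<^bold>\<and> b')) = 0" by (rule z[OF d3 dB(1)]) simp
  moreover have "bideg_hol 2 ((\<delta> \<^bold>\<and> (a \<^bold>\<and> a' \<^bold>\<and> a')) \<^bold>\<and> (b \<^bold>\<and> b' \<^bold>\<and> b')) = 0" by (rule z[OF d3 dB(2)]) simp
  ultimately have "bideg_hol 2 ((\<delta> \<^bold>\<and> (a + a \<^bold>\<and> a' + a \<^bold>\<and> a' \<^bold>\<and> a')) \<^bold>\<and> B_form zt z) = (\<delta> \<^bold>\<and> a) \<^bold>\<and> b"
   unfolding B by (simp only: wedge_add_right wedge_add_left bideg_hol_add) simp
  then show ?thesis using g1 unfolding G fin wedge_diff_left bideg_hol_diff by simp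
 qed
qed

lemma bounded_linear_divide_dzeta: "bounded_linear divide_dzeta"
 by (rule linear_conv_bounded_linear[THEN iffD1])
  (auto intro!: linearI simp: divide_dzeta_def vec_eq_iff)

lemma degr_divide_dzeta:
 assumes "degr 3 k a"
 shows "degr 0 (k - 3) (divide_dzeta a)"
 unfolding degr_def
proof (intro allI impI)
 fix S assume "divide_dzeta a $ S ~= 0"
 then have S: "S Int range Dzeta = {}" "a $ (range Dzeta \<union> S) ~= 0" by (auto simp: divide_dzeta_def split: if_splits)
 have "card (range Dzeta \<union> S) = card (range Dzeta) + card S" using S(1) by (intro card_Un_disjoint) auto
 moreover have "card (range Dzeta) = 3" by (subst card_image) (auto intro: inj_onI)
 ultimately show "card (S Int range Dzeta) = 0 \<and> card S = k - 3"
  using degrD[OF assms S(2)] S(1) by simp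
qed

section \<open>Integral estimates\<close>

lemma dyadic_scale:
 fixes t :: real
 assumes "0 < t" "t < 1"
 obtains n :: nat where "(1/2) ^ Suc n <= t" "t < (1/2) ^ n"
proof -
 obtain m where m: "(1/2::real) ^ m < t" using real_arch_pow_inv[OF assms(1), of "1/2"] by auto
 define k where "k = (LEAST m. (1/2::real) ^ m <= t)"
 have k: "(1/2) ^ k <= t" unfolding k_def by (rule LeastI[of _ m]) (use m in simp)
 then have "k ~= 0" using assms(2) by (intro notI) simp
 then obtain n where n: "k = Suc n" using not0_implies_Suc by blast
 have "\<not> (1/2) ^ n <= t" using not_less_Least[of n "%m. (1/2::real) ^ m <= t"] n by (simp add: k_def)
 then show ?thesis using that[of n] k n by simp
qed

text \<open>Dyadic shells: where 2^(-n-1) \<le> |x - z| < 2^(-n), the integrand is at most 2^((n+1)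
  a) and the mass at most C 2^(-4 n), so the series is geometric with ratio 2^(a - 4). The bound is
  uniform in z, which need not lie in S.\<close>

lemma nn_integral_riesz_bound:
 fixes \<mu> :: "'a::euclidean_space measure"
 assumes id: "(%x. x) \<in> borel_measurable \<mu>" and S: "S \<in> sets \<mu>"
  and growth: "!!z r. 0 < r ==> emeasure \<mu> (S Int ball z r) <= ennreal (C * r ^ 4)"
  and tot: "emeasure \<mu> S <= ennreal C" and C: "0 <= C" and a: "0 <= a" "a < 4"
 shows "EX B>=0. ALL z. (\<integral>\<^sup>+x\<in>S. ennreal (norm (x - z) powr (- a)) \<partial>\<mu>) <= ennreal B"
proof -
 define c where "c n = (2::real) powr ((real n + 1) * a)" for n :: nat
 define x0 where "x0 = (2::real) powr (a - 4)"
 have x0: "0 < x0" "x0 < 1" using a(2) by (auto simp: x0_def powr_less_one)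
 have geo: "c n * (C * ((1/2) ^ n) ^ 4) = C * 2 powr a * x0 ^ n" for n
 proof -
  have "((1/2::real) ^ n) ^ 4 = 2 powr (- 4 * real n)"
   by (simp add: powr_minus powr_realpow[symmetric] power_mult[symmetric] power_one_over inverse_eq_divide powr_powr mult.commute)
  moreover have "x0 ^ n = 2 powr ((a - 4) * real n)"
   using x0 by (simp add: x0_def powr_realpow[symmetric] powr_powr)
  ultimately show ?thesis
   by (simp add: c_def powr_add[symmetric] algebra_simps)
 qed
 define B where "B = C + (\<Sum>n. C * 2 powr a * x0 ^ n)"
 have sumb: "summable (%n. C * 2 powr a * x0 ^ n)" using x0 by (intro summable_mult summable_geometric) auto
 have B0: "0 <= (\<Sum>n. C * 2 powr a * x0 ^ n)" using C x0 by (intro suminf_nonneg[OF sumb]) auto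
 have bm: "S Int ball z r \<in> sets \<mu>" for z r
 proof -
  have "(%x. x) -` ball z r Int space \<mu> \<in> sets \<mu>" by (rule measurable_sets[OF id]) simp
  moreover have "S Int ball z r = S Int ((%x. x) -` ball z r Int space \<mu>)" using sets.sets_into_space[OF S] by auto
  ultimately show ?thesis using S by (metis sets.Int)
 qed
 have "(\<integral>\<^sup>+x\<in>S. ennreal (norm (x - z) powr (- a)) \<partial>\<mu>) <= ennreal B" for z
 proof -
  have pw: "ennreal (norm (x - z) powr (- a)) * indicator S x <=
    indicator S x + (\<Sum>n. ennreal (c n) * indicator (S Int ball z ((1/2) ^ n)) x)" for x
  proof (cases "x \<in> S \<and> x ~= z \<and> norm (x - z) < 1")
   case True
   then have t: "0 < norm (x - z)" "norm (x - z) < 1" by auto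
   obtain n where n: "(1/2) ^ Suc n <= norm (x - z)" "norm (x - z) < (1/2) ^ n" using dyadic_scale[OF t] .
   have "norm (x - z) powr (- a) <= ((1/2) ^ Suc n) powr (- a)"
    using n(1) a by (intro powr_mono2') auto
   also have "... = c n"
    by (simp add: c_def powr_minus powr_realpow[symmetric] powr_powr power_one_over powr_divide field_simps del: power_Suc)
   finally have "ennreal (norm (x - z) powr (- a)) * indicator S x <= ennreal (c n) * indicator (S Int ball z ((1/2) ^ n)) x"
    using n(2) True by (auto simp: ennreal_leI dist_norm norm_minus_commute)
   also have "... <= (\<Sum>n. ennreal (c n) * indicator (S Int ball z ((1/2) ^ n)) x)"
   proof -
    define F where "F n = ennreal (c n) * indicator (S Int ball z ((1/2) ^ n)) x" for n
    have "F n <= (\<Sum>n. F n)" using sum_le_suminf[of F "{n}"] by simp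
    then show ?thesis unfolding F_def .
   qed
   also have "... <= indicator S x + (\<Sum>n. ennreal (c n) * indicator (S Int ball z ((1/2) ^ n)) x)" by simp
   finally show ?thesis .
  next
   \<comment> \<open>Either x is outside S, or |x - z| \<ge> 1 and the power is at most 1, or x = z,
     where \<open>powr\<close> with base 0 is 0.\<close>
   case False
   then have "ennreal (norm (x - z) powr (- a)) * indicator S x <= indicator S x"
    using a(1) powr_mono2'[of "- a" 1 "norm (x - z)"] by (auto simp: indicator_def)
   then show ?thesis by (rule order_trans) simp
  qed
  have "(\<integral>\<^sup>+x\<in>S. ennreal (norm (x - z) powr (- a)) \<partial>\<mu>) <=
    (\<integral>\<^sup>+x. indicator S x + (\<Sum>n. ennreal (c n) * indicator (S Int ball z ((1/2) ^ n)) x) \<partial>\<mu>)"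
   by (rule nn_integral_mono) (rule pw)
  also have "... = emeasure \<mu> S + (\<Sum>n. ennreal (c n) * emeasure \<mu> (S Int ball z ((1/2) ^ n)))"
   using S bm by (subst nn_integral_add) (auto simp: nn_integral_suminf nn_integral_cmult_indicator intro!: borel_measurable_suminf_order)
  also have "... <= ennreal C + (\<Sum>n. ennreal (C * 2 powr a * x0 ^ n))"
  proof (rule add_mono[OF tot], rule suminf_le)
   fix n
   have "ennreal (c n) * emeasure \<mu> (S Int ball z ((1/2) ^ n)) <= ennreal (c n) * ennreal (C * ((1/2) ^ n) ^ 4)"
    by (intro mult_left_mono growth) auto
   also have "... = ennreal (C * 2 powr a * x0 ^ n)"
    using C by (subst ennreal_mult''[symmetric]) (simp_all add: geo)
   finally show "ennreal (c n) * emeasure \<mu> (S Int ball z ((1/2) ^ n)) <= ennreal (C * 2 powr a * x0 ^ n)" .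
  qed auto
  also have "(\<Sum>n. ennreal (C * 2 powr a * x0 ^ n)) = ennreal (\<Sum>n. C * 2 powr a * x0 ^ n)"
   using sumb C x0 by (intro suminf_ennreal2) auto
  also have "ennreal C + ennreal (\<Sum>n. C * 2 powr a * x0 ^ n) = ennreal B"
   using C B0 by (simp add: B_def)
  finally show ?thesis .
 qed
 moreover have "0 <= B" using C B0 by (simp add: B_def)
 ultimately show ?thesis by blast
qed

section \<open>Hoelder's inequality\<close>

lemma young_simple:
 fixes a b :: real
 assumes "1 < p" "0 <= a" "0 <= b"
 shows "a * b <= a powr p + b powr (p / (p - 1))"
proof -
 have q: "1 < p / (p - 1)" "1 / p + 1 / (p / (p - 1)) = 1" using assms(1) by (auto simp: field_simps)
 have "a * b <= a powr p / p + b powr (p / (p - 1)) / (p / (p - 1))"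
  by (rule Youngs_inequality[OF assms(1) q assms(2,3)])
 also have "... <= a powr p / 1 + b powr (p / (p - 1)) / 1"
  using assms(1) q by (intro add_mono divide_left_mono) auto
 finally show ?thesis by simp
qed

text \<open>Hoelder with a loss of 2^p: Young's inequality for the factors t g and h/t, with t
  balancing the two terms. The positive power of A in the conclusion is what later turns a small
  bound for g into a small operator norm.\<close>

lemma nn_integral_holder:
 fixes g h :: "'a => real"
 assumes m: "g \<in> borel_measurable \<mu>" "h \<in> borel_measurable \<mu>" and nn: "!!x. 0 <= g x" "!!x. 0 <= h x"
  and p: "1 < p" and A: "0 < A" "(\<integral>\<^sup>+x. ennreal (g x powr (p / (p - 1))) \<partial>\<mu>) <= ennreal A"
  and H: "0 <= H" "(\<integral>\<^sup>+x. ennreal (h x powr p) \<partial>\<mu>) <= ennreal H"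
 shows "(\<integral>\<^sup>+x. ennreal (g x * h x) \<partial>\<mu>) < \<infinity>"
  and "enn2real (\<integral>\<^sup>+x. ennreal (g x * h x) \<partial>\<mu>) powr p <= 2 powr p * A powr (p - 1) * H"
proof -
 define p' where "p' = p / (p - 1)"
 have p': "1 < p'" "p' > 0" using p by (auto simp: p'_def field_simps)
 have p'eq: "p' / (p' - 1) = p" "p' * (p - 1) = p" using p by (auto simp: p'_def field_simps)
 define I where "I = (\<integral>\<^sup>+x. ennreal (g x * h x) \<partial>\<mu>)"
 have key: "I <= ennreal (t powr p' * A + t powr (- p) * H)" if t: "0 < t" for t
 proof -
  have "g x * h x <= t powr p' * g x powr p' + t powr (- p) * h x powr p" for x
  proof -
   have "g x * h x = (t * g x) * (h x / t)" using t by simp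
   also have "... <= (t * g x) powr p' + (h x / t) powr (p' / (p' - 1))"
    using p' nn t by (intro young_simple) auto
   also have "... = t powr p' * g x powr p' + t powr (- p) * h x powr p"
   proof -
    have "(h x / t) powr p = t powr (- p) * h x powr p"
     using t nn by (subst powr_divide) (auto simp: powr_minus field_simps)
    then show ?thesis unfolding p'eq using t nn by (simp add: powr_mult)
   qed
   finally show ?thesis .
  qed
  then have "I <= (\<integral>\<^sup>+x. ennreal (t powr p' * g x powr p' + t powr (- p) * h x powr p) \<partial>\<mu>)"
   unfolding I_def by (intro nn_integral_mono ennreal_leI)
  also have "... = (\<integral>\<^sup>+x. ennreal (t powr p') * ennreal (g x powr p') + ennreal (t powr (- p)) * ennreal (h x powr p) \<partial>\<mu>)"
   by (simp add: ennreal_mult)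
  also have "... = ennreal (t powr p') * (\<integral>\<^sup>+x. ennreal (g x powr p') \<partial>\<mu>) + ennreal (t powr (- p)) * (\<integral>\<^sup>+x. ennreal (h x powr p) \<partial>\<mu>)"
   using m by (simp add: nn_integral_add nn_integral_cmult)
  also have "... <= ennreal (t powr p') * ennreal A + ennreal (t powr (- p)) * ennreal H"
   using A H by (intro add_mono mult_left_mono) (auto simp: p'_def)
  also have "... = ennreal (t powr p' * A + t powr (- p) * H)"
   using A H by (simp add: ennreal_mult)
  finally show ?thesis .
 qed
 have fin: "I < \<infinity>" using key[of 1] by (simp add: less_top[symmetric] top_unique) (metis ennreal_less_top le_less_trans less_irrefl)
 then show "(\<integral>\<^sup>+x. ennreal (g x * h x) \<partial>\<mu>) < \<infinity>" by (simp add: I_def)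
 have real: "enn2real I <= t powr p' * A + t powr (- p) * H" if "0 < t" for t
  using key[OF that] A H by (intro enn2real_leI) auto
 \<comment> \<open>H may be 0, and the optimal t would then be 0 too; e keeps it positive and is
   removed by letting it tend to 0.\<close>
 have *: "enn2real I powr p <= 2 powr p * A powr (p - 1) * (H + e)" if e: "0 < e" for e
 proof -
  define h where "h = H + e"
  have h: "0 < h" using H e by (simp add: h_def)
  \<comment> \<open>With h in place of H, this value makes the two terms of \<open>real\<close>
    equal.\<close>
  define t where "t = (h / A) powr (1 / (p * p'))"
  have t: "0 < t" using h A by (simp add: t_def)
  have e1: "t powr p' * A = h powr (1 / p) * A powr (1 - 1 / p)"
   using h A p p' by (simp add: t_def powr_powr powr_divide powr_diff)
  have pp: "1 / p' = 1 - 1 / p" using p by (simp add: p'_def field_simps)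
  have e2: "t powr (- p) * h = h powr (1 / p) * A powr (1 - 1 / p)"
  proof -
   have pd: "(h / A) powr (- b) = h powr (- b) * A powr b" for b
    using h A by (subst powr_divide) (auto simp: powr_minus field_simps)
   have "t powr (- p) = (h / A) powr (- (1 / p'))" using p p' by (simp add: t_def powr_powr)
   also have "... = h powr (- (1 - 1 / p)) * A powr (1 - 1 / p)"
    unfolding pp by (rule pd)
   finally have "t powr (- p) * h = h powr (- (1 - 1 / p)) * h powr 1 * A powr (1 - 1 / p)" using h by simp
   then show ?thesis unfolding powr_add[symmetric] by simp
  qed
  have "enn2real I <= t powr p' * A + t powr (- p) * h"
  proof -
   have "t powr (- p) * H <= t powr (- p) * h" using e by (intro mult_left_mono) (auto simp: h_def)
   then show ?thesis using real[OF t] by linarith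
  qed
  also have "... = 2 * (h powr (1 / p) * A powr (1 - 1 / p))" unfolding e1 e2 by simp
  finally have "enn2real I powr p <= (2 * (h powr (1 / p) * A powr (1 - 1 / p))) powr p"
   using p by (intro powr_mono2) auto
  also have "... = 2 powr p * (h * A powr (p - 1))"
   using h A p by (simp add: powr_mult powr_powr) (simp add: left_diff_distrib)
  finally show ?thesis by (simp add: h_def mult_ac)
 qed
 define K where "K = 2 powr p * A powr (p - 1)"
 have K: "0 < K" using A by (simp add: K_def)
 have "enn2real I powr p <= K * H"
 proof (rule field_le_epsilon)
  fix e :: real assume "0 < e"
  then have "enn2real I powr p <= K * (H + e / K)" using *[of "e / K"] K by (simp add: K_def)
  then show "enn2real I powr p <= K * H + e" using K by (simp add: distrib_left)
 qed
 then show "enn2real (\<integral>\<^sup>+x. ennreal (g x * h x) \<partial>\<mu>) powr p <= 2 powr p * A powr (p - 1) * H"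
  by (simp add: I_def K_def)
qed

text \<open>The data of the integral estimates: \<mu> for the variable of integration, considered on
  S, and \<nu> for the variable of the result, both with growth r^4, and a weight W that lies in
  L^q1 for every q1 < q.\<close>

locale riesz =
 fixes \<mu> \<nu> :: "(complex ^ 3) measure" and S :: "(complex ^ 3) set" and W :: "complex ^ 3 => real" and C q :: real
 assumes \<mu>: "sigma_finite_measure \<mu>" and \<nu>: "finite_measure \<nu>"
  and id_\<mu>: "(%x. x) \<in> borel_measurable \<mu>" and id_\<nu>: "(%x. x) \<in> borel_measurable \<nu>"
  and S: "S \<in> sets \<mu>" and C: "0 <= C"
  and growth_\<mu>: "!!z r. 0 < r ==> emeasure \<mu> (S Int ball z r) <= ennreal (C * r ^ 4)" and tot_\<mu>: "emeasure \<mu> S <= ennreal C"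
  and growth_\<nu>: "!!z r. 0 < r ==> emeasure \<nu> (space \<nu> Int ball z r) <= ennreal (C * r ^ 4)" and tot_\<nu>: "emeasure \<nu> (space \<nu>) <= ennreal C"
  and W: "W \<in> borel_measurable \<mu>" "!!x. 0 <= W x"
  and Wq: "!!q1. 1 <= q1 ==> q1 < q ==> (\<integral>\<^sup>+x. ennreal (W x powr q1) \<partial>\<mu>) < \<infinity>"
  and q: "2 < q" "q <= 4"
begin

definition kap :: "real => complex ^ 3 => complex ^ 3 => real" where
 "kap a z x = norm (x - z) powr (- 3 - a) + W x * norm (x - z) powr (- 2 - a)"

lemma kap_nonneg: "0 <= kap a z x" using W(2) by (simp add: kap_def)

lemma meas_z: "(%x. norm (x - z) powr b) \<in> borel_measurable \<mu>"
 using id_\<mu> by measurable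

lemma kap_meas: "(%x. kap a z x) \<in> borel_measurable \<mu>"
 unfolding kap_def using id_\<mu> W(1) by measurable

lemma riesz_\<mu>: "0 <= a ==> a < 4 ==> EX B>=0. ALL z. (\<integral>\<^sup>+x\<in>S. ennreal (norm (x - z) powr (- a)) \<partial>\<mu>) <= ennreal B"
 by (rule nn_integral_riesz_bound[OF id_\<mu> S growth_\<mu> tot_\<mu> C])

lemma riesz_\<nu>: "0 <= a ==> a < 4 ==> EX B>=0. ALL z. (\<integral>\<^sup>+x. ennreal (norm (x - z) powr (- a)) \<partial>\<nu>) <= ennreal B"
proof -
 assume a: "0 <= a" "a < 4"
 obtain B where B: "0 <= B" "!!z. (\<integral>\<^sup>+x\<in>space \<nu>. ennreal (norm (x - z) powr (- a)) \<partial>\<nu>) <= ennreal B"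
  using nn_integral_riesz_bound[OF id_\<nu> sets.top growth_\<nu> tot_\<nu> C a] by blast
 have "(\<integral>\<^sup>+x\<in>space \<nu>. ennreal (norm (x - z) powr (- a)) \<partial>\<nu>) = (\<integral>\<^sup>+x. ennreal (norm (x - z) powr (- a)) \<partial>\<nu>)" for z
  by (intro nn_integral_cong) auto
 then show ?thesis using B by auto
qed

text \<open>Hoelder's inequality for \<open>W\<close> against a power of the distance, in the form of Young's inequality;
 the exponent \<open>q1\<close> is chosen slightly below \<open>q\<close>.\<close>

lemma riesz_W:
 assumes P: "1 <= P" "P < q1" "q1 < q" and b: "0 <= b" "b * q1 / (q1 - P) < 4"
 shows "EX B>=0. ALL z. (\<integral>\<^sup>+x\<in>S. ennreal (W x powr P * norm (x - z) powr (- b)) \<partial>\<mu>) <= ennreal B"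
proof -
 define s where "s = q1 / P"
 have s: "1 < s" "s / (s - 1) = q1 / (q1 - P)" using P by (auto simp: s_def field_simps)
 define a where "a = b * (s / (s - 1))"
 have a: "0 <= a" "a < 4" using b P unfolding a_def s(2) by auto
 obtain B where B: "0 <= B" "!!z. (\<integral>\<^sup>+x\<in>S. ennreal (norm (x - z) powr (- a)) \<partial>\<mu>) <= ennreal B"
  using riesz_\<mu>[OF a] by blast
 obtain B1 where B1: "(\<integral>\<^sup>+x. ennreal (W x powr q1) \<partial>\<mu>) = ennreal B1" "0 <= B1"
  using Wq[of q1] P by (cases "(\<integral>\<^sup>+x. ennreal (W x powr q1) \<partial>\<mu>)") auto
 have "(\<integral>\<^sup>+x\<in>S. ennreal (W x powr P * norm (x - z) powr (- b)) \<partial>\<mu>) <= ennreal (B1 + B)" for z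
 proof -
  have pw: "W x powr P * norm (x - z) powr (- b) <= W x powr q1 + norm (x - z) powr (- a)" for x
  proof -
   have "W x powr P * norm (x - z) powr (- b) <= (W x powr P) powr s + (norm (x - z) powr (- b)) powr (s / (s - 1))"
    using s(1) by (intro young_simple) auto
   also have "... = W x powr q1 + norm (x - z) powr (- a)"
    using P by (simp add: powr_powr a_def s_def)
   finally show ?thesis .
  qed
  have "(\<integral>\<^sup>+x\<in>S. ennreal (W x powr P * norm (x - z) powr (- b)) \<partial>\<mu>) <=
   (\<integral>\<^sup>+x. ennreal (W x powr q1) + ennreal (norm (x - z) powr (- a)) * indicator S x \<partial>\<mu>)"
  proof (rule nn_integral_mono)
   fix x
   have "ennreal (W x powr P * norm (x - z) powr (- b)) <= ennreal (W x powr q1) + ennreal (norm (x - z) powr (- a))"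
    using ennreal_leI[OF pw] by simp
   then show "ennreal (W x powr P * norm (x - z) powr (- b)) * indicator S x <=
     ennreal (W x powr q1) + ennreal (norm (x - z) powr (- a)) * indicator S x"
    by (auto simp: indicator_def)
  qed
  also have "... = ennreal B1 + (\<integral>\<^sup>+x\<in>S. ennreal (norm (x - z) powr (- a)) \<partial>\<mu>)"
   using W(1) meas_z S by (subst nn_integral_add) (auto simp: B1)
  also have "... <= ennreal B1 + ennreal B" using B by (intro add_left_mono) auto
  finally show ?thesis using B B1 by simp
 qed
 then show ?thesis using B B1 by (intro exI[of _ "B1 + B"]) auto
qed

text \<open>The term without W needs 3 + a < 4, which holds since a < 2 - 4/q \<le> 1. The other one
  needs (2 + a) q1/(q1 - 1) < 4 for some q1 < q; for i = 1/q1 this is the linear condition 1/q < i <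
  (2 - a)/4.\<close>

lemma kap_bound:
 assumes a: "0 <= a" "a < 2 - 4 / q"
 shows "EX B>=0. ALL z. (\<integral>\<^sup>+x\<in>S. ennreal (kap a z x) \<partial>\<mu>) <= ennreal B"
proof -
 have q4: "1 <= 4 / q" using q by simp
 have a4: "0 <= 3 + a" "3 + a < 4" using a q4 by auto
 have "1 / q < (2 - a) / 4" using a q by (simp add: field_simps)
 then obtain i where i: "1 / q < i" "i < min ((2 - a) / 4) 1" using dense[of "1 / q" "min ((2 - a) / 4) 1"] q by auto
 have i0: "0 < i" using i(1) q by (intro less_trans[OF _ i(1)]) auto
 define q1 where "q1 = 1 / i"
 have q1: "1 < q1" "q1 < q" using i i0 q by (auto simp: q1_def field_simps)
 have "(2 + a) * q1 / (q1 - 1) = (2 + a) / (1 - i)" using i i0 by (simp add: q1_def field_simps)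
 also have "... < 4" using i by (simp add: field_simps)
 finally have c: "(2 + a) * q1 / (q1 - 1) < 4" .
 obtain B1 where B1: "0 <= B1" "!!z. (\<integral>\<^sup>+x\<in>S. ennreal (norm (x - z) powr (- (3 + a))) \<partial>\<mu>) <= ennreal B1"
  using riesz_\<mu>[OF a4] by blast
 obtain B2 where B2: "0 <= B2" "!!z. (\<integral>\<^sup>+x\<in>S. ennreal (W x powr 1 * norm (x - z) powr (- (2 + a))) \<partial>\<mu>) <= ennreal B2"
  using riesz_W[of 1 q1 "2 + a"] q1 a c by auto
 have "(\<integral>\<^sup>+x\<in>S. ennreal (kap a z x) \<partial>\<mu>) <= ennreal (B1 + B2)" for z
 proof -
  have e: "ennreal (kap a z x) * indicator S x = ennreal (norm (x - z) powr (- (3 + a))) * indicator S x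
    + ennreal (W x powr 1 * norm (x - z) powr (- (2 + a))) * indicator S x" for x
  proof -
   have "- 3 - a = - (3 + a)" "- 2 - a = - (2 + a)" by auto
   then have "kap a z x = norm (x - z) powr (- (3 + a)) + W x powr 1 * norm (x - z) powr (- (2 + a))"
    using W(2)[of x] unfolding kap_def by (simp only: powr_one)
   then show ?thesis by (auto simp: indicator_def)
  qed
  have "(\<integral>\<^sup>+x\<in>S. ennreal (kap a z x) \<partial>\<mu>) = (\<integral>\<^sup>+x\<in>S. ennreal (norm (x - z) powr (- (3 + a))) \<partial>\<mu>) +
    (\<integral>\<^sup>+x\<in>S. ennreal (W x powr 1 * norm (x - z) powr (- (2 + a))) \<partial>\<mu>)"
   unfolding e
  proof (rule nn_integral_add)
   have "(%x. W x powr 1 * norm (x - z) powr - (2 + a)) \<in> borel_measurable \<mu>"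
    using id_\<mu> W(1) by measurable
   then show "(%x. ennreal (W x powr 1 * norm (x - z) powr - (2 + a)) * indicator S x) \<in> borel_measurable \<mu>"
    using S by auto
  qed (use meas_z S in auto)
  also have "... <= ennreal B1 + ennreal B2" by (intro add_mono B1 B2)
  finally show ?thesis using B1 B2 by simp
 qed
 then show ?thesis using B1 B2 by (intro exI[of _ "B1 + B2"]) auto
qed

text \<open>The kernel is split as G |x - z|^(-\<sigma>). The second factor needs \<sigma> p < 4,
  and G must be uniformly in L^P for some P strictly above the dual exponent p/(p - 1); the excess
  yields smallness on sets of small measure. In the reciprocals of the exponents all conditions
  become linear.\<close>

lemma exponents:
 assumes p: "q / (q - 1) < p"
 obtains \<sigma> P where "0 <= \<sigma>" "\<sigma> <= 2" "\<sigma> * p < 4" "p / (p - 1) < P" "1 < p"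
  "EX B>=0. ALL z. (\<integral>\<^sup>+x\<in>S. ennreal ((norm (x - z) powr (\<sigma> - 3) + W x * norm (x - z) powr (\<sigma> - 2)) powr P) \<partial>\<mu>) <= ennreal B"
proof -
 have q0: "1 < q / (q - 1)" using q by (simp add: field_simps)
 then have p1: "1 < p" using p by simp
 have pq: "1 / p + 1 / q < 1"
 proof -
  have "1 / p < 1 / (q / (q - 1))" using p q0 by (intro divide_strict_left_mono mult_pos_pos) auto
  also have "... = 1 - 1 / q" using q by (simp add: field_simps)
  finally show ?thesis by simp
 qed
 have q4: "1 / 4 <= 1 / q" "1 / q < 1 / 2" using q by (auto simp: field_simps)
 \<comment> \<open>The lower bounds express (3 - \<sigma>)/4 < 1 - 1/p and (2 - \<sigma>)/4 + 1/q <
   1 - 1/p. That they lie below 4/p and 2 uses q > 2, q \<le> 4 and 1/p + 1/q < 1.\<close>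
 define lo where "lo = max 0 (max (4 / p - 1) (4 / p - 2 + 4 / q))"
 define hi where "hi = min (4 / p) 2"
 have "lo < hi"
  using p1 pq q4 unfolding lo_def hi_def by (auto simp: less_max_iff_disj)
 then obtain \<sigma> where \<sigma>: "lo < \<sigma>" "\<sigma> < hi" using dense by blast
 have \<sigma>': "0 < \<sigma>" "4 / p - 1 < \<sigma>" "4 / p - 2 + 4 / q < \<sigma>" "\<sigma> < 4 / p" "\<sigma> < 2"
  using \<sigma> by (auto simp: lo_def hi_def)
 define x where "x = 1 - 1 / p"
 have x: "0 < x" "x < 1" "1 / q < x" using p1 pq by (auto simp: x_def)
 have c1: "(3 - \<sigma>) / 4 < x" and c2: "(2 - \<sigma>) / 4 + 1 / q < x" using \<sigma>' by (auto simp: x_def field_simps)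
 define lo2 where "lo2 = max (1 / q) (max ((3 - \<sigma>) / 4) ((2 - \<sigma>) / 4 + 1 / q))"
 have "lo2 < x" using x c1 c2 by (auto simp: lo2_def)
 then obtain y where y: "lo2 < y" "y < x" using dense by blast
 have y': "1 / q < y" "(3 - \<sigma>) / 4 < y" "(2 - \<sigma>) / 4 + 1 / q < y" using y by (auto simp: lo2_def)
 have "1 / q < min y (y - (2 - \<sigma>) / 4)" using y' \<sigma>' by auto
 then obtain i where i: "1 / q < i" "i < min y (y - (2 - \<sigma>) / 4)" using dense by blast
 have i0: "0 < i" using q4 i(1) by linarith
 have y0: "0 < y" "y < 1" using y' q4 y(2) x by auto
 define P where "P = 1 / y" define q1 where "q1 = 1 / i"
 have P1: "1 < P" using y0 by (simp add: P_def field_simps)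
 have Pq1: "P < q1" "q1 < q" using i i0 y0 q by (auto simp: P_def q1_def field_simps)
 have Pp: "p / (p - 1) < P"
 proof -
  have "p / (p - 1) = 1 / x" using p1 by (simp add: x_def field_simps)
  also have "... < P" unfolding P_def using y y0 x by (intro divide_strict_left_mono mult_pos_pos) auto
  finally show ?thesis .
 qed
 have b1: "0 <= (3 - \<sigma>) * P" "(3 - \<sigma>) * P < 4" using \<sigma>' y' y0 by (auto simp: P_def field_simps)
 have "(2 - \<sigma>) * P * q1 / (q1 - P) = (2 - \<sigma>) / (y - i)" using y0 i0 i by (simp add: P_def q1_def field_simps)
 also have "... < 4" using i by (simp add: field_simps)
 finally have b2: "(2 - \<sigma>) * P * q1 / (q1 - P) < 4" .
 obtain B1 where B1: "0 <= B1" "!!z. (\<integral>\<^sup>+x\<in>S. ennreal (norm (x - z) powr (- ((3 - \<sigma>) * P))) \<partial>\<mu>) <= ennreal B1"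
  using riesz_\<mu>[OF b1] by blast
 obtain B2 where B2: "0 <= B2" "!!z. (\<integral>\<^sup>+x\<in>S. ennreal (W x powr P * norm (x - z) powr (- ((2 - \<sigma>) * P))) \<partial>\<mu>) <= ennreal B2"
  using riesz_W[OF less_imp_le[OF P1] Pq1, of "(2 - \<sigma>) * P"] b2 \<sigma>' P1 by auto
 have "(\<integral>\<^sup>+x\<in>S. ennreal ((norm (x - z) powr (\<sigma> - 3) + W x * norm (x - z) powr (\<sigma> - 2)) powr P) \<partial>\<mu>) <= ennreal (2 powr P * (B1 + B2))" for z
 proof -
  have pw: "(a + b) powr P <= 2 powr P * (a powr P + b powr P)" if "0 <= a" "0 <= b" for a b :: real
  proof -
   have "(a + b) powr P <= (2 * max a b) powr P" using that P1 by (intro powr_mono2) auto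
   also have "... = 2 powr P * (max a b) powr P" using that by (simp add: powr_mult)
   also have "(max a b) powr P <= a powr P + b powr P" by (simp add: max_def)
   finally show ?thesis by simp
  qed
  have pw2: "(norm (x - z) powr (\<sigma> - 3) + W x * norm (x - z) powr (\<sigma> - 2)) powr P <=
    2 powr P * (norm (x - z) powr (- ((3 - \<sigma>) * P)) + W x powr P * norm (x - z) powr (- ((2 - \<sigma>) * P)))" for x
   using pw[of "norm (x - z) powr (\<sigma> - 3)" "W x * norm (x - z) powr (\<sigma> - 2)"] W(2)[of x]
   by (simp add: powr_powr powr_mult algebra_simps)
  have "(\<integral>\<^sup>+x\<in>S. ennreal ((norm (x - z) powr (\<sigma> - 3) + W x * norm (x - z) powr (\<sigma> - 2)) powr P) \<partial>\<mu>) <=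
   (\<integral>\<^sup>+x. ennreal (2 powr P) * (ennreal (norm (x - z) powr (- ((3 - \<sigma>) * P))) * indicator S x
     + ennreal (W x powr P * norm (x - z) powr (- ((2 - \<sigma>) * P))) * indicator S x) \<partial>\<mu>)"
  proof (rule nn_integral_mono)
   fix x
   have "ennreal ((norm (x - z) powr (\<sigma> - 3) + W x * norm (x - z) powr (\<sigma> - 2)) powr P) <=
    ennreal (2 powr P) * (ennreal (norm (x - z) powr (- ((3 - \<sigma>) * P))) + ennreal (W x powr P * norm (x - z) powr (- ((2 - \<sigma>) * P))))"
    using ennreal_leI[OF pw2[of x]] by (simp add: ennreal_mult)
   then show "ennreal ((norm (x - z) powr (\<sigma> - 3) + W x * norm (x - z) powr (\<sigma> - 2)) powr P) * indicator S x <=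
    ennreal (2 powr P) * (ennreal (norm (x - z) powr (- ((3 - \<sigma>) * P))) * indicator S x
     + ennreal (W x powr P * norm (x - z) powr (- ((2 - \<sigma>) * P))) * indicator S x)"
    by (auto simp: indicator_def)
  qed
  also have "... = ennreal (2 powr P) * ((\<integral>\<^sup>+x\<in>S. ennreal (norm (x - z) powr (- ((3 - \<sigma>) * P))) \<partial>\<mu>)
    + (\<integral>\<^sup>+x\<in>S. ennreal (W x powr P * norm (x - z) powr (- ((2 - \<sigma>) * P))) \<partial>\<mu>))"
   using S id_\<mu> W(1) by (simp add: nn_integral_cmult nn_integral_add)
  also have "... <= ennreal (2 powr P) * (ennreal B1 + ennreal B2)"
   by (intro mult_left_mono add_mono B1 B2) auto
  finally show ?thesis using B1 B2 by (simp add: ennreal_mult)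
 qed
 then have "EX B>=0. ALL z. (\<integral>\<^sup>+x\<in>S. ennreal ((norm (x - z) powr (\<sigma> - 3) + W x * norm (x - z) powr (\<sigma> - 2)) powr P) \<partial>\<mu>) <= ennreal B"
  using B1 B2 by (intro exI[of _ "2 powr P * (B1 + B2)"]) auto
 moreover have "\<sigma> * p < 4" using \<sigma>'(4) p1 by (simp add: field_simps)
 ultimately show ?thesis using that[of \<sigma> P] \<sigma>' Pp p1 by auto
qed

text \<open>Hoelder in the variable of integration pairs G with |x - z|^(-\<sigma>) N. The p-th
  power of the latter is integrated over z first, by Fubini, where \<sigma> p < 4 gives a uniform
  bound. The constant is thus governed by the norm of G, in the dual exponent, over the set that
  carries N.\<close>

lemma Lp_bound:
 assumes p: "q / (q - 1) < p"
 obtains K where "0 <= K" "!!\<epsilon>. 0 < \<epsilon> ==> \<exists>\<delta>>0. ALL N E. N \<in> borel_measurable \<mu> --> (ALL x. 0 <= N x) --> E \<in> sets \<mu> -->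
    (ALL x. N x ~= 0 --> x \<in> E) --> emeasure \<mu> (S Int E) <= ennreal \<delta> --> (\<integral>\<^sup>+x. ennreal (N x powr p) \<partial>\<mu>) < \<infinity> -->
    (\<integral>\<^sup>+z. ennreal (enn2real (\<integral>\<^sup>+x\<in>S. ennreal (kap 0 z x * N x) \<partial>\<mu>) powr p) \<partial>\<nu>) <= ennreal \<epsilon> * (\<integral>\<^sup>+x. ennreal (N x powr p) \<partial>\<mu>)"
  "!!N. N \<in> borel_measurable \<mu> ==> (!!x. 0 <= N x) ==> (\<integral>\<^sup>+x. ennreal (N x powr p) \<partial>\<mu>) < \<infinity> ==>
    (AE z in \<nu>. (\<integral>\<^sup>+x\<in>S. ennreal (kap 0 z x * N x) \<partial>\<mu>) < \<infinity>) \<and>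
    (\<integral>\<^sup>+z. ennreal (enn2real (\<integral>\<^sup>+x\<in>S. ennreal (kap 0 z x * N x) \<partial>\<mu>) powr p) \<partial>\<nu>) <= ennreal K * (\<integral>\<^sup>+x. ennreal (N x powr p) \<partial>\<mu>)"
proof -
 obtain \<sigma> P where \<sigma>: "0 <= \<sigma>" "\<sigma> <= 2" "\<sigma> * p < 4" and P: "p / (p - 1) < P" and p1: "1 < p"
  and "EX B>=0. ALL z. (\<integral>\<^sup>+x\<in>S. ennreal ((norm (x - z) powr (\<sigma> - 3) + W x * norm (x - z) powr (\<sigma> - 2)) powr P) \<partial>\<mu>) <= ennreal B"
  using exponents[OF p] by blast
 then obtain B where B: "0 <= B" "!!z. (\<integral>\<^sup>+x\<in>S. ennreal ((norm (x - z) powr (\<sigma> - 3) + W x * norm (x - z) powr (\<sigma> - 2)) powr P) \<partial>\<mu>) <= ennreal B"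
  by blast
 obtain B' where B': "0 <= B'" "!!x. (\<integral>\<^sup>+z. ennreal (norm (z - x) powr (- (\<sigma> * p))) \<partial>\<nu>) <= ennreal B'"
  using riesz_\<nu>[of "\<sigma> * p"] \<sigma> p1 by auto
 define p' where "p' = p / (p - 1)"
 have p': "1 < p'" "p' < P" using p1 P by (auto simp: p'_def field_simps)
 define G where "G z x = norm (x - z) powr (\<sigma> - 3) + W x * norm (x - z) powr (\<sigma> - 2)" for z x
 have G0: "0 <= G z x" for z x using W(2) by (simp add: G_def)
 have Gm: "(%x. G z x) \<in> borel_measurable \<mu>" for z unfolding G_def using id_\<mu> W(1) by measurable
 have kapG: "kap 0 z x = G z x * norm (x - z) powr (- \<sigma>)" for z x
  unfolding kap_def G_def by (simp add: distrib_right mult.assoc powr_add[symmetric])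
 text \<open>Smallness on sets of small measure, from the extra integrability \<open>P > p'\<close>.\<close>
 have GE: "(\<integral>\<^sup>+x. ennreal ((G z x * indicator (S Int E) x) powr p') \<partial>\<mu>) <= ennreal (T powr (p' - P) * B + T powr p' * \<delta>)"
  if E: "E \<in> sets \<mu>" "emeasure \<mu> (S Int E) <= ennreal \<delta>" "0 <= \<delta>" and T: "0 < T" for E T \<delta> z
 proof -
  have pw: "G z x powr p' <= T powr (p' - P) * G z x powr P + T powr p'" for x
  proof (cases "G z x <= T")
   case True
   then have "G z x powr p' <= T powr p'" using G0 p' by (intro powr_mono2) auto
   then show ?thesis by (simp add: add_increasing)
  next
   case False
   then have "G z x powr (p' - P) <= T powr (p' - P)" using T p' by (intro powr_mono2') auto
   then have "G z x powr (p' - P) * G z x powr P <= T powr (p' - P) * G z x powr P" by (intro mult_right_mono) auto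
   then show ?thesis by (simp add: powr_add[symmetric] add_increasing2)
  qed
  have "(\<integral>\<^sup>+x. ennreal ((G z x * indicator (S Int E) x) powr p') \<partial>\<mu>) <=
    (\<integral>\<^sup>+x. ennreal (T powr (p' - P)) * (ennreal (G z x powr P) * indicator S x) + ennreal (T powr p') * indicator (S Int E) x \<partial>\<mu>)"
  proof (rule nn_integral_mono)
   fix x
   have "ennreal (G z x powr p') <= ennreal (T powr (p' - P)) * ennreal (G z x powr P) + ennreal (T powr p')"
    using ennreal_leI[OF pw[of x]] by (simp add: ennreal_mult)
   then show "ennreal ((G z x * indicator (S Int E) x) powr p') <=
     ennreal (T powr (p' - P)) * (ennreal (G z x powr P) * indicator S x) + ennreal (T powr p') * indicator (S Int E) x"
    by (auto simp: indicator_def)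
  qed
  also have "... = ennreal (T powr (p' - P)) * (\<integral>\<^sup>+x\<in>S. ennreal (G z x powr P) \<partial>\<mu>) + ennreal (T powr p') * emeasure \<mu> (S Int E)"
   using S E Gm by (subst nn_integral_add) (auto simp: nn_integral_cmult nn_integral_cmult_indicator)
  also have "... <= ennreal (T powr (p' - P)) * ennreal B + ennreal (T powr p') * ennreal \<delta>"
   using B(2)[of z] E(2) by (intro add_mono mult_left_mono) (auto simp: G_def)
  finally show ?thesis using B E(3) by (simp add: ennreal_mult)
 qed
 \<comment> \<open>The carrier E enters only through the bound A for G over it; boundedness and
   smallness are the cases of a fixed and of a small A.\<close>
 have main: "(AE z in \<nu>. (\<integral>\<^sup>+x\<in>S. ennreal (kap 0 z x * N x) \<partial>\<mu>) < \<infinity>) \<and>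
    (\<integral>\<^sup>+z. ennreal (enn2real (\<integral>\<^sup>+x\<in>S. ennreal (kap 0 z x * N x) \<partial>\<mu>) powr p) \<partial>\<nu>)
     <= ennreal (2 powr p * A powr (p - 1) * B') * (\<integral>\<^sup>+x. ennreal (N x powr p) \<partial>\<mu>)"
  if N: "N \<in> borel_measurable \<mu>" "!!x. 0 <= N x" "(\<integral>\<^sup>+x. ennreal (N x powr p) \<partial>\<mu>) < \<infinity>"
   and E: "E \<in> sets \<mu>" "!!x. N x ~= 0 ==> x \<in> E"
   and A: "0 < A" "!!z. (\<integral>\<^sup>+x. ennreal ((G z x * indicator (S Int E) x) powr p') \<partial>\<mu>) <= ennreal A" for N E A
 proof -
  define H where "H z = (\<integral>\<^sup>+x. ennreal ((norm (x - z) powr (- \<sigma>) * N x) powr p) \<partial>\<mu>)" for z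
  interpret \<mu>: sigma_finite_measure \<mu> by (rule \<mu>)
  interpret \<nu>: finite_measure \<nu> by (rule \<nu>)
  interpret pair_sigma_finite \<nu> \<mu> ..
  have fm: "fst \<in> borel_measurable (\<nu> \<Otimes>\<^sub>M \<mu>)" "snd \<in> borel_measurable (\<nu> \<Otimes>\<^sub>M \<mu>)" "(%y. N (snd y)) \<in> borel_measurable (\<nu> \<Otimes>\<^sub>M \<mu>)"
   using measurable_compose[OF measurable_fst id_\<nu>, of \<mu>] measurable_compose[OF measurable_snd id_\<mu>, of \<nu>]
    measurable_compose[OF measurable_snd N(1), of \<nu>] by simp_all
  have jm: "(%(z, x). ennreal ((norm (x - z) powr (- \<sigma>) * N x) powr p)) \<in> borel_measurable (\<nu> \<Otimes>\<^sub>M \<mu>)"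
   unfolding case_prod_beta using fm by measurable
  have Hm: "H \<in> borel_measurable \<nu>"
   unfolding H_def using jm by (rule \<mu>.borel_measurable_nn_integral)
  have pe: "ennreal ((norm (x - z) powr (- \<sigma>) * N x) powr p) = ennreal (norm (z - x) powr (- (\<sigma> * p))) * ennreal (N x powr p)" for x z
   using N(2) by (simp add: powr_mult powr_powr ennreal_mult norm_minus_commute)
  have Hint: "(\<integral>\<^sup>+z. H z \<partial>\<nu>) <= ennreal B' * (\<integral>\<^sup>+x. ennreal (N x powr p) \<partial>\<mu>)"
  proof -
   have "(\<integral>\<^sup>+z. H z \<partial>\<nu>) = (\<integral>\<^sup>+x. (\<integral>\<^sup>+z. ennreal ((norm (x - z) powr (- \<sigma>) * N x) powr p) \<partial>\<nu>) \<partial>\<mu>)"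
    unfolding H_def by (rule Fubini'[OF jm, symmetric])
   also have "... <= (\<integral>\<^sup>+x. ennreal B' * ennreal (N x powr p) \<partial>\<mu>)"
   proof (rule nn_integral_mono)
    fix x
    have "(\<integral>\<^sup>+z. ennreal ((norm (x - z) powr (- \<sigma>) * N x) powr p) \<partial>\<nu>) = (\<integral>\<^sup>+z. ennreal (norm (z - x) powr (- (\<sigma> * p))) \<partial>\<nu>) * ennreal (N x powr p)"
     unfolding pe using id_\<nu> by (intro nn_integral_multc) measurable
    also have "... <= ennreal B' * ennreal (N x powr p)" by (intro mult_right_mono B') auto
    finally show "(\<integral>\<^sup>+z. ennreal ((norm (x - z) powr (- \<sigma>) * N x) powr p) \<partial>\<nu>) <= ennreal B' * ennreal (N x powr p)" .
   qed
   also have "... = ennreal B' * (\<integral>\<^sup>+x. ennreal (N x powr p) \<partial>\<mu>)" using N(1) by (intro nn_integral_cmult) measurable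
   finally show ?thesis .
  qed
  have "(\<integral>\<^sup>+z. H z \<partial>\<nu>) ~= \<infinity>" using Hint N(3) by (auto simp: ennreal_mult_eq_top_iff top_unique)
  from nn_integral_PInf_AE[OF Hm this] have Hfin: "AE z in \<nu>. H z ~= \<infinity>" .
  have pt: "(\<integral>\<^sup>+x\<in>S. ennreal (kap 0 z x * N x) \<partial>\<mu>) < \<infinity> \<and>
    ennreal (enn2real (\<integral>\<^sup>+x\<in>S. ennreal (kap 0 z x * N x) \<partial>\<mu>) powr p) <= ennreal (2 powr p * A powr (p - 1)) * H z"
   if Hz: "H z ~= \<infinity>" for z
  proof -
   obtain r where r: "H z = ennreal r" "0 <= r" using Hz by (cases "H z") auto
   have e: "(\<integral>\<^sup>+x\<in>S. ennreal (kap 0 z x * N x) \<partial>\<mu>) = (\<integral>\<^sup>+x. ennreal ((G z x * indicator (S Int E) x) * (norm (x - z) powr (- \<sigma>) * N x)) \<partial>\<mu>)"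
   proof (rule nn_integral_cong)
    fix x
    have "N x = 0" if "x \<notin> E" using E(2) that by blast
    then show "ennreal (kap 0 z x * N x) * indicator S x = ennreal ((G z x * indicator (S Int E) x) * (norm (x - z) powr (- \<sigma>) * N x))"
     by (auto simp: kapG indicator_def mult_ac)
   qed
   have gm: "(%x. G z x * indicator (S Int E) x) \<in> borel_measurable \<mu>"
    and hm: "(%x. norm (x - z) powr (- \<sigma>) * N x) \<in> borel_measurable \<mu>"
    using Gm S E meas_z N(1) by auto
   have *: "(\<integral>\<^sup>+x. ennreal ((G z x * indicator (S Int E) x) * (norm (x - z) powr (- \<sigma>) * N x)) \<partial>\<mu>) < \<infinity> \<and>
    enn2real (\<integral>\<^sup>+x. ennreal ((G z x * indicator (S Int E) x) * (norm (x - z) powr (- \<sigma>) * N x)) \<partial>\<mu>) powr p <= 2 powr p * A powr (p - 1) * r"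
   proof (intro conjI nn_integral_holder[OF _ _ _ _ p1 A(1)])
   qed (use gm hm A(2) G0 N(2) r in \<open>auto simp: p'_def H_def[symmetric]\<close>)
   then have "ennreal (enn2real (\<integral>\<^sup>+x\<in>S. ennreal (kap 0 z x * N x) \<partial>\<mu>) powr p) <= ennreal (2 powr p * A powr (p - 1) * r)"
    unfolding e by (intro ennreal_leI) blast
   also have "... = ennreal (2 powr p * A powr (p - 1)) * H z" using r by (simp add: ennreal_mult)
   finally show ?thesis using * unfolding e by blast
  qed
  have "(\<integral>\<^sup>+z. ennreal (enn2real (\<integral>\<^sup>+x\<in>S. ennreal (kap 0 z x * N x) \<partial>\<mu>) powr p) \<partial>\<nu>)
    <= (\<integral>\<^sup>+z. ennreal (2 powr p * A powr (p - 1)) * H z \<partial>\<nu>)"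
   using Hfin pt by (intro nn_integral_mono_AE) (auto elim: eventually_mono)
  also have "... = ennreal (2 powr p * A powr (p - 1)) * (\<integral>\<^sup>+z. H z \<partial>\<nu>)" using Hm by (rule nn_integral_cmult)
  also have "... <= ennreal (2 powr p * A powr (p - 1)) * (ennreal B' * (\<integral>\<^sup>+x. ennreal (N x powr p) \<partial>\<mu>))"
   by (intro mult_left_mono Hint) auto
  also have "... = ennreal (2 powr p * A powr (p - 1) * B') * (\<integral>\<^sup>+x. ennreal (N x powr p) \<partial>\<mu>)"
   using B'(1) by (simp add: ennreal_mult mult.assoc)
  finally show ?thesis using Hfin pt by (auto elim: eventually_mono)
 qed
 define A0 where "A0 = B + C + 1"
 have A0: "0 < A0" using B C by (simp add: A0_def)
 show ?thesis
 proof (rule that[of "2 powr p * A0 powr (p - 1) * B'"])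
  show "0 <= 2 powr p * A0 powr (p - 1) * B'" using B' by simp
 next
  fix N :: "complex ^ 3 => real" assume N: "N \<in> borel_measurable \<mu>" "!!x. 0 <= N x" "(\<integral>\<^sup>+x. ennreal (N x powr p) \<partial>\<mu>) < \<infinity>"
  \<comment> \<open>Values outside the space of \<mu> do not affect the integrals; setting them to 0
    makes the whole space a carrier.\<close>
  define N' where "N' x = (if x \<in> space \<mu> then N x else 0)" for x
  have N'm: "N' \<in> borel_measurable \<mu>" unfolding N'_def using N(1) by (subst measurable_cong[of _ _ N]) auto
  have eq1: "(\<integral>\<^sup>+x. ennreal (N' x powr p) \<partial>\<mu>) = (\<integral>\<^sup>+x. ennreal (N x powr p) \<partial>\<mu>)"
   by (intro nn_integral_cong) (simp add: N'_def)
  have eq2: "(\<integral>\<^sup>+x\<in>S. ennreal (kap 0 z x * N' x) \<partial>\<mu>) = (\<integral>\<^sup>+x\<in>S. ennreal (kap 0 z x * N x) \<partial>\<mu>)" for z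
   by (intro nn_integral_cong) (simp add: N'_def)
  have "S Int space \<mu> = S" using sets.sets_into_space[OF S] by blast
  then have GA: "(\<integral>\<^sup>+x. ennreal ((G z x * indicator (S Int space \<mu>) x) powr p') \<partial>\<mu>) <= ennreal A0" for z
  proof -
   have "(\<integral>\<^sup>+x. ennreal ((G z x * indicator (S Int space \<mu>) x) powr p') \<partial>\<mu>) <= ennreal (1 powr (p' - P) * B + 1 powr p' * C)"
    by (rule GE) (use \<open>S Int space \<mu> = S\<close> tot_\<mu> C in simp_all)
   also have "... <= ennreal A0" by (rule ennreal_leI) (simp add: A0_def)
   finally show ?thesis .
  qed
  have "(AE z in \<nu>. (\<integral>\<^sup>+x\<in>S. ennreal (kap 0 z x * N' x) \<partial>\<mu>) < \<infinity>) \<and>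
    (\<integral>\<^sup>+z. ennreal (enn2real (\<integral>\<^sup>+x\<in>S. ennreal (kap 0 z x * N' x) \<partial>\<mu>) powr p) \<partial>\<nu>) <= ennreal (2 powr p * A0 powr (p - 1) * B') * (\<integral>\<^sup>+x. ennreal (N' x powr p) \<partial>\<mu>)"
  proof (rule main[OF N'm _ _ sets.top _ A0])
   show "0 <= N' x" for x by (simp add: N'_def N(2))
   show "(\<integral>\<^sup>+x. ennreal (N' x powr p) \<partial>\<mu>) < \<infinity>" unfolding eq1 by (rule N(3))
   show "x \<in> space \<mu>" if "N' x ~= 0" for x using that by (simp add: N'_def split: if_splits)
  qed (rule GA)
  then show "(AE z in \<nu>. (\<integral>\<^sup>+x\<in>S. ennreal (kap 0 z x * N x) \<partial>\<mu>) < \<infinity>) \<and>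
    (\<integral>\<^sup>+z. ennreal (enn2real (\<integral>\<^sup>+x\<in>S. ennreal (kap 0 z x * N x) \<partial>\<mu>) powr p) \<partial>\<nu>) <= ennreal (2 powr p * A0 powr (p - 1) * B') * (\<integral>\<^sup>+x. ennreal (N x powr p) \<partial>\<mu>)"
   unfolding eq1 eq2 .
 next
  fix \<epsilon> :: real assume \<epsilon>: "0 < \<epsilon>"
  define c where "c = 2 powr p * (B' + 1)"
  have c: "0 < c" using B' by (simp add: c_def)
  \<comment> \<open>Solves c A^(p-1) = \<epsilon>; the summand 1 in c covers B' = 0.\<close>
  define A where "A = (\<epsilon> / c) powr (1 / (p - 1))"
  have A: "0 < A" using \<epsilon> c by (simp add: A_def)
  have Ae: "2 powr p * A powr (p - 1) * B' <= \<epsilon>"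
  proof -
   have "A powr (p - 1) = \<epsilon> / c" using p1 \<epsilon> c by (simp add: A_def powr_powr)
   then have "2 powr p * A powr (p - 1) = \<epsilon> / (B' + 1)" by (simp add: c_def)
   then have "2 powr p * A powr (p - 1) * B' = \<epsilon> * (B' / (B' + 1))" by simp
   also have "... <= \<epsilon> * 1" using \<epsilon> B' by (intro mult_left_mono) (auto simp: field_simps)
   finally show ?thesis by simp
  qed
  \<comment> \<open>Above the level T the excess P - p' bounds the contribution of G by A/2;
    \<delta> is then chosen so that the part below the level contributes the other half.\<close>
  define T where "T = max 1 ((2 * (B + 1) / A) powr (1 / (P - p')))"
  have T: "1 <= T" by (simp add: T_def)
  have TB: "T powr (p' - P) * B <= A / 2"
  proof -
   have "(2 * (B + 1) / A) powr (1 / (P - p')) <= T" by (simp add: T_def)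
   then have "((2 * (B + 1) / A) powr (1 / (P - p'))) powr (P - p') <= T powr (P - p')"
    using p' by (intro powr_mono2) auto
   then have "2 * (B + 1) / A <= T powr (P - p')" using p' B A by (simp add: powr_powr)
   then have "(B + 1) / T powr (P - p') <= A / 2" using A T by (simp add: field_simps)
   moreover have "T powr (p' - P) * B <= (B + 1) / T powr (P - p')"
    using T B by (simp add: powr_minus_divide[of T "P - p'", simplified] field_simps)
   ultimately show ?thesis by linarith
  qed
  define \<delta> where "\<delta> = A / (2 * T powr p')"
  have \<delta>: "0 < \<delta>" using A T by (simp add: \<delta>_def)
  have TA: "T powr (p' - P) * B + T powr p' * \<delta> <= A"
   using TB T by (simp add: \<delta>_def)
  show "\<exists>\<delta>>0. ALL N E. N \<in> borel_measurable \<mu> --> (ALL x. 0 <= N x) --> E \<in> sets \<mu> -->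
    (ALL x. N x ~= 0 --> x \<in> E) --> emeasure \<mu> (S Int E) <= ennreal \<delta> --> (\<integral>\<^sup>+x. ennreal (N x powr p) \<partial>\<mu>) < \<infinity> -->
    (\<integral>\<^sup>+z. ennreal (enn2real (\<integral>\<^sup>+x\<in>S. ennreal (kap 0 z x * N x) \<partial>\<mu>) powr p) \<partial>\<nu>) <= ennreal \<epsilon> * (\<integral>\<^sup>+x. ennreal (N x powr p) \<partial>\<mu>)"
  proof (intro exI[of _ \<delta>] conjI allI impI \<delta>)
   fix N :: "complex ^ 3 => real" and E
   assume N: "N \<in> borel_measurable \<mu>" "ALL x. 0 <= N x" and E: "E \<in> sets \<mu>" "ALL x. N x ~= 0 --> x \<in> E"
    "emeasure \<mu> (S Int E) <= ennreal \<delta>" and Np: "(\<integral>\<^sup>+x. ennreal (N x powr p) \<partial>\<mu>) < \<infinity>"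
   have "(\<integral>\<^sup>+x. ennreal ((G z x * indicator (S Int E) x) powr p') \<partial>\<mu>) <= ennreal A" for z
    by (rule order_trans[OF GE[OF E(1,3), of T z] ennreal_leI[OF TA]]) (use \<delta> T in auto)
   then have "(\<integral>\<^sup>+z. ennreal (enn2real (\<integral>\<^sup>+x\<in>S. ennreal (kap 0 z x * N x) \<partial>\<mu>) powr p) \<partial>\<nu>)
     <= ennreal (2 powr p * A powr (p - 1) * B') * (\<integral>\<^sup>+x. ennreal (N x powr p) \<partial>\<mu>)"
    using main[of N E A] N E Np A by blast
   also have "... <= ennreal \<epsilon> * (\<integral>\<^sup>+x. ennreal (N x powr p) \<partial>\<mu>)"
    by (intro mult_right_mono ennreal_leI Ae) auto
   finally show "(\<integral>\<^sup>+z. ennreal (enn2real (\<integral>\<^sup>+x\<in>S. ennreal (kap 0 z x * N x) \<partial>\<mu>) powr p) \<partial>\<nu>)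
     <= ennreal \<epsilon> * (\<integral>\<^sup>+x. ennreal (N x powr p) \<partial>\<mu>)" .
  qed
 qed
qed

end

section \<open>The operator\<close>

text \<open>The canonical singularity enters as \<open>D_ne\<close>: a point of D other than 0 makes
  \<open>M\<close> nonempty, as the chart construction requires, and likewise the set of Hoelder
  quotients on D.\<close>

locale koppelman =
 fixes \<Omega>' \<Omega> X D :: "(complex ^ 3) set"
  and f :: "complex ^ 3 => complex"
  and \<omega> :: "complex ^ 3 => ext"
  and q :: real
  and h s :: "complex ^ 3 => complex ^ 3 => complex ^ 3"
  and cutoff :: "complex ^ 3 => real"
  and Vs Ws :: "(complex ^ 3) set"
  and r :: nat
 assumes \<Omega>': "bounded \<Omega>'" "open \<Omega>'"
  and fh: "holo_on \<Omega>' f"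
  and X: "X = {zt \<in> \<Omega>'. f zt = 0}"
  and smooth_off_0: "!!x. x \<in> \<Omega>' ==> f x = 0 ==> x ~= 0 ==> df f x ~= 0"
  and \<Omega>: "open \<Omega>" "compact (closure \<Omega>)" "closure \<Omega> <= \<Omega>'"
  and D: "D = X Int \<Omega>" and D_ne: "D - {0} ~= {}"
  and \<omega>: "structure_form f X \<omega>"
  and q: "2 < q" "q <= 4"
   "ALL q'. 1 <= q' \<and> q' < q -->
     (\<integral>\<^sup>+x. ennreal (form_norm f x 2 (\<omega> x) powr q') \<partial>dV_reg X X) < \<infinity>"
  and h: "ALL j. holo_on_prod (\<Omega>' \<times> \<Omega>') (%(zt, z). h zt z $ j)"
   "\<forall>zt\<in>\<Omega>'. \<forall>z\<in>\<Omega>'. delta_eta zt z (form1 (h zt z)) = scal (f zt - f z)"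
  and cutoff: "smooth_on UNIV cutoff" "compact (closure {zt. cutoff zt ~= 0})"
   "closure {zt. cutoff zt ~= 0} <= \<Omega>'"
  and s: "open Vs" "supp_dbar cutoff <= Vs" "open Ws" "closure \<Omega> <= Ws"
   "smooth_on (Vs \<times> Ws) (%(zt, z). s zt z)"
   "\<forall>zt\<in>Vs. holo_map_on Ws (%z. s zt z)"
  and r: "r = 1 \<or> r = 2"
begin

definition M where "M = X - {0}"
definition \<Omega>0 where "\<Omega>0 = \<Omega>' - {0}"
definition A where "A = closure {zt. cutoff zt ~= 0}"
definition Z where "Z = closure \<Omega>"
definition g where "g zt = norm (grad f zt)"

lemma X_iff: "x \<in> X \<longleftrightarrow> x \<in> \<Omega>' \<and> f x = 0"
 by (simp only: X mem_Collect_eq)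

lemma D_iff: "x \<in> D \<longleftrightarrow> x \<in> X \<and> x \<in> \<Omega>"
 by (simp only: D Int_iff)

lemma M_eq': "M = {x \<in> \<Omega>0. f x = 0}"
 by (auto simp: M_def \<Omega>0_def X_iff)

lemma grad_nz: "zt \<in> M ==> grad f zt ~= 0"
 using smooth_off_0[of zt] by (auto simp: M_def X_iff df_eq_0_iff)

lemma f0: "holo_on \<Omega>0 f" and \<Omega>0_open: "open \<Omega>0"
 using fh \<Omega>'(2) by (auto simp: \<Omega>0_def intro: holo_on_subset)

sublocale hypersurface f \<Omega>0 M
proof
 show "open \<Omega>0" by (rule \<Omega>0_open)
 show "holo_on \<Omega>0 f" by (rule f0)
 show "M = {x \<in> \<Omega>0. f x = 0}" by (rule M_eq')
 show "M ~= {}" using D_ne by (auto simp: M_def D_iff)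
 show "EX j. frechet_derivative f (at x) (axis j 1) ~= 0" if "x \<in> M" for x
  using grad_nz[OF that] by (auto simp: vec_eq_iff)
qed

lemma space_dV: "space (dV M) = M"
 using sets_eq_imp_space_eq[OF dV_props(1)] by (simp add: space_restrict_space)

section \<open>The measures on X and D and the growth of their volume\<close>

definition \<mu> where "\<mu> = dV_reg X X"
definition \<nu> where "\<nu> = dV_reg X D"

lemma dV_reg_eq: "\<mu> = restrict_space (dV M) M" "\<nu> = restrict_space (dV M) (D - {0})"
 by (simp_all add: \<mu>_def \<nu>_def dV_reg_def M_def)

lemma D0: "D - {0} = M Int \<Omega>" by (auto simp: D_iff M_def)

lemma D0_sets: "D - {0} \<in> sets (dV M)" "M \<in> sets (dV M)"
 unfolding D0 sets_dV_iff using M_borel \<Omega>(1) by auto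

lemma D0_Int: "(D - {0}) Int space (dV M) = D - {0}" "M Int space (dV M) = M"
 using D0 by (auto simp: space_dV)

lemma sets_\<mu>: "E \<in> sets \<mu> \<longleftrightarrow> E \<in> sets borel \<and> E <= M"
proof -
 have "E \<in> sets \<mu> \<longleftrightarrow> E <= M \<and> E \<in> sets (dV M)"
  unfolding dV_reg_eq by (rule sets_restrict_space_iff) (simp only: D0_Int D0_sets)
 then show ?thesis by (auto simp: sets_dV_iff)
qed

lemma sets_\<nu>: "E \<in> sets \<nu> \<longleftrightarrow> E \<in> sets borel \<and> E <= D - {0}"
proof -
 have "E \<in> sets \<nu> \<longleftrightarrow> E <= D - {0} \<and> E \<in> sets (dV M)"
  unfolding dV_reg_eq by (rule sets_restrict_space_iff) (simp only: D0_Int D0_sets)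
 moreover have "D - {0} <= M" using D0 by blast
 ultimately show ?thesis by (auto simp: sets_dV_iff)
qed

lemma space_\<mu>: "space \<mu> = M" and space_\<nu>: "space \<nu> = D - {0}"
 unfolding dV_reg_eq using D0_sets sets.sets_into_space[OF D0_sets(1)] by (auto simp: space_restrict_space space_dV)

lemma emeasure_\<mu>: "E \<in> sets \<mu> ==> emeasure \<mu> E = emeasure (dV M) E"
 unfolding dV_reg_eq
 by (rule emeasure_restrict_space) (simp only: D0_Int D0_sets, use sets_\<mu> in \<open>simp add: dV_reg_eq\<close>)

lemma emeasure_\<nu>: "E \<in> sets \<nu> ==> emeasure \<nu> E = emeasure (dV M) E"
 unfolding dV_reg_eq
 by (rule emeasure_restrict_space) (simp only: D0_Int D0_sets, use sets_\<nu> in \<open>simp add: dV_reg_eq\<close>)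

lemma borel_to_\<mu>: "F \<in> borel_measurable borel ==> F \<in> borel_measurable \<mu>"
 and borel_to_\<nu>: "F \<in> borel_measurable borel ==> F \<in> borel_measurable \<nu>"
proof -
 assume F: "F \<in> borel_measurable borel"
 have "F -` B Int M \<in> sets \<mu>" "F -` B Int (D - {0}) \<in> sets \<nu>" if "B \<in> sets borel" for B
  using measurable_sets_borel[OF F that] D0_sets by (auto simp: sets_\<mu> sets_\<nu> sets_dV_iff)
 then show "F \<in> borel_measurable \<mu>" "F \<in> borel_measurable \<nu>"
  by (auto intro!: measurableI simp: space_\<mu> space_\<nu>)
qed

text \<open>If f vanished on a nonempty open set, its differential would vanish at some zero of f
  other than 0.\<close>

lemma f_nontrivial:
 assumes "x0 \<in> \<Omega>'" "0 < e"
 shows "\<exists>x\<in>ball x0 e. f x ~= 0"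
proof (rule ccontr)
 assume neg: "\<not> ?thesis"
 define U where "U = ball x0 e Int \<Omega>'"
 have U: "open U" "x0 \<in> U" using assms \<Omega>' by (auto simp: U_def)
 have "infinite U" using U by (metis empty_iff finite_imp_not_open not_open_singleton finite.intros(1) open_subset finite_subset)
 then obtain y where y: "y \<in> U" "y ~= 0" by (metis finite.emptyI finite.insertI finite_subset insertI1 subsetI)
 have fz: "f x = 0" if "x \<in> U" for x using neg that by (auto simp: U_def)
 have "(f has_derivative (%v. 0)) (at y)"
  by (rule has_derivative_transform_within_open[OF has_derivative_const U(1) y(1)]) (simp add: fz)
 then have "frechet_derivative f (at y) = (%v. 0)" using frechet_derivative_at by metis
 then have "grad f y = 0" by (simp add: grad_def vec_eq_iff)
 then have "df f y = 0" by (simp only: df_eq_0_iff)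
 then show False using smooth_off_0[of y] y fz by (auto simp: U_def)
qed

lemma growth_at:
 assumes "x0 \<in> \<Omega>'"
 shows "\<exists>\<rho> C. 0 < \<rho> \<and> 0 <= C \<and> (ALL E z r. E \<in> sets borel --> E <= M Int ball x0 \<rho> --> E <= ball z r --> 0 < r -->
   emeasure (dV M) E <= ennreal (C * r ^ 4))"
proof -
 have sub: "\<Omega>0 <= \<Omega>'" by (auto simp: \<Omega>0_def)
 show ?thesis
 proof (rule growth[OF \<Omega>'(2) sub fh assms])
  show "\<exists>x\<in>ball x0 e. f x ~= 0" if "0 < e" for e by (rule f_nontrivial[OF assms that])
  fix \<rho> C assume "0 < \<rho>" "0 <= C" and "!!E z r. E \<in> sets borel ==> E <= M Int ball x0 \<rho> ==> E <= ball z r ==> 0 < r ==>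
   emeasure (dV M) E <= ennreal (C * r ^ 4)"
  then show ?thesis by (intro exI[of _ \<rho>] exI[of _ C]) simp
 qed
qed

lemma growth_compact:
 assumes K: "compact K" "K <= \<Omega>'"
 shows "EX C>=0. ALL z r. 0 < r --> emeasure (dV M) (M Int K Int ball z r) <= ennreal (C * r ^ 4)"
proof -
 have "\<exists>\<rho> C. 0 < \<rho> \<and> 0 <= C \<and> (ALL E z r. E \<in> sets borel --> E <= M Int ball x \<rho> --> E <= ball z r --> 0 < r -->
   emeasure (dV M) E <= ennreal (C * r ^ 4))" if "x \<in> K" for x
  using growth_at that K(2) by blast
 then obtain \<rho> C where \<rho>C: "!!x. x \<in> K ==> 0 < \<rho> x" "!!x. x \<in> K ==> 0 <= C x"
  "!!x E z r. x \<in> K ==> E \<in> sets borel ==> E <= M Int ball x (\<rho> x) ==> E <= ball z r ==> 0 < r ==>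
   emeasure (dV M) E <= ennreal (C x * r ^ 4)"
  by metis
 have "EX T<=K. finite T \<and> K <= (\<Union>x\<in>T. ball x (\<rho> x))"
  using compactE_image[OF K(1), of K "%x. ball x (\<rho> x)"] \<rho>C(1) by (metis (no_types, lifting) UN_I centre_in_ball open_ball subsetI)
 then obtain T where T: "T <= K" "finite T" "K <= (\<Union>x\<in>T. ball x (\<rho> x))" by blast
 have "emeasure (dV M) (M Int K Int ball z r) <= ennreal ((\<Sum>x\<in>T. C x) * r ^ 4)" if r: "0 < r" for z r
 proof -
  have Kb: "K \<in> sets borel" using K(1) by (simp add: borel_closed compact_imp_closed)
  define E where "E x = M Int K Int ball z r Int ball x (\<rho> x)" for x
  have Eb: "E x \<in> sets borel" for x using M_borel Kb by (auto simp: E_def)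
  have "M Int K Int ball z r = (\<Union>x\<in>T. E x)" using T(3) by (auto simp: E_def)
  then have "emeasure (dV M) (M Int K Int ball z r) <= (\<Sum>x\<in>T. emeasure (dV M) (E x))"
   using T(2) Eb by (simp only:) (rule emeasure_subadditive_finite, auto simp: sets_dV_iff E_def)
  also have "... <= (\<Sum>x\<in>T. ennreal (C x * r ^ 4))"
   using T(1) r Eb by (intro sum_mono \<rho>C(3)) (auto simp: E_def)
  also have "... = ennreal (\<Sum>x\<in>T. C x * r ^ 4)"
   using T(1) \<rho>C(2) r by (intro sum_ennreal) (auto simp: subset_iff)
  finally show ?thesis by (simp add: sum_distrib_right)
 qed
 then show ?thesis using T(1) \<rho>C(2) by (intro exI[of _ "\<Sum>x\<in>T. C x"]) (auto intro!: sum_nonneg)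
qed

lemma sigma_finite_\<mu>: "sigma_finite_measure \<mu>"
proof -
 have "EX N. open N \<and> x \<in> N \<and> emeasure (dV M) (M Int N) < \<infinity>" if x: "x \<in> M" for x
 proof -
  have "x \<in> \<Omega>'" using x by (auto simp: M_def X_iff)
  then obtain \<rho> C where \<rho>C: "0 < \<rho>" "0 <= C" "!!E z r. E \<in> sets borel ==> E <= M Int ball x \<rho> ==> E <= ball z r ==> 0 < r ==>
   emeasure (dV M) E <= ennreal (C * r ^ 4)" using growth_at by metis
  have "emeasure (dV M) (M Int ball x \<rho>) <= ennreal (C * \<rho> ^ 4)"
   by (rule \<rho>C(3)[of _ x]) (use M_borel \<rho>C(1) in auto)
  also have "... < \<infinity>" by simp
  finally show ?thesis using \<rho>C(1) by (intro exI[of _ "ball x \<rho>"]) auto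
 qed
 from countable_open_subcover[OF this M_ne] obtain N where N: "!!i::nat. open (N i)"
  "!!i. emeasure (dV M) (M Int N i) < \<infinity>" "M <= (\<Union>i. N i)" by blast
 show ?thesis
 proof
  have "M Int N i \<in> sets \<mu>" for i using M_borel N(1) by (auto simp: sets_\<mu>)
  then show "EX A. countable A \<and> A <= sets \<mu> \<and> \<Union>A = space \<mu> \<and> (\<forall>a\<in>A. emeasure \<mu> a ~= \<infinity>)"
   using N(2,3) by (intro exI[of _ "range (%i. M Int N i)"]) (auto simp: space_\<mu> emeasure_\<mu> less_top)
 qed
qed

text \<open>The kernel vanishes off the support of the cutoff. Growth with a single constant comes
  from a finite cover and is therefore available on compact subsets of \<Omega>', such as this
  support.\<close>

definition S where "S = M Int A"

lemma A: "compact A" "A <= \<Omega>'" and Z: "compact Z" "Z <= \<Omega>'" "Z <= Ws"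
 using cutoff \<Omega> s(4) by (auto simp: A_def Z_def)

lemma DZ: "D <= Z"
 using closure_subset[of \<Omega>] by (auto simp: D_iff Z_def)

lemma S_sets: "S \<in> sets \<mu>"
 using M_borel A(1) by (auto simp: sets_\<mu> S_def compact_imp_closed)

lemma grad_continuous: "continuous_on \<Omega>' (grad f)"
 unfolding grad_def by (intro continuous_on_vec_lambda holo_deriv_continuous[OF \<Omega>'(2) fh])

definition gr where "gr zt = (if zt \<in> \<Omega>' then grad f zt else 0)"

lemma gr_measurable: "gr \<in> borel_measurable borel"
 unfolding gr_def using \<Omega>'(2) grad_continuous
 by (intro borel_measurable_continuous_on_if) auto

lemma gr_eq: "zt \<in> M ==> gr zt = grad f zt"
 by (auto simp: gr_def M_def X_iff)

definition W where "W zt = 1 / norm (gr zt)"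

lemma W_measurable: "W \<in> borel_measurable borel"
 unfolding W_def using gr_measurable by measurable

lemma \<omega>D: "zt \<in> M ==> form_20 (\<omega> zt)" "zt \<in> M ==> df f zt \<^bold>\<and> \<omega> zt = (2 * pi * \<i>) *s dzeta123"
 using \<omega> by (auto simp: structure_form_def M_def)

lemma M_in: "zt \<in> M ==> zt \<in> \<Omega>'" by (auto simp: M_def X_iff)

lemma W_Lq:
 assumes "1 <= q1" "q1 < q"
 shows "(\<integral>\<^sup>+x. ennreal (W x powr q1) \<partial>\<mu>) < \<infinity>"
proof -
 have "(\<integral>\<^sup>+x. ennreal (W x powr q1) \<partial>\<mu>) <= (\<integral>\<^sup>+x. ennreal (form_norm f x 2 (\<omega> x) powr q1) \<partial>\<mu>)"
 proof (intro nn_integral_mono ennreal_leI powr_mono2)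
  fix x assume "x \<in> space \<mu>"
  then have x: "x \<in> M" by (simp add: space_\<mu>)
  show "W x <= form_norm f x 2 (\<omega> x)"
   using structure_form_norm[OF fh M_in[OF x] grad_nz[OF x] \<omega>D[OF x]] by (simp add: W_def gr_eq[OF x])
 qed (use assms in \<open>auto simp: W_def\<close>)
 also have "... < \<infinity>" using q(3) assms by (simp add: \<mu>_def)
 finally show ?thesis .
qed

lemma riesz_exists: "EX C. riesz \<mu> \<nu> S W C q"
proof -
 obtain C1 where C1: "0 <= C1" "!!z r. 0 < r ==> emeasure (dV M) (M Int A Int ball z r) <= ennreal (C1 * r ^ 4)"
  using growth_compact[OF A] by auto
 obtain C2 where C2: "0 <= C2" "!!z r. 0 < r ==> emeasure (dV M) (M Int Z Int ball z r) <= ennreal (C2 * r ^ 4)"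
  using growth_compact[OF Z(1,2)] by auto
 obtain R0 where R0: "\<Omega>' <= ball 0 R0"
  using bounded_subset_ballD[OF \<Omega>'(1), of 0] by blast
 define R where "R = max 1 R0"
 have R: "1 <= R" "\<Omega>' <= ball 0 R"
  using R0 subset_ball[of R0 R 0] by (auto simp: R_def)
 \<comment> \<open>The factor R^4 lets the same constant bound the total masses, since a ball of
   radius R contains everything.\<close>
 define C where "C = (C1 + C2) * R ^ 4"
 have R4: "1 <= R ^ 4" using R(1) by (rule one_le_power)
 have C: "0 <= C" "C1 <= C" "C2 <= C" "C1 * R ^ 4 <= C" "C2 * R ^ 4 <= C"
 proof -
  have "C1 * 1 <= C1 * R ^ 4" "C2 * 1 <= C2 * R ^ 4" using C1(1) C2(1) R4 by (intro mult_left_mono; simp)+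
  moreover have "C = C1 * R ^ 4 + C2 * R ^ 4" by (simp add: C_def distrib_right)
  ultimately show "0 <= C" "C1 <= C" "C2 <= C" "C1 * R ^ 4 <= C" "C2 * R ^ 4 <= C" using C1(1) C2(1) by auto
 qed
 have ballb: "ball z r \<in> sets borel" for z :: "complex ^ 3" and r by simp
 have Sb: "S Int ball z r \<in> sets \<mu>" for z r using S_sets by (auto simp: sets_\<mu>)
 have nb: "(D - {0}) Int ball z r \<in> sets \<nu>" for z r using D0_sets by (auto simp: sets_\<nu> sets_dV_iff)
 have sub: "emeasure (dV M) ((D - {0}) Int ball z r) <= emeasure (dV M) (M Int Z Int ball z r)" for z r
 proof (rule emeasure_mono)
  show "(D - {0}) Int ball z r <= M Int Z Int ball z r" using DZ D0 by auto
  show "M Int Z Int ball z r \<in> sets (dV M)" using M_borel Z(1) by (auto simp: sets_dV_iff compact_imp_closed)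
 qed
 have g1: "emeasure \<mu> (S Int ball z r) <= ennreal (C1 * r ^ 4)" if "0 < r" for z r
  using C1(2)[OF that, of z] unfolding emeasure_\<mu>[OF Sb] by (simp add: S_def)
 have g2: "emeasure \<nu> ((D - {0}) Int ball z r) <= ennreal (C2 * r ^ 4)" if "0 < r" for z r
  unfolding emeasure_\<nu>[OF nb] by (rule order_trans[OF sub C2(2)[OF that]])
 have MB: "S Int ball 0 R = S" "(D - {0}) Int ball 0 R = D - {0}"
  using R(2) M_in by (auto simp: S_def D0)
 have tot1: "emeasure \<mu> S <= ennreal C"
  using g1[of R 0] R(1) C ennreal_leI[OF C(4)] unfolding MB by (auto intro: order_trans)
 have tot2: "emeasure \<nu> (D - {0}) <= ennreal C"
  using g2[of R 0] R(1) C ennreal_leI[OF C(5)] unfolding MB by (auto intro: order_trans)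
 have up: "ennreal (C1 * r ^ 4) <= ennreal (C * r ^ 4)" "ennreal (C2 * r ^ 4) <= ennreal (C * r ^ 4)" if "0 < r" for r
  using C that by (auto intro!: ennreal_leI mult_right_mono)
 have "riesz \<mu> \<nu> S W C q"
 proof (rule riesz.intro)
  show "sigma_finite_measure \<mu>" by (rule sigma_finite_\<mu>)
  have "emeasure \<nu> (space \<nu>) ~= \<infinity>" using tot2 by (auto simp: space_\<nu> top_unique)
  then show "finite_measure \<nu>" by (rule finite_measureI)
  show "S \<in> sets \<mu>" by (rule S_sets)
  show "emeasure \<mu> (S Int ball z r) <= ennreal (C * r ^ 4)" if "0 < r" for z r
   by (rule order_trans[OF g1[OF that] up(1)[OF that]])
  show "emeasure \<nu> (space \<nu> Int ball z r) <= ennreal (C * r ^ 4)" if "0 < r" for z r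
   unfolding space_\<nu> by (rule order_trans[OF g2[OF that] up(2)[OF that]])
  show "emeasure \<mu> S <= ennreal C" by (rule tot1)
  show "emeasure \<nu> (space \<nu>) <= ennreal C" unfolding space_\<nu> by (rule tot2)
  show "0 <= W x" for x by (simp add: W_def)
  show "(\<integral>\<^sup>+x. ennreal (W x powr q1) \<partial>\<mu>) < \<infinity>" if "1 <= q1" "q1 < q" for q1 by (rule W_Lq[OF that])
 qed (use C q W_measurable in \<open>auto intro!: borel_to_\<mu> borel_to_\<nu>\<close>)
 then show ?thesis by blast
qed

section \<open>The cutoff, the form s and the Hefer form\<close>

lemma cutoff_C1: "cutoff differentiable (at x)" "continuous_on UNIV (%x. frechet_derivative cutoff (at x) v)"
proof -
 have "Ck_on (Suc 0) UNIV cutoff" using cutoff(1) by (simp add: smooth_on_def)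
 then show "cutoff differentiable (at x)" "continuous_on UNIV (%x. frechet_derivative cutoff (at x) v)" by simp_all
qed

lemma cutoff_continuous: "continuous_on UNIV cutoff"
 by (intro continuous_at_imp_continuous_on ballI differentiable_imp_continuous_within cutoff_C1(1))

lemma dcut_continuous: "continuous_on UNIV (dcut cutoff)"
 unfolding dcut_def scal_def
proof (intro continuous_on_sum bounded_linear.continuous_on[OF bounded_bilinear.bounded_linear_right[OF bounded_bilinear_wedge]])
 fix j
 have "continuous_on UNIV (%x. if S = {} then (of_real (frechet_derivative cutoff (at x) (axis j 1)) + \<i> * of_real (frechet_derivative cutoff (at x) (axis j \<i>))) / 2 else (0 :: complex))" for S :: "gen set"
  by (cases "S = {}") (auto intro!: continuous_intros cutoff_C1(2))
 then have "continuous_on UNIV (%x. \<chi> S :: gen set. if S = {} then (of_real (frechet_derivative cutoff (at x) (axis j 1)) + \<i> * of_real (frechet_derivative cutoff (at x) (axis j \<i>))) / 2 else (0 :: complex))"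
  by (rule continuous_on_vec_lambda)
 then show "continuous_on UNIV (%x. axis {} ((of_real (frechet_derivative cutoff (at x) (axis j 1)) + \<i> * of_real (frechet_derivative cutoff (at x) (axis j \<i>))) / 2) :: ext)"
  unfolding axis_def by (simp add: eq_commute cong: if_cong)
qed

lemma supp_dbar_eq: "supp_dbar cutoff = closure {zt. dcut cutoff zt ~= 0}"
 unfolding supp_dbar_def dbar_cut_form[OF cutoff_C1(1)] ..

lemma outside_A:
 assumes "zt \<notin> A"
 shows "cutoff zt = 0" "dcut cutoff zt = 0"
proof -
 have "open (- A)" unfolding A_def by (rule open_Compl) (rule closed_closure)
 have z: "cutoff x = 0" if "x \<in> - A" for x
  using that closure_subset[of "{zt. cutoff zt ~= 0}"] by (auto simp: A_def)
 show "cutoff zt = 0" using z assms by simp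
 have "(cutoff has_derivative (%v. 0)) (at zt)"
  by (rule has_derivative_transform_within_open[OF has_derivative_const \<open>open (- A)\<close>]) (use assms z in auto)
 then have e: "frechet_derivative cutoff (at zt) = (%v. 0)" using frechet_derivative_at by metis
 have "scal 0 = 0" by (simp add: scal_def vec_eq_iff axis_def)
 then show "dcut cutoff zt = 0" by (simp add: dcut_def e)
qed

lemma supp_dbar_subset: "supp_dbar cutoff <= A" "compact (supp_dbar cutoff)"
proof -
 have "{zt. dcut cutoff zt ~= 0} <= A" using outside_A(2) by auto
 then show "supp_dbar cutoff <= A" unfolding supp_dbar_eq by (intro closure_minimal) (simp_all add: A_def)
 then show "compact (supp_dbar cutoff)"
  using A(1) compact_Int_closed[of A "supp_dbar cutoff"] by (simp add: supp_dbar_eq Int_absorb1)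
qed

lemma dcut_nz: "dcut cutoff zt ~= 0 ==> zt \<in> supp_dbar cutoff"
 unfolding supp_dbar_eq by (rule subsetD[OF closure_subset]) simp

lemma s_continuous: "continuous_on (Vs \<times> Ws) (%(zt, z). s zt z)"
proof -
 have "Ck_on 0 (Vs \<times> Ws) (%(zt, z). s zt z)" using s(5) unfolding smooth_on_def by blast
 then show ?thesis by simp
qed

lemma s_differentiable:
 assumes "zt \<in> Vs" "z \<in> Ws"
 shows "(%\<xi>. s \<xi> z) differentiable (at zt)" "(%w. s zt w) differentiable (at z)"
proof -
 have "Ck_on (Suc 0) (Vs \<times> Ws) (%(zt, z). s zt z)" using s(5) unfolding smooth_on_def by blast
 then have "(%(zt, z). s zt z) differentiable (at (zt, z))" using assms by simp
 then obtain F where F: "((%(zt, z). s zt z) has_derivative F) (at (zt, z))" by (auto simp: differentiable_def)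
 have p1: "((%\<xi>. (\<xi>, z)) has_derivative (%v. (v, 0))) (at zt)" and p2: "((%w. (zt, w)) has_derivative (%v. (0, v))) (at z)"
  by (auto intro!: derivative_eq_intros)
 show "(%\<xi>. s \<xi> z) differentiable (at zt)"
  using has_derivative_compose[OF p1 F] by (auto simp: differentiable_def)
 show "(%w. s zt w) differentiable (at z)"
  using has_derivative_compose[OF p2 F] by (auto simp: differentiable_def)
qed

abbreviation "Kt \<equiv> K_tilde cutoff s h"

lemma Kt_eq:
 assumes "z \<in> Ws"
 shows "Kt zt z = divide_dzeta (form1 (h zt z) \<^bold>\<and> Pker cutoff s zt z)"
 unfolding K_tilde_def K_numerator_def
 by (subst bideg_hol_g_B[OF cutoff_C1(1)]) (use dcut_nz s(2) s_differentiable assms in \<open>auto simp: subset_iff\<close>)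

lemma Kt_degr:
 assumes "z \<in> Ws"
 shows "degr 0 1 (Kt zt z)"
proof -
 have e: "(0::nat) + 1 + 1 = 2" "(1::nat) + 1 + 1 = 3" "(1::nat) + 1 = 2" "(2::nat) + 1 = 3" "(1::nat) + 2 = 3" "(1::nat) + 3 = 4" "(4::nat) - 3 = 1"
  by simp_all
 have "degr (1 + 1) (1 + 2) (bF \<eta> \<^bold>\<and> dbF \<eta>)" for \<eta> by (intro degr_wedge degr_bF degr_dbF)
 then have 1: "degr 2 3 (of_real c *s P1 \<eta>)" for c \<eta> unfolding e P1_def by (intro degr_smult)
 have "degr (0 + 1 + 1) (1 + 1 + 1) ((dcut cutoff zt \<^bold>\<and> form1 (s zt z)) \<^bold>\<and> bF \<eta>)" for \<eta>
  by (intro degr_wedge degr_bF degr_dcut degr_form1)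
 then have "degr 2 3 (Pker cutoff s zt z)"
  unfolding Pker_def e by (intro degr_diff 1)
 from degr_wedge[OF degr_form1 this] have "degr 3 4 (form1 (h zt z) \<^bold>\<and> Pker cutoff s zt z)" unfolding e .
 from degr_divide_dzeta[OF this] show ?thesis unfolding Kt_eq[OF assms] e .
qed

lemmas divide_dzeta_0 = linear_0[OF bounded_linear.linear[OF bounded_linear_divide_dzeta]]
 and wedge_0_left = bounded_bilinear.zero_left[OF bounded_bilinear_wedge]
 and wedge_0_right = bounded_bilinear.zero_right[OF bounded_bilinear_wedge]

lemma Kt_diag:
 assumes "z \<in> Ws"
 shows "Kt z z = 0"
proof -
 have "Pker cutoff s z z = 0"
  by (simp only: Pker_def P1_def diff_self bF_0 wedge_0_left wedge_0_right vector_smult_rzero)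
 then show ?thesis by (simp only: Kt_eq[OF assms] wedge_0_right divide_dzeta_0)
qed

lemma Kt_outside:
 assumes "z \<in> Ws" "zt \<notin> A"
 shows "Kt zt z = 0"
proof -
 have "Pker cutoff s zt z = 0"
  by (simp only: Pker_def outside_A[OF assms(2)] of_real_0 vector_smult_lzero wedge_0_left diff_self)
 then show ?thesis by (simp only: Kt_eq[OF assms(1)] wedge_0_right divide_dzeta_0)
qed

lemma h_continuous: "continuous_on (\<Omega>' \<times> \<Omega>') (%(zt, z). h zt z $ j)"
 unfolding continuous_on_eq_continuous_within
proof
 fix x assume "x \<in> \<Omega>' \<times> \<Omega>'"
 then obtain F where "((%(zt, z). h zt z $ j) has_derivative F) (at x)"
  using h(1) unfolding holo_on_prod_def by blast
 then show "continuous (at x within \<Omega>' \<times> \<Omega>') (%(zt, z). h zt z $ j)"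
  using has_derivative_continuous continuous_at_imp_continuous_at_within by blast
qed

lemma h_holo:
 assumes "zt \<in> \<Omega>'"
 shows "holo_on \<Omega>' (%z. h zt z $ j)"
 unfolding holo_on_def
proof
 fix z assume "z \<in> \<Omega>'"
 then obtain F where F: "((%(zt, z). h zt z $ j) has_derivative F) (at (zt, z))" "!!c u v. F (c *s u, c *s v) = c * F (u, v)"
  using h(1) assms unfolding holo_on_prod_def by blast
 have p2: "((%w. (zt, w)) has_derivative (%v. (0, v))) (at z)"
  by (auto intro!: derivative_eq_intros)
 have "((%w. h zt w $ j) has_derivative (%v. F (0, v))) (at z)"
  using has_derivative_compose[OF p2 F(1)] by simp
 moreover have "F (0, c *s v) = c * F (0, v)" for c v using F(2)[of c 0 v] by simp
 ultimately show "EX D. ((%z. h zt z $ j) has_derivative D) (at z) \<and> (ALL c v. D (c *s v) = c * D v)" by blast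
qed

lemma vec3_uniform_lipschitz:
 fixes F :: "complex ^ 3 => complex ^ 3 => complex ^ 3"
 assumes "compact B" "compact Y" "Y <= U" "open U"
  and "!!j. continuous_on (B \<times> U) (%(a, z). F a z $ j)" "!!a j. a \<in> B ==> holo_on U (%z. F a z $ j)"
 obtains L where "0 < L" "!!a z. a \<in> B ==> z \<in> Y ==> norm (F a z) <= L"
  "!!a z w. a \<in> B ==> z \<in> Y ==> w \<in> Y ==> norm (F a z - F a w) <= L * norm (z - w)"
proof -
 have "\<exists>L>0. (ALL a z. a \<in> B --> z \<in> Y --> cmod (F a z $ j) <= L) \<and>
  (ALL a z w. a \<in> B --> z \<in> Y --> w \<in> Y --> cmod (F a z $ j - F a w $ j) <= L * dist z w)" for j
  by (rule holo_uniform_lipschitz[OF assms(1-5), of j]) (use assms(6) in auto)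
 then obtain L where L: "!!j. 0 < L j" "!!j a z. a \<in> B ==> z \<in> Y ==> cmod (F a z $ j) <= L j"
  "!!j a z w. a \<in> B ==> z \<in> Y ==> w \<in> Y ==> cmod (F a z $ j - F a w $ j) <= L j * dist z w"
  by metis
 show ?thesis
 proof (rule that[of "L 1 + L 2 + L 3"])
  show "0 < L 1 + L 2 + L 3" using L(1) by (simp add: add_pos_pos)
  fix a z assume *: "a \<in> B" "z \<in> Y"
  show "norm (F a z) <= L 1 + L 2 + L 3"
   by (rule order_trans[OF norm_vec3_le]) (intro add_mono L(2)[OF *])
  fix w assume w: "w \<in> Y"
  have "norm (F a z - F a w) <= L 1 * dist z w + L 2 * dist z w + L 3 * dist z w"
   by (rule order_trans[OF norm_vec3_le]) (simp only: vector_minus_component, intro add_mono L(3)[OF * w])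
  then show "norm (F a z - F a w) <= (L 1 + L 2 + L 3) * norm (z - w)" by (simp add: distrib_right dist_norm)
 qed
qed

text \<open>Along the j-th axis the Hefer identity reads 2 \<pi> i t h_j(\<zeta>, \<zeta> - t e_j) =
  f(\<zeta>) - f(\<zeta> - t e_j). Dividing by t and letting t tend to 0 identifies 2 \<pi> i h on
  the diagonal with the gradient of f. This factor cancels the size of \<omega> in the most singular
  term of the kernel.\<close>

lemma h_diag:
 assumes "zt \<in> \<Omega>'"
 shows "norm (h zt zt) <= norm (grad f zt)"
proof -
 have "2 * pi * \<i> * h zt zt $ j = grad f zt $ j" for j
 proof -
  have ev: "\<forall>\<^sub>F t in at 0. 2 * pi * \<i> * h zt (zt - t *s axis j 1) $ j = (f zt - f (zt - t *s axis j 1)) / t"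
  proof -
   have "((%t::complex. zt - t *s axis j 1) \<longlongrightarrow> zt - 0 *s axis j 1) (at 0)"
    by (intro tendsto_diff tendsto_const bounded_linear.tendsto[OF bounded_linear_smult_left] tendsto_ident_at)
   then have "\<forall>\<^sub>F t in at (0::complex). zt - t *s axis j 1 \<in> \<Omega>'"
    using assms \<Omega>'(2) by (auto dest: topological_tendstoD)
   moreover have "\<forall>\<^sub>F t in at (0::complex). t ~= 0" by (rule eventually_at_filter[THEN iffD2]) simp
   ultimately show ?thesis
   proof eventually_elim
    case (elim t)
    have "delta_eta zt (zt - t *s axis j 1) (form1 (h zt (zt - t *s axis j 1))) $ {} = scal (f zt - f (zt - t *s axis j 1)) $ {}"
     using h(2) assms elim by simp
    moreover have "delta_eta zt z (form1 y) $ {} = (\<Sum>k\<in>UNIV. 2 * pi * \<i> * (zt $ k - z $ k) * y $ k)" for z y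
    proof -
     have "delta_eta zt z (form1 y) = scal (\<Sum>k\<in>UNIV. 2 * pi * \<i> * (zt $ k - z $ k) * y $ k)"
      unfolding delta_eta_def form1_axis interior_mult_add interior_axis_1 scal_def
      by (simp add: sum_3 vec_eq_iff axis_def)
     then show ?thesis by (simp add: scal_def axis_def)
    qed
    ultimately have u1: "(\<Sum>k\<in>UNIV. 2 * pi * \<i> * (t *s axis j 1 :: complex ^ 3) $ k * h zt (zt - t *s axis j 1) $ k) = f zt - f (zt - t *s axis j 1)"
     by (simp add: scal_def axis_def)
    have u2: "(\<Sum>k\<in>UNIV. 2 * pi * \<i> * (t *s axis j 1 :: complex ^ 3) $ k * y $ k) = 2 * pi * \<i> * t * y $ j" for y :: "complex ^ 3"
     using exhaust_3[of j] by (auto simp: sum_3 axis_def)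
    have "2 * pi * \<i> * t * h zt (zt - t *s axis j 1) $ j = f zt - f (zt - t *s axis j 1)"
     by (rule trans[OF u2[symmetric] u1])
    then show ?case using elim by (simp add: eq_divide_eq mult_ac)
   qed
  qed
  have "continuous_on \<Omega>' (%z. h zt z $ j)" by (rule holo_on_imp_continuous_on[OF h_holo[OF assms]])
  then have "isCont (%z. h zt z $ j) zt" using assms \<Omega>'(2) continuous_on_eq_continuous_at by blast
  then have hz: "isCont (%z. h zt z $ j) (zt - 0 *s axis j 1)" by simp
  have "((%t::complex. zt - t *s axis j 1) \<longlongrightarrow> zt - 0 *s axis j 1) (at 0)"
   by (intro tendsto_diff tendsto_const bounded_linear.tendsto[OF bounded_linear_smult_left] tendsto_ident_at)
  from isCont_tendsto_compose[OF hz this]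
  have l1: "((%t. 2 * pi * \<i> * h zt (zt - t *s axis j 1) $ j) \<longlongrightarrow> 2 * pi * \<i> * h zt zt $ j) (at 0)"
   by (intro tendsto_mult tendsto_const) simp
  have z: "zt + 0 *s (- axis j 1) \<in> \<Omega>'" using assms by simp
  have neg: "frechet_derivative f (at zt) (- axis j 1) = - frechet_derivative f (at zt) (axis j 1)"
   using linear_neg[OF has_derivative_linear[OF holo_onD(1)[OF fh assms]]] .
  have "((%t. (f (zt + t *s (- axis j 1)) - f zt) / t) \<longlongrightarrow> - frechet_derivative f (at zt) (axis j 1)) (at 0)"
   using holo_on_line[OF fh z] unfolding has_field_derivative_iff by (simp add: neg)
  from tendsto_minus[OF this]
  have "((%t. - ((f (zt - t *s axis j 1) - f zt) / t)) \<longlongrightarrow> grad f zt $ j) (at 0)"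
   by (simp add: vector_sneg_minus1[symmetric] flip: minus_divide_left)
    (simp add: vector_smult_rneg)?
  then have l2: "((%t. (f zt - f (zt - t *s axis j 1)) / t) \<longlongrightarrow> grad f zt $ j) (at 0)"
   by (simp only: minus_divide_left minus_diff_eq)
  show ?thesis
   by (rule tendsto_unique[OF _ Lim_transform_eventually[OF l1 ev] l2]) simp
 qed
 then have "(2 * pi * \<i>) *s h zt zt = grad f zt" by (simp add: vec_eq_iff)
 then have "2 * pi * norm (h zt zt) = norm (grad f zt)" using norm_smult_vec[of "2 * pi * \<i>" "h zt zt"] by (simp add: norm_mult)
 moreover have "1 * norm (h zt zt) <= 2 * pi * norm (h zt zt)" using pi_ge_two by (intro mult_right_mono) auto
 ultimately show ?thesis by simp
qed

end

section \<open>Kernels with a singularity along the diagonal\<close>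

lemma powr_frac_le:
 fixes x t a :: real
 assumes "0 <= x" "x <= t" "0 < t" "0 <= a" "a <= 1"
 shows "x * t powr (- b) <= x powr a * t powr (1 - a - b)"
proof (cases "x = 0")
 case False
 then have x: "0 < x" using assms by simp
 have "x * t powr (- b) = x powr a * (x powr (1 - a) * t powr (- b))"
  using x by (simp flip: powr_add mult.assoc)
 also have "... <= x powr a * (t powr (1 - a) * t powr (- b))"
  using assms x by (intro mult_left_mono mult_right_mono powr_mono2) auto
 also have "... = x powr a * t powr (1 - a - b)" by (simp flip: powr_add)
 finally show ?thesis .
qed simp

text \<open>For x at least the distance t, the factor (x/t)^a is at least 1 and may be
  inserted.\<close>

lemma powr_frac_ge:
 fixes x t a :: real
 assumes "t <= x" "0 < t" "0 <= a"
 shows "t powr (- b) <= x powr a * t powr (- b - a)"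
proof -
 have "t powr (- b) = t powr a * t powr (- b - a)" by (simp flip: powr_add)
 also have "... <= x powr a * t powr (- b - a)"
  using assms by (intro mult_right_mono powr_mono2) auto
 finally show ?thesis .
qed

lemma div_power_mono: "0 <= C ==> 0 < t ==> t <= x ==> C / x ^ n <= C / (t :: real) ^ n"
 by (intro divide_left_mono power_mono mult_pos_pos) auto

text \<open>The counterpart of \<open>sing\<close> for kernels that do not depend on \<zeta> - z
  alone, uniform on A and Z. Here t is a common lower bound of the two distances; orders again add
  under products.\<close>

definition kernel_order :: "(complex ^ 3) set => (complex ^ 3) set => nat
  => (complex ^ 3 => complex ^ 3 => 'b::real_normed_vector) => bool" where
 "kernel_order A Z n F \<longleftrightarrow> (EX C>=0. \<forall>zt\<in>A. \<forall>z\<in>Z. (zt ~= z --> norm (F zt z) <= C / norm (zt - z) ^ n) \<and>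
   (\<forall>w\<in>Z. \<forall>t>0. t <= norm (zt - z) --> t <= norm (zt - w) -->
    norm (F zt z - F zt w) <= C * norm (z - w) / t ^ (n + 1)))"

lemma kernel_orderI:
 assumes "0 <= C" "!!zt z. zt \<in> A ==> z \<in> Z ==> zt ~= z ==> norm (F zt z) <= C / norm (zt - z) ^ n"
  "!!zt z w t. zt \<in> A ==> z \<in> Z ==> w \<in> Z ==> 0 < t ==> t <= norm (zt - z) ==> t <= norm (zt - w) ==>
   norm (F zt z - F zt w) <= C * norm (z - w) / t ^ (n + 1)"
 shows "kernel_order A Z n F"
 unfolding kernel_order_def using assms by (intro exI[of _ C]) simp

lemma kernel_orderE:
 assumes "kernel_order A Z n F"
 obtains C where "0 <= C" "!!zt z. zt \<in> A ==> z \<in> Z ==> zt ~= z ==> norm (F zt z) <= C / norm (zt - z) ^ n"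
  "!!zt z w t. zt \<in> A ==> z \<in> Z ==> w \<in> Z ==> 0 < t ==> t <= norm (zt - z) ==> t <= norm (zt - w) ==>
   norm (F zt z - F zt w) <= C * norm (z - w) / t ^ (n + 1)"
 using assms unfolding kernel_order_def by metis

lemma kernel_order_sing: "sing n F ==> kernel_order A Z n (%zt z. F (zt - z))"
proof -
 assume "sing n F"
 then obtain C where C: "0 <= C" "!!x. x ~= 0 ==> norm (F x) <= C / norm x ^ n"
  "!!x y s. 0 < s ==> s <= norm x ==> s <= norm y ==> norm (F x - F y) <= C * norm (x - y) / s ^ (n + 1)"
  unfolding sing_def by metis
 show ?thesis
 proof (rule kernel_orderI[OF C(1)])
  fix zt z w :: "complex ^ 3" and t :: real
  show "zt ~= z ==> norm (F (zt - z)) <= C / norm (zt - z) ^ n" using C(2)[of "zt - z"] by simp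
  show "0 < t ==> t <= norm (zt - z) ==> t <= norm (zt - w) ==> norm (F (zt - z) - F (zt - w)) <= C * norm (z - w) / t ^ (n + 1)"
   using C(3)[of t "zt - z" "zt - w"] by (simp add: norm_minus_commute)
 qed
qed

lemma kernel_order_bilinear:
 fixes F :: "complex ^ 3 => complex ^ 3 => 'b::real_normed_vector" and G :: "complex ^ 3 => complex ^ 3 => 'c::real_normed_vector"
  and B :: "'b => 'c => 'd::real_normed_vector"
 assumes B: "bounded_bilinear B" and F: "kernel_order A Z m F" and G: "kernel_order A Z n G"
 shows "kernel_order A Z (m + n) (%zt z. B (F zt z) (G zt z))"
proof -
 obtain K where K: "0 <= K" "!!a b. norm (B a b) <= norm a * norm b * K"
  using bounded_bilinear.nonneg_bounded[OF B] by auto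
 obtain C1 where C1: "0 <= C1" "!!zt z. zt \<in> A ==> z \<in> Z ==> zt ~= z ==> norm (F zt z) <= C1 / norm (zt - z) ^ m"
  "!!zt z w t. zt \<in> A ==> z \<in> Z ==> w \<in> Z ==> 0 < t ==> t <= norm (zt - z) ==> t <= norm (zt - w) ==>
   norm (F zt z - F zt w) <= C1 * norm (z - w) / t ^ (m + 1)"
  by (rule kernel_orderE[OF F]) (rule that; (assumption | blast))
 obtain C2 where C2: "0 <= C2" "!!zt z. zt \<in> A ==> z \<in> Z ==> zt ~= z ==> norm (G zt z) <= C2 / norm (zt - z) ^ n"
  "!!zt z w t. zt \<in> A ==> z \<in> Z ==> w \<in> Z ==> 0 < t ==> t <= norm (zt - z) ==> t <= norm (zt - w) ==>
   norm (G zt z - G zt w) <= C2 * norm (z - w) / t ^ (n + 1)"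
  by (rule kernel_orderE[OF G]) (rule that; (assumption | blast))
 define C where "C = 2 * (C1 * C2 * K)"
 have C0: "0 <= C1 * C2 * K" using C1(1) C2(1) K(1) by simp
 show ?thesis
 proof (rule kernel_orderI[of C])
  show "0 <= C" using C0 by (simp add: C_def)
  fix zt z assume *: "zt \<in> A" "z \<in> Z"
  show "norm (B (F zt z) (G zt z)) <= C / norm (zt - z) ^ (m + n)" if "zt ~= z"
  proof -
   have "norm (B (F zt z) (G zt z)) <= norm (F zt z) * norm (G zt z) * K" by (rule K(2))
   also have "... <= (C1 / norm (zt - z) ^ m) * (C2 / norm (zt - z) ^ n) * K"
    using C1(1) C2(1) K(1) by (intro mult_right_mono mult_mono C1(2)[OF * that] C2(2)[OF * that]) auto
   also have "... = (C1 * C2 * K) / norm (zt - z) ^ (m + n)" by (simp add: power_add)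
   also have "... <= C / norm (zt - z) ^ (m + n)" using C0 by (intro divide_right_mono) (auto simp: C_def)
   finally show ?thesis .
  qed
  fix w t assume w: "w \<in> Z" and t: "0 < t" "t <= norm (zt - z)" "t <= norm (zt - w)"
  have ne: "zt ~= z" "zt ~= w" using t by auto
  have g: "norm (G zt z) <= C2 / t ^ n"
   by (rule order_trans[OF C2(2)[OF * ne(1)] div_power_mono[OF C2(1) t(1,2)]])
  have fw: "norm (F zt w) <= C1 / t ^ m"
   by (rule order_trans[OF C1(2)[OF *(1) w ne(2)] div_power_mono[OF C1(1) t(1,3)]])
  have "B (F zt z) (G zt z) - B (F zt w) (G zt w) = B (F zt z - F zt w) (G zt z) + B (F zt w) (G zt z - G zt w)"
   by (simp add: bounded_bilinear.diff_left[OF B] bounded_bilinear.diff_right[OF B])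
  also have "norm ... <= norm (F zt z - F zt w) * norm (G zt z) * K + norm (F zt w) * norm (G zt z - G zt w) * K"
   by (rule order_trans[OF norm_triangle_ineq]) (intro add_mono K(2))
  also have "... <= (C1 * norm (z - w) / t ^ (m + 1)) * (C2 / t ^ n) * K + (C1 / t ^ m) * (C2 * norm (z - w) / t ^ (n + 1)) * K"
   using C1(1) C2(1) K(1) t
   by (intro add_mono mult_right_mono mult_mono C1(3)[OF * w t] C2(3)[OF * w t] g fw) auto
  also have "... = C * norm (z - w) / t ^ (m + n + 1)" using t by (simp add: C_def field_simps power_add)
  finally show "norm (B (F zt z) (G zt z) - B (F zt w) (G zt w)) <= C * norm (z - w) / t ^ (m + n + 1)" .
 qed
qed

lemma kernel_order_diff:
 assumes F: "kernel_order A Z m F" and G: "kernel_order A Z m G"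
 shows "kernel_order A Z m (%zt z. F zt z - G zt z)"
proof -
 obtain C1 where C1: "0 <= C1" "!!zt z. zt \<in> A ==> z \<in> Z ==> zt ~= z ==> norm (F zt z) <= C1 / norm (zt - z) ^ m"
  "!!zt z w t. zt \<in> A ==> z \<in> Z ==> w \<in> Z ==> 0 < t ==> t <= norm (zt - z) ==> t <= norm (zt - w) ==>
   norm (F zt z - F zt w) <= C1 * norm (z - w) / t ^ (m + 1)"
  by (rule kernel_orderE[OF F]) (rule that; (assumption | blast))
 obtain C2 where C2: "0 <= C2" "!!zt z. zt \<in> A ==> z \<in> Z ==> zt ~= z ==> norm (G zt z) <= C2 / norm (zt - z) ^ m"
  "!!zt z w t. zt \<in> A ==> z \<in> Z ==> w \<in> Z ==> 0 < t ==> t <= norm (zt - z) ==> t <= norm (zt - w) ==>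
   norm (G zt z - G zt w) <= C2 * norm (z - w) / t ^ (m + 1)"
  by (rule kernel_orderE[OF G]) (rule that; (assumption | blast))
 show ?thesis
 proof (rule kernel_orderI[of "C1 + C2"])
  fix zt z w and t :: real assume *: "zt \<in> A" "z \<in> Z"
  show "norm (F zt z - G zt z) <= (C1 + C2) / norm (zt - z) ^ m" if "zt ~= z"
   unfolding add_divide_distrib by (rule order_trans[OF norm_triangle_ineq4]) (intro add_mono C1(2)[OF * that] C2(2)[OF * that])
  assume w: "w \<in> Z" "0 < t" "t <= norm (zt - z)" "t <= norm (zt - w)"
  have "F zt z - G zt z - (F zt w - G zt w) = (F zt z - F zt w) - (G zt z - G zt w)" by simp
  also have "norm ... <= C1 * norm (z - w) / t ^ (m + 1) + C2 * norm (z - w) / t ^ (m + 1)"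
   by (rule order_trans[OF norm_triangle_ineq4]) (intro add_mono C1(3)[OF * w] C2(3)[OF * w])
  finally show "norm (F zt z - G zt z - (F zt w - G zt w)) <= (C1 + C2) * norm (z - w) / t ^ (m + 1)"
   by (simp add: add_divide_distrib distrib_right)
 qed (use C1(1) C2(1) in simp)
qed

lemma kernel_order_raise:
 assumes F: "kernel_order A Z m F" and mn: "m <= n" and bd: "bounded A" "bounded Z"
 shows "kernel_order A Z n F"
proof -
 obtain C where C: "0 <= C" "!!zt z. zt \<in> A ==> z \<in> Z ==> zt ~= z ==> norm (F zt z) <= C / norm (zt - z) ^ m"
  "!!zt z w t. zt \<in> A ==> z \<in> Z ==> w \<in> Z ==> 0 < t ==> t <= norm (zt - z) ==> t <= norm (zt - w) ==>
   norm (F zt z - F zt w) <= C * norm (z - w) / t ^ (m + 1)"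
  by (rule kernel_orderE[OF F]) (rule that; (assumption | blast))
 obtain a b where ab: "!!zt. zt \<in> A ==> norm zt <= a" "!!z. z \<in> Z ==> norm z <= b" using bd unfolding bounded_iff by metis
 define d where "d = a + b"
 have d: "norm (zt - z) <= d" if "zt \<in> A" "z \<in> Z" for zt z
  unfolding d_def by (rule order_trans[OF norm_triangle_ineq4]) (intro add_mono ab that)
 have key: "1 / t ^ k <= d ^ (n - m) / t ^ (k + (n - m))" if "0 < t" "t <= d" for t :: real and k
 proof -
  have "1 / t ^ k = t ^ (n - m) / t ^ (k + (n - m))" using that by (simp add: power_add)
  also have "... <= d ^ (n - m) / t ^ (k + (n - m))" using that by (intro divide_right_mono power_mono) auto
  finally show ?thesis .
 qed
 have e: "m + (n - m) = n" "m + 1 + (n - m) = n + 1" using mn by auto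
 show ?thesis
 proof (cases "A = {} \<or> Z = {}")
  case True
  then show ?thesis by (intro kernel_orderI[of 0]) auto
 next
  case False
  then have d0: "0 <= d" using d order_trans[OF norm_ge_zero] by blast
  show ?thesis
  proof (rule kernel_orderI[of "C * d ^ (n - m)"])
   fix zt z assume *: "zt \<in> A" "z \<in> Z"
   show "norm (F zt z) <= C * d ^ (n - m) / norm (zt - z) ^ n" if "zt ~= z"
   proof -
    have "norm (F zt z) <= C * (1 / norm (zt - z) ^ m)" using C(2)[OF * that] by simp
    also have "... <= C * (d ^ (n - m) / norm (zt - z) ^ n)"
     using key[of "norm (zt - z)" m] that d[OF *] C(1) unfolding e by (intro mult_left_mono) auto
    finally show ?thesis by simp
   qed
   fix w t assume w: "w \<in> Z" "0 < t" "t <= norm (zt - z)" "t <= norm (zt - w)"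
   have "norm (F zt z - F zt w) <= C * norm (z - w) * (1 / t ^ (m + 1))" using C(3)[OF * w] by simp
   also have "... <= C * norm (z - w) * (d ^ (n - m) / t ^ (n + 1))"
    using key[of t "m + 1"] w d[OF *] C(1) unfolding e by (intro mult_left_mono) auto
   finally show "norm (F zt z - F zt w) <= C * d ^ (n - m) * norm (z - w) / t ^ (n + 1)" by (simp add: mult_ac)
  qed (use C(1) d0 in simp)
 qed
qed

text \<open>On bounded sets t is at most d, so a bound L |z - w| is at most L d |z - w|/t, as order
  0 demands.\<close>

lemma kernel_order_lipschitz:
 assumes "0 <= L" "bounded A" "bounded Z" "!!zt z. zt \<in> A ==> z \<in> Z ==> norm (F zt z) <= L"
  "!!zt z w. zt \<in> A ==> z \<in> Z ==> w \<in> Z ==> norm (F zt z - F zt w) <= L * norm (z - w)"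
 shows "kernel_order A Z 0 F"
proof -
 obtain a b where ab: "!!zt. zt \<in> A ==> norm zt <= a" "!!z. z \<in> Z ==> norm z <= b" using assms(2,3) unfolding bounded_iff by metis
 define d where "d = max 1 (a + b)"
 have d: "norm (zt - z) <= d" if "zt \<in> A" "z \<in> Z" for zt z
  using order_trans[OF norm_triangle_ineq4 add_mono[OF ab(1)[OF that(1)] ab(2)[OF that(2)]]] by (simp add: d_def)
 have d1: "1 <= d" by (simp add: d_def)
 show ?thesis
 proof (rule kernel_orderI[of "L * d"])
  show "0 <= L * d" using assms(1) d1 by simp
  fix zt z assume *: "zt \<in> A" "z \<in> Z"
  have "L * 1 <= L * d" using assms(1) d1 by (intro mult_left_mono)
  then show "norm (F zt z) <= L * d / norm (zt - z) ^ 0" using assms(4)[OF *] by simp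
  fix w t assume w: "w \<in> Z" "0 < t" "t <= norm (zt - z)" "t <= norm (zt - w)"
  have "norm (F zt z - F zt w) <= L * norm (z - w) * 1" using assms(5)[OF * w(1)] by simp
  also have "... <= L * norm (z - w) * (d / t)"
   using w d[OF *] assms(1) by (intro mult_left_mono) auto
  finally show "norm (F zt z - F zt w) <= L * d * norm (z - w) / t ^ (0 + 1)" by (simp add: mult_ac)
 qed
qed

section \<open>Estimates of the kernel\<close>

context koppelman
begin

lemma A_bounded: "bounded A" and Z_bounded: "bounded Z"
 using A(1) Z(1) by (simp_all add: compact_imp_bounded)

text \<open>The value on the diagonal is at most |grad f|, and the rest is a Lipschitz estimate. The
  compact set for the second variable is A \<union> Z rather than Z, so that \<zeta> itself may be
  inserted for z.\<close>

lemma h_bounds: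
 obtains L where "0 < L" "!!zt z. zt \<in> A ==> z \<in> Z ==> norm (h zt z) <= g zt + L * norm (zt - z)"
  "!!zt z w. zt \<in> A ==> z \<in> Z ==> w \<in> Z ==> norm (h zt z - h zt w) <= L * norm (z - w)"
proof -
 have 1: "compact (A \<union> Z)" "A \<union> Z <= \<Omega>'" using A Z by (auto intro: compact_Un)
 have 2: "continuous_on (A \<times> \<Omega>') (%(a, z). h a z $ j)" for j
  by (rule continuous_on_subset[OF h_continuous]) (use A(2) in auto)
 have 3: "holo_on \<Omega>' (%z. h a z $ j)" if "a \<in> A" for a j using h_holo that A(2) by blast
 obtain L where L: "0 < L"
  "!!a z w. a \<in> A ==> z \<in> A \<union> Z ==> w \<in> A \<union> Z ==> norm (h a z - h a w) <= L * norm (z - w)"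
  by (rule vec3_uniform_lipschitz[OF A(1) 1 \<Omega>'(2) 2]) (erule 3, (rule that; (assumption | blast)))
 show ?thesis
 proof (rule that[OF L(1)])
  fix zt z assume *: "zt \<in> A" "z \<in> Z"
  have "norm (h zt z) <= norm (h zt zt) + norm (h zt z - h zt zt)" by (rule norm_triangle_sub)
  also have "... <= g zt + L * norm (z - zt)"
   unfolding g_def using * A(2) by (intro add_mono h_diag L(2)) auto
  finally show "norm (h zt z) <= g zt + L * norm (zt - z)" by (simp add: norm_minus_commute)
 qed (use L(2) in auto)
qed

lemma cut_bounds:
 obtains L where "0 <= L" "!!zt. zt \<in> A ==> \<bar>cutoff zt\<bar> <= L" "!!zt. zt \<in> A ==> norm (dcut cutoff zt) <= L"
proof -
 have "compact (cutoff ` A)" "compact (dcut cutoff ` A)"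
  by (intro compact_continuous_image A(1) continuous_on_subset[OF cutoff_continuous] continuous_on_subset[OF dcut_continuous]; simp)+
 then have "bounded (cutoff ` A)" "bounded (dcut cutoff ` A)" by (auto intro: compact_imp_bounded)
 then obtain L1 L2 where "!!x. x \<in> A ==> norm (cutoff x) <= L1" "!!x. x \<in> A ==> norm (dcut cutoff x) <= L2"
  unfolding bounded_iff by blast
 then have "\<bar>cutoff x\<bar> <= \<bar>L1\<bar> + \<bar>L2\<bar>" "norm (dcut cutoff x) <= \<bar>L1\<bar> + \<bar>L2\<bar>" if "x \<in> A" for x
  using that by (smt (verit) real_norm_def)+
 then show ?thesis by (intro that[of "\<bar>L1\<bar> + \<bar>L2\<bar>"]) auto
qed

lemma s_bounds:
 obtains L where "0 < L" "!!zt z. zt \<in> supp_dbar cutoff ==> z \<in> Z ==> norm (s zt z) <= L"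
  "!!zt z w. zt \<in> supp_dbar cutoff ==> z \<in> Z ==> w \<in> Z ==> norm (s zt z - s zt w) <= L * norm (z - w)"
proof -
 have 2: "continuous_on (supp_dbar cutoff \<times> Ws) (%(a, z). s a z $ j)" for j
  using continuous_on_component[OF continuous_on_subset[OF s_continuous], of "supp_dbar cutoff \<times> Ws" j] s(2)
  by (auto simp: case_prod_beta)
 have 3: "holo_on Ws (%z. s a z $ j)" if "a \<in> supp_dbar cutoff" for a j
  using s(2,6) that by (auto simp: holo_map_on_def)
 show ?thesis
  by (rule vec3_uniform_lipschitz[OF supp_dbar_subset(2) Z(1) Z(3) s(3) 2]) (erule 3, (rule that; (assumption | blast)))
qed

text \<open>s is controlled only on the support of the derivative of the cutoff; off it
  \<open>dcut\<close> is 0, so the product is bounded on all of A. The resulting order 1 is raised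
  to 3 to match the main term.\<close>

lemma Pker_order: "kernel_order A Z 3 (Pker cutoff s)"
proof -
 obtain L1 where L1: "0 <= L1" "!!zt. zt \<in> A ==> \<bar>cutoff zt\<bar> <= L1" "!!zt. zt \<in> A ==> norm (dcut cutoff zt) <= L1" by (rule cut_bounds) (rule that; (assumption | blast))
 obtain L2 where L2: "0 < L2" "!!zt z. zt \<in> supp_dbar cutoff ==> z \<in> Z ==> norm (s zt z) <= L2"
  "!!zt z w. zt \<in> supp_dbar cutoff ==> z \<in> Z ==> w \<in> Z ==> norm (s zt z - s zt w) <= L2 * norm (z - w)" by (rule s_bounds) (rule that; (assumption | blast))
 have c: "kernel_order A Z 0 (%zt z. cutoff zt)"
  by (rule kernel_order_lipschitz[OF L1(1) A_bounded Z_bounded]) (use L1 in auto)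
 have bw: "bounded_bilinear (%d x. d \<^bold>\<and> form1 x)"
  by (rule bounded_bilinear.comp[OF bounded_bilinear_wedge bounded_linear_ident bounded_linear_form1])
 obtain K where K: "0 <= K" "!!d x. norm (d \<^bold>\<and> form1 x) <= norm d * norm x * K"
  using bounded_bilinear.nonneg_bounded[OF bw] by auto
 have LK: "0 <= L1 * L2 * K" using L1(1) L2(1) K(1) by simp
 have "kernel_order A Z 0 (%zt z. dcut cutoff zt \<^bold>\<and> form1 (s zt z))"
 proof (rule kernel_order_lipschitz[OF LK A_bounded Z_bounded])
  fix zt z assume *: "zt \<in> A" "z \<in> Z"
  show "norm (dcut cutoff zt \<^bold>\<and> form1 (s zt z)) <= L1 * L2 * K"
  proof (cases "dcut cutoff zt = 0")
   case True then show ?thesis using LK by (simp only: wedge_0_left norm_zero)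
  next
   case False
   then have "zt \<in> supp_dbar cutoff" by (rule dcut_nz)
   then show ?thesis using * L1 L2 K(1)
    by (intro order_trans[OF K(2)] mult_right_mono mult_mono) auto
  qed
  fix w assume w: "w \<in> Z"
  show "norm (dcut cutoff zt \<^bold>\<and> form1 (s zt z) - dcut cutoff zt \<^bold>\<and> form1 (s zt w)) <= L1 * L2 * K * norm (z - w)"
  proof (cases "dcut cutoff zt = 0")
   case True then show ?thesis using LK by (simp add: wedge_0_left)
  next
   case False
   then have sp: "zt \<in> supp_dbar cutoff" by (rule dcut_nz)
   have "norm (dcut cutoff zt \<^bold>\<and> form1 (s zt z) - dcut cutoff zt \<^bold>\<and> form1 (s zt w)) <= norm (dcut cutoff zt) * norm (s zt z - s zt w) * K"
    unfolding bounded_bilinear.diff_right[OF bw, symmetric] by (rule K(2))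
   also have "... <= L1 * (L2 * norm (z - w)) * K"
    using * sp w L1 L2 K(1) by (intro mult_right_mono mult_mono) auto
   finally show ?thesis by (simp add: mult_ac)
  qed
 qed
 from kernel_order_bilinear[OF bounded_bilinear_wedge this kernel_order_sing[OF sing_bF]]
 have 1: "kernel_order A Z 3 (%zt z. (dcut cutoff zt \<^bold>\<and> form1 (s zt z)) \<^bold>\<and> bF (zt - z))"
  by (rule kernel_order_raise) (simp_all add: A_bounded Z_bounded)
 have "kernel_order A Z 3 (%zt z. cutoff zt *\<^sub>R P1 (zt - z))"
  using kernel_order_bilinear[OF bounded_bilinear_scaleR c kernel_order_sing[OF sing_P1]] by simp
 from kernel_order_diff[OF this 1] show ?thesis
  unfolding Pker_def[abs_def] scaleR_smult .
qed

text \<open>The product of |h| \<le> const (g + t) and t^(-3). In the difference, the Lipschitz term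
  of h gives |z - w| t^(-3), which equals |z - w| t times t^(-4) and is absorbed. z is taken to be
  the nearer point, so that t bounds both distances from below.\<close>

lemma Kt_bounds:
 obtains C where "0 <= C" "!!zt z. zt \<in> A ==> z \<in> Z ==> zt ~= z ==> norm (Kt zt z) <= C * (g zt + norm (zt - z)) / norm (zt - z) ^ 3"
  "!!zt z w. zt \<in> A ==> z \<in> Z ==> w \<in> Z ==> zt ~= z ==> norm (zt - z) <= norm (zt - w) ==>
   norm (Kt zt z - Kt zt w) <= C * norm (z - w) * (g zt + norm (zt - z)) / norm (zt - z) ^ 4"
proof -
 obtain L where L: "0 < L" "!!zt z. zt \<in> A ==> z \<in> Z ==> norm (h zt z) <= g zt + L * norm (zt - z)"
  "!!zt z w. zt \<in> A ==> z \<in> Z ==> w \<in> Z ==> norm (h zt z - h zt w) <= L * norm (z - w)" by (rule h_bounds) (rule that; (assumption | blast))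
 obtain C where C: "0 <= C" "!!zt z. zt \<in> A ==> z \<in> Z ==> zt ~= z ==> norm (Pker cutoff s zt z) <= C / norm (zt - z) ^ 3"
  "!!zt z w t. zt \<in> A ==> z \<in> Z ==> w \<in> Z ==> 0 < t ==> t <= norm (zt - z) ==> t <= norm (zt - w) ==>
   norm (Pker cutoff s zt z - Pker cutoff s zt w) <= C * norm (z - w) / t ^ (3 + 1)"
  by (rule kernel_orderE[OF Pker_order]) (rule that; (assumption | blast))
 obtain K1 where K1: "0 <= K1" "!!x. norm (divide_dzeta x) <= norm x * K1"
  using bounded_linear.nonneg_bounded[OF bounded_linear_divide_dzeta] by auto
 have bw: "bounded_bilinear (%x p. form1 x \<^bold>\<and> p)"
  by (rule bounded_bilinear.comp[OF bounded_bilinear_wedge bounded_linear_form1 bounded_linear_ident])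
 obtain K2 where K2: "0 <= K2" "!!d x. norm (form1 d \<^bold>\<and> x) <= norm d * norm x * K2"
  using bounded_bilinear.nonneg_bounded[OF bw] by auto
 define K where "K = K1 * K2"
 have K: "0 <= K" "norm (divide_dzeta (form1 d \<^bold>\<and> x)) <= K * (norm d * norm x)" for d x
  using K1(1) K2(1) order_trans[OF K1(2) mult_right_mono[OF K2(2) K1(1)]] by (auto simp: K_def mult_ac)
 define L' where "L' = max 1 L"
 have L': "1 <= L'" "L <= L'" by (auto simp: L'_def)
 have g0: "0 <= g zt" for zt by (simp add: g_def)
 have hb: "norm (h zt z) <= L' * (g zt + norm (zt - z))" if "zt \<in> A" "z \<in> Z" for zt z
 proof -
  have "g zt + L * norm (zt - z) <= L' * g zt + L' * norm (zt - z)"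
   using L' g0[of zt] mult_right_mono[OF L'(1) g0[of zt]] by (intro add_mono mult_right_mono) auto
  then show ?thesis using L(2)[OF that] by (simp add: distrib_left)
 qed
 define C' where "C' = 2 * (K * L' * C)"
 have C'0: "0 <= K * L' * C" using K(1) L' C(1) by simp
 have C': "K * L' * C <= C'" "0 <= C'" using C'0 unfolding C'_def by linarith+
 show ?thesis
 proof (rule that[OF C'(2)])
  fix zt z assume *: "zt \<in> A" "z \<in> Z" and ne: "zt ~= z"
  define t where "t = norm (zt - z)"
  have t: "0 < t" using ne by (simp add: t_def)
  have gt: "0 <= g zt + t" using g0[of zt] t by simp
  have zW: "z \<in> Ws" using * Z(3) by auto
  have "norm (Kt zt z) <= K * (norm (h zt z) * norm (Pker cutoff s zt z))" unfolding Kt_eq[OF zW] by (rule K(2))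
  also have "... <= K * ((L' * (g zt + t)) * (C / t ^ 3))"
   unfolding t_def using K(1) gt L' by (intro mult_left_mono mult_mono hb[OF *] C(2)[OF * ne]) (auto simp: t_def)
  also have "... = K * L' * C * ((g zt + t) / t ^ 3)" by simp
  also have "... <= C' * ((g zt + t) / t ^ 3)" using C' gt t by (intro mult_right_mono) auto
  finally show "norm (Kt zt z) <= C' * (g zt + norm (zt - z)) / norm (zt - z) ^ 3" by (simp add: t_def)
  fix w assume w: "w \<in> Z" and le: "norm (zt - z) <= norm (zt - w)"
  have le': "t <= norm (zt - z)" "t <= norm (zt - w)" using le by (auto simp: t_def)
  have ne': "zt ~= w" using le' t by auto
  have wW: "w \<in> Ws" using w Z(3) by auto
  let ?P = "Pker cutoff s"
  have Pw: "norm (?P zt w) <= C / t ^ 3"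
   by (rule order_trans[OF C(2)[OF *(1) w ne'] div_power_mono[OF C(1) t le'(2)]])
  have "Kt zt z - Kt zt w = divide_dzeta (form1 (h zt z) \<^bold>\<and> (?P zt z - ?P zt w)) + divide_dzeta (form1 (h zt z - h zt w) \<^bold>\<and> ?P zt w)"
   unfolding Kt_eq[OF zW] Kt_eq[OF wW] bounded_bilinear.diff_left[OF bw] bounded_bilinear.diff_right[OF bw]
    linear_diff[OF bounded_linear.linear[OF bounded_linear_divide_dzeta]] by simp
  also have "norm ... <= K * (norm (h zt z) * norm (?P zt z - ?P zt w)) + K * (norm (h zt z - h zt w) * norm (?P zt w))"
   by (rule order_trans[OF norm_triangle_ineq]) (intro add_mono K(2))
  also have "... <= K * ((L' * (g zt + t)) * (C * norm (z - w) / t ^ 4)) + K * ((L' * norm (z - w)) * (C / t ^ 3))"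
  proof (intro add_mono mult_left_mono mult_mono K(1))
   show "norm (h zt z) <= L' * (g zt + t)" unfolding t_def by (rule hb[OF *])
   show "norm (?P zt z - ?P zt w) <= C * norm (z - w) / t ^ 4" using C(3)[OF * w t le'] by simp
   show "norm (h zt z - h zt w) <= L' * norm (z - w)"
    by (rule order_trans[OF L(3)[OF * w] mult_right_mono[OF L'(2)]]) simp
  qed (use Pw L' gt in auto)
  also have "... = K * L' * C * norm (z - w) * ((g zt + t) / t ^ 4 + t / t ^ 4)"
  proof -
   have e3: "1 / t ^ 3 = t / t ^ 4" using t by (simp add: power4_eq_xxxx power3_eq_cube)
   show ?thesis unfolding e3[symmetric] by (simp add: divide_inverse algebra_simps)
  qed
  also have "... <= K * L' * C * norm (z - w) * ((g zt + t) / t ^ 4 + (g zt + t) / t ^ 4)"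
   using C'0 g0[of zt] t by (intro mult_left_mono add_mono divide_right_mono) auto
  also have "... = C' * norm (z - w) * ((g zt + t) / t ^ 4)"
   unfolding C'_def by (simp only: mult_2[symmetric] mult_ac)
  finally show "norm (Kt zt z - Kt zt w) <= C' * norm (z - w) * (g zt + norm (zt - z)) / norm (zt - z) ^ 4"
   by (simp add: t_def)
 qed
qed

definition CR where "CR = (SOME C. riesz \<mu> \<nu> S W C q)"

sublocale R: riesz \<mu> \<nu> S W CR q
 unfolding CR_def by (rule someI_ex[OF riesz_exists])

abbreviation KI where "KI \<phi> z J zt \<equiv> K_integrand f \<omega> cutoff s h \<phi> z J zt"

lemma KI_eq: "KI \<phi> z J zt = KT f zt (\<omega> zt) J (Kt zt z) (\<phi> zt)"
 unfolding K_integrand_def K_kernel_def KT_def ..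

lemma g_W: "zt \<in> M ==> g zt ~= 0" "zt \<in> M ==> W zt = 1 / g zt"
 using grad_nz[of zt] gr_eq[of zt] by (auto simp: g_def W_def)

lemma KT_le:
 assumes "zt \<in> M" "degr 0 1 k" "form_0r r p"
 shows "cmod (KT f zt (\<omega> zt) J k p) <= 48 * pi * norm k * form_norm f zt r p * W zt"
 using KT_bound[OF fh M_in[OF assms(1)] grad_nz[OF assms(1)] \<omega>D[OF assms(1)] assms(2,3) r, of J] g_W(2)[OF assms(1)]
 by (simp add: g_def)

text \<open>Multiplication by 1/g, the size of \<omega>, cancels g in the first term and leaves the
  weight W in the second.\<close>

lemma kap_pos:
 assumes "zt \<in> M" "zt ~= z"
 shows "(g zt + norm (zt - z)) / norm (zt - z) ^ 3 * W zt = R.kap 0 z zt"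
proof -
 have t: "0 < norm (zt - z)" using assms by simp
 show ?thesis
  using g_W[OF assms(1)] t by (simp add: R.kap_def powr_minus powr_numeral field_simps power3_eq_cube power2_eq_square)
qed

text \<open>Let t be the distance to the nearer point. For |z - w| \<le> t, part of the factor |z -
  w| in the Lipschitz bound is exchanged for t, leaving the power \<alpha>. For |z - w| > t, the two
  values are estimated separately and (|z - w|/t)^\<alpha> \<ge> 1 is inserted. Either point may be
  the nearer one, hence the sum of both kernels.\<close>

lemma KI_bounds:
 obtains C where "0 <= C"
  "!!\<phi> zt z J. zt \<in> M ==> z \<in> Z ==> form_0r r (\<phi> zt) ==>
   cmod (KI \<phi> z J zt) <= C * (R.kap 0 z zt * form_norm f zt r (\<phi> zt)) * indicator S zt"
  "!!\<phi> zt z w J \<alpha>. zt \<in> M ==> z \<in> Z ==> w \<in> Z ==> zt ~= z ==> zt ~= w ==> form_0r r (\<phi> zt) ==> 0 <= \<alpha> ==> \<alpha> <= 1 ==>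
   cmod (KI \<phi> z J zt - KI \<phi> w J zt) <= C * norm (z - w) powr \<alpha> * ((R.kap \<alpha> z zt + R.kap \<alpha> w zt) * form_norm f zt r (\<phi> zt)) * indicator S zt"
proof -
 obtain C where C: "0 <= C" "!!zt z. zt \<in> A ==> z \<in> Z ==> zt ~= z ==> norm (Kt zt z) <= C * (g zt + norm (zt - z)) / norm (zt - z) ^ 3"
  "!!zt z w. zt \<in> A ==> z \<in> Z ==> w \<in> Z ==> zt ~= z ==> norm (zt - z) <= norm (zt - w) ==>
   norm (Kt zt z - Kt zt w) <= C * norm (z - w) * (g zt + norm (zt - z)) / norm (zt - z) ^ 4" by (rule Kt_bounds) (rule that; (assumption | blast))
 define C' where "C' = 96 * pi * C"
 have C': "0 <= C'" using C(1) by (simp add: C'_def)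
 have ZW: "z \<in> Ws" if "z \<in> Z" for z using that Z(3) by auto
 have out: "KI \<phi> z J zt = 0" if "zt \<in> M" "zt \<notin> S" "z \<in> Z" "form_0r r (\<phi> zt)" for \<phi> zt z J
 proof -
  have "zt \<notin> A" using that by (auto simp: S_def)
  then show ?thesis
   using KT_le[OF that(1) Kt_degr[OF ZW[OF that(3)]] that(4), of J zt] by (simp add: KI_eq Kt_outside ZW that(3))
 qed
 have b1: "cmod (KI \<phi> z J zt) <= C' / 2 * (R.kap 0 z zt * form_norm f zt r (\<phi> zt))"
  if *: "zt \<in> M" "zt \<in> A" "z \<in> Z" "form_0r r (\<phi> zt)" for \<phi> zt z J
 proof (cases "zt = z")
  case True
  have "cmod (KI \<phi> z J zt) <= 0"
   using KT_le[OF *(1) Kt_degr[OF ZW[OF *(3)]] *(4), of J zt] True by (simp add: KI_eq Kt_diag ZW *(3))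
  also have "0 <= C' / 2 * (R.kap 0 z zt * form_norm f zt r (\<phi> zt))" using C' R.kap_nonneg by simp
  finally show ?thesis .
 next
  case False
  have "cmod (KI \<phi> z J zt) <= 48 * pi * norm (Kt zt z) * form_norm f zt r (\<phi> zt) * W zt"
   unfolding KI_eq by (rule KT_le[OF *(1) Kt_degr[OF ZW[OF *(3)]] *(4)])
  also have "... <= 48 * pi * (C * (g zt + norm (zt - z)) / norm (zt - z) ^ 3) * form_norm f zt r (\<phi> zt) * W zt"
   using R.W(2) by (intro mult_right_mono mult_left_mono C(2) * False) auto
  also have "... = C' / 2 * (((g zt + norm (zt - z)) / norm (zt - z) ^ 3 * W zt) * form_norm f zt r (\<phi> zt))"
   by (simp add: C'_def)
  finally show ?thesis unfolding kap_pos[OF *(1) False] .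
 qed
 have b2: "cmod (KI \<phi> z J zt - KI \<phi> w J zt) <= C' * norm (z - w) powr \<alpha> * (R.kap \<alpha> z zt * form_norm f zt r (\<phi> zt))"
  if *: "zt \<in> M" "zt \<in> A" "z \<in> Z" "w \<in> Z" "form_0r r (\<phi> zt)" "zt ~= z" "norm (zt - z) <= norm (zt - w)" and a: "0 <= \<alpha>" "\<alpha> <= 1"
  for \<phi> zt z w J \<alpha>
 proof -
  define t where "t = norm (zt - z)"
  have t: "0 < t" using *(6) by (simp add: t_def)
  have ne: "zt ~= w" using * t by (auto simp: t_def)
  let ?n = "form_norm f zt r (\<phi> zt)" and ?x = "norm (z - w)"
  have W0: "0 <= W zt" by (rule R.W(2))
  show ?thesis
  proof (cases "?x <= t")
   case True
   have e: "KI \<phi> z J zt - KI \<phi> w J zt = KT f zt (\<omega> zt) J (Kt zt z - Kt zt w) (\<phi> zt)"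
    unfolding KI_eq KT_linear ..
   have "cmod (KI \<phi> z J zt - KI \<phi> w J zt) <= 48 * pi * norm (Kt zt z - Kt zt w) * ?n * W zt"
    unfolding e by (rule KT_le[OF *(1) _ *(5)]) (intro degr_diff Kt_degr ZW *)
   also have "... <= 48 * pi * (C * ?x * (g zt + t) / t ^ 4) * ?n * W zt"
   proof -
    have k: "norm (Kt zt z - Kt zt w) <= C * ?x * (g zt + t) / t ^ 4"
     unfolding t_def by (rule C(3)[OF *(2,3,4,6,7)])
    show ?thesis by (rule mult_right_mono[OF mult_right_mono[OF mult_left_mono[OF k]]]) (simp_all add: W0)
   qed
   also have "... = C' / 2 * (?x * ((g zt + t) / t ^ 4 * W zt) * ?n)" by (simp add: C'_def)
   also have "?x * ((g zt + t) / t ^ 4 * W zt) = ?x * t powr (- 4) + W zt * (?x * t powr (- 3))"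
    using g_W[OF *(1)] t by (simp add: powr_minus powr_numeral field_simps power4_eq_xxxx power3_eq_cube)
   also have "C' / 2 * ((?x * t powr (- 4) + W zt * (?x * t powr (- 3))) * ?n)
     <= C' / 2 * ((?x powr \<alpha> * t powr (1 - \<alpha> - 4) + W zt * (?x powr \<alpha> * t powr (1 - \<alpha> - 3))) * ?n)"
    using True t a C' W0 by (intro mult_left_mono mult_right_mono add_mono powr_frac_le) auto
   also have "... = C' / 2 * (?x powr \<alpha> * (R.kap \<alpha> z zt * ?n))"
   proof -
    have ex: "1 - \<alpha> - 4 = - 3 - \<alpha>" "1 - \<alpha> - 3 = - 2 - \<alpha>" by simp_all
    show ?thesis unfolding ex R.kap_def t_def by (simp only: distrib_left distrib_right mult_ac)
   qed
   also have "... <= C' * (?x powr \<alpha> * (R.kap \<alpha> z zt * ?n))"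
    using C' R.kap_nonneg[of \<alpha> z zt] by (intro mult_right_mono) auto
   finally show ?thesis by simp
  next
   case False
   \<comment> \<open>w is the farther point, and the exponents are negative.\<close>
   have kw: "R.kap 0 w zt <= R.kap 0 z zt"
    unfolding R.kap_def using * t W0 ne by (intro add_mono mult_left_mono powr_mono2') (auto simp: t_def)
   have kz: "R.kap 0 z zt <= ?x powr \<alpha> * R.kap \<alpha> z zt"
   proof -
    have "R.kap 0 z zt = t powr (- 3) + W zt * t powr (- 2)" by (simp add: R.kap_def t_def)
    also have "... <= ?x powr \<alpha> * t powr (- 3 - \<alpha>) + W zt * (?x powr \<alpha> * t powr (- 2 - \<alpha>))"
     using False t a W0 by (intro add_mono mult_left_mono powr_frac_ge) auto
    also have "... = ?x powr \<alpha> * R.kap \<alpha> z zt" by (simp add: R.kap_def t_def algebra_simps)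
    finally show ?thesis .
   qed
   have "cmod (KI \<phi> z J zt - KI \<phi> w J zt) <= C' / 2 * (R.kap 0 z zt * ?n) + C' / 2 * (R.kap 0 w zt * ?n)"
    by (rule order_trans[OF norm_triangle_ineq4]) (intro add_mono b1 *)
   also have "... <= C' / 2 * (R.kap 0 z zt * ?n) + C' / 2 * (R.kap 0 z zt * ?n)"
    using C' kw by (intro add_mono mult_left_mono mult_right_mono) auto
   also have "... = C' * (R.kap 0 z zt * ?n)" by simp
   also have "... <= C' * ((?x powr \<alpha> * R.kap \<alpha> z zt) * ?n)"
    using C' kz by (intro mult_left_mono mult_right_mono) auto
   finally show ?thesis by (simp add: mult_ac)
  qed
 qed
 show ?thesis
 proof (rule that[OF C'])
  fix \<phi> :: "complex ^ 3 => ext" and zt z J assume *: "zt \<in> M" "z \<in> Z" "form_0r r (\<phi> zt)"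
  show "cmod (KI \<phi> z J zt) <= C' * (R.kap 0 z zt * form_norm f zt r (\<phi> zt)) * indicator S zt"
  proof (cases "zt \<in> S")
   case True
   then have "zt \<in> A" by (simp add: S_def)
   from b1[of _ _ \<phi> J, OF *(1) this *(2,3)]
   have "cmod (KI \<phi> z J zt) <= C' / 2 * (R.kap 0 z zt * form_norm f zt r (\<phi> zt))" .
   also have "... <= C' * (R.kap 0 z zt * form_norm f zt r (\<phi> zt))"
    using C' R.kap_nonneg[of 0 z zt] by (intro mult_right_mono) auto
   finally show ?thesis using True by simp
  qed (simp add: out[of _ _ \<phi>, OF *(1) _ *(2,3)])
  fix w and \<alpha> :: real assume w: "w \<in> Z" "zt ~= z" "zt ~= w" and a: "0 <= \<alpha>" "\<alpha> <= 1"
  show "cmod (KI \<phi> z J zt - KI \<phi> w J zt) <= C' * norm (z - w) powr \<alpha> * ((R.kap \<alpha> z zt + R.kap \<alpha> w zt) * form_norm f zt r (\<phi> zt)) * indicator S zt"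
  proof (cases "zt \<in> S")
   case True
   then have zt: "zt \<in> A" by (simp add: S_def)
   let ?n = "form_norm f zt r (\<phi> zt)" and ?x = "norm (z - w) powr \<alpha>"
   have "cmod (KI \<phi> z J zt - KI \<phi> w J zt) <= C' * ?x * (R.kap \<alpha> z zt * ?n) \<or> cmod (KI \<phi> z J zt - KI \<phi> w J zt) <= C' * ?x * (R.kap \<alpha> w zt * ?n)"
   proof (cases "norm (zt - z) <= norm (zt - w)")
    case True
    then show ?thesis using b2[of _ _ _ \<phi> \<alpha> J, OF *(1) zt *(2) w(1) *(3) w(2) True a] by simp
   next
    case False
    then have le: "norm (zt - w) <= norm (zt - z)" by simp
    show ?thesis using b2[of _ _ _ \<phi> \<alpha> J, OF *(1) zt w(1) *(2,3) w(3) le a] by (simp add: norm_minus_commute)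
   qed
   moreover have "0 <= C' * ?x * (R.kap \<alpha> z zt * ?n)" "0 <= C' * ?x * (R.kap \<alpha> w zt * ?n)"
    using C' R.kap_nonneg by auto
   moreover have aux: "a <= x \<or> a <= y ==> 0 <= x ==> 0 <= y ==> a <= x + y" for a x y :: real by auto
   ultimately have "cmod (KI \<phi> z J zt - KI \<phi> w J zt) <= C' * ?x * (R.kap \<alpha> z zt * ?n) + C' * ?x * (R.kap \<alpha> w zt * ?n)" by (intro aux)
   then show ?thesis using True by (simp add: distrib_left distrib_right)
  qed (simp add: out[of _ _ \<phi>, OF *(1) _ *(2,3)] out[of _ _ \<phi>, OF *(1) _ w(1) *(3)])
 qed
qed

end

section \<open>Compactness\<close>

text \<open>Riesz-Fischer for functions instead of classes. The limit is exhibited as the pointwise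
  limit of a subsequence, with value 0 where that diverges, so that closed linear conditions at each
  point, here the bidegree of a form, pass to it everywhere.\<close>

lemma Lp_complete:
 fixes a :: "nat => 'a => 'b::{banach, second_countable_topology}"
 assumes p: "0 < p" and meas: "!!n. a n \<in> borel_measurable N"
  and cauchy: "!!\<epsilon>. 0 < \<epsilon> ==> EX n0. ALL i>=n0. ALL j>=n0. (\<integral>\<^sup>+x. ennreal (norm (a i x - a j x) powr p) \<partial>N) <= ennreal \<epsilon>"
 defines "b k \<equiv> %x. if convergent (%n. a (k n) x) then lim (%n. a (k n) x) else 0"
 shows "EX k. strict_mono k \<and> b k \<in> borel_measurable N \<and>
  (\<forall>\<epsilon>>0. EX n0. ALL i>=n0. (\<integral>\<^sup>+x. ennreal (norm (a i x - b k x) powr p) \<partial>N) <= ennreal \<epsilon>)"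
proof -
 \<comment> \<open>Chosen so that the sum over j of (2^j d_j)^p has a finite integral. Then 2^j d_j
   is bounded in j almost everywhere, and the increments decay geometrically.\<close>
 define \<epsilon>0 where "\<epsilon>0 j = 1 / (2 ^ j * (2 powr p) ^ j)" for j :: nat
 have \<epsilon>0: "0 < \<epsilon>0 j" for j by (simp add: \<epsilon>0_def)
 have "ALL j. EX n0. ALL i>=n0. ALL l>=n0. (\<integral>\<^sup>+x. ennreal (norm (a i x - a l x) powr p) \<partial>N) <= ennreal (\<epsilon>0 j)"
  using cauchy[OF \<epsilon>0] by blast
 then obtain n0 where n0: "!!j i l. n0 j <= i ==> n0 j <= l ==> (\<integral>\<^sup>+x. ennreal (norm (a i x - a l x) powr p) \<partial>N) <= ennreal (\<epsilon>0 j)"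
  by metis
 define k where "k = rec_nat (n0 0) (%j m. max (Suc m) (n0 (Suc j)))"
 have kS: "k (Suc j) = max (Suc (k j)) (n0 (Suc j))" for j by (simp add: k_def)
 have k: "strict_mono k" by (rule strict_monoI_Suc) (simp add: kS)
 have kn: "n0 j <= k j" for j by (cases j) (auto simp: kS, simp add: k_def)
 have kk: "n0 j <= k (Suc j)" for j using kn[of j] kS[of j] by simp
 define d where "d j x = norm (a (k (Suc j)) x - a (k j) x)" for j x
 have dm: "d j \<in> borel_measurable N" for j unfolding d_def using meas by measurable
 have di: "(\<integral>\<^sup>+x. ennreal ((2 powr p) ^ j * d j x powr p) \<partial>N) <= ennreal ((1 / 2) ^ j)" for j
 proof -
  have "(\<integral>\<^sup>+x. ennreal ((2 powr p) ^ j * d j x powr p) \<partial>N) = ennreal ((2 powr p) ^ j) * (\<integral>\<^sup>+x. ennreal (d j x powr p) \<partial>N)"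
   using dm by (subst nn_integral_cmult[symmetric]) (auto simp: ennreal_mult)
  also have "... <= ennreal ((2 powr p) ^ j) * ennreal (\<epsilon>0 j)"
   unfolding d_def by (intro mult_left_mono n0 kk kn) simp
  also have "... = ennreal ((1 / 2) ^ j)"
   by (simp add: \<epsilon>0_def ennreal_mult[symmetric] power_one_over)
  finally show ?thesis .
 qed
 have "(\<integral>\<^sup>+x. (\<Sum>j. ennreal ((2 powr p) ^ j * d j x powr p)) \<partial>N) = (\<Sum>j. \<integral>\<^sup>+x. ennreal ((2 powr p) ^ j * d j x powr p) \<partial>N)"
  using dm by (intro nn_integral_suminf) measurable
 also have "... <= (\<Sum>j. ennreal ((1 / 2) ^ j))" by (intro suminf_le di) auto
 also have "... = ennreal (\<Sum>j. (1 / 2) ^ j)"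
  by (intro suminf_ennreal2 summable_geometric) auto
 also have "... < \<infinity>" by simp
 finally have "AE x in N. (\<Sum>j. ennreal ((2 powr p) ^ j * d j x powr p)) ~= \<infinity>"
  using dm by (intro nn_integral_PInf_AE) auto
 then have conv: "AE x in N. convergent (%n. a (k n) x)"
 proof eventually_elim
  case (elim x)
  obtain H where H: "0 <= H" "(\<Sum>j. ennreal ((2 powr p) ^ j * d j x powr p)) = ennreal H"
   using elim by (metis ennreal_cases infinity_ennreal_def)
  have "d j x <= H powr (1 / p) * (1 / 2) ^ j" for j
  proof -
   have "ennreal ((2 powr p) ^ j * d j x powr p) <= ennreal H"
   proof -
    have "(\<Sum>j\<in>{j}. ennreal ((2 powr p) ^ j * d j x powr p)) <= (\<Sum>j. ennreal ((2 powr p) ^ j * d j x powr p))"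
     by (rule sum_le_suminf) auto
    then show ?thesis unfolding H(2) by (simp only: sum.insert[OF finite.emptyI] empty_iff not_False_eq_True sum.empty add_0_right)
   qed
   then have "(2 powr p) ^ j * d j x powr p <= H" using H(1) by (simp add: ennreal_le_iff)
   moreover have "(2 powr p) ^ j * d j x powr p = (2 ^ j * d j x) powr p"
   proof -
    have "(2 powr p) ^ j = (2 ^ j) powr p" by (induction j) (simp_all add: powr_mult)
    then show ?thesis by (simp add: powr_mult d_def)
   qed
   ultimately have "((2 ^ j * d j x) powr p) powr (1 / p) <= H powr (1 / p)" using p by (intro powr_mono2) auto
   then have "2 ^ j * d j x <= H powr (1 / p)" using p by (simp add: powr_powr d_def)
   then show ?thesis by (simp add: power_one_over field_simps)
  qed
  then have dl: "norm (a (k (Suc j)) x - a (k j) x) <= H powr (1 / p) * (1 / 2) ^ j" for j by (simp only: d_def)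
  have "summable (%j. H powr (1 / p) * (1 / 2) ^ j)" by (rule summable_mult) (simp add: summable_geometric)
  then have "summable (%j. a (k (Suc j)) x - a (k j) x)"
   by (rule summable_comparison_test') (rule dl)
  then have "convergent (%n. \<Sum>j<n. a (k (Suc j)) x - a (k j) x)" by (simp add: summable_iff_convergent)
  moreover have "(%n. \<Sum>j<n. a (k (Suc j)) x - a (k j) x) = (%n. a (k n) x - a (k 0) x)"
   by (rule ext) (rule sum_lessThan_telescope)
  ultimately have "convergent (%n. a (k n) x - a (k 0) x)" by (simp only:)
  from convergent_add[OF this convergent_const[of "a (k 0) x"]] show "convergent (%n. a (k n) x)" by simp
 qed
 have bm: "b k \<in> borel_measurable N"
 proof -
  have beq: "b k = (%x. lim (%n. if convergent (%n. a (k n) x) then a (k n) x else 0))"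
   by (auto simp: b_def fun_eq_iff)
  have "Measurable.pred N (%x. convergent (%n. a (k n) x))"
   unfolding Cauchy_convergent_iff[symmetric] using meas by measurable
  then have "{x \<in> space N. convergent (%n. a (k n) x)} \<in> sets N" by simp
  then have "(%x. if convergent (%n. a (k n) x) then a (k n) x else 0) \<in> borel_measurable N" for n
   using meas by (intro measurable_If) auto
  then show ?thesis unfolding beq by (rule borel_measurable_lim_metric)
 qed
 show ?thesis
 proof (intro exI[of _ k] conjI k bm allI impI)
  fix \<epsilon> :: real assume "0 < \<epsilon>"
  then obtain m where m: "!!i j. m <= i ==> m <= j ==> (\<integral>\<^sup>+x. ennreal (norm (a i x - a j x) powr p) \<partial>N) <= ennreal \<epsilon>"
   using cauchy by blast
  have "(\<integral>\<^sup>+x. ennreal (norm (a i x - b k x) powr p) \<partial>N) <= ennreal \<epsilon>" if i: "m <= i" for i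
  proof -
   \<comment> \<open>Fatou's lemma takes the limit along the subsequence out of the
     integral.\<close>
   have "(\<integral>\<^sup>+x. ennreal (norm (a i x - b k x) powr p) \<partial>N) = (\<integral>\<^sup>+x. liminf (%j. ennreal (norm (a i x - a (k j) x) powr p)) \<partial>N)"
   proof (rule nn_integral_cong_AE, use conv in eventually_elim)
    case (elim x)
    have "(%j. a (k j) x) \<longlonglongrightarrow> b k x" using elim by (simp add: b_def convergent_LIMSEQ_iff)
    then have "(%j. norm (a i x - a (k j) x)) \<longlonglongrightarrow> norm (a i x - b k x)" by (intro tendsto_intros)
    then have "(%j. norm (a i x - a (k j) x) powr p) \<longlonglongrightarrow> norm (a i x - b k x) powr p"
     using p by (intro tendsto_powr' tendsto_const) auto
    then have "(%j. ennreal (norm (a i x - a (k j) x) powr p)) \<longlonglongrightarrow> ennreal (norm (a i x - b k x) powr p)"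
     by (rule tendsto_ennrealI)
    from lim_imp_Liminf[OF _ this] show ?case by simp
   qed
   also have "... <= liminf (%j. \<integral>\<^sup>+x. ennreal (norm (a i x - a (k j) x) powr p) \<partial>N)"
    using meas by (intro nn_integral_liminf) measurable
   also have "... <= liminf (%j. ennreal \<epsilon>)"
    using seq_suble[OF k] i
    by (intro Liminf_mono eventually_sequentiallyI[of m] m) (auto intro: order_trans)
   also have "... = ennreal \<epsilon>" by (simp add: Liminf_const)
   finally show ?thesis .
  qed
  then show "EX n0. ALL i>=n0. (\<integral>\<^sup>+x. ennreal (norm (a i x - b k x) powr p) \<partial>N) <= ennreal \<epsilon>" by blast
 qed
qed

lemma norm_vec_le_card:
 fixes x :: "complex ^ 'n"
 assumes "!!i. cmod (x $ i) <= c"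
 shows "norm x <= real CARD('n) * c"
proof -
 have "norm x <= (\<Sum>i\<in>UNIV. cmod (x $ i))" unfolding norm_vec_def by (rule L2_set_le_sum) simp
 also have "... <= real CARD('n) * c" using sum_bounded_above[of UNIV "%i. cmod (x $ i)" c] assms by simp
 finally show ?thesis .
qed

lemma bounded_linear_dual_anti: "bounded_linear dual_anti"
 by (rule linear_conv_bounded_linear[THEN iffD1])
  (auto intro!: linearI simp: vec_eq_iff forall_3 dual_anti_def)

lemma bounded_linear_z_part: "bounded_linear (z_part J)"
 by (rule linear_conv_bounded_linear[THEN iffD1])
  (auto intro!: linearI simp: vec_eq_iff z_part_def)

lemma bounded_linear_axis: "bounded_linear (axis T :: complex => ext)"
 by (rule linear_conv_bounded_linear[THEN iffD1])
  (auto intro!: linearI simp: vec_eq_iff axis_def)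

lemma bounded_bilinear_bd: "bounded_bilinear bd"
 unfolding bilinear_conv_bounded_bilinear[symmetric] bilinear_def
 by (intro conjI allI linearI) (simp_all add: bd_3 algebra_simps)

lemma borel_measurable_bounded_linear:
 "bounded_linear L ==> F \<in> borel_measurable N ==> (%x. L (F x)) \<in> borel_measurable N"
 by (rule measurable_compose[OF _ borel_measurable_continuous_onI[OF linear_continuous_on]])

lemma borel_measurable_bounded_bilinear:
 fixes B :: "'b::{real_normed_vector, second_countable_topology} => 'c::{real_normed_vector, second_countable_topology} => 'd::real_normed_vector"
 assumes "bounded_bilinear B" "F \<in> borel_measurable N" "G \<in> borel_measurable N"
 shows "(%x. B (F x) (G x)) \<in> borel_measurable N"
 by (rule borel_measurable_continuous_Pair[OF assms(2,3)])
  (intro bounded_bilinear.continuous_on[OF assms(1)] continuous_intros)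

lemma dominated_integral:
 fixes u :: "'a => complex"
 assumes u: "u \<in> borel_measurable N" and d: "AE x in N. ennreal (cmod (u x)) <= v x" and v: "(\<integral>\<^sup>+x. v x \<partial>N) < \<infinity>"
 shows "integrable N u" "cmod (\<integral>x. u x \<partial>N) <= enn2real (\<integral>\<^sup>+x. v x \<partial>N)"
proof -
 have le: "(\<integral>\<^sup>+x. ennreal (norm (u x)) \<partial>N) <= (\<integral>\<^sup>+x. v x \<partial>N)" using d by (intro nn_integral_mono_AE)
 show i: "integrable N u" by (rule integrableI_bounded[OF u]) (rule order.strict_trans1[OF le v])
 have "ennreal (norm (\<integral>x. u x \<partial>N)) <= (\<integral>\<^sup>+x. v x \<partial>N)"
  by (rule order_trans[OF integral_norm_bound_ennreal[OF i] le])
 then have "enn2real (ennreal (norm (\<integral>x. u x \<partial>N))) <= enn2real (\<integral>\<^sup>+x. v x \<partial>N)"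
  using v by (intro enn2real_mono) auto
 then show "cmod (\<integral>x. u x \<partial>N) <= enn2real (\<integral>\<^sup>+x. v x \<partial>N)" by simp
qed

section \<open>Measurability of the integrand and the estimate for bounded forms\<close>

context koppelman
begin

text \<open>Pairs off the diagonal with z first, matching the product of \<nu> and \<mu>. The set is
  open, so a function continuous on it and 0 elsewhere is Borel.\<close>

definition Wd :: "((complex ^ 3) \<times> (complex ^ 3)) set" where
 "Wd = {x. fst x \<in> \<Omega>' Int Ws \<and> snd x \<in> \<Omega>' \<and> fst x ~= snd x}"

lemma Wd_open: "open Wd"
proof -
 have "Wd = ((\<Omega>' Int Ws) \<times> \<Omega>') Int {x. fst x ~= snd x}" by (auto simp: Wd_def)
 moreover have "open {x :: (complex ^ 3) \<times> (complex ^ 3). fst x ~= snd x}"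
  by (intro open_Collect_neq continuous_intros)
 ultimately show ?thesis using \<Omega>'(2) s(3) by (auto intro!: open_Int open_Times)
qed

text \<open>The factor without global meaning is \<open>s\<close>. Its product with
  \<open>dcut\<close> is continuous where s is defined and is 0 off the support of the derivative of
  the cutoff; these two open sets cover the domain.\<close>

lemma Kt_continuous: "continuous_on Wd (%x. Kt (snd x) (fst x))"
proof -
 have sw: "continuous_on Wd (%x. (snd x, fst x))" by (intro continuous_intros)
 have hj: "continuous_on Wd (%x. h (snd x) (fst x) $ j)" for j
 proof -
  have "(%x. (snd x, fst x)) ` Wd <= \<Omega>' \<times> \<Omega>'" by (auto simp: Wd_def)
  from continuous_on_compose2[OF h_continuous[of j] sw this] show ?thesis by (simp only: prod.case)
 qed
 have hc: "continuous_on Wd (%x. h (snd x) (fst x))"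
 proof -
  have "continuous_on Wd (%x. \<chi> j. h (snd x) (fst x) $ j)" by (rule continuous_on_vec_lambda) (rule hj)
  then show ?thesis by (simp only: vec_lambda_eta)
 qed
 have df: "continuous_on Wd (%x. snd x - fst x)" by (intro continuous_intros)
 have P1c: "continuous_on Wd (%x. P1 (snd x - fst x))" and bFc: "continuous_on Wd (%x. bF (snd x - fst x))"
 proof -
  have im: "(%x. snd x - fst x) ` Wd <= - {0}" by (auto simp: Wd_def)
  show "continuous_on Wd (%x. P1 (snd x - fst x))" by (rule continuous_on_compose2[OF sing_isCont[OF sing_P1] df im])
  show "continuous_on Wd (%x. bF (snd x - fst x))" by (rule continuous_on_compose2[OF sing_isCont[OF sing_bF] df im])
 qed
 have dc: "continuous_on U (%x. dcut cutoff (snd x))" for U :: "((complex ^ 3) \<times> (complex ^ 3)) set"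
  by (rule continuous_on_compose2[OF dcut_continuous continuous_on_snd[OF continuous_on_id] subset_UNIV])
 have cc: "continuous_on U (%x. cutoff (snd x))" for U :: "((complex ^ 3) \<times> (complex ^ 3)) set"
  by (rule continuous_on_compose2[OF cutoff_continuous continuous_on_snd[OF continuous_on_id] subset_UNIV])
 define Q where "Q x = dcut cutoff (snd x) \<^bold>\<and> form1 (s (snd x) (fst x))" for x
 have Q1: "continuous_on (Ws \<times> Vs) Q"
 proof -
  have sw: "continuous_on (Ws \<times> Vs) (%x. (snd x, fst x))" by (intro continuous_intros)
  have im: "(%x. (snd x, fst x)) ` (Ws \<times> Vs) <= Vs \<times> Ws" by auto
  have "continuous_on (Ws \<times> Vs) (%x. s (snd x) (fst x))"
   using continuous_on_compose2[OF s_continuous sw im] by (simp only: prod.case)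
  then show ?thesis unfolding Q_def
   by (intro bounded_bilinear.continuous_on[OF bounded_bilinear_wedge] dc bounded_linear.continuous_on[OF bounded_linear_form1])
 qed
 have Q2: "continuous_on (Ws \<times> (- supp_dbar cutoff)) Q"
 proof (rule continuous_on_eq[OF continuous_on_const[of _ 0]])
  fix x assume "x \<in> Ws \<times> (- supp_dbar cutoff)"
  then have "snd x \<notin> supp_dbar cutoff" by auto
  then have "dcut cutoff (snd x) = 0" using dcut_nz by blast
  then show "0 = Q x" by (simp only: Q_def wedge_0_left)
 qed
 have "continuous_on ((Ws \<times> Vs) \<union> (Ws \<times> (- supp_dbar cutoff))) Q"
  using s(1,3) supp_dbar_subset(2) by (intro continuous_on_open_Un Q1 Q2 open_Times) (auto intro: open_Compl compact_imp_closed)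
 then have Qc: "continuous_on Wd Q"
  by (rule continuous_on_subset) (use s(2) in \<open>auto simp: Wd_def\<close>)
 have Pc: "continuous_on Wd (%x. Pker cutoff s (snd x) (fst x))"
 proof -
  have "continuous_on Wd (%x. cutoff (snd x) *\<^sub>R P1 (snd x - fst x) - Q x \<^bold>\<and> bF (snd x - fst x))"
   by (intro continuous_on_diff continuous_on_scaleR cc P1c bounded_bilinear.continuous_on[OF bounded_bilinear_wedge] Qc bFc)
  then show ?thesis unfolding Pker_def Q_def scaleR_smult .
 qed
 have "continuous_on Wd (%x. divide_dzeta (form1 (h (snd x) (fst x)) \<^bold>\<and> Pker cutoff s (snd x) (fst x)))"
  by (intro bounded_linear.continuous_on[OF bounded_linear_divide_dzeta] bounded_bilinear.continuous_on[OF bounded_bilinear_wedge]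
    bounded_linear.continuous_on[OF bounded_linear_form1] hc Pc)
 then show ?thesis
  by (rule continuous_on_eq) (rule Kt_eq[symmetric], simp add: Wd_def)
qed

definition GK where "GK x = (if x \<in> Wd then Kt (snd x) (fst x) else 0)"

lemma GK_meas: "GK \<in> borel_measurable borel"
 unfolding GK_def by (rule borel_measurable_continuous_on_if) (use Wd_open Kt_continuous in auto)

lemma GK_eq:
 assumes "z \<in> Z" "zt \<in> M"
 shows "GK (z, zt) = Kt zt z"
 using assms M_in[of zt] Z Kt_diag[of z] by (auto simp: GK_def Wd_def)

text \<open>The integrand with the arbitrary frame eliminated and the kernel extended by 0, which
  makes it visibly Borel in both points jointly. On the spaces of the two measures it agrees with
  \<open>K_integrand\<close>.\<close>

definition KG where "KG J z zt p = (if card J = r - 1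
 then 8 * pi * \<i> * bd (dual_anti (z_part J (GK (z, zt) \<^bold>\<and> p))) (cv (gr zt)) / of_real ((norm (gr zt))\<^sup>2) else 0)"

lemma KI_KG:
 assumes "z \<in> Z" "zt \<in> M" "form_0r r (\<phi> zt)"
 shows "KI \<phi> z J zt = KG J z zt (\<phi> zt)"
proof -
 have zW: "z \<in> Ws" using assms(1) Z(3) by auto
 have r1: "1 <= r" using r by auto
 show ?thesis
  unfolding KI_eq KG_def GK_eq[OF assms(1,2)] gr_eq[OF assms(2)]
  by (rule KT_formula[OF fh M_in[OF assms(2)] grad_nz[OF assms(2)] \<omega>D[OF assms(2)] Kt_degr[OF zW] assms(3) r1])
qed

lemma KG_meas:
 assumes a: "a \<in> borel_measurable N" and b: "b \<in> borel_measurable N" and p: "p \<in> borel_measurable N"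
 shows "(%x. KG J (a x) (b x) (p x)) \<in> borel_measurable N"
proof -
 have gb: "(%x. gr (b x)) \<in> borel_measurable N" by (rule measurable_compose[OF b gr_measurable])
 have "(%x. GK (a x, b x)) \<in> borel_measurable N"
  by (rule measurable_compose[OF _ GK_meas]) (rule borel_measurable_Pair[OF a b])
 then have "(%x. bd (dual_anti (z_part J (GK (a x, b x) \<^bold>\<and> p x))) (cv (gr (b x)))) \<in> borel_measurable N"
  by (intro borel_measurable_bounded_bilinear[OF bounded_bilinear_bd] borel_measurable_bounded_linear[OF bounded_linear_dual_anti]
    borel_measurable_bounded_linear[OF bounded_linear_z_part] borel_measurable_bounded_bilinear[OF bounded_bilinear_wedge]
    borel_measurable_bounded_linear[OF bounded_linear_cv] gb p)
 moreover have "(%x. complex_of_real ((norm (gr (b x)))\<^sup>2)) \<in> borel_measurable N" using gb by measurable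
 ultimately show ?thesis unfolding KG_def by (cases "card J = r - 1") (simp_all add: borel_measurable_divide borel_measurable_times)
qed

abbreviation FO where "FO \<phi> \<equiv> (\<forall>x\<in>M. form_0r r (\<phi> x)) \<and> \<phi> \<in> borel_measurable \<mu>"

lemma KI_meas:
 assumes "FO \<phi>" "z \<in> Z"
 shows "KI \<phi> z J \<in> borel_measurable \<mu>"
proof -
 have "(%zt. KG J z zt (\<phi> zt)) \<in> borel_measurable \<mu>" using assms by (intro KG_meas R.id_\<mu>) auto
 then show ?thesis by (subst measurable_cong[of \<mu>]) (use assms KI_KG in \<open>auto simp: space_\<mu>\<close>)
qed

abbreviation Kop where "Kop \<phi> z \<equiv> K_op f X \<omega> cutoff s h \<phi> z"

lemma Kop_nth: "Kop \<phi> z $ T = (if T <= range Dzetabar then \<integral>zt. KI \<phi> z {j. Dzetabar j \<in> T} zt \<partial>\<mu> else 0)"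
 by (simp add: K_op_def \<mu>_def)

lemma Kop_form:
 assumes "FO \<phi>" "z \<in> Z"
 shows "form_0r (r - 1) (Kop \<phi> z)"
 unfolding form_0r_def
proof (intro allI impI)
 fix T assume nz: "Kop \<phi> z $ T ~= 0"
 then have T: "T <= range Dzetabar" by (auto simp: Kop_nth split: if_splits)
 define J where "J = {j. Dzetabar j \<in> T}"
 have TJ: "T = Dzetabar ` J" using T by (auto simp: J_def)
 have "card J = r - 1"
 proof (rule ccontr)
  assume "card J ~= r - 1"
  then have "(\<integral>zt. KI \<phi> z J zt \<partial>\<mu>) = (\<integral>zt. 0 \<partial>\<mu>)"
   using assms by (intro Bochner_Integration.integral_cong refl) (simp add: KI_KG KG_def space_\<mu>)
  then show False using nz T by (simp add: Kop_nth J_def)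
 qed
 moreover have "card T = card J" unfolding TJ by (rule card_image) (auto intro: inj_onI)
 ultimately show "T <= range Dzetabar \<and> card T = r - 1" using T by simp
qed

lemma \<nu>_Z: "z \<in> space \<nu> ==> z \<in> Z" using DZ by (auto simp: space_\<nu>)

lemma Kop_meas:
 assumes "FO \<phi>"
 shows "Kop \<phi> \<in> borel_measurable \<nu>"
proof -
 have "(%z. \<integral>zt. KI \<phi> z J zt \<partial>\<mu>) \<in> borel_measurable \<nu>" for J
 proof (rule sigma_finite_measure.borel_measurable_lebesgue_integral[OF R.\<mu>])
  have "(%x. KG J (fst x) (snd x) (\<phi> (snd x))) \<in> borel_measurable (\<nu> \<Otimes>\<^sub>M \<mu>)"
   using assms by (intro KG_meas measurable_compose[OF measurable_fst R.id_\<nu>] measurable_compose[OF measurable_snd R.id_\<mu>]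
     measurable_compose[OF measurable_snd]) auto
  then show "(%(z, zt). KI \<phi> z J zt) \<in> borel_measurable (\<nu> \<Otimes>\<^sub>M \<mu>)"
   by (subst measurable_cong[of "\<nu> \<Otimes>\<^sub>M \<mu>"]) (use assms KI_KG \<nu>_Z in \<open>auto simp: space_\<mu> space_pair_measure\<close>)
 qed
 then have "(%z. Kop \<phi> z $ T) \<in> borel_measurable \<nu>" for T by (simp add: Kop_nth)
 then have "(%z. \<Sum>T\<in>UNIV. axis T (Kop \<phi> z $ T)) \<in> borel_measurable \<nu>"
  by (intro borel_measurable_sum borel_measurable_bounded_linear[OF bounded_linear_axis])
 then show ?thesis unfolding ext_eq_sum[symmetric] .
qed

lemma Kop_linear:
 assumes "!!J. integrable \<mu> (KI \<phi> z J)" "!!J. integrable \<mu> (KI \<psi> z J)"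
 shows "Kop (%x. \<phi> x + \<psi> x) z = Kop \<phi> z + Kop \<psi> z" "Kop (%x. c *s \<phi> x) z = c *s Kop \<phi> z"
 "Kop (%x. \<phi> x - \<psi> x) z = Kop \<phi> z - Kop \<psi> z"
proof -
 have e: "\<phi> x - \<psi> x = \<phi> x + (-1) *s \<psi> x" for x by (simp add: vector_sneg_minus1[symmetric])
 have "KI (%x. \<phi> x + \<psi> x) z J = (%zt. KI \<phi> z J zt + KI \<psi> z J zt)" "KI (%x. c *s \<phi> x) z J = (%zt. c * KI \<phi> z J zt)"
  "KI (%x. \<phi> x - \<psi> x) z J = (%zt. KI \<phi> z J zt - KI \<psi> z J zt)" for J
  unfolding KI_eq KT_linear e by (simp_all add: fun_eq_iff)
 then show "Kop (%x. \<phi> x + \<psi> x) z = Kop \<phi> z + Kop \<psi> z" "Kop (%x. c *s \<phi> x) z = c *s Kop \<phi> z"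
  "Kop (%x. \<phi> x - \<psi> x) z = Kop \<phi> z - Kop \<psi> z"
  using assms by (auto simp: vec_eq_iff Kop_nth)
qed

text \<open>The estimate for differences excludes \<zeta> = z and \<zeta> = w; growth r^4 shows that
  single points are null.\<close>

lemma S_null: "AE zt in \<mu>. zt \<in> S --> zt ~= z"
proof -
 have Sz: "S Int {z} \<in> sets \<mu>" using S_sets by (auto simp: sets_\<mu>)
 have "emeasure \<mu> (S Int {z}) <= 0 + ennreal e" if "0 < e" for e
 proof -
  define t where "t = min 1 (e / (CR + 1))"
  have c1: "0 < CR + 1" using R.C by simp
  have t: "0 < t" "t <= 1" "t <= e / (CR + 1)" using that c1 by (auto simp: t_def)
  have t3: "t * (CR + 1) <= e" using t(3) pos_le_divide_eq[OF c1] by blast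
  have Sb: "S Int ball z t \<in> sets \<mu>" using S_sets by (auto simp: sets_\<mu>)
  have "emeasure \<mu> (S Int {z}) <= emeasure \<mu> (S Int ball z t)" using t by (intro emeasure_mono Sb) auto
  also have "... <= ennreal (CR * t ^ 4)" by (rule R.growth_\<mu>[OF t(1)])
  also have "... <= ennreal e"
  proof (rule ennreal_leI)
   have "t ^ 4 <= t ^ 1" using t by (intro power_decreasing) auto
   then have "CR * t ^ 4 <= CR * t" using R.C by (intro mult_left_mono) auto
   also have "... <= e" using t t3 by (simp add: algebra_simps)
   finally show "CR * t ^ 4 <= e" .
  qed
  finally show ?thesis by simp
 qed
 then have "emeasure \<mu> (S Int {z}) = 0" using ennreal_le_epsilon[of 0 "emeasure \<mu> (S Int {z})"] by simp
 then show ?thesis using Sz by (intro AE_I[of _ _ "S Int {z}"]) auto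
qed

abbreviation cG :: real where "cG \<equiv> real CARD(gen set)"

lemma cG: "1 <= cG"
 using card_gt_0_iff[of "UNIV :: gen set set"] by (simp add: Suc_le_eq)

lemma Linf_est:
 assumes a: "0 <= \<alpha>" "\<alpha> < 2 - 4 / q"
 shows "EX C>=0. \<forall>\<phi> B. FO \<phi> \<and> 0 <= B \<and> (AE x in \<mu>. form_norm f x r (\<phi> x) <= B) -->
  (\<forall>z\<in>Z. (ALL J. integrable \<mu> (KI \<phi> z J)) \<and> norm (Kop \<phi> z) <= C * B \<and>
    (\<forall>w\<in>Z. norm (Kop \<phi> z - Kop \<phi> w) <= C * B * norm (z - w) powr \<alpha>))"
proof -
 have a1: "\<alpha> <= 1"
 proof -
  have "1 <= 4 / q" using q by simp
  then show ?thesis using a by linarith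
 qed
 obtain C where C: "0 <= C"
  "!!\<phi> zt z J. zt \<in> M ==> z \<in> Z ==> form_0r r (\<phi> zt) ==>
   cmod (KI \<phi> z J zt) <= C * (R.kap 0 z zt * form_norm f zt r (\<phi> zt)) * indicator S zt"
  "!!\<phi> zt z w J \<alpha>. zt \<in> M ==> z \<in> Z ==> w \<in> Z ==> zt ~= z ==> zt ~= w ==> form_0r r (\<phi> zt) ==> 0 <= \<alpha> ==> \<alpha> <= 1 ==>
   cmod (KI \<phi> z J zt - KI \<phi> w J zt) <= C * norm (z - w) powr \<alpha> * ((R.kap \<alpha> z zt + R.kap \<alpha> w zt) * form_norm f zt r (\<phi> zt)) * indicator S zt"
  using KI_bounds by metis
 obtain B0 where B0: "0 <= B0" "!!z. (\<integral>\<^sup>+x\<in>S. ennreal (R.kap 0 z x) \<partial>\<mu>) <= ennreal B0"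
  using R.kap_bound[of 0] a by auto
 obtain B1 where B1: "0 <= B1" "!!z. (\<integral>\<^sup>+x\<in>S. ennreal (R.kap \<alpha> z x) \<partial>\<mu>) <= ennreal B1"
  using R.kap_bound[OF a] by auto
 have dom: "integrable \<mu> u \<and> cmod (\<integral>x. u x \<partial>\<mu>) <= c * I"
  if "u \<in> borel_measurable \<mu>" "0 <= c" "0 <= I" "k \<in> borel_measurable \<mu>" "(\<integral>\<^sup>+x\<in>S. ennreal (k x) \<partial>\<mu>) <= ennreal I"
   "AE x in \<mu>. cmod (u x) <= c * k x * indicator S x" for u k and c I :: real
 proof -
  have "(\<integral>\<^sup>+x. ennreal c * (ennreal (k x) * indicator S x) \<partial>\<mu>) = ennreal c * (\<integral>\<^sup>+x\<in>S. ennreal (k x) \<partial>\<mu>)"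
   using that borel_measurable_indicator[OF S_sets] by (intro nn_integral_cmult) measurable
  also have "... <= ennreal c * ennreal I" using that by (intro mult_left_mono) auto
  finally have le: "(\<integral>\<^sup>+x. ennreal c * (ennreal (k x) * indicator S x) \<partial>\<mu>) <= ennreal (c * I)"
   using that by (simp add: ennreal_mult)
  then have fin: "(\<integral>\<^sup>+x. ennreal c * (ennreal (k x) * indicator S x) \<partial>\<mu>) < \<infinity>"
   by (rule order.strict_trans1) simp
  have "AE x in \<mu>. ennreal (cmod (u x)) <= ennreal c * (ennreal (k x) * indicator S x)"
   using that(6) by eventually_elim (use that(2) in \<open>auto simp: indicator_def ennreal_mult' dest: ennreal_leI split: if_splits\<close>)
  note d = dominated_integral[OF that(1) this fin]
  have "enn2real (\<integral>\<^sup>+x. ennreal c * (ennreal (k x) * indicator S x) \<partial>\<mu>) <= c * I"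
   using enn2real_mono[OF le] that by simp
  then show ?thesis using d by linarith
 qed
 \<comment> \<open>B0 bounds the values, and 2 B1 the differences, with one kernel for each of z and
   w; \<open>cG\<close> is the number of coefficients of a form.\<close>
 define C' where "C' = cG * (C * (B0 + 2 * B1))"
 have C': "0 <= C'" using C(1) B0(1) B1(1) by (simp add: C'_def)
 show ?thesis
 proof (intro exI[of _ C'] conjI C' allI impI ballI)
  fix \<phi> B z assume \<phi>: "FO \<phi> \<and> 0 <= B \<and> (AE x in \<mu>. form_norm f x r (\<phi> x) <= B)" and z: "z \<in> Z"
  then have ae: "AE x in \<mu>. form_norm f x r (\<phi> x) <= B" and B: "0 <= B" by auto
  have 1: "integrable \<mu> (KI \<phi> z J) \<and> cmod (\<integral>x. KI \<phi> z J x \<partial>\<mu>) <= C * B * B0" if z: "z \<in> Z" for z J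
  proof (rule dom[OF _ _ B0(1) R.kap_meas B0(2)])
   show "KI \<phi> z J \<in> borel_measurable \<mu>" using \<phi> z by (intro KI_meas) auto
   show "0 <= C * B" using C(1) B by simp
   show "AE x in \<mu>. cmod (KI \<phi> z J x) <= C * B * R.kap 0 z x * indicator S x"
    using ae AE_space
   proof eventually_elim
    case (elim x)
    then have x: "x \<in> M" "form_0r r (\<phi> x)" using \<phi> by (auto simp: space_\<mu>)
    have "cmod (KI \<phi> z J x) <= C * (R.kap 0 z x * form_norm f x r (\<phi> x)) * indicator S x" by (rule C(2)[of x z \<phi> J, OF x(1) z x(2)])
    also have "... <= C * (R.kap 0 z x * B) * indicator S x"
     using C(1) elim R.kap_nonneg by (intro mult_right_mono mult_left_mono) auto
    finally show ?case by (simp add: mult_ac)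
   qed
  qed
  show "integrable \<mu> (KI \<phi> z J)" for J using 1[OF z] by simp
  have le1: "C * B * B0 <= C * (B0 + 2 * B1) * B" using C(1) B B0(1) B1(1) by (simp add: algebra_simps)
  have le2: "C * B * (2 * B1) <= C * (B0 + 2 * B1) * B" using C(1) B B0(1) B1(1) by (simp add: algebra_simps)
  have "norm (Kop \<phi> z) <= cG * (C * (B0 + 2 * B1) * B)"
  proof (rule norm_vec_le_card)
   fix T show "cmod (Kop \<phi> z $ T) <= C * (B0 + 2 * B1) * B"
    using order_trans[OF 1[OF z, THEN conjunct2] le1] C(1) B B0(1) B1(1) by (simp add: Kop_nth)
  qed
  then show "norm (Kop \<phi> z) <= C' * B" by (simp add: C'_def mult_ac)
  fix w assume w: "w \<in> Z"
  define x where "x = norm (z - w) powr \<alpha>"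
  have x0: "0 <= x" by (simp add: x_def)
  have 2: "cmod (\<integral>zt. KI \<phi> z J zt - KI \<phi> w J zt \<partial>\<mu>) <= C * x * B * (2 * B1)" for J
  proof (rule dom[THEN conjunct2])
   show "(%zt. KI \<phi> z J zt - KI \<phi> w J zt) \<in> borel_measurable \<mu>"
    using \<phi> z w by (intro borel_measurable_diff KI_meas) auto
   show "0 <= C * x * B" using C(1) B x0 by simp
   show "0 <= 2 * B1" using B1(1) by simp
   show "(%zt. R.kap \<alpha> z zt + R.kap \<alpha> w zt) \<in> borel_measurable \<mu>" by (intro borel_measurable_add R.kap_meas)
   have [measurable]: "S \<in> sets \<mu>" "!!z. R.kap \<alpha> z \<in> borel_measurable \<mu>" by (rule S_sets, rule R.kap_meas)
   have "(\<integral>\<^sup>+zt\<in>S. ennreal (R.kap \<alpha> z zt + R.kap \<alpha> w zt) \<partial>\<mu>) = (\<integral>\<^sup>+zt\<in>S. ennreal (R.kap \<alpha> z zt) \<partial>\<mu>) + (\<integral>\<^sup>+zt\<in>S. ennreal (R.kap \<alpha> w zt) \<partial>\<mu>)"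
    unfolding ennreal_plus[OF R.kap_nonneg R.kap_nonneg] distrib_right
    by (intro nn_integral_add) measurable
   also have "... <= ennreal B1 + ennreal B1" by (intro add_mono B1(2))
   also have "... = ennreal (2 * B1)" using B1(1) by (simp flip: ennreal_plus)
   finally show "(\<integral>\<^sup>+zt\<in>S. ennreal (R.kap \<alpha> z zt + R.kap \<alpha> w zt) \<partial>\<mu>) <= ennreal (2 * B1)" .
   show "AE zt in \<mu>. cmod (KI \<phi> z J zt - KI \<phi> w J zt) <= C * x * B * (R.kap \<alpha> z zt + R.kap \<alpha> w zt) * indicator S zt"
    using ae AE_space S_null[of z] S_null[of w]
   proof eventually_elim
    case (elim zt)
    then have m: "zt \<in> M" "form_0r r (\<phi> zt)" using \<phi> by (auto simp: space_\<mu>)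
    show ?case
    proof (cases "zt \<in> S")
     case True
     then have ne: "zt ~= z" "zt ~= w" using elim by auto
     have "cmod (KI \<phi> z J zt - KI \<phi> w J zt) <= C * x * ((R.kap \<alpha> z zt + R.kap \<alpha> w zt) * form_norm f zt r (\<phi> zt)) * indicator S zt"
      unfolding x_def by (rule C(3)[of zt z w \<phi> \<alpha> J, OF m(1) z w ne m(2) a(1) a1])
     also have "... <= C * x * ((R.kap \<alpha> z zt + R.kap \<alpha> w zt) * B) * indicator S zt"
      using C(1) elim R.kap_nonneg x0 by (intro mult_right_mono mult_left_mono) (auto intro: add_nonneg_nonneg)
     finally show ?thesis by (simp add: mult_ac)
    next
     case False
     then show ?thesis using C(2)[of zt z \<phi> J, OF m(1) z m(2)] C(2)[of zt w \<phi> J, OF m(1) w m(2)] by simp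
    qed
   qed
  qed
  have "norm (Kop \<phi> z - Kop \<phi> w) <= cG * (C * (B0 + 2 * B1) * B * x)"
  proof (rule norm_vec_le_card)
   fix T
   have "C * x * B * (2 * B1) <= C * (B0 + 2 * B1) * B * x" using mult_right_mono[OF le2 x0] by (simp add: mult_ac)
   with 2[of "{j. Dzetabar j \<in> T}"] show "cmod ((Kop \<phi> z - Kop \<phi> w) $ T) <= C * (B0 + 2 * B1) * B * x"
    using 1[OF z] 1[OF w] C(1) B B0(1) B1(1) x0 by (auto simp: Kop_nth)
  qed
  then show "norm (Kop \<phi> z - Kop \<phi> w) <= C' * B * norm (z - w) powr \<alpha>" by (simp add: C'_def x_def mult_ac)
 qed
qed

end

lemma form_0r_zero: "form_0r k 0"
 by (simp add: form_0r_def)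

lemma form_0r_diff:
 assumes "form_0r k a" "form_0r k b"
 shows "form_0r k (a - b)"
 unfolding form_0r_def
proof (intro allI impI)
 fix S assume "(a - b) $ S ~= 0"
 then have "a $ S ~= 0 \<or> b $ S ~= 0" by auto
 then show "S <= range Dzetabar \<and> card S = k" using assms unfolding form_0r_def by blast
qed

lemma form_norm_zero: "form_norm f x k 0 = 0"
proof -
 have "ev vs 0 = 0" for vs using ev_smult[of vs 0 0] by simp
 then show ?thesis by (simp add: form_norm_def)
qed

lemma form_0r_limit:
 assumes "!!n. form_0r k (a n)" "a \<longlonglongrightarrow> b"
 shows "form_0r k b"
 unfolding form_0r_def
proof (intro allI impI)
 fix S assume nz: "b $ S ~= 0"
 have "EX n. a n $ S ~= 0"
 proof (rule ccontr)
  assume "\<not> ?thesis"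
  then have "(%n. a n $ S) = (%n. 0)" by auto
  then have "(%n. 0) \<longlonglongrightarrow> b $ S" using tendsto_vec_nth[OF assms(2), of S] by (simp only:)
  then have "b $ S = 0" by (rule LIMSEQ_unique) (rule tendsto_const)
  then show False using nz by simp
 qed
 then show "S <= range Dzetabar \<and> card S = k" using assms(1) unfolding form_0r_def by blast
qed

lemma powr_sum3_le:
 fixes x y w p :: real
 assumes "0 <= x" "0 <= y" "0 <= w" "0 < p"
 shows "(x + y + w) powr p <= 3 powr p * (x powr p + y powr p + w powr p)"
proof -
 define m where "m = max x (max y w)"
 have "(x + y + w) powr p <= (3 * m) powr p" using assms by (intro powr_mono2) (auto simp: m_def)
 also have "... = 3 powr p * m powr p" using assms by (simp add: powr_mult m_def)
 also have "m powr p <= x powr p + y powr p + w powr p"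
  using powr_ge_zero[of x p] powr_ge_zero[of y p] powr_ge_zero[of w p] unfolding m_def max_def by auto
 finally show ?thesis by simp
qed

lemma interpolation:
 fixes x a b \<theta> :: real
 assumes "0 <= x" "x <= a" "x <= b" "0 <= \<theta>" "\<theta> <= 1"
 shows "x <= a powr (1 - \<theta>) * b powr \<theta>"
proof (cases "x = 0")
 case False
 then have "x = x powr (1 - \<theta>) * x powr \<theta>" using assms by (simp flip: powr_add)
 also have "... <= a powr (1 - \<theta>) * b powr \<theta>" using assms by (intro mult_mono powr_mono2) auto
 finally show ?thesis .
qed simp

section \<open>Compactness from L^p\<close>

context koppelman
begin

text \<open>Measurability of the norm is a conjunct of its own: the norm is defined by the chosen
  frame, so it does not follow directly from measurability of the form.\<close>

definition LF where
 "LF p \<phi> \<longleftrightarrow> FO \<phi> \<and> (%x. form_norm f x r (\<phi> x)) \<in> borel_measurable \<mu> \<and> (\<integral>\<^sup>+x. ennreal (form_norm f x r (\<phi> x) powr p) \<partial>\<mu>) < \<infinity>"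

abbreviation in_int where "in_int p \<phi> \<equiv> \<integral>\<^sup>+x. ennreal (form_norm f x r (\<phi> x) powr p) \<partial>\<mu>"
abbreviation out_int where "out_int p \<phi> \<equiv> \<integral>\<^sup>+z. ennreal (norm (Kop \<phi> z) powr p) \<partial>\<nu>"

lemma LF_meas: "LF p \<phi> ==> (%x. form_norm f x r (\<phi> x)) \<in> borel_measurable \<mu>"
 by (simp add: LF_def)

lemma Linf_integrable:
 assumes "FO \<phi>" "0 <= B" "AE x in \<mu>. form_norm f x r (\<phi> x) <= B" "z \<in> Z"
 shows "integrable \<mu> (KI \<phi> z J)"
proof -
 have "0 < 2 - 4 / q" using q(1) by (simp add: divide_less_eq)
 from Linf_est[OF order_refl this] obtain C where "\<forall>\<phi> B. FO \<phi> \<and> 0 <= B \<and> (AE x in \<mu>. form_norm f x r (\<phi> x) <= B) -->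
  (\<forall>z\<in>Z. (ALL J. integrable \<mu> (KI \<phi> z J)) \<and> norm (Kop \<phi> z) <= C * B \<and>
    (\<forall>w\<in>Z. norm (Kop \<phi> z - Kop \<phi> w) <= C * B * norm (z - w) powr 0))" by blast
 then have "\<forall>z\<in>Z. (ALL J. integrable \<mu> (KI \<phi> z J))" using assms(1-3) by blast
 then show ?thesis using assms(4) by blast
qed

text \<open>The operator is dominated by the positive operator of \<open>R.Lp_bound\<close>, applied
  to a constant times the norm of the form. The number of coefficients is put into that constant, so
  the norm of the whole image is bounded with no further factor.\<close>

lemma Lp_op:
 assumes p: "q / (q - 1) < p"
 shows "EX K>=0. (\<forall>\<phi>. LF p \<phi> --> (AE z in \<nu>. ALL J. integrable \<mu> (KI \<phi> z J)) \<and>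
   out_int p \<phi> <= ennreal K * in_int p \<phi>) \<and>
  (\<forall>\<epsilon>>0. \<exists>\<delta>>0. \<forall>\<phi> E. LF p \<phi> --> E \<in> sets \<mu> --> (\<forall>x\<in>M. form_norm f x r (\<phi> x) ~= 0 --> x \<in> E) -->
   emeasure \<mu> (S Int E) <= ennreal \<delta> -->
   out_int p \<phi> <= ennreal \<epsilon> * in_int p \<phi>)"
proof -
 have p1: "1 < p"
 proof -
  have "1 < q / (q - 1)" using q by simp
  then show ?thesis using p by linarith
 qed
 obtain C where C: "0 <= C"
  "!!\<phi> zt z J. zt \<in> M ==> z \<in> Z ==> form_0r r (\<phi> zt) ==>
   cmod (KI \<phi> z J zt) <= C * (R.kap 0 z zt * form_norm f zt r (\<phi> zt)) * indicator S zt"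
  using KI_bounds by metis
 define cc :: real where "cc = cG"
 have cc: "1 <= cc" unfolding cc_def by (rule cG)
 define c where "c = cc * C"
 have c: "0 <= c" using C(1) cc by (simp add: c_def)
 define N where "N \<phi> x = (if x \<in> M then c * form_norm f x r (\<phi> x) else 0)" for \<phi> x
 have N0: "0 <= N \<phi> x" for \<phi> x using c by (simp add: N_def)
 have Nm: "N \<phi> \<in> borel_measurable \<mu>" if "LF p \<phi>" for \<phi>
 proof -
  have "(%x. c * form_norm f x r (\<phi> x)) \<in> borel_measurable \<mu>"
   by (intro borel_measurable_times borel_measurable_const LF_meas[OF that])
  then show ?thesis by (subst measurable_cong[of \<mu>]) (auto simp: N_def space_\<mu>)
 qed
 have Nint: "(\<integral>\<^sup>+x. ennreal (N \<phi> x powr p) \<partial>\<mu>) = ennreal (c powr p) * in_int p \<phi>" if "LF p \<phi>" for \<phi>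
 proof -
  have "(\<integral>\<^sup>+x. ennreal (N \<phi> x powr p) \<partial>\<mu>) = (\<integral>\<^sup>+x. ennreal (c powr p) * ennreal (form_norm f x r (\<phi> x) powr p) \<partial>\<mu>)"
   by (intro nn_integral_cong) (use c in \<open>auto simp: N_def space_\<mu> powr_mult ennreal_mult\<close>)
  also have "... = ennreal (c powr p) * in_int p \<phi>"
  proof -
   have [measurable]: "(%x. form_norm f x r (\<phi> x)) \<in> borel_measurable \<mu>" by (rule LF_meas[OF that])
   show ?thesis by (intro nn_integral_cmult) measurable
  qed
  finally show ?thesis .
 qed
 have Nfin: "(\<integral>\<^sup>+x. ennreal (N \<phi> x powr p) \<partial>\<mu>) < \<infinity>" if "LF p \<phi>" for \<phi>
  unfolding Nint[OF that] using that unfolding LF_def by (auto intro!: ennreal_mult_less_top[THEN iffD2])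
 define T where "T \<phi> z = (\<integral>\<^sup>+x\<in>S. ennreal (R.kap 0 z x * N \<phi> x) \<partial>\<mu>)" for \<phi> z
 have one: "(ALL J. integrable \<mu> (KI \<phi> z J)) \<and> norm (Kop \<phi> z) <= enn2real (T \<phi> z)"
  if \<phi>: "LF p \<phi>" and z: "z \<in> Z" and fin: "T \<phi> z < \<infinity>" for \<phi> z
 proof -
  have FO: "FO \<phi>" using \<phi> by (simp add: LF_def)
  have b: "AE x in \<mu>. ennreal (cmod (of_real cc * KI \<phi> z J x)) <= ennreal (R.kap 0 z x * N \<phi> x) * indicator S x" for J
  proof (rule AE_I2)
   fix x assume "x \<in> space \<mu>"
   then have x: "x \<in> M" "form_0r r (\<phi> x)" using FO by (auto simp: space_\<mu>)
   have "cc * cmod (KI \<phi> z J x) <= cc * (C * (R.kap 0 z x * form_norm f x r (\<phi> x)) * indicator S x)"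
    using C(2)[of x z \<phi> J, OF x(1) z x(2)] cc by (intro mult_left_mono) auto
   also have "... = R.kap 0 z x * N \<phi> x * indicator S x" using x by (simp add: N_def c_def)
   finally have le: "cc * cmod (KI \<phi> z J x) <= R.kap 0 z x * N \<phi> x * indicator S x" .
   have "cmod (of_real cc * KI \<phi> z J x) = cc * cmod (KI \<phi> z J x)" using cc by (simp add: norm_mult abs_of_nonneg)
   then show "ennreal (cmod (of_real cc * KI \<phi> z J x)) <= ennreal (R.kap 0 z x * N \<phi> x) * indicator S x"
    using ennreal_leI[OF le] by (cases "x \<in> S") simp_all
  qed
  have m: "(%x. of_real cc * KI \<phi> z J x) \<in> borel_measurable \<mu>" for J
   using KI_meas[OF FO z] by (intro borel_measurable_times borel_measurable_const)
  note d = dominated_integral[OF m b fin[unfolded T_def]]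
  have cc0: "complex_of_real cc ~= 0" using cc by auto
  have i: "integrable \<mu> (KI \<phi> z J)" for J
   using integrable_mult_right[of "1 / complex_of_real cc", OF d(1)[of J]] cc0 by (simp add: mult.assoc[symmetric])
  have le: "cc * cmod (\<integral>x. KI \<phi> z J x \<partial>\<mu>) <= enn2real (T \<phi> z)" for J
   using d(2)[of J] cc by (simp add: norm_mult abs_of_nonneg T_def)
  have comp: "cmod (Kop \<phi> z $ U) <= enn2real (T \<phi> z) / cc" for U
   using le[of "{j. Dzetabar j \<in> U}"] cc by (simp add: Kop_nth field_simps)
  have "norm (Kop \<phi> z) <= cG * (enn2real (T \<phi> z) / cc)"
   by (rule norm_vec_le_card) (rule comp)
  also have "... = enn2real (T \<phi> z)" unfolding cc_def[symmetric] using cc by simp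
  finally have "norm (Kop \<phi> z) <= enn2real (T \<phi> z)" .
  then show ?thesis using i cc0 by simp
 qed
 show ?thesis
 proof (rule R.Lp_bound[OF p])
  fix K :: real assume K: "0 <= K"
   and K1: "!!\<epsilon>. 0 < \<epsilon> ==> \<exists>\<delta>>0. ALL N E. N \<in> borel_measurable \<mu> --> (ALL x. 0 <= N x) --> E \<in> sets \<mu> -->
    (ALL x. N x ~= 0 --> x \<in> E) --> emeasure \<mu> (S Int E) <= ennreal \<delta> --> (\<integral>\<^sup>+x. ennreal (N x powr p) \<partial>\<mu>) < \<infinity> -->
    (\<integral>\<^sup>+z. ennreal (enn2real (\<integral>\<^sup>+x\<in>S. ennreal (R.kap 0 z x * N x) \<partial>\<mu>) powr p) \<partial>\<nu>) <= ennreal \<epsilon> * (\<integral>\<^sup>+x. ennreal (N x powr p) \<partial>\<mu>)"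
   and K2: "!!N. N \<in> borel_measurable \<mu> ==> (!!x. 0 <= N x) ==> (\<integral>\<^sup>+x. ennreal (N x powr p) \<partial>\<mu>) < \<infinity> ==>
    (AE z in \<nu>. (\<integral>\<^sup>+x\<in>S. ennreal (R.kap 0 z x * N x) \<partial>\<mu>) < \<infinity>) \<and>
    (\<integral>\<^sup>+z. ennreal (enn2real (\<integral>\<^sup>+x\<in>S. ennreal (R.kap 0 z x * N x) \<partial>\<mu>) powr p) \<partial>\<nu>) <= ennreal K * (\<integral>\<^sup>+x. ennreal (N x powr p) \<partial>\<mu>)"
  have fin: "AE z in \<nu>. T \<phi> z < \<infinity>" if "LF p \<phi>" for \<phi>
   unfolding T_def using K2[OF Nm[OF that] N0 Nfin[OF that]] by blast
  have ae: "AE z in \<nu>. (ALL J. integrable \<mu> (KI \<phi> z J)) \<and> norm (Kop \<phi> z) <= enn2real (T \<phi> z)" if "LF p \<phi>" for \<phi>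
   using fin[OF that] AE_space by eventually_elim (use one[OF that] \<nu>_Z in auto)
  have le: "out_int p \<phi> <= (\<integral>\<^sup>+z. ennreal (enn2real (T \<phi> z) powr p) \<partial>\<nu>)" if "LF p \<phi>" for \<phi>
   by (rule nn_integral_mono_AE, use ae[OF that] in eventually_elim) (use p1 in \<open>auto intro!: ennreal_leI powr_mono2\<close>)
  show ?thesis
  proof (rule exI[of _ "K * c powr p"], intro conjI allI impI)
   show "0 <= K * c powr p" using K by simp
   fix \<phi> assume \<phi>: "LF p \<phi>"
   show "AE z in \<nu>. ALL J. integrable \<mu> (KI \<phi> z J)" using ae[OF \<phi>] by eventually_elim simp
   have "(\<integral>\<^sup>+z. ennreal (enn2real (T \<phi> z) powr p) \<partial>\<nu>) <= ennreal K * (\<integral>\<^sup>+x. ennreal (N \<phi> x powr p) \<partial>\<mu>)"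
    unfolding T_def using K2[OF Nm[OF \<phi>] N0 Nfin[OF \<phi>]] by blast
   then show "out_int p \<phi> <= ennreal (K * c powr p) * in_int p \<phi>"
    using order_trans[OF le[OF \<phi>]] K by (simp add: Nint[OF \<phi>] ennreal_mult mult.assoc)
  next
   fix \<epsilon> :: real assume \<epsilon>: "0 < \<epsilon>"
   define \<epsilon>' where "\<epsilon>' = \<epsilon> / (1 + c powr p)"
   have cp: "0 < 1 + c powr p" using powr_ge_zero[of c p] by linarith
   have e: "0 < \<epsilon>'" "\<epsilon>' * c powr p <= \<epsilon>"
   proof -
    show "0 < \<epsilon>'" using \<epsilon> cp by (simp add: \<epsilon>'_def)
    then have "\<epsilon>' * c powr p <= \<epsilon>' * (1 + c powr p)" by (intro mult_left_mono) auto
    then show "\<epsilon>' * c powr p <= \<epsilon>" using cp by (simp add: \<epsilon>'_def)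
   qed
   obtain \<delta> where \<delta>: "0 < \<delta>" "ALL N E. N \<in> borel_measurable \<mu> --> (ALL x. 0 <= N x) --> E \<in> sets \<mu> -->
    (ALL x. N x ~= 0 --> x \<in> E) --> emeasure \<mu> (S Int E) <= ennreal \<delta> --> (\<integral>\<^sup>+x. ennreal (N x powr p) \<partial>\<mu>) < \<infinity> -->
    (\<integral>\<^sup>+z. ennreal (enn2real (\<integral>\<^sup>+x\<in>S. ennreal (R.kap 0 z x * N x) \<partial>\<mu>) powr p) \<partial>\<nu>) <= ennreal \<epsilon>' * (\<integral>\<^sup>+x. ennreal (N x powr p) \<partial>\<mu>)"
    using K1[OF e(1)] by blast
   have "out_int p \<phi> <= ennreal \<epsilon> * in_int p \<phi>"
    if \<phi>: "LF p \<phi>" and E: "E \<in> sets \<mu>" "\<forall>x\<in>M. form_norm f x r (\<phi> x) ~= 0 --> x \<in> E" "emeasure \<mu> (S Int E) <= ennreal \<delta>" for \<phi> E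
   proof -
    have NE: "ALL x. N \<phi> x ~= 0 --> x \<in> E" using E(2) by (auto simp: N_def split: if_splits)
    have N0': "ALL x. 0 <= N \<phi> x" using N0 by blast
    have "(\<integral>\<^sup>+z. ennreal (enn2real (T \<phi> z) powr p) \<partial>\<nu>) <= ennreal \<epsilon>' * (\<integral>\<^sup>+x. ennreal (N \<phi> x powr p) \<partial>\<mu>)"
     unfolding T_def by (rule \<delta>(2)[rule_format, OF Nm[OF \<phi>] N0 E(1) NE[rule_format] E(3) Nfin[OF \<phi>]])
    also have "... = ennreal (\<epsilon>' * c powr p) * in_int p \<phi>"
     using e(1) by (simp add: Nint[OF \<phi>] ennreal_mult mult.assoc)
    also have "... <= ennreal \<epsilon> * in_int p \<phi>"
     by (intro mult_right_mono ennreal_leI e(2)) simp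
    finally show ?thesis using le[OF \<phi>] order_trans by blast
   qed
   then show "\<exists>\<delta>>0. \<forall>\<phi> E. LF p \<phi> --> E \<in> sets \<mu> --> (\<forall>x\<in>M. form_norm f x r (\<phi> x) ~= 0 --> x \<in> E) -->
    emeasure \<mu> (S Int E) <= ennreal \<delta> -->
    out_int p \<phi> <= ennreal \<epsilon> * in_int p \<phi>"
    using \<delta>(1) by blast
  qed
 qed
qed

text \<open>The Hoelder estimate holds on the whole compact closure of \<Omega>, also at points off
  X, so Arzela-Ascoli applies directly.\<close>

lemma Kop_uniform_subsequence:
 assumes \<phi>: "!!n. FO (\<phi> n)" "!!n. AE x in \<mu>. form_norm f x r (\<phi> n x) <= B" and B: "0 <= B"
 shows "\<exists>\<psi> (k :: nat => nat). continuous_on Z \<psi> \<and> strict_mono k \<and>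
  (\<forall>e>0. EX n0. ALL n>=n0. \<forall>z\<in>Z. norm (Kop (\<phi> (k n)) z - \<psi> z) < e)"
proof -
 \<comment> \<open>The middle of the admissible range; equicontinuity asks for some positive
   exponent.\<close>
 define a where "a = (2 - 4 / q) / 2"
 have "4 / q < 2" using q(1) by (simp add: divide_less_eq)
 then have a: "0 < a" "a < 2 - 4 / q" by (auto simp: a_def)
 obtain C where C: "0 <= C" "!!\<phi> B z. FO \<phi> \<and> 0 <= B \<and> (AE x in \<mu>. form_norm f x r (\<phi> x) <= B) ==> z \<in> Z ==>
   norm (Kop \<phi> z) <= C * B \<and> (\<forall>w\<in>Z. norm (Kop \<phi> z - Kop \<phi> w) <= C * B * norm (z - w) powr a)"
 proof -
  from Linf_est[OF less_imp_le[OF a(1)] a(2)] obtain C where C: "0 <= C" "\<forall>\<phi> B. FO \<phi> \<and> 0 <= B \<and> (AE x in \<mu>. form_norm f x r (\<phi> x) <= B) -->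
   (\<forall>z\<in>Z. (ALL J. integrable \<mu> (KI \<phi> z J)) \<and> norm (Kop \<phi> z) <= C * B \<and>
     (\<forall>w\<in>Z. norm (Kop \<phi> z - Kop \<phi> w) <= C * B * norm (z - w) powr a))" by blast
  show ?thesis
  proof (rule that[OF C(1)])
   fix \<phi> B z assume "FO \<phi> \<and> 0 <= B \<and> (AE x in \<mu>. form_norm f x r (\<phi> x) <= B)" "z \<in> Z"
   then show "norm (Kop \<phi> z) <= C * B \<and> (\<forall>w\<in>Z. norm (Kop \<phi> z - Kop \<phi> w) <= C * B * norm (z - w) powr a)"
    using C(2)[THEN spec, THEN spec, THEN mp, of \<phi> B] by blast
  qed
 qed
 have H: "FO (\<phi> n) \<and> 0 <= B \<and> (AE x in \<mu>. form_norm f x r (\<phi> n x) <= B)" for n using \<phi> B by blast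
 have CB: "0 <= C * B" using C(1) B by simp
 have eq: "EX d. 0 < d \<and> (ALL n y. y \<in> Z \<and> norm (x - y) < d --> norm (Kop (\<phi> n) x - Kop (\<phi> n) y) < e)" if x: "x \<in> Z" and e: "0 < e" for x and e :: real
 \<comment> \<open>Solves (C B + 1) d^a = e for d; the summand 1 covers C B = 0.\<close>
 proof (intro exI[of _ "(e / (C * B + 1)) powr (1 / a)"] conjI allI impI)
  have e1: "0 < e / (C * B + 1)" using e CB by simp
  show "0 < (e / (C * B + 1)) powr (1 / a)" unfolding powr_gt_zero using e1 by (metis less_irrefl)
  fix n y assume y: "y \<in> Z \<and> norm (x - y) < (e / (C * B + 1)) powr (1 / a)"
  have "norm (x - y) powr a <= ((e / (C * B + 1)) powr (1 / a)) powr a"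
   using y a by (intro powr_mono2) auto
  also have "... = e / (C * B + 1)"
  proof -
   have h: "1 / a * a = 1" using a by simp
   show ?thesis unfolding powr_powr h powr_one_gt_zero_iff by (rule less_imp_le[OF e1])
  qed
  finally have "C * B * norm (x - y) powr a <= C * B * (e / (C * B + 1))" using CB by (intro mult_left_mono)
  also have "... < (C * B + 1) * (e / (C * B + 1))" by (rule mult_strict_right_mono[OF _ e1]) simp
  also have "... = e"
  proof -
   have "C * B + 1 ~= 0" using CB by linarith
   then show ?thesis by simp
  qed
  finally show "norm (Kop (\<phi> n) x - Kop (\<phi> n) y) < e" using C(2)[OF H x, of n] y by (meson le_less_trans)
 qed
 have bd: "norm (Kop (\<phi> n) x) <= C * B" if "x \<in> Z" for n x using C(2)[OF H that] by blast
 show ?thesis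
 proof (rule Arzela_Ascoli[OF Z(1) bd eq])
  fix \<psi> k assume "continuous_on Z \<psi>" "strict_mono (k :: nat => nat)"
   and "!!e. 0 < e ==> EX N. ALL n x. N <= n \<and> x \<in> Z --> norm (Kop (\<phi> (k n)) x - \<psi> x) < e"
  then show ?thesis by (intro exI[of _ \<psi>] exI[of _ k]) blast
 qed
qed

definition trunc where "trunc m \<phi> x = (if form_norm f x r (\<phi> x) <= m then \<phi> x else 0)" for m :: real and \<phi> :: "complex ^ 3 => ext" and x
definition rest where "rest m \<phi> x = (if form_norm f x r (\<phi> x) <= m then 0 else \<phi> x)" for m :: real and \<phi> :: "complex ^ 3 => ext" and x

lemma trunc_rest:
 assumes \<phi>: "LF p \<phi>" and p: "0 < p"
 shows "\<phi> = (%x. trunc m \<phi> x + rest m \<phi> x)" "FO (trunc m \<phi>)" "LF p (rest m \<phi>)"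
  "in_int p (rest m \<phi>) <= in_int p \<phi>"
proof -
 note [measurable] = \<phi>[unfolded LF_def, THEN conjunct2, THEN conjunct1] \<phi>[unfolded LF_def, THEN conjunct1, THEN conjunct2]
 have F: "\<forall>x\<in>M. form_0r r (\<phi> x)" using \<phi> by (simp add: LF_def)
 show "\<phi> = (%x. trunc m \<phi> x + rest m \<phi> x)" by (auto simp: trunc_def rest_def)
 have "trunc m \<phi> \<in> borel_measurable \<mu>" "rest m \<phi> \<in> borel_measurable \<mu>"
  unfolding trunc_def[abs_def] rest_def[abs_def] by measurable
 moreover have "\<forall>x\<in>M. form_0r r (trunc m \<phi> x)" "\<forall>x\<in>M. form_0r r (rest m \<phi> x)"
  using F form_0r_zero by (auto simp: trunc_def rest_def)
 ultimately have 1: "FO (trunc m \<phi>)" "FO (rest m \<phi>)" by auto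
 have e: "form_norm f x r (rest m \<phi> x) = (if form_norm f x r (\<phi> x) <= m then 0 else form_norm f x r (\<phi> x))" for x
  by (simp add: rest_def form_norm_zero)
 have 2: "(%x. form_norm f x r (rest m \<phi> x)) \<in> borel_measurable \<mu>" unfolding e by measurable
 show 3: "in_int p (rest m \<phi>) <= in_int p \<phi>"
  unfolding e by (intro nn_integral_mono ennreal_leI) auto
 have "in_int p (rest m \<phi>) < \<infinity>"
  by (rule order.strict_trans1[OF 3]) (use \<phi> in \<open>simp add: LF_def\<close>)
 then show "FO (trunc m \<phi>)" "LF p (rest m \<phi>)" using 1 2 by (simp_all add: LF_def)
qed

text \<open>Chebyshev's inequality: for forms in the unit ball, the set that carries the remainder
  has measure at most m^(-p), uniformly.\<close>

lemma emeasure_large: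
 assumes \<phi>: "LF p \<phi>" "in_int p \<phi> <= 1" and m: "0 < m" and p: "0 < p"
 defines "E \<equiv> {x \<in> M. m < form_norm f x r (\<phi> x)}"
 shows "E \<in> sets \<mu>" "emeasure \<mu> (S Int E) <= ennreal (1 / m powr p)"
proof -
 have [measurable]: "(%x. form_norm f x r (\<phi> x)) \<in> borel_measurable \<mu>" using \<phi>(1) by (simp add: LF_def)
 have "{x \<in> space \<mu>. m < form_norm f x r (\<phi> x)} \<in> sets \<mu>" by measurable
 then show E: "E \<in> sets \<mu>" by (simp add: E_def space_\<mu>)
 have mp: "0 < m powr p" using m by simp
 have "ennreal (m powr p) * emeasure \<mu> E = (\<integral>\<^sup>+x. ennreal (m powr p) * indicator E x \<partial>\<mu>)"
  using E by (simp add: nn_integral_cmult_indicator)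
 also have "... <= in_int p \<phi>"
  using m p by (intro nn_integral_mono) (auto simp: E_def indicator_def intro!: ennreal_leI powr_mono2)
 finally have "ennreal (1 / m powr p) * (ennreal (m powr p) * emeasure \<mu> E) <= ennreal (1 / m powr p) * 1"
  using \<phi>(2) by (intro mult_left_mono) auto
 then have "emeasure \<mu> E <= ennreal (1 / m powr p)"
  using mp by (simp add: mult.assoc[symmetric] ennreal_mult[symmetric])
 moreover have "emeasure \<mu> (S Int E) <= emeasure \<mu> E" using E by (intro emeasure_mono) auto
 ultimately show "emeasure \<mu> (S Int E) <= ennreal (1 / m powr p)" by (rule order_trans[rotated])
qed

text \<open>For the truncations the Cauchy property is recorded instead of the limits, since limits
  at different levels would have to be compared. A fixed level with uniformly small remainders gives
  the Cauchy property in L^p, and completeness supplies the limit.\<close>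

lemma Lp_compact:
 fixes \<Phi> :: "nat => complex ^ 3 => ext"
 assumes p: "q / (q - 1) < p"
  and \<Phi>: "!!n. LF p (\<Phi> n)" "!!n. in_int p (\<Phi> n) <= 1"
 shows "\<exists>\<psi> (k :: nat => nat). strict_mono k \<and> \<psi> \<in> borel_measurable \<nu> \<and> (\<forall>z\<in>D - {0}. form_0r (r - 1) (\<psi> z)) \<and>
  (\<forall>\<epsilon>>0. EX n0. ALL i>=n0. (\<integral>\<^sup>+z. ennreal (norm (Kop (\<Phi> (k i)) z - \<psi> z) powr p) \<partial>\<nu>) <= ennreal \<epsilon>)"
proof -
 have p1: "1 < p"
 proof -
  have "1 < q / (q - 1)" using q by simp
  then show ?thesis using p by linarith
 qed
 have p0: "0 < p" using p1 by simp
 note tr = trunc_rest[OF \<Phi>(1) p0]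
 define P where "P m sq \<longleftrightarrow> (\<forall>e>0. EX n0. ALL i>=n0. ALL j>=n0. \<forall>z\<in>Z. norm (Kop (trunc (real m) (\<Phi> (sq i))) z - Kop (trunc (real m) (\<Phi> (sq j))) z) < e)"
  for m :: nat and sq :: "nat => nat"
 have tb: "form_norm f x r (trunc (real m) (\<Phi> n) x) <= real m" for m n x
  by (simp add: trunc_def form_norm_zero)
 have ex: "EX r'. strict_mono r' \<and> P m (sq \<circ> r')" for m and sq :: "nat => nat"
 proof -
  have "\<exists>\<psi> (k :: nat => nat). continuous_on Z \<psi> \<and> strict_mono k \<and>
   (\<forall>e>0. EX n0. ALL n>=n0. \<forall>z\<in>Z. norm (Kop (trunc (real m) (\<Phi> (sq (k n)))) z - \<psi> z) < e)"
  proof (rule Kop_uniform_subsequence)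
   show "FO (trunc (real m) (\<Phi> (sq n)))" for n by (rule tr(2))
   show "AE x in \<mu>. form_norm f x r (trunc (real m) (\<Phi> (sq n)) x) <= real m" for n by (rule AE_I2) (rule tb)
  qed simp
  then obtain \<psi> and k :: "nat => nat" where k: "strict_mono k" "!!e. e > 0 ==> EX n0. ALL n>=n0. \<forall>z\<in>Z. norm (Kop (trunc (real m) (\<Phi> (sq (k n)))) z - \<psi> z) < e"
   by blast
  have "P m (sq \<circ> k)"
   unfolding P_def
  proof (intro allI impI)
   fix e :: real assume "0 < e"
   then obtain n0 where n0: "!!n z. n0 <= n ==> z \<in> Z ==> norm (Kop (trunc (real m) (\<Phi> (sq (k n)))) z - \<psi> z) < e / 2"
    using k(2)[of "e / 2"] by auto
   show "EX n0. ALL i>=n0. ALL j>=n0. \<forall>z\<in>Z. norm (Kop (trunc (real m) (\<Phi> ((sq \<circ> k) i))) z - Kop (trunc (real m) (\<Phi> ((sq \<circ> k) j))) z) < e"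
   proof (intro exI[of _ n0] allI impI ballI)
    fix i j z assume "n0 <= i" "n0 <= j" "z \<in> Z"
    then have "norm (Kop (trunc (real m) (\<Phi> (sq (k i)))) z - \<psi> z) < e / 2" "norm (\<psi> z - Kop (trunc (real m) (\<Phi> (sq (k j)))) z) < e / 2"
     using n0[of i z] n0[of j z] by (simp_all only: norm_minus_commute)
    from norm_diff_triangle_less[OF this] show "norm (Kop (trunc (real m) (\<Phi> ((sq \<circ> k) i))) z - Kop (trunc (real m) (\<Phi> ((sq \<circ> k) j))) z) < e"
     by (simp only: comp_apply field_sum_of_halves)
   qed
  qed
  then show ?thesis using k(1) by blast
 qed
 interpret subseqs P by unfold_locales (rule ex)
 define d where "d = diagseq"
 have dm: "strict_mono d" unfolding d_def by (rule subseq_diagseq)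
 \<comment> \<open>The diagonal sequence is a subsequence of the m-th one only after finitely many
   terms, hence the shift by Suc m.\<close>
 have Pd: "P m (d \<circ> ((+) (Suc m)))" for m
  unfolding d_def
 proof (rule diagseq_holds)
  fix rr sq n assume rr: "strict_mono (rr :: nat => nat)" and "P n sq"
  then show "P n (sq \<circ> rr)"
   unfolding P_def
  proof (intro allI impI)
   fix e :: real assume "0 < e" and "\<forall>e>0. EX n0. ALL i>=n0. ALL j>=n0. \<forall>z\<in>Z. norm (Kop (trunc (real n) (\<Phi> (sq i))) z - Kop (trunc (real n) (\<Phi> (sq j))) z) < e"
   then obtain n0 where n0: "!!i j z. n0 <= i ==> n0 <= j ==> z \<in> Z ==> norm (Kop (trunc (real n) (\<Phi> (sq i))) z - Kop (trunc (real n) (\<Phi> (sq j))) z) < e"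
    by blast
   have "n0 <= rr i" if "n0 <= i" for i using seq_suble[OF rr, of i] that by linarith
   then show "EX n0. ALL i>=n0. ALL j>=n0. \<forall>z\<in>Z. norm (Kop (trunc (real n) (\<Phi> ((sq \<circ> rr) i))) z - Kop (trunc (real n) (\<Phi> ((sq \<circ> rr) j))) z) < e"
    unfolding comp_apply using n0 by blast
  qed
 qed
 have unif: "EX n0. ALL i>=n0. ALL j>=n0. \<forall>z\<in>Z. norm (Kop (trunc (real m) (\<Phi> (d i))) z - Kop (trunc (real m) (\<Phi> (d j))) z) < e" if "0 < e" for m and e :: real
 proof -
  have "EX n0. ALL i>=n0. ALL j>=n0. \<forall>z\<in>Z. norm (Kop (trunc (real m) (\<Phi> ((d \<circ> ((+) (Suc m))) i))) z - Kop (trunc (real m) (\<Phi> ((d \<circ> ((+) (Suc m))) j))) z) < e"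
   using Pd[of m, unfolded P_def] that by blast
  then obtain n0 where n0: "!!i j z. n0 <= i ==> n0 <= j ==> z \<in> Z ==> norm (Kop (trunc (real m) (\<Phi> (d (Suc m + i)))) z - Kop (trunc (real m) (\<Phi> (d (Suc m + j)))) z) < e"
   unfolding comp_apply by blast
  show ?thesis
  proof (intro exI[of _ "Suc m + n0"] allI impI ballI)
   fix i j z assume "Suc m + n0 <= i" "Suc m + n0 <= j" "z \<in> Z"
   then show "norm (Kop (trunc (real m) (\<Phi> (d i))) z - Kop (trunc (real m) (\<Phi> (d j))) z) < e"
    using n0[of "i - Suc m" "j - Suc m" z] by simp
  qed
 qed
 obtain K where K: "!!\<phi>. LF p \<phi> ==> (AE z in \<nu>. ALL J. integrable \<mu> (KI \<phi> z J))"
  "!!\<epsilon>. \<epsilon> > 0 ==> \<exists>\<delta>>0. \<forall>\<phi> E. LF p \<phi> --> E \<in> sets \<mu> --> (\<forall>x\<in>M. form_norm f x r (\<phi> x) ~= 0 --> x \<in> E) -->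
   emeasure \<mu> (S Int E) <= ennreal \<delta> -->
   out_int p \<phi> <= ennreal \<epsilon> * in_int p \<phi>"
 proof -
  from Lp_op[OF p] obtain K where K: "\<forall>\<phi>. LF p \<phi> --> (AE z in \<nu>. ALL J. integrable \<mu> (KI \<phi> z J)) \<and>
    out_int p \<phi> <= ennreal K * in_int p \<phi>"
   "\<forall>\<epsilon>>0. \<exists>\<delta>>0. \<forall>\<phi> E. LF p \<phi> --> E \<in> sets \<mu> --> (\<forall>x\<in>M. form_norm f x r (\<phi> x) ~= 0 --> x \<in> E) -->
   emeasure \<mu> (S Int E) <= ennreal \<delta> -->
   out_int p \<phi> <= ennreal \<epsilon> * in_int p \<phi>"
   by (elim exE conjE) (rule that)
  show ?thesis by (rule that[OF K(1)[THEN spec, THEN mp, THEN conjunct1] K(2)[THEN spec, THEN mp]])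
 qed
 have ti: "integrable \<mu> (KI (trunc (real m) (\<Phi> n)) z J)" if "z \<in> Z" for m n z J
 proof -
  show ?thesis by (rule Linf_integrable[OF tr(2) _ _ that, of "real m"]) (simp_all add: tb)
 qed
 have Km: "Kop \<phi> \<in> borel_measurable \<nu>" if "FO \<phi>" for \<phi> by (rule Kop_meas[OF that])
 have FOn: "FO (\<Phi> n)" for n using \<Phi>(1) by (simp add: LF_def)
 have FOr: "FO (rest m (\<Phi> n))" for m n using tr(3) by (simp add: LF_def)
 have cauchy: "EX n0. ALL i>=n0. ALL j>=n0. (\<integral>\<^sup>+z. ennreal (norm (Kop (\<Phi> (d i)) z - Kop (\<Phi> (d j)) z) powr p) \<partial>\<nu>) <= ennreal \<epsilon>"
  if \<epsilon>: "0 < \<epsilon>" for \<epsilon>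
 proof -
  define \<epsilon>1 where "\<epsilon>1 = \<epsilon> / (3 * 3 powr p)"
  have \<epsilon>1: "0 < \<epsilon>1" "3 powr p * (\<epsilon>1 + \<epsilon>1 + \<epsilon>1) = \<epsilon>" using \<epsilon> by (auto simp: \<epsilon>1_def)
  obtain \<delta> where \<delta>: "0 < \<delta>" "!!\<phi> E. LF p \<phi> ==> E \<in> sets \<mu> ==> (\<forall>x\<in>M. form_norm f x r (\<phi> x) ~= 0 --> x \<in> E) ==>
   emeasure \<mu> (S Int E) <= ennreal \<delta> ==>
   out_int p \<phi> <= ennreal \<epsilon>1 * in_int p \<phi>"
   using K(2)[OF \<epsilon>1(1)] by blast
  \<comment> \<open>At this level the set where the form is large has measure at most m^(-p) \<le>
    1/m \<le> \<delta>.\<close>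
  obtain m :: nat where m: "max 1 (1 / \<delta>) <= real m" using real_arch_simple by blast
  have m0: "0 < real m" using m by simp
  have md: "1 / real m powr p <= \<delta>"
  proof -
   have "1 / \<delta> <= real m powr 1" using m by simp
   also have "... <= real m powr p" using m p1 by (intro powr_mono) auto
   finally show ?thesis using \<delta>(1) m0 by (simp add: field_simps)
  qed
  have rb: "out_int p ((rest (real m) (\<Phi> n))) <= ennreal \<epsilon>1" for n
  proof -
   define E where "E = {x \<in> M. real m < form_norm f x r (\<Phi> n x)}"
   have E: "E \<in> sets \<mu>" "emeasure \<mu> (S Int E) <= ennreal (1 / real m powr p)"
    using emeasure_large[OF \<Phi>(1,2) m0 p0] unfolding E_def by auto
   have "emeasure \<mu> (S Int E) <= ennreal \<delta>" using E(2) ennreal_leI[OF md] by (rule order_trans)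
   moreover have "\<forall>x\<in>M. form_norm f x r (rest (real m) (\<Phi> n) x) ~= 0 --> x \<in> E"
    by (auto simp: rest_def E_def form_norm_zero)
   ultimately have "out_int p ((rest (real m) (\<Phi> n))) <= ennreal \<epsilon>1 * in_int p (rest (real m) (\<Phi> n))"
    using E(1) by (intro \<delta>(2)[OF tr(3)])
   also have "... <= ennreal \<epsilon>1 * 1" by (intro mult_left_mono order_trans[OF tr(4) \<Phi>(2)]) simp
   finally show ?thesis by simp
  qed
  \<comment> \<open>Uniform closeness e costs e^p times the mass of \<nu>, which is at most
    \<open>CR\<close>; the choice keeps this below \<epsilon>1.\<close>
  define e where "e = (\<epsilon>1 / (CR + 1)) powr (1 / p)"
  have c1: "0 < CR + 1" using R.C by simp
  have e0: "0 < e" using \<epsilon>1 c1 by (simp add: e_def)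
  have ep: "e powr p * CR <= \<epsilon>1"
  proof -
   have "e powr p = \<epsilon>1 / (CR + 1)" using \<epsilon>1 c1 p0 by (simp add: e_def powr_powr)
   then have "e powr p * CR <= \<epsilon>1 / (CR + 1) * (CR + 1)" using \<epsilon>1 c1 by (simp only:) (intro mult_left_mono, auto)
   then show ?thesis using c1 by simp
  qed
  obtain n0 where n0: "!!i j z. n0 <= i ==> n0 <= j ==> z \<in> Z ==> norm (Kop (trunc (real m) (\<Phi> (d i))) z - Kop (trunc (real m) (\<Phi> (d j))) z) < e"
   using unif[OF e0, of m] by auto
  show ?thesis
  proof (intro exI[of _ n0] allI impI)
   fix i j assume ij: "n0 <= i" "n0 <= j"
   let ?t = "%n z. Kop (trunc (real m) (\<Phi> (d n))) z" and ?r = "%n z. Kop (rest (real m) (\<Phi> (d n))) z"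
   \<comment> \<open>The integral of the remainder is known to converge only for almost every z, and
     additivity of the operator needs convergence.\<close>
   have dec: "AE z in \<nu>. Kop (\<Phi> (d n)) z = ?t n z + ?r n z" for n
    using K(1)[OF tr(3), of "real m" "d n"] AE_space
   proof eventually_elim
    case (elim z)
    have "Kop (%x. trunc (real m) (\<Phi> (d n)) x + rest (real m) (\<Phi> (d n)) x) z = ?t n z + ?r n z"
     by (rule Kop_linear(1)[OF ti[OF \<nu>_Z[OF elim(2)]] elim(1)[rule_format]])
    moreover have "Kop (\<Phi> (d n)) z = Kop (%x. trunc (real m) (\<Phi> (d n)) x + rest (real m) (\<Phi> (d n)) x) z"
     by (rule arg_cong[where f = "%\<phi>. Kop \<phi> z", OF tr(1)])
    ultimately show ?case by (simp only:)
   qed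
   have "(\<integral>\<^sup>+z. ennreal (norm (Kop (\<Phi> (d i)) z - Kop (\<Phi> (d j)) z) powr p) \<partial>\<nu>) <=
    (\<integral>\<^sup>+z. ennreal (3 powr p) * (ennreal (e powr p) + ennreal (norm (?r i z) powr p) + ennreal (norm (?r j z) powr p)) \<partial>\<nu>)"
   proof (rule nn_integral_mono_AE, use dec[of i] dec[of j] AE_space in eventually_elim)
    case (elim z)
    have "Kop (\<Phi> (d i)) z - Kop (\<Phi> (d j)) z = (?t i z - ?t j z) + ?r i z - ?r j z" unfolding elim(1,2) by simp
    then have "norm (Kop (\<Phi> (d i)) z - Kop (\<Phi> (d j)) z) <= norm (?t i z - ?t j z) + norm (?r i z) + norm (?r j z)"
     using norm_triangle_ineq4[of "(?t i z - ?t j z) + ?r i z" "?r j z"] norm_triangle_ineq[of "?t i z - ?t j z" "?r i z"] by simp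
    also have "... <= e + norm (?r i z) + norm (?r j z)" using n0[OF ij \<nu>_Z[OF elim(3)]] by simp
    finally have "norm (Kop (\<Phi> (d i)) z - Kop (\<Phi> (d j)) z) powr p <= (e + norm (?r i z) + norm (?r j z)) powr p"
     using p0 by (intro powr_mono2) auto
    also have "... <= 3 powr p * (e powr p + norm (?r i z) powr p + norm (?r j z) powr p)"
     using e0 p0 by (intro powr_sum3_le) auto
    finally show ?case by (simp flip: ennreal_plus ennreal_mult add: ennreal_leI)
   qed
   also have "... = ennreal (3 powr p) * (ennreal (e powr p) * emeasure \<nu> (space \<nu>) + (\<integral>\<^sup>+z. ennreal (norm (?r i z) powr p) \<partial>\<nu>) + (\<integral>\<^sup>+z. ennreal (norm (?r j z) powr p) \<partial>\<nu>))"
    using Km[OF FOr] by (simp add: nn_integral_cmult nn_integral_add)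
   also have "... <= ennreal (3 powr p) * (ennreal \<epsilon>1 + ennreal \<epsilon>1 + ennreal \<epsilon>1)"
   proof (intro mult_left_mono add_mono rb)
    have "ennreal (e powr p) * emeasure \<nu> (space \<nu>) <= ennreal (e powr p) * ennreal CR" by (intro mult_left_mono R.tot_\<nu>) simp
    also have "... <= ennreal \<epsilon>1" using ennreal_leI[OF ep] R.C by (simp add: ennreal_mult)
    finally show "ennreal (e powr p) * emeasure \<nu> (space \<nu>) <= ennreal \<epsilon>1" .
   qed simp
   also have "... = ennreal \<epsilon>" using \<epsilon>1 by (simp flip: ennreal_plus ennreal_mult)
   finally show "(\<integral>\<^sup>+z. ennreal (norm (Kop (\<Phi> (d i)) z - Kop (\<Phi> (d j)) z) powr p) \<partial>\<nu>) <= ennreal \<epsilon>" .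
  qed
 qed
 define b where "b k = (%z. if convergent (%n. Kop (\<Phi> (d (k n))) z) then lim (%n. Kop (\<Phi> (d (k n))) z) else 0)" for k :: "nat => nat"
 obtain k where k: "b k \<in> borel_measurable \<nu>"
  "\<forall>\<epsilon>>0. EX n0. ALL i>=n0. (\<integral>\<^sup>+z. ennreal (norm (Kop (\<Phi> (d i)) z - b k z) powr p) \<partial>\<nu>) <= ennreal \<epsilon>"
  using Lp_complete[of p "%n. Kop (\<Phi> (d n))" \<nu>, OF p0 Km[OF FOn] cauchy] unfolding b_def by blast
 have "form_0r (r - 1) (b k z)" if "z \<in> D - {0}" for z
 proof (cases "convergent (%n. Kop (\<Phi> (d (k n))) z)")
  case True
  have zZ: "z \<in> Z" using that DZ by auto
  have "(%n. Kop (\<Phi> (d (k n))) z) \<longlonglongrightarrow> b k z" using True by (simp add: b_def convergent_LIMSEQ_iff)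
  then show ?thesis by (rule form_0r_limit[rotated]) (rule Kop_form[OF FOn zZ])
 qed (simp add: b_def form_0r_zero)
 then show ?thesis using dm k by (intro exI[of _ "b k"] exI[of _ d]) auto
qed

end

section \<open>Points of X near the singularity\<close>

lemma bounded_bilinear_cross: "bounded_bilinear cross"
 unfolding bilinear_conv_bounded_bilinear[symmetric] bilinear_def
 by (intro conjI allI linearI) (simp_all add: vec_eq_iff forall_3 algebra_simps)

lemma bounded_linear_anti1: "bounded_linear anti1"
 by (rule linear_conv_bounded_linear[THEN iffD1]) (auto intro!: linearI simp: vec_eq_iff)

text \<open>Explicit curves: (t, i t, 0) for A_n, (0, t, 0) for D_n, and (i t^3, t^2, 0) for E_6,
  E_7 and E_8, the last because (i t^3)^2 + (t^2)^3 = 0.\<close>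

lemma du_val_zero_near_0:
 assumes P: "P \<in> du_val_equations" and e: "0 < e"
 shows "EX w. w ~= 0 \<and> norm w < e \<and> P w = 0"
proof -
 \<comment> \<open>The bound 1/2 gives t^2 and t^3 at most t, and e/4 leaves room for two nonzero
   coordinates.\<close>
 define t where "t = min (1 / 2) (e / 4)"
 have t: "0 < t" "t <= 1 / 2" "t <= e / 4" using e by (auto simp: t_def)
 define a b c where "a = (vector [of_real t, \<i> * of_real t, 0] :: complex ^ 3)"
  and "b = (vector [0, of_real t, 0] :: complex ^ 3)"
  and "c = (vector [\<i> * of_real t ^ 3, of_real t ^ 2, 0] :: complex ^ 3)"
 have a: "a $ 1 = of_real t" "a $ 2 = \<i> * of_real t" "a $ 3 = 0" by (simp_all add: a_def)
 have b: "b $ 1 = 0" "b $ 2 = of_real t" "b $ 3 = 0" by (simp_all add: b_def)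
 have c: "c $ 1 = \<i> * of_real t ^ 3" "c $ 2 = of_real t ^ 2" "c $ 3 = 0" by (simp_all add: c_def)
 have t2: "t ^ 2 <= t ^ 1" "t ^ 3 <= t ^ 1" using t by (intro power_decreasing; simp)+
 have "a $ 1 ~= 0" "b $ 2 ~= 0" "c $ 2 ~= 0" using t by (simp_all add: a b c)
 then have nz: "a ~= 0" "b ~= 0" "c ~= 0" by auto
 have na: "norm a < e" using norm_vec3_le[of a] t by (simp add: a norm_mult)
 have nb: "norm b < e" using norm_vec3_le[of b] t by (simp add: b)
 have nc: "norm c < e" using norm_vec3_le[of c] t t2 by (simp add: c norm_mult norm_power)
 have e6: "(\<i> * complex_of_real t ^ 3)\<^sup>2 + (complex_of_real t ^ 2) ^ 3 = 0"
  by (simp add: power_mult_distrib flip: power_mult)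
 have e2: "(complex_of_real t)\<^sup>2 + (\<i> * complex_of_real t)\<^sup>2 = 0" by (simp add: power_mult_distrib)
 have "P a = 0 \<or> P b = 0 \<or> P c = 0"
  using P unfolding du_val_equations_def
 proof (elim UnE CollectE exE conjE insertE emptyE)
  fix n :: nat assume "P = (%w. (w$1)^2 + (w$2)^2 + (w$3)^(n+1))"
  then have "P a = 0" using e2 by (simp add: a)
  then show ?thesis by blast
 next
  fix n :: nat assume "P = (%w. (w$1)^2 + (w$2)^2 * w$3 + (w$3)^(n-1))" "4 <= n"
  then have "P b = 0" by (simp add: b)
  then show ?thesis by blast
 next
  assume "P = (%w. (w$1)^2 + (w$2)^3 + (w$3)^4)"
  then have "P c = 0" using e6 by (simp add: c)
  then show ?thesis by blast
 next
  assume "P = (%w. (w$1)^2 + (w$2)^3 + w$2 * (w$3)^3)"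
  then have "P c = 0" using e6 by (simp add: c)
  then show ?thesis by blast
 next
  assume "P = (%w. (w$1)^2 + (w$2)^3 + (w$3)^5)"
  then have "P c = 0" using e6 by (simp add: c)
  then show ?thesis by blast
 qed
 then show ?thesis using nz na nb nc by blast
qed

text \<open>The inverse of the local biholomorphism is continuous at 0, so zeros of the model
  equation close to 0 come from points of X in \<Omega>; injectivity keeps them away from 0.\<close>

lemma canonical_singularity_not_isolated:
 assumes can: "canonical_singularity_at_0 X" and \<Omega>: "open \<Omega>" "0 \<in> \<Omega>"
 shows "X Int \<Omega> - {0} ~= {}"
proof -
 from can obtain P U V \<Phi> \<Psi> where P: "P \<in> du_val_equations" and "open U" and U: "open V" "0 \<in> U" "\<Phi> 0 = 0" "\<Phi> ` U = V"
  and "\<Psi> ` V = U" and inv: "\<forall>x\<in>U. \<Psi> (\<Phi> x) = x" and "\<forall>y\<in>V. \<Phi> (\<Psi> y) = y" "holo_map_on U \<Phi>"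
  and holo: "holo_map_on V \<Psi>" and im: "\<Phi> ` (X Int U) = {w \<in> V. P w = 0}"
  unfolding canonical_singularity_at_0_def by (elim bexE exE conjE) (rule that)
 have "continuous_on V (%x. \<Psi> x $ j)" for j
  by (rule holo_on_imp_continuous_on) (use holo in \<open>simp add: holo_map_on_def\<close>)
 then have "continuous_on V (%x. \<chi> j. \<Psi> x $ j)" by (rule continuous_on_vec_lambda)
 then have "continuous_on V \<Psi>" by (simp only: vec_lambda_eta)
 from continuous_open_preimage[OF this U(1) \<Omega>(1)] have o: "open (V Int \<Psi> -` \<Omega>)" .
 have "0 \<in> V" using U(2,3,4) by (metis imageI)
 moreover have "\<Psi> 0 = 0" using inv[rule_format, OF U(2)] U(3) by simp
 ultimately have m: "0 \<in> V Int \<Psi> -` \<Omega>" using \<Omega>(2) by simp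
 obtain e where e: "0 < e" "ball 0 e <= V Int \<Psi> -` \<Omega>" by (rule openE[OF o m])
 obtain w where w: "w ~= 0" "norm w < e" "P w = 0" using du_val_zero_near_0[OF P e(1)] by blast
 have "w \<in> V Int \<Psi> -` \<Omega>" using e(2) w(2) by (auto simp: subset_iff)
 then have wV: "w \<in> V" "\<Psi> w \<in> \<Omega>" by auto
 then obtain x where x: "x \<in> X" "x \<in> U" "w = \<Phi> x" using im w(3) by blast
 then have "x \<in> \<Omega>" using inv wV by auto
 moreover have "x ~= 0" using x U(3) w(1) by auto
 ultimately show ?thesis using x by blast
qed

section \<open>The two mapping properties\<close>

context koppelman
begin

text \<open>Images have degree 0 or 1, where the norm has a formula without the frame.\<close>

lemma out_meas:
 assumes \<psi>: "\<psi> \<in> borel_measurable \<nu>" "\<forall>z\<in>D - {0}. form_0r (r - 1) (\<psi> z)"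
 shows "(%x. form_norm f x (r - 1) (\<psi> x)) \<in> borel_measurable \<nu>"
 using r
proof
 assume "r = 1"
 have "(%x. \<psi> x $ {}) \<in> borel_measurable \<nu>" by (rule borel_measurable_bounded_linear[OF bounded_linear_vec_nth \<psi>(1)])
 then have "(%x. cmod (\<psi> x $ {})) \<in> borel_measurable \<nu>" by measurable
 then show ?thesis using \<open>r = 1\<close> by (simp add: form_norm_0)
next
 assume r2: "r = 2"
 have gn: "gr \<in> borel_measurable \<nu>" by (rule borel_to_\<nu>) (rule gr_measurable)
 have "(%x. cross (anti1 (\<psi> x)) (cv (gr x))) \<in> borel_measurable \<nu>"
  by (intro borel_measurable_bounded_bilinear[OF bounded_bilinear_cross] borel_measurable_bounded_linear[OF bounded_linear_anti1]
    borel_measurable_bounded_linear[OF bounded_linear_cv] gn \<psi>(1))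
 then have m: "(%x. sqrt 2 * norm (cross (anti1 (\<psi> x)) (cv (gr x))) / norm (gr x)) \<in> borel_measurable \<nu>"
  using gn by measurable
 have "form_norm f x (r - 1) (\<psi> x) = sqrt 2 * norm (cross (anti1 (\<psi> x)) (cv (gr x))) / norm (gr x)" if "x \<in> space \<nu>" for x
 proof -
  have x: "x \<in> D - {0}" using that by (simp add: space_\<nu>)
  then have xM: "x \<in> M" using D0 by blast
  have "form_0r 1 (\<psi> x)" using \<psi>(2) x r2 by simp
  from form_norm_1_cross[OF fh M_in[OF xM] grad_nz[OF xM] this] show ?thesis unfolding gr_eq[OF xM] using r2 by simp
 qed
 then show ?thesis using m by (subst measurable_cong[of \<nu>]) auto
qed

lemma out_bound:
 assumes "x \<in> D - {0}" "form_0r (r - 1) a"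
 shows "form_norm f x (r - 1) a <= 6 * norm a"
proof -
 have xM: "x \<in> M" using assms(1) D0 by blast
 have "r - 1 = 0 \<or> r - 1 = 1" using r by auto
 from form_norm_le[OF fh M_in[OF xM] grad_nz[OF xM] this assms(2)] show ?thesis .
qed

lemma out_Lp:
 assumes p: "0 < p" and \<psi>: "\<psi> \<in> borel_measurable \<nu>" "\<forall>z\<in>D - {0}. form_0r (r - 1) (\<psi> z)"
  and I: "(\<integral>\<^sup>+z. ennreal (norm (\<psi> z) powr p) \<partial>\<nu>) <= ennreal I" "0 <= I"
 shows "\<psi> \<in> Lp_forms f X D p (r - 1)" "Lp_norm f X D p (r - 1) \<psi> <= 6 * I powr (1 / p)"
proof -
 let ?u = "%x. form_norm f x (r - 1) (\<psi> x) powr p"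
 have u: "?u \<in> borel_measurable \<nu>" using out_meas[OF \<psi>] by measurable
 have "(\<integral>\<^sup>+x. ennreal (?u x) \<partial>\<nu>) <= (\<integral>\<^sup>+x. ennreal (6 powr p) * ennreal (norm (\<psi> x) powr p) \<partial>\<nu>)"
 proof (rule nn_integral_mono)
  fix x assume "x \<in> space \<nu>"
  then have x: "x \<in> D - {0}" by (simp add: space_\<nu>)
  have "?u x <= (6 * norm (\<psi> x)) powr p" using out_bound[OF x] \<psi>(2) x p by (intro powr_mono2) auto
  then show "ennreal (?u x) <= ennreal (6 powr p) * ennreal (norm (\<psi> x) powr p)"
   by (simp add: powr_mult ennreal_leI flip: ennreal_mult)
 qed
 also have "... = ennreal (6 powr p) * (\<integral>\<^sup>+x. ennreal (norm (\<psi> x) powr p) \<partial>\<nu>)"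
  using \<psi>(1) by (intro nn_integral_cmult) measurable
 also have "... <= ennreal (6 powr p) * ennreal I" by (intro mult_left_mono I) simp
 finally have le: "(\<integral>\<^sup>+x. ennreal (?u x) \<partial>\<nu>) <= ennreal (6 powr p * I)" using I(2) by (simp add: ennreal_mult)
 have "(\<integral>\<^sup>+x. ennreal (norm (?u x)) \<partial>\<nu>) < \<infinity>" using order.strict_trans1[OF le] by simp
 then have i: "integrable \<nu> ?u" by (intro integrableI_bounded u)
 then show "\<psi> \<in> Lp_forms f X D p (r - 1)" using \<psi> unfolding Lp_forms_def \<nu>_def[symmetric] by blast
 have "(\<integral>x. ?u x \<partial>\<nu>) = enn2real (\<integral>\<^sup>+x. ennreal (?u x) \<partial>\<nu>)" by (intro integral_eq_nn_integral u) simp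
 also have "... <= 6 powr p * I" using enn2real_mono[OF le] I(2) by simp
 finally have "(\<integral>x. ?u x \<partial>\<nu>) powr (1 / p) <= (6 powr p * I) powr (1 / p)"
  using p by (intro powr_mono2 integral_nonneg_AE) auto
 also have "... = 6 * I powr (1 / p)" using p I(2) by (simp add: powr_mult powr_powr)
 finally show "Lp_norm f X D p (r - 1) \<psi> <= 6 * I powr (1 / p)" unfolding Lp_norm_def \<nu>_def[symmetric] .
qed

text \<open>Integrability includes measurability of the p-th power of the norm; the p-th root then
  gives that of the norm itself.\<close>

lemma Lp_forms_LF:
 assumes "\<phi> \<in> Lp_forms f X X p r" "0 < p"
 shows "LF p \<phi>" "in_int p \<phi> = ennreal (\<integral>x. form_norm f x r (\<phi> x) powr p \<partial>\<mu>)"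
proof -
 have FO: "FO \<phi>" and i: "integrable \<mu> (%x. form_norm f x r (\<phi> x) powr p)"
  using assms(1) unfolding Lp_forms_def \<mu>_def[symmetric] M_def[symmetric] by auto
 have "(%x. (form_norm f x r (\<phi> x) powr p) powr (1 / p)) \<in> borel_measurable \<mu>"
  using borel_measurable_integrable[OF i] by measurable
 then have m: "(%x. form_norm f x r (\<phi> x)) \<in> borel_measurable \<mu>" using assms(2) by (simp add: powr_powr)
 show e: "in_int p \<phi> = ennreal (\<integral>x. form_norm f x r (\<phi> x) powr p \<partial>\<mu>)"
  by (intro nn_integral_eq_integral i) simp
 have "in_int p \<phi> < \<infinity>" unfolding e by simp
 then show "LF p \<phi>" unfolding LF_def using FO m by blast
qed

lemma Lp_part:
 assumes p: "q / (q - 1) < p"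
 shows "(\<forall>\<phi>\<in>Lp_forms f X X p r. AE z in dV_reg X D. K_converges f X \<omega> cutoff s h \<phi> z) \<and>
  compact_operator (Lp_forms f X X p r) (Lp_norm f X X p r)
   (Lp_forms f X D p (r - 1)) (Lp_norm f X D p (r - 1)) (K_op f X \<omega> cutoff s h)"
proof -
 have p1: "1 < p"
 proof -
  have "1 < q / (q - 1)" using q by simp
  then show ?thesis using p by linarith
 qed
 have p0: "0 < p" using p1 by simp
 from Lp_op[OF p] obtain K where K0: "0 <= K" and K: "\<forall>\<phi>. LF p \<phi> --> (AE z in \<nu>. ALL J. integrable \<mu> (KI \<phi> z J)) \<and>
   out_int p \<phi> <= ennreal K * in_int p \<phi>"
  by (elim exE conjE) (rule that)
 note LFI = Lp_forms_LF(1)[OF _ p0]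
 have ae: "AE z in \<nu>. ALL J. integrable \<mu> (KI \<phi> z J)" if "\<phi> \<in> Lp_forms f X X p r" for \<phi>
  using K[THEN spec, THEN mp, OF LFI[OF that]] by (rule conjunct1)
 have FO: "FO \<phi>" if "\<phi> \<in> Lp_forms f X X p r" for \<phi> using LFI[OF that] by (simp add: LF_def)
 have DZ': "z \<in> Z" if "z \<in> D - {0}" for z using that DZ by auto
 have kb: "out_int p \<phi> <= ennreal (K * (\<integral>x. form_norm f x r (\<phi> x) powr p \<partial>\<mu>))"
  if \<phi>: "\<phi> \<in> Lp_forms f X X p r" for \<phi>
  using K[THEN spec, THEN mp, OF LFI[OF \<phi>], THEN conjunct2] K0 unfolding Lp_forms_LF(2)[OF \<phi> p0]
  by (simp add: ennreal_mult' integral_nonneg_AE)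
 have kf: "\<forall>z\<in>D - {0}. form_0r (r - 1) (Kop \<phi> z)" if "\<phi> \<in> Lp_forms f X X p r" for \<phi>
  using Kop_form[OF FO[OF that] DZ'] by blast
 have mem: "Kop \<phi> \<in> Lp_forms f X D p (r - 1)" if \<phi>: "\<phi> \<in> Lp_forms f X X p r" for \<phi>
  by (rule out_Lp(1)[OF p0 Kop_meas[OF FO[OF \<phi>]] kf[OF \<phi>] kb[OF \<phi>]]) (use K0 in \<open>auto intro!: mult_nonneg_nonneg integral_nonneg_AE\<close>)
 have zero: "Lp_norm f X D p (r - 1) u = 0" if "AE z in \<nu>. u z = 0" for u
 proof -
  have "AE z in \<nu>. form_norm f z (r - 1) (u z) powr p = 0"
   using that by eventually_elim (simp add: form_norm_zero)
  then have "(\<integral>z. form_norm f z (r - 1) (u z) powr p \<partial>\<nu>) = 0" by (rule integral_eq_zero_AE)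
  then show ?thesis by (simp add: Lp_norm_def \<nu>_def)
 qed
 have lin1: "Lp_norm f X D p (r - 1) (%x. Kop (%y. \<phi> y + \<psi> y) x - (Kop \<phi> x + Kop \<psi> x)) = 0"
  if "\<phi> \<in> Lp_forms f X X p r" "\<psi> \<in> Lp_forms f X X p r" for \<phi> \<psi>
 proof (rule zero, use ae[OF that(1)] ae[OF that(2)] in eventually_elim)
  case (elim z)
  show ?case using Kop_linear(1)[of \<phi> z \<psi>, OF elim(1)[rule_format] elim(2)[rule_format]] by simp
 qed
 have lin2: "Lp_norm f X D p (r - 1) (%x. Kop (%y. c *s \<phi> y) x - c *s Kop \<phi> x) = 0"
  if "\<phi> \<in> Lp_forms f X X p r" for \<phi> c
 proof (rule zero, use ae[OF that] in eventually_elim)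
  case (elim z)
  show ?case using Kop_linear(2)[of \<phi> z \<phi> c, OF elim[rule_format] elim[rule_format]] by simp
 qed
 have cpt: "\<exists>\<psi>\<in>Lp_forms f X D p (r - 1). EX k. strict_mono k \<and>
   (%n. Lp_norm f X D p (r - 1) (%x. Kop (\<Phi> (k n)) x - \<psi> x)) \<longlonglongrightarrow> 0"
  if \<Phi>: "ALL n. \<Phi> n \<in> Lp_forms f X X p r \<and> Lp_norm f X X p r (\<Phi> n) <= 1" for \<Phi> :: "nat => complex ^ 3 => ext"
 proof -
  have \<Phi>m: "\<Phi> n \<in> Lp_forms f X X p r" for n using \<Phi> by blast
  have \<Phi>1: "in_int p (\<Phi> n) <= 1" for n
  proof -
   have le: "(\<integral>x. form_norm f x r (\<Phi> n x) powr p \<partial>\<mu>) powr (1 / p) <= 1"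
    using \<Phi> unfolding Lp_norm_def \<mu>_def[symmetric] by blast
   have "(\<integral>x. form_norm f x r (\<Phi> n x) powr p \<partial>\<mu>) <= 1"
   proof (rule ccontr)
    assume "\<not> ?thesis"
    then have "1 < (\<integral>x. form_norm f x r (\<Phi> n x) powr p \<partial>\<mu>)" by simp
    from gr_one_powr[OF this, of "1 / p"] le show False using p0 by simp
   qed
   then show ?thesis unfolding Lp_forms_LF(2)[OF \<Phi>m p0] using ennreal_leI by fastforce
  qed
  have "\<exists>\<psi> (k :: nat => nat). strict_mono k \<and> \<psi> \<in> borel_measurable \<nu> \<and> (\<forall>z\<in>D - {0}. form_0r (r - 1) (\<psi> z)) \<and>
   (\<forall>\<epsilon>>0. EX n0. ALL i>=n0. (\<integral>\<^sup>+z. ennreal (norm (Kop (\<Phi> (k i)) z - \<psi> z) powr p) \<partial>\<nu>) <= ennreal \<epsilon>)"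
   by (rule Lp_compact[OF p LFI[OF \<Phi>m] \<Phi>1])
  then obtain \<psi> and k :: "nat => nat" where k: "strict_mono k" and \<psi>: "\<psi> \<in> borel_measurable \<nu>" "\<forall>z\<in>D - {0}. form_0r (r - 1) (\<psi> z)"
   and conv: "!!\<epsilon>. \<epsilon> > 0 ==> EX n0. ALL i>=n0. (\<integral>\<^sup>+z. ennreal (norm (Kop (\<Phi> (k i)) z - \<psi> z) powr p) \<partial>\<nu>) <= ennreal \<epsilon>"
   by blast
  have dm: "(%z. Kop (\<Phi> n) z - \<psi> z) \<in> borel_measurable \<nu>" for n
   using Kop_meas[OF FO[OF \<Phi>m]] \<psi>(1) by (intro borel_measurable_diff)
  have df: "\<forall>z\<in>D - {0}. form_0r (r - 1) (Kop (\<Phi> n) z - \<psi> z)" for n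
   using kf[OF \<Phi>m] \<psi>(2) form_0r_diff by blast
  have "(%n. Lp_norm f X D p (r - 1) (%x. Kop (\<Phi> (k n)) x - \<psi> x)) \<longlonglongrightarrow> 0"
  proof (rule LIMSEQ_I)
   fix e :: real assume e: "0 < e"
   \<comment> \<open>Division by 7 beats the factor 6 in \<open>out_Lp\<close> and leaves a strict
     inequality.\<close>
   have "0 < (e / 7) powr p" using e by simp
   then obtain n0 where n0: "!!i. n0 <= i ==> (\<integral>\<^sup>+z. ennreal (norm (Kop (\<Phi> (k i)) z - \<psi> z) powr p) \<partial>\<nu>) <= ennreal ((e / 7) powr p)"
    using conv by blast
   have "norm (Lp_norm f X D p (r - 1) (%x. Kop (\<Phi> (k i)) x - \<psi> x) - 0) < e" if "n0 <= i" for i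
   proof -
    have "Lp_norm f X D p (r - 1) (%x. Kop (\<Phi> (k i)) x - \<psi> x) <= 6 * ((e / 7) powr p) powr (1 / p)"
     by (rule out_Lp(2)[OF p0 dm df n0[OF that]]) simp
    also have "... < e" using e p0 by (simp add: powr_powr)
    finally show ?thesis by (simp add: Lp_norm_def)
   qed
   then show "EX no. ALL n>=no. norm (Lp_norm f X D p (r - 1) (%x. Kop (\<Phi> (k n)) x - \<psi> x) - 0) < e" by blast
  qed
  moreover have "\<psi> \<in> Lp_forms f X D p (r - 1)"
  proof -
   \<comment> \<open>One image at finite L^p distance from \<psi> is enough, because that image lies
     in L^p.\<close>
   obtain n0 where n0: "(\<integral>\<^sup>+z. ennreal (norm (Kop (\<Phi> (k n0)) z - \<psi> z) powr p) \<partial>\<nu>) <= ennreal 1"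
    using conv[of 1] by auto
   let ?a = "Kop (\<Phi> (k n0))" and ?H = "K * (\<integral>x. form_norm f x r (\<Phi> (k n0) x) powr p \<partial>\<mu>)"
   have H: "0 <= ?H" using K0 by (intro mult_nonneg_nonneg integral_nonneg_AE) auto
   have am: "?a \<in> borel_measurable \<nu>" by (rule Kop_meas[OF FO[OF \<Phi>m]])
   have "(\<integral>\<^sup>+z. ennreal (norm (\<psi> z) powr p) \<partial>\<nu>) <= (\<integral>\<^sup>+z. ennreal (3 powr p) * (ennreal (norm (?a z - \<psi> z) powr p) + ennreal (norm (?a z) powr p)) \<partial>\<nu>)"
   proof (rule nn_integral_mono)
    fix z
    have "norm (\<psi> z) <= norm (?a z - \<psi> z) + norm (?a z) + 0"
     using norm_triangle_ineq4[of "?a z" "?a z - \<psi> z"] by simp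
    then have "norm (\<psi> z) powr p <= (norm (?a z - \<psi> z) + norm (?a z) + 0) powr p" using p0 by (intro powr_mono2) auto
    also have "... <= 3 powr p * (norm (?a z - \<psi> z) powr p + norm (?a z) powr p + 0 powr p)"
     using p0 by (intro powr_sum3_le) auto
    finally show "ennreal (norm (\<psi> z) powr p) <= ennreal (3 powr p) * (ennreal (norm (?a z - \<psi> z) powr p) + ennreal (norm (?a z) powr p))"
     by (simp flip: ennreal_plus ennreal_mult add: ennreal_leI)
   qed
   also have "... = ennreal (3 powr p) * ((\<integral>\<^sup>+z. ennreal (norm (?a z - \<psi> z) powr p) \<partial>\<nu>) + (\<integral>\<^sup>+z. ennreal (norm (?a z) powr p) \<partial>\<nu>))"
    using am \<psi>(1) by (simp add: nn_integral_cmult nn_integral_add)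
   also have "... <= ennreal (3 powr p) * (ennreal 1 + ennreal ?H)" by (intro mult_left_mono add_mono n0 kb[OF \<Phi>m]) simp
   also have "... = ennreal (3 powr p * (1 + ?H))" using H by (simp add: ennreal_mult)
   finally have fin: "(\<integral>\<^sup>+z. ennreal (norm (\<psi> z) powr p) \<partial>\<nu>) <= ennreal (3 powr p * (1 + ?H))" .
   show ?thesis by (rule out_Lp(1)[OF p0 \<psi> fin]) (use H in simp)
  qed
  ultimately show ?thesis using k by blast
 qed
 show ?thesis
 proof (intro conjI ballI)
  fix \<phi> assume "\<phi> \<in> Lp_forms f X X p r"
  from ae[OF this] show "AE z in dV_reg X D. K_converges f X \<omega> cutoff s h \<phi> z"
   unfolding K_converges_def \<mu>_def \<nu>_def .
 next
  show "compact_operator (Lp_forms f X X p r) (Lp_norm f X X p r)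
   (Lp_forms f X D p (r - 1)) (Lp_norm f X D p (r - 1)) (K_op f X \<omega> cutoff s h)"
   unfolding compact_operator_def
  proof (intro conjI ballI allI impI)
   fix \<phi> assume "\<phi> \<in> Lp_forms f X X p r"
   then show "Kop \<phi> \<in> Lp_forms f X D p (r - 1)" by (rule mem)
  qed (rule lin1 lin2 cpt; assumption)+
 qed
qed

text \<open>\<psi> represents itself, which bounds the infimum over representations. The point of D
  other than 0 makes the set of difference quotients nonempty, so that its supremum is
  meaningful.\<close>

lemma Calpha_bound:
 assumes D0': "0 \<in> D" and \<psi>: "!!x. x \<in> D ==> form_0r (r - 1) (\<psi> x)" "continuous_on D \<psi>"
  and A1: "0 <= A1" "!!x. x \<in> D ==> norm (\<psi> x) <= A1"
  and L: "0 <= L" "!!x y. x \<in> D ==> y \<in> D ==> norm (\<psi> x - \<psi> y) <= L * norm (x - y) powr \<alpha>"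
 shows "\<psi> \<in> Calpha_forms f D \<alpha> (r - 1)" "0 <= Calpha_norm f D \<alpha> (r - 1) \<psi>"
  "Calpha_norm f D \<alpha> (r - 1) \<psi> <= sqrt (2 ^ (r - 1) * cG) * (A1 + L)"
proof -
 obtain x1 where x1: "x1 \<in> D" "x1 ~= 0" using D_ne by blast
 have uA: "cmod (\<psi> x $ S) <= A1" if "x \<in> D" for x S
  using order_trans[OF Finite_Cartesian_Product.norm_nth_le A1(2)[OF that]] .
 have uL: "cmod (\<psi> x $ S - \<psi> y $ S) <= L * dist x y powr \<alpha>" if "x \<in> D" "y \<in> D" for x y S
  using order_trans[OF Finite_Cartesian_Product.norm_nth_le[of "\<psi> x - \<psi> y" S] L(2)[OF that]] by (simp add: dist_norm)
 have ho: "holder_on \<alpha> D (%x. \<psi> x $ S)" for S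
  unfolding holder_on_def
 proof (intro conjI)
  show "continuous_on D (%x. \<psi> x $ S)" by (rule continuous_on_component[OF \<psi>(2)])
  show "EX C. \<forall>x\<in>D. cmod (\<psi> x $ S) <= C" using uA by blast
  show "EX C. \<forall>x\<in>D. \<forall>y\<in>D. x ~= y --> cmod (\<psi> x $ S - \<psi> y $ S) <= C * dist x y powr \<alpha>" using uL by blast
 qed
 have rep: "holder_rep f D \<alpha> (r - 1) \<psi> \<psi>"
  unfolding holder_rep_def same_pullback_def using \<psi>(1) ho by blast
 then show "\<psi> \<in> Calpha_forms f D \<alpha> (r - 1)" unfolding Calpha_forms_def using \<psi>(1) by blast
 have hn: "0 <= holder_norm \<alpha> D (%x. \<psi> x $ S)" "holder_norm \<alpha> D (%x. \<psi> x $ S) <= A1 + L" for S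
 proof -
  let ?P = "{cmod (\<psi> x $ S - \<psi> y $ S) / dist x y powr \<alpha> | x y. x \<in> D \<and> y \<in> D \<and> x ~= y}"
  have pb: "v <= L" "0 <= v" if vP: "v \<in> ?P" for v
  proof -
   from vP obtain x y where v: "v = cmod (\<psi> x $ S - \<psi> y $ S) / dist x y powr \<alpha>" "x \<in> D" "y \<in> D" "x ~= y" by blast
   have d: "0 < dist x y powr \<alpha>" using v(4) by simp
   show "v <= L" unfolding v(1) using uL[OF v(2,3), of S] pos_divide_le_eq[OF d] by blast
   show "0 <= v" unfolding v(1) by simp
  qed
  have ne: "cmod (\<psi> x1 $ S - \<psi> 0 $ S) / dist x1 0 powr \<alpha> \<in> ?P" using x1 D0' by blast
  have s1: "Sup ?P <= L" using ne pb(1) by (intro cSup_least) auto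
  have "bdd_above ?P" using pb(1) by (rule bdd_aboveI)
  from cSup_upper[OF ne this] pb(2)[OF ne] have s2: "0 <= Sup ?P" by (rule order_trans[rotated])
  have t1: "Sup ((%x. cmod (\<psi> x $ S)) ` D) <= A1" using D0' uA by (intro cSup_least) auto
  have "bdd_above ((%x. cmod (\<psi> x $ S)) ` D)" using uA by (auto intro!: bdd_aboveI)
  from cSup_upper[OF imageI[OF D0'] this] have t2: "0 <= Sup ((%x. cmod (\<psi> x $ S)) ` D)"
   by (rule order_trans[OF norm_ge_zero])
  show "0 <= holder_norm \<alpha> D (%x. \<psi> x $ S)" "holder_norm \<alpha> D (%x. \<psi> x $ S) <= A1 + L"
   unfolding holder_norm_def using s1 s2 t1 t2 by linarith+
 qed
 define T where "T c = 2 ^ (r - 1) * (\<Sum>S | S <= range Dzetabar \<and> card S = r - 1. (holder_norm \<alpha> D (%x. c x $ S))\<^sup>2)" for c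
 have T0: "0 <= T c" for c unfolding T_def by (intro mult_nonneg_nonneg sum_nonneg) auto
 let ?Q = "{T c | c. holder_rep f D \<alpha> (r - 1) \<psi> c}"
 have cn: "Calpha_norm f D \<alpha> (r - 1) \<psi> = sqrt (Inf ?Q)" unfolding Calpha_norm_def T_def ..
 have Q: "T \<psi> \<in> ?Q" using rep by blast
 have "bdd_below ?Q" using T0 by (auto intro!: bdd_belowI)
 from cInf_lower[OF Q this] have i1: "Inf ?Q <= T \<psi>" .
 have "0 <= Inf ?Q" using Q T0 by (intro cInf_greatest) auto
 then show "0 <= Calpha_norm f D \<alpha> (r - 1) \<psi>" unfolding cn by simp
 have AL: "0 <= A1 + L" using A1(1) L(1) by simp
 have "(\<Sum>S | S <= range Dzetabar \<and> card S = r - 1. (holder_norm \<alpha> D (%x. \<psi> x $ S))\<^sup>2) <= (\<Sum>S | S <= range Dzetabar \<and> card S = r - 1. (A1 + L)\<^sup>2)"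
  by (intro sum_mono power_mono hn)
 also have "... <= (\<Sum>S\<in>(UNIV :: gen set set). (A1 + L)\<^sup>2)" by (rule sum_mono2) auto
 also have "... = cG * (A1 + L)\<^sup>2" by simp
 finally have "T \<psi> <= 2 ^ (r - 1) * (cG * (A1 + L)\<^sup>2)" unfolding T_def by (intro mult_left_mono) auto
 with i1 have "Inf ?Q <= 2 ^ (r - 1) * cG * (A1 + L)\<^sup>2" by (simp only: mult.assoc)
 then have "sqrt (Inf ?Q) <= sqrt (2 ^ (r - 1) * cG * (A1 + L)\<^sup>2)" by (rule real_sqrt_le_mono)
 also have "... = sqrt (2 ^ (r - 1) * cG) * (A1 + L)" using AL by (simp only: real_sqrt_mult[of _ "(A1 + L)\<^sup>2"] real_sqrt_abs abs_of_nonneg)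
 finally show "Calpha_norm f D \<alpha> (r - 1) \<psi> <= sqrt (2 ^ (r - 1) * cG) * (A1 + L)" unfolding cn .
qed

lemma Linf_part:
 assumes \<alpha>: "0 <= \<alpha>" "\<alpha> < 2 - 4 / q" and D0': "0 \<in> D"
 shows "(\<forall>\<phi>\<in>Linf_forms f X X r. \<forall>z\<in>D - {0}. K_converges f X \<omega> cutoff s h \<phi> z) \<and>
  compact_operator (Linf_forms f X X r) (Linf_norm f X X r)
   (Calpha_forms f D \<alpha> (r - 1)) (Calpha_norm f D \<alpha> (r - 1)) (K_op f X \<omega> cutoff s h)"
proof -
 have Zin: "z \<in> Z" if "z \<in> D" for z using that DZ by auto
 have LD: "FO \<phi> \<and> (EX B>=0. AE x in \<mu>. form_norm f x r (\<phi> x) <= B)" if "\<phi> \<in> Linf_forms f X X r" for \<phi>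
 proof -
  have FO: "FO \<phi>" and "EX C. AE x in \<mu>. form_norm f x r (\<phi> x) <= C"
   using that unfolding Linf_forms_def \<mu>_def[symmetric] M_def[symmetric] by auto
  then obtain C where "AE x in \<mu>. form_norm f x r (\<phi> x) <= C" by blast
  then have "AE x in \<mu>. form_norm f x r (\<phi> x) <= max 0 C" by eventually_elim simp
  then have "EX B>=0. AE x in \<mu>. form_norm f x r (\<phi> x) <= B" by (intro exI[of _ "max 0 C"]) simp
  with FO show ?thesis by blast
 qed
 have int: "integrable \<mu> (KI \<phi> z J)" if \<phi>: "\<phi> \<in> Linf_forms f X X r" and z: "z \<in> Z" for \<phi> z J
 proof -
  obtain B where "0 <= B" "AE x in \<mu>. form_norm f x r (\<phi> x) <= B" using LD[OF \<phi>] by blast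
  then show ?thesis using LD[OF \<phi>] z by (intro Linf_integrable[of \<phi> B]) blast+
 qed
 have est: "EX C>=0. \<forall>\<phi> B. FO \<phi> \<and> 0 <= B \<and> (AE x in \<mu>. form_norm f x r (\<phi> x) <= B) -->
  (\<forall>z\<in>Z. norm (Kop \<phi> z) <= C * B \<and> (\<forall>w\<in>Z. norm (Kop \<phi> z - Kop \<phi> w) <= C * B * norm (z - w) powr a))"
  if "0 <= a" "a < 2 - 4 / q" for a
  using Linf_est[OF that] by meson
 \<comment> \<open>For \<alpha> = 0 the Hoelder bound gives no continuity. It is read off from the
   constant sequence, whose uniform limit is continuous and equals the image itself.\<close>
 have cont: "continuous_on D (Kop \<phi>)" if \<phi>: "\<phi> \<in> Linf_forms f X X r" for \<phi>
 proof -
  obtain B where B: "0 <= B" "AE x in \<mu>. form_norm f x r (\<phi> x) <= B" using LD[OF \<phi>] by blast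
  have "\<exists>\<psi> (k :: nat => nat). continuous_on Z \<psi> \<and> strict_mono k \<and> (\<forall>e>0. EX n0. ALL n>=n0. \<forall>z\<in>Z. norm (Kop ((%n::nat. \<phi>) (k n)) z - \<psi> z) < e)"
   by (rule Kop_uniform_subsequence) (use LD[OF \<phi>] B in blast)+
  then obtain \<psi> where \<psi>: "continuous_on Z \<psi>" "!!e. e > 0 ==> \<forall>z\<in>Z. norm (Kop \<phi> z - \<psi> z) < e" by blast
  have "Kop \<phi> z = \<psi> z" if "z \<in> Z" for z
  proof (rule ccontr)
   assume "Kop \<phi> z ~= \<psi> z"
   then have "0 < norm (Kop \<phi> z - \<psi> z)" by simp
   from \<psi>(2)[OF this] that show False by auto
  qed
  then have "continuous_on Z (Kop \<phi>)" using \<psi>(1) continuous_on_cong[of Z Z "Kop \<phi>" \<psi>] by blast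
  then show ?thesis using continuous_on_subset DZ by blast
 qed
 have kf: "form_0r (r - 1) (Kop \<phi> z)" if "\<phi> \<in> Linf_forms f X X r" "z \<in> D" for \<phi> z
  by (rule Kop_form) (use LD[OF that(1)] Zin[OF that(2)] in blast)+
 have mem: "Kop \<phi> \<in> Calpha_forms f D \<alpha> (r - 1)" if \<phi>: "\<phi> \<in> Linf_forms f X X r" for \<phi>
 proof -
  obtain B where B: "FO \<phi> \<and> 0 <= B \<and> (AE x in \<mu>. form_norm f x r (\<phi> x) <= B)" using LD[OF \<phi>] by blast
  from est[OF \<alpha>] obtain C where C: "0 <= C" "\<forall>z\<in>Z. norm (Kop \<phi> z) <= C * B \<and> (\<forall>w\<in>Z. norm (Kop \<phi> z - Kop \<phi> w) <= C * B * norm (z - w) powr \<alpha>)"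
   using B by blast
  have CB: "0 <= C * B" using C(1) B by simp
  show ?thesis by (rule Calpha_bound(1)[OF D0' kf[OF \<phi>] cont[OF \<phi>] CB _ CB]) (use C(2) Zin in blast)+
 qed
 have zero: "Calpha_norm f D \<alpha> (r - 1) u = 0" if u: "!!x. x \<in> D ==> u x = 0" for u
 proof -
  have c0: "continuous_on D u" using continuous_on_cong[of D D u "%_. 0"] u by simp
  have "0 <= Calpha_norm f D \<alpha> (r - 1) u" "Calpha_norm f D \<alpha> (r - 1) u <= sqrt (2 ^ (r - 1) * cG) * (0 + 0)"
   by (rule Calpha_bound(2)[OF D0' _ c0, of 0 0] Calpha_bound(3)[OF D0' _ c0, of 0 0]; simp add: u form_0r_zero)+
  then show ?thesis by simp
 qed
 have lin1: "Calpha_norm f D \<alpha> (r - 1) (%x. Kop (%y. \<phi> y + \<psi> y) x - (Kop \<phi> x + Kop \<psi> x)) = 0"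
  if "\<phi> \<in> Linf_forms f X X r" "\<psi> \<in> Linf_forms f X X r" for \<phi> \<psi>
 proof (rule zero)
  fix x assume "x \<in> D"
  then show "Kop (%y. \<phi> y + \<psi> y) x - (Kop \<phi> x + Kop \<psi> x) = 0"
   using Kop_linear(1)[of \<phi> x \<psi>, OF int[OF that(1) Zin] int[OF that(2) Zin]] by simp
 qed
 have lin2: "Calpha_norm f D \<alpha> (r - 1) (%x. Kop (%y. c *s \<phi> y) x - c *s Kop \<phi> x) = 0"
  if "\<phi> \<in> Linf_forms f X X r" for \<phi> c
 proof (rule zero)
  fix x assume "x \<in> D"
  then show "Kop (%y. c *s \<phi> y) x - c *s Kop \<phi> x = 0"
   using Kop_linear(2)[of \<phi> x \<phi> c, OF int[OF that Zin] int[OF that Zin]] by simp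
 qed
 have cpt: "\<exists>\<psi>\<in>Calpha_forms f D \<alpha> (r - 1). EX k. strict_mono k \<and>
   (%n. Calpha_norm f D \<alpha> (r - 1) (%x. Kop (\<Phi> (k n)) x - \<psi> x)) \<longlonglongrightarrow> 0"
  if \<Phi>: "ALL n. \<Phi> n \<in> Linf_forms f X X r \<and> Linf_norm f X X r (\<Phi> n) <= 1" for \<Phi> :: "nat => complex ^ 3 => ext"
 proof -
  have \<Phi>m: "\<Phi> n \<in> Linf_forms f X X r" for n using \<Phi> by blast
  \<comment> \<open>The norm is an infimum of essential bounds, so a norm of at most 1 provides some
    bound below 2.\<close>
  have \<Phi>2: "AE x in \<mu>. form_norm f x r (\<Phi> n x) <= 2" for n
  proof -
   let ?C = "{C. 0 <= C \<and> (AE x in \<mu>. form_norm f x r (\<Phi> n x) <= C)}"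
   have "Inf ?C <= 1" using \<Phi> unfolding Linf_norm_def \<mu>_def[symmetric] by blast
   then have i2: "Inf ?C < 2" by simp
   have "?C ~= {}" using LD[OF \<Phi>m] by blast
   from cInf_lessD[OF this i2] obtain C where C: "AE x in \<mu>. form_norm f x r (\<Phi> n x) <= C" "C < 2" by blast
   from C(1) show ?thesis by eventually_elim (use C(2) in simp)
  qed
  have \<Phi>3: "FO (\<Phi> n) \<and> 0 <= (2::real) \<and> (AE x in \<mu>. form_norm f x r (\<Phi> n x) <= 2)" for n
   using LD[OF \<Phi>m[of n]] \<Phi>2[of n] by simp
  have "\<exists>\<psi> (k :: nat => nat). continuous_on Z \<psi> \<and> strict_mono k \<and> (\<forall>e>0. EX n0. ALL n>=n0. \<forall>z\<in>Z. norm (Kop (\<Phi> (k n)) z - \<psi> z) < e)"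
   by (rule Kop_uniform_subsequence[OF \<Phi>3[THEN conjunct1] \<Phi>2]) simp
  then obtain \<psi> and k :: "nat => nat" where \<psi>: "continuous_on Z \<psi>" and k: "strict_mono k"
   and uc: "!!e. e > 0 ==> EX n0. ALL n>=n0. \<forall>z\<in>Z. norm (Kop (\<Phi> (k n)) z - \<psi> z) < e" by blast
  have pw: "(%n. Kop (\<Phi> (k n)) z) \<longlonglongrightarrow> \<psi> z" if "z \<in> Z" for z
   by (rule LIMSEQ_I) (use uc that in blast)
  have \<psi>f: "form_0r (r - 1) (\<psi> x)" if "x \<in> D" for x
   by (rule form_0r_limit[OF _ pw[OF Zin[OF that]]]) (rule kf[OF \<Phi>m that])
  have \<psi>c: "continuous_on D \<psi>" using \<psi> continuous_on_subset DZ by blast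
  have lim: "EX C>=0. (ALL n. \<forall>x\<in>D. norm (Kop (\<Phi> n) x) <= C \<and> (\<forall>y\<in>D. norm (Kop (\<Phi> n) x - Kop (\<Phi> n) y) <= C * norm (x - y) powr a)) \<and>
    (\<forall>x\<in>D. norm (\<psi> x) <= C \<and> (\<forall>y\<in>D. norm (\<psi> x - \<psi> y) <= C * norm (x - y) powr a))"
   if a: "0 <= a" "a < 2 - 4 / q" for a
  proof -
   from est[OF a] obtain C where C: "0 <= C" "\<forall>\<phi> B. FO \<phi> \<and> 0 <= B \<and> (AE x in \<mu>. form_norm f x r (\<phi> x) <= B) -->
    (\<forall>z\<in>Z. norm (Kop \<phi> z) <= C * B \<and> (\<forall>w\<in>Z. norm (Kop \<phi> z - Kop \<phi> w) <= C * B * norm (z - w) powr a))" by blast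
   have b: "norm (Kop (\<Phi> n) x) <= C * 2" "!!y. y \<in> D ==> norm (Kop (\<Phi> n) x - Kop (\<Phi> n) y) <= C * 2 * norm (x - y) powr a" if "x \<in> D" for n x
    using C(2)[THEN spec, THEN spec, THEN mp, OF \<Phi>3[of n]] Zin that by blast+
   have "norm (\<psi> x) <= C * 2" if "x \<in> D" for x
    using Lim_bounded[OF tendsto_norm[OF pw[OF Zin[OF that]]]] b(1)[OF that] by blast
   moreover have "norm (\<psi> x - \<psi> y) <= C * 2 * norm (x - y) powr a" if "x \<in> D" "y \<in> D" for x y
    using Lim_bounded[OF tendsto_norm[OF tendsto_diff[OF pw[OF Zin[OF that(1)]] pw[OF Zin[OF that(2)]]]]] b(2)[OF that] by blast
   ultimately show ?thesis using b C(1) by (intro exI[of _ "C * 2"]) simp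
  qed
  have "\<psi> \<in> Calpha_forms f D \<alpha> (r - 1)"
  proof -
   obtain C where C: "0 <= C" "\<forall>x\<in>D. norm (\<psi> x) <= C \<and> (\<forall>y\<in>D. norm (\<psi> x - \<psi> y) <= C * norm (x - y) powr \<alpha>)"
    using lim[OF \<alpha>] by blast
   show ?thesis by (rule Calpha_bound(1)[OF D0' \<psi>f \<psi>c C(1) _ C(1)]) (use C(2) in blast)+
  qed
  moreover have "(%n. Calpha_norm f D \<alpha> (r - 1) (%x. Kop (\<Phi> (k n)) x - \<psi> x)) \<longlonglongrightarrow> 0"
  proof (rule LIMSEQ_I)
   fix \<epsilon> :: real assume \<epsilon>: "0 < \<epsilon>"
   \<comment> \<open>An exponent strictly between \<alpha> and the threshold. Interpolation with
     \<theta> = \<alpha>/a, between uniform convergence and the fixed bound in the exponent a, gives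
     convergence in the exponent \<alpha>.\<close>
   define a where "a = (\<alpha> + (2 - 4 / q)) / 2"
   have a: "\<alpha> < a" "0 < a" "a < 2 - 4 / q" using \<alpha> by (auto simp: a_def)
   define \<theta> where "\<theta> = \<alpha> / a"
   have \<theta>: "0 <= \<theta>" "\<theta> < 1" "a * \<theta> = \<alpha>" using \<alpha>(1) a by (auto simp: \<theta>_def)
   obtain C where C: "0 <= C" "!!n x y. x \<in> D ==> y \<in> D ==> norm (Kop (\<Phi> n) x - Kop (\<Phi> n) y) <= C * norm (x - y) powr a"
    "!!x y. x \<in> D ==> y \<in> D ==> norm (\<psi> x - \<psi> y) <= C * norm (x - y) powr a"
    using lim[OF less_imp_le[OF a(2)] a(3)] by blast
   define Q where "Q = sqrt (2 ^ (r - 1) * cG) + 1"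
   have Q: "0 < Q" "sqrt (2 ^ (r - 1) * cG) <= Q" 
   proof -
    have "0 <= sqrt (2 ^ (r - 1) * cG)" by (intro real_sqrt_ge_zero mult_nonneg_nonneg) simp_all
    then show "0 < Q" "sqrt (2 ^ (r - 1) * cG) <= Q" unfolding Q_def by linarith+
   qed
   define H where "H = (2 * C) powr \<theta> + 1"
   have H: "0 < H" "(2 * C) powr \<theta> <= H" unfolding H_def using powr_ge_zero[of "2 * C" \<theta>] by linarith+
   \<comment> \<open>The first bound makes the supremum, and the second the Hoelder quotient, at
     most \<epsilon>/(4 Q); H is an upper bound for the constant (2 C)^\<theta> left by the
     interpolation.\<close>
   define e where "e = min (\<epsilon> / (4 * Q)) ((\<epsilon> / (4 * Q * H)) powr (1 / (1 - \<theta>)) / 2)"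
   have QH: "0 < \<epsilon> / (4 * Q * H)" using \<epsilon> Q H by simp
   have e: "0 < e" "e <= \<epsilon> / (4 * Q)" "2 * e <= (\<epsilon> / (4 * Q * H)) powr (1 / (1 - \<theta>))"
    using \<epsilon> Q QH by (auto simp: e_def)
   have e2: "(2 * e) powr (1 - \<theta>) <= \<epsilon> / (4 * Q * H)"
   proof -
    have "(2 * e) powr (1 - \<theta>) <= ((\<epsilon> / (4 * Q * H)) powr (1 / (1 - \<theta>))) powr (1 - \<theta>)"
     using e \<theta> by (intro powr_mono2) auto
    also have "... = \<epsilon> / (4 * Q * H)"
    proof -
     have h: "1 / (1 - \<theta>) * (1 - \<theta>) = 1" using \<theta> by simp
     show ?thesis unfolding powr_powr h powr_one_gt_zero_iff by (rule less_imp_le[OF QH])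
    qed
    finally show ?thesis .
   qed
   define L where "L = (2 * e) powr (1 - \<theta>) * (2 * C) powr \<theta>"
   have L0: "0 <= L" by (simp add: L_def)
   have "L <= \<epsilon> / (4 * Q * H) * H" unfolding L_def using H QH by (intro mult_mono e2) auto
   then have L1: "L <= \<epsilon> / (4 * Q)" using H by simp
   obtain n0 where n0: "!!n z. n0 <= n ==> z \<in> Z ==> norm (Kop (\<Phi> (k n)) z - \<psi> z) < e" using uc[OF e(1)] by blast
   have "norm (Calpha_norm f D \<alpha> (r - 1) (%x. Kop (\<Phi> (k n)) x - \<psi> x) - 0) < \<epsilon>" if n: "n0 <= n" for n
   proof -
    let ?u = "%x. Kop (\<Phi> (k n)) x - \<psi> x"
    have uf: "form_0r (r - 1) (?u x)" if "x \<in> D" for x by (rule form_0r_diff[OF kf[OF \<Phi>m that] \<psi>f[OF that]])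
    have ucont: "continuous_on D ?u" by (rule continuous_on_diff[OF cont[OF \<Phi>m] \<psi>c])
    have ue: "norm (?u x) <= e" if "x \<in> D" for x using n0[OF n Zin[OF that]] by simp
    have uL: "norm (?u x - ?u y) <= L * norm (x - y) powr \<alpha>" if xy: "x \<in> D" "y \<in> D" for x y
    proof -
     have b1: "norm (?u x - ?u y) <= 2 * e" using norm_triangle_ineq4[of "?u x" "?u y"] ue[OF xy(1)] ue[OF xy(2)] by linarith
     have "?u x - ?u y = (Kop (\<Phi> (k n)) x - Kop (\<Phi> (k n)) y) - (\<psi> x - \<psi> y)" by simp
     then have "norm (?u x - ?u y) <= norm (Kop (\<Phi> (k n)) x - Kop (\<Phi> (k n)) y) + norm (\<psi> x - \<psi> y)"
      using norm_triangle_ineq4[of "Kop (\<Phi> (k n)) x - Kop (\<Phi> (k n)) y" "\<psi> x - \<psi> y"] by (simp only:)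
     then have b2: "norm (?u x - ?u y) <= 2 * C * norm (x - y) powr a"
      using C(2)[OF xy, of "k n"] C(3)[OF xy] by linarith
     have "norm (?u x - ?u y) <= (2 * e) powr (1 - \<theta>) * (2 * C * norm (x - y) powr a) powr \<theta>"
      using \<theta> by (intro interpolation b1 b2) auto
     also have "(2 * C * norm (x - y) powr a) powr \<theta> = (2 * C) powr \<theta> * norm (x - y) powr \<alpha>"
      using C(1) \<theta>(3) by (simp add: powr_mult powr_powr)
     finally show ?thesis by (simp add: L_def mult.assoc)
    qed
    have "Calpha_norm f D \<alpha> (r - 1) ?u <= sqrt (2 ^ (r - 1) * cG) * (e + L)"
     by (rule Calpha_bound(3)[OF D0' uf ucont less_imp_le[OF e(1)] ue L0 uL])
    also have "... <= Q * (\<epsilon> / (4 * Q) + \<epsilon> / (4 * Q))"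
     using Q e L0 L1 by (intro mult_mono add_mono) auto
    also have "... < \<epsilon>" using Q \<epsilon> by (simp add: field_simps)
    finally have lt: "Calpha_norm f D \<alpha> (r - 1) ?u < \<epsilon>" .
    have "0 <= Calpha_norm f D \<alpha> (r - 1) ?u"
     by (rule Calpha_bound(2)[OF D0' uf ucont less_imp_le[OF e(1)] ue L0 uL])
    then show ?thesis using lt by simp
   qed
   then show "EX no. ALL n>=no. norm (Calpha_norm f D \<alpha> (r - 1) (%x. Kop (\<Phi> (k n)) x - \<psi> x) - 0) < \<epsilon>" by blast
  qed
  ultimately show ?thesis using k by blast
 qed
 show ?thesis
 proof (intro conjI ballI)
  fix \<phi> z assume "\<phi> \<in> Linf_forms f X X r" "z \<in> D - {0}"
  then show "K_converges f X \<omega> cutoff s h \<phi> z"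
   unfolding K_converges_def \<mu>_def[symmetric] using int Zin by blast
 next
  show "compact_operator (Linf_forms f X X r) (Linf_norm f X X r)
   (Calpha_forms f D \<alpha> (r - 1)) (Calpha_norm f D \<alpha> (r - 1)) (K_op f X \<omega> cutoff s h)"
   unfolding compact_operator_def
  proof (intro conjI ballI allI impI)
   fix \<phi> assume "\<phi> \<in> Linf_forms f X X r"
   then show "Kop \<phi> \<in> Calpha_forms f D \<alpha> (r - 1)" by (rule mem)
  qed (rule lin1 lin2 cpt; assumption)+
 qed
qed

end

theorem theorem1p2:
  fixes \<Omega>' \<Omega>'' \<Omega> W X D :: "(complex ^ 3) set"
    and f :: "complex ^ 3 \<Rightarrow> complex"
    and \<omega> :: "complex ^ 3 \<Rightarrow> ext"
    and q pX :: real
    and h s :: "complex ^ 3 \<Rightarrow> complex ^ 3 \<Rightarrow> complex ^ 3"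
    and cutoff :: "complex ^ 3 \<Rightarrow> real"
    and V\<^sub>s W\<^sub>s :: "(complex ^ 3) set"
    and r :: nat
  assumes \<Omega>': "bounded \<Omega>'" "pseudoconvex \<Omega>'"
    and f: "open W" "\<Omega>' \<subseteq> W" "holo_on W f"
    and X: "X = {\<zeta> \<in> \<Omega>'. f \<zeta> = 0}" "0 \<in> X"
    and smooth_off_0: "\<forall>x\<in>W. f x = 0 \<and> x \<noteq> 0 \<longrightarrow> df f x \<noteq> 0"
    and canonical: "canonical_singularity_at_0 X"
    and \<Omega>: "open \<Omega>" "0 \<in> \<Omega>" "compact (closure \<Omega>)" "closure \<Omega> \<subseteq> \<Omega>'"
    and D: "D = X \<inter> \<Omega>"
    and \<omega>: "structure_form f X \<omega>"
    and q: "2 < q" "q \<le> 4"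
      "\<forall>q'. 1 \<le> q' \<and> q' < q \<longrightarrow>
         (\<integral>\<^sup>+x. ennreal (form_norm f x 2 (\<omega> x) powr q') \<partial>dV_reg X X) < \<infinity>"
    and pX: "pX = q / (q - 1)"
    and h: "\<forall>j. holo_on_prod (\<Omega>' \<times> \<Omega>') (\<lambda>(\<zeta>, z). h \<zeta> z $ j)"
      "\<forall>\<zeta>\<in>\<Omega>'. \<forall>z\<in>\<Omega>'. delta_eta \<zeta> z (form1 (h \<zeta> z)) = scal (f \<zeta> - f z)"
    and \<Omega>'': "stein_open \<Omega>''" "closure \<Omega> \<subseteq> \<Omega>''" "compact (closure \<Omega>'')" "closure \<Omega>'' \<subseteq> \<Omega>'"
    and cutoff: "smooth_on UNIV cutoff" "compact (closure {\<zeta>. cutoff \<zeta> \<noteq> 0})"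
      "closure {\<zeta>. cutoff \<zeta> \<noteq> 0} \<subseteq> \<Omega>'" "\<forall>\<zeta>\<in>\<Omega>''. cutoff \<zeta> = 1"
    and s: "open V\<^sub>s" "supp_dbar cutoff \<subseteq> V\<^sub>s" "open W\<^sub>s" "closure \<Omega> \<subseteq> W\<^sub>s"
      "smooth_on (V\<^sub>s \<times> W\<^sub>s) (\<lambda>(\<zeta>, z). s \<zeta> z)"
      "\<forall>\<zeta>\<in>V\<^sub>s. holo_map_on W\<^sub>s (\<lambda>z. s \<zeta> z)"
      "\<forall>\<zeta>\<in>supp_dbar cutoff. \<forall>z\<in>closure \<Omega>. delta_eta \<zeta> z (form1 (s \<zeta> z)) = scal 1"
    and r: "r \<in> {1, 2}"
  shows "(\<forall>p. pX < p \<longrightarrow>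
           (\<forall>\<phi>\<in>Lp_forms f X X p r. AE z in dV_reg X D. K_converges f X \<omega> cutoff s h \<phi> z) \<and>
           compact_operator (Lp_forms f X X p r) (Lp_norm f X X p r)
             (Lp_forms f X D p (r - 1)) (Lp_norm f X D p (r - 1)) (K_op f X \<omega> cutoff s h)) \<and>
         (\<forall>\<alpha>. 0 \<le> \<alpha> \<and> \<alpha> < 4 / pX - 2 \<longrightarrow>
           (\<forall>\<phi>\<in>Linf_forms f X X r. \<forall>z\<in>D - {0}. K_converges f X \<omega> cutoff s h \<phi> z) \<and>
           compact_operator (Linf_forms f X X r) (Linf_norm f X X r)
             (Calpha_forms f D \<alpha> (r - 1)) (Calpha_norm f D \<alpha> (r - 1)) (K_op f X \<omega> cutoff s h))"
proof -
  have o: "open \<Omega>'" using \<Omega>'(2) by (simp add: pseudoconvex_def)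
  have fh: "holo_on \<Omega>' f" by (rule holo_on_subset[OF f(3) f(2)])
  have sm: "\<And>x. x \<in> \<Omega>' \<Longrightarrow> f x = 0 \<Longrightarrow> x \<noteq> 0 \<Longrightarrow> df f x \<noteq> 0" using smooth_off_0 f(2) by blast
  have Dne: "D - {0} \<noteq> {}" unfolding D by (rule canonical_singularity_not_isolated[OF canonical \<Omega>(1,2)])
  have r': "r = 1 \<or> r = 2" using r by simp
  interpret K: koppelman \<Omega>' \<Omega> X D f \<omega> q h s cutoff V\<^sub>s W\<^sub>s r
    by (rule koppelman.intro) (fact \<Omega>' o fh X sm \<Omega> D Dne \<omega> q h cutoff s r')+
  have 0: "0 \<in> D" unfolding D using X(2) \<Omega>(2) by blast
  have e: "4 / pX - 2 = 2 - 4 / q"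
  proof -
    have "4 / pX = 4 * (q - 1) / q" by (simp add: pX)
    also have "\<dots> = 4 - 4 / q" using q(1) by (simp add: field_simps)
    finally show ?thesis by simp
  qed
  show ?thesis
    unfolding e unfolding pX
    by (rule conjI, rule allI, rule impI, erule K.Lp_part, rule allI, rule impI, erule conjE, rule K.Linf_part[OF _ _ 0])
qed

end
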